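(* Let $\Gamma=N+S$, let $n\in\mathbb N$ and $f\in M_0^{!,\infty}(\Gamma)$. If $f^{(d)}\in M_0^{!,\infty}(\Gamma^{(d)})$ for all $d\mid n$, then $f|T(n)$ is weakly holomorphic.
   Context: Groups. $\mathbb H$ is the complex upper half-plane, $\tau\in\mathbb H$, $q=e^{2\pi i\tau}$. For a positive integer $N$, an exact divisor of $N$ is $Q\mid N$ with $\gcd(Q,N/Q)=1$; $W_{Q,N}$ denotes any matrix $\begin{pmatrix}Qx&y\\ Nz&Qw\end{pmatrix}$ with $x,y,z,w\in\mathbb Z$ and determinant $Q$. For a set $S$ of exact divisors of $N$, $\Gamma=N+S$ is the subgroup of $\mathrm{PSL}_2(\mathbb R)$ generated by $\Gamma_0(N)$ and all $W_{Q,N}$, $Q\in S$. Among the sets of exact divisors $>1$ generating the same group, $S$ is taken to be the largest one. Groups $\Gamma^{(m)}$. For a prime $p$, $\Gamma^{(p)}=N^{(p)}+S^{(p)}$ where $N^{(p)}=N/\gcd(p,N)$ and $S^{(p)}$ is the set of $Q\in S$ dividing $N^{(p)}$. For $m=p_1p_2\cdots p_r$ (primes, repetitions allowed), $\Gamma^{(m)}=\Gamma^{(p_1)(p_2)\cdots(p_r)}$; $\Gamma^{(1)}=\Gamma$. The functions $J_{\Gamma,n}$. Let $\Gamma_\infty=\{\pm\begin{pmatrix}1&t\\0&1\end{pmatrix}:t\in\mathbb Z\}$, $e(x)=e^{2\pi i x}$, and for $n\in\mathbb N$, $\mathrm{Re}(s)>1$ put $$G_{\Gamma,-n}(\tau,s)=2\pi\sum_{\gamma\in\Gamma_\infty\backslash\Gamma}f_n(\gamma\tau),\qquad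 f_n(\tau)=e(-n\,\mathrm{Re}\,\tau)\,(n\,\mathrm{Im}\,\tau)^{1/2}I_{s-\frac12}(2\pi n\,\mathrm{Im}\,\tau),$$ with $I$ the $I$-Bessel function. It continues analytically to $\mathrm{Re}(s)>1/2$; set $j_{\Gamma,n}(\tau)=G_{\Gamma,-n}(\tau,1)$, a $\Gamma$-invariant harmonic function with expansion $j_{\Gamma,n}=q^{-n}-\bar q^n+c_\Gamma(n,0)+\sum_{\ell\ge1}(c_\Gamma(n,\ell)q^\ell+c_\Gamma(n,-\ell)\bar q^\ell)$. Define $J_{\Gamma,n}=j_{\Gamma,n}-c_\Gamma(n,0)$ for $n\ge1$ and $J_{\Gamma,0}=1$. The $m$-plicate is $J_{\Gamma,n}^{(m)}=J_{\Gamma^{(m)},n}$. Operators. $(f|U^*_m)(\tau)=\sum_{i=0}^{m-1}f\left(\frac{\tau+i}{m}\right)$. For a prime $p$ and $r\ge1$, $J_{\Gamma,n}|T(p^r)(\tau)=\sum_{i=0}^{r}\bigl(J^{(p^i)}_{\Gamma,n}|U^*_{p^{r-i}}\bigr)(p^i\tau)$. For $m=p_1^{k_1}\cdots p_r^{k_r}$ with distinct primes, $T(m)=T(p_1^{k_1})\circ\cdots\circ T(p_r^{k_r})$, $T(1)$ the identity. In a composition, for $n\ge1$, $J_{\Gamma,n}|T(p^k)$ is written as the finite combination $\sum_{p^j\mid\gcd(n,p^k)}p^jJ^{(p^j)}_{\Gamma,p^kn/p^{2j}}$ of functions $J_{\Gamma',n'}$ (to which it is equal; for $n=0$ it is a constant),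 and the next operator acts term by term, linearly; the factors for distinct primes commute. $M_0^{!,\infty}(\Gamma)$ is the space of weakly holomorphic modular functions on $\Gamma$ (weight $0$, holomorphic on $\mathbb H$, meromorphic at cusps) whose poles are supported only at the cusp $i\infty$ and which are holomorphic at the other cusps. By a theorem of Niebur each $f\in M_0^{!,\infty}(\Gamma)$ can be written (uniquely) as $f=\sum_{k=0}^{\ell}a_kJ_{\Gamma,k}$, $a_k\in\mathbb C$; one defines $f|T(m)=\sum_k a_k\,J_{\Gamma,k}|T(m)$ and the $m$-plicate $f^{(m)}=\sum_k a_kJ_{\Gamma,k}^{(m)}$. A function is called weakly holomorphic if it is a weakly holomorphic modular function (for some finite-index subgroup), i.e. holomorphic on $\mathbb H$ and meromorphic at the cusps. *)

theory Defs
  imports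
    "HOL-Complex_Analysis.Complex_Analysis"
    "HOL-Algebra.Generated_Groups"
    "HOL-Computational_Algebra.Primes"
    "HOL-Library.Multiset"
begin

section \<open>Matrix groups and their action on the upper half-plane\<close>

definition upper_half_plane :: "complex set" where
  "upper_half_plane = {\<tau>. Im \<tau> > 0}"

definition mat2 :: "real \<Rightarrow> real \<Rightarrow> real \<Rightarrow> real \<Rightarrow> real^2^2" where
  "mat2 a b c d = vector [vector [a, b], vector [c, d]]"

definition moebius :: "real^2^2 \<Rightarrow> complex \<Rightarrow> complex" where
  "moebius A \<tau> =
     (of_real (A$1$1) * \<tau> + of_real (A$1$2)) / (of_real (A$2$1) * \<tau> + of_real (A$2$2))"

definition SL2R :: "(real^2^2) monoid" where
  "SL2R = \<lparr>carrier = {A. det A = 1}, monoid.mult = (**), one = mat 1\<rparr>"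

definition SL2Z :: "(real^2^2) set" where
  "SL2Z = {A. det A = 1 \<and> (\<forall>i j. A$i$j \<in> \<int>)}"

definition Gamma0 :: "nat \<Rightarrow> (real^2^2) set" where
  "Gamma0 N = {A \<in> SL2Z. \<exists>z::int. A$2$1 = real N * of_int z}"

definition exact_divisor :: "nat \<Rightarrow> nat \<Rightarrow> bool" where
  "exact_divisor Q N \<longleftrightarrow> Q dvd N \<and> coprime Q (N div Q)"

text \<open>The matrices \<open>W\<^bsub>Q,N\<^esub>\<close> of determinant \<open>Q\<close>, divided by \<open>sqrt Q\<close> so as to lie in \<open>SL\<^sub>2(\<real>)\<close>.\<close>

definition atkin_lehner :: "nat \<Rightarrow> nat \<Rightarrow> (real^2^2) set" where
  "atkin_lehner N Q =
     {(1 / sqrt (real Q)) *\<^sub>R M | M. \<exists>x y z w :: int.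
        M = mat2 (real Q * of_int x) (of_int y) (real N * of_int z) (real Q * of_int w) \<and>
        det M = real Q}"

text \<open>
  A level \<open>(N, S)\<close> stands for the group \<open>N+S\<close>. Subgroups of \<open>PSL\<^sub>2(\<real>)\<close> are represented by their
  full preimages in \<open>SL\<^sub>2(\<real>)\<close>; note that \<open>Gamma0 N\<close> contains \<open>- mat 1\<close>.
\<close>

type_synonym level = "nat \<times> nat set"

definition level_group :: "level \<Rightarrow> (real^2^2) set" where
  "level_group = (\<lambda>(N, S). generate SL2R (Gamma0 N \<union> (\<Union>Q\<in>S. atkin_lehner N Q)))"

definition largest_divisor_set :: "nat \<Rightarrow> nat set \<Rightarrow> bool" where
  "largest_divisor_set N S \<longleftrightarrow>
     S \<subseteq> {Q. exact_divisor Q N \<and> Q > 1} \<and>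
     (\<forall>S'. S' \<subseteq> {Q. exact_divisor Q N \<and> Q > 1} \<and> level_group (N, S') = level_group (N, S)
            \<longrightarrow> S' \<subseteq> S)"

definition plicate_prime :: "nat \<Rightarrow> level \<Rightarrow> level" where
  "plicate_prime p = (\<lambda>(N, S). (N div gcd p N, {Q \<in> S. Q dvd N div gcd p N}))"

text \<open>The steps for different primes commute, so the order in which they are performed is immaterial.\<close>

definition plicate_level :: "nat \<Rightarrow> level \<Rightarrow> level" where
  "plicate_level m L = fold plicate_prime (sorted_list_of_multiset (prime_factorization m)) L"


section \<open>Niebur's harmonic functions\<close>

definition Gamma_inf :: "(real^2^2) set" where
  "Gamma_inf = {A. \<exists>t::int. A = mat2 1 (of_int t) 0 1 \<or> A = - mat2 1 (of_int t) 0 1}"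

definition e_cis :: "complex \<Rightarrow> complex" where
  "e_cis z = exp (2 * of_real pi * \<i> * z)"

definition bessel_I :: "complex \<Rightarrow> real \<Rightarrow> complex" where
  "bessel_I \<nu> x =
     (\<Sum>k. rGamma (of_nat k + \<nu> + 1) / fact k * (of_real x / 2) powr (\<nu> + 2 * of_nat k))"

definition niebur_seed :: "nat \<Rightarrow> complex \<Rightarrow> complex \<Rightarrow> complex" where
  "niebur_seed n s \<tau> =
     e_cis (- of_nat n * of_real (Re \<tau>)) * of_real (sqrt (real n * Im \<tau>)) *
     bessel_I (s - 1/2) (2 * pi * real n * Im \<tau>)"

text \<open>
  The sum runs over the right cosets \<open>\<Gamma>\<^sub>\<infinity> \<gamma>\<close>, \<open>\<gamma> \<in> \<Gamma>\<close>. The seed is invariant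
  under \<open>\<Gamma>\<^sub>\<infinity>\<close>, so the representative chosen in each coset does not matter.
\<close>

definition niebur_G :: "level \<Rightarrow> nat \<Rightarrow> complex \<Rightarrow> complex \<Rightarrow> complex" where
  "niebur_G L n \<tau> s = 2 * of_real pi *
     (\<Sum>\<^sub>\<infinity>C \<in> rcosets\<^bsub>SL2R\<lparr>carrier := level_group L\<rparr>\<^esub> Gamma_inf.
        niebur_seed n s (moebius (SOME \<gamma>. \<gamma> \<in> C) \<tau>))"

text \<open>
  The value at \<open>s = 1\<close> of the analytic continuation of \<open>niebur_G\<close> from \<open>Re s > 1\<close> to a larger
  half-plane. By the identity theorem this value does not depend on the half-plane.
\<close>

definition niebur_j :: "level \<Rightarrow> nat \<Rightarrow> complex \<Rightarrow> complex" where
  "niebur_j L n \<tau> =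
     (SOME F. \<exists>\<sigma><1. F holomorphic_on {s. Re s > \<sigma>} \<and>
                    (\<forall>s. Re s > 1 \<longrightarrow> F s = niebur_G L n \<tau> s)) 1"

definition niebur_c :: "level \<Rightarrow> nat \<Rightarrow> int \<Rightarrow> complex" where
  "niebur_c L n = (SOME c. \<forall>\<tau>\<in>upper_half_plane.
     ((\<lambda>l::nat. c (int l) * e_cis \<tau> ^ l + c (- int l) * cnj (e_cis \<tau>) ^ l) has_sum
        (niebur_j L n \<tau> - (inverse (e_cis \<tau>) ^ n - cnj (e_cis \<tau>) ^ n + c 0))) {1..})"

definition niebur_J :: "level \<Rightarrow> nat \<Rightarrow> complex \<Rightarrow> complex" where
  "niebur_J L n \<tau> = (if n = 0 then 1 else niebur_j L n \<tau> - niebur_c L n 0)"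


section \<open>Weakly holomorphic modular functions\<close>

text \<open>
  Expansions at \<open>\<i>\<infinity>\<close> in the local parameter \<open>e(\<tau>/h)\<close>. The value of \<open>g'\<close> at \<open>0\<close> is not
  constrained by \<open>g\<close>.
\<close>

definition meromorphic_at_iinf :: "(complex \<Rightarrow> complex) \<Rightarrow> bool" where
  "meromorphic_at_iinf g \<longleftrightarrow>
     (\<exists>h::nat. h > 0 \<and> (\<exists>g'. g' meromorphic_on {0} \<and>
        (\<forall>\<tau>\<in>upper_half_plane. g \<tau> = g' (e_cis (\<tau> / of_nat h)))))"

definition holomorphic_at_iinf :: "(complex \<Rightarrow> complex) \<Rightarrow> bool" where
  "holomorphic_at_iinf g \<longleftrightarrow>
     (\<exists>h::nat. h > 0 \<and> (\<exists>g'. g' analytic_on {0} \<and>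
        (\<forall>\<tau>\<in>upper_half_plane. g \<tau> = g' (e_cis (\<tau> / of_nat h)))))"

text \<open>
  For groups commensurable with \<open>SL\<^sub>2(\<int>)\<close> the cusps are represented by the points
  \<open>\<alpha>(\<i>\<infinity>)\<close> with \<open>\<alpha> \<in> SL\<^sub>2(\<int>)\<close>.
\<close>

definition weakly_holomorphic_on_group :: "(real^2^2) set \<Rightarrow> (complex \<Rightarrow> complex) \<Rightarrow> bool" where
  "weakly_holomorphic_on_group G f \<longleftrightarrow>
     f holomorphic_on upper_half_plane \<and>
     (\<forall>\<gamma>\<in>G. \<forall>\<tau>\<in>upper_half_plane. f (moebius \<gamma> \<tau>) = f \<tau>) \<and>
     (\<forall>\<alpha>\<in>SL2Z. meromorphic_at_iinf (\<lambda>\<tau>. f (moebius \<alpha> \<tau>)))"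

definition weakly_holomorphic :: "(complex \<Rightarrow> complex) \<Rightarrow> bool" where
  "weakly_holomorphic f \<longleftrightarrow>
     (\<exists>G. subgroup G (SL2R\<lparr>carrier := SL2Z\<rparr>) \<and>
          finite (rcosets\<^bsub>SL2R\<lparr>carrier := SL2Z\<rparr>\<^esub> G) \<and>
          weakly_holomorphic_on_group G f)"

text \<open>
  The cusp \<open>\<alpha>(\<i>\<infinity>)\<close> is equivalent to \<open>\<i>\<infinity>\<close> under \<open>G\<close> iff some \<open>\<gamma> \<alpha>\<close> with
  \<open>\<gamma> \<in> G\<close> fixes \<open>\<i>\<infinity>\<close>, that is, has vanishing lower left entry.
\<close>

definition M0_inf :: "(real^2^2) set \<Rightarrow> (complex \<Rightarrow> complex) set" where
  "M0_inf G = {f. weakly_holomorphic_on_group G f \<and>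
     (\<forall>\<alpha>\<in>SL2Z. (\<nexists>\<gamma>. \<gamma> \<in> G \<and> (\<gamma> ** \<alpha>)$2$1 = 0) \<longrightarrow>
        holomorphic_at_iinf (\<lambda>\<tau>. f (moebius \<alpha> \<tau>)))}"


section \<open>Hecke operators\<close>

definition U_star :: "nat \<Rightarrow> (complex \<Rightarrow> complex) \<Rightarrow> complex \<Rightarrow> complex" where
  "U_star m f \<tau> = (\<Sum>i<m. f ((\<tau> + of_nat i) / of_nat m))"

definition hecke_J_prime_power :: "nat \<Rightarrow> nat \<Rightarrow> level \<Rightarrow> nat \<Rightarrow> complex \<Rightarrow> complex" where
  "hecke_J_prime_power p r L n \<tau> =
     (\<Sum>i\<le>r. U_star (p ^ (r - i)) (niebur_J (plicate_level (p ^ i) L) n) (of_nat (p ^ i) * \<tau>))"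

text \<open>
  \<open>hecke_J_list [(p\<^sub>1,k\<^sub>1), \<dots>, (p\<^sub>r,k\<^sub>r)] L n\<close> is \<open>J\<^bsub>L,n\<^esub>\<close> with \<open>T(p\<^sub>1^k\<^sub>1)\<close>, then
  \<open>T(p\<^sub>2^k\<^sub>2)\<close>, and so on applied to it. Whenever a further operator follows,
  \<open>J\<^bsub>L,n\<^esub> | T(p^k)\<close> is written as a finite combination of functions \<open>J\<^bsub>L',n'\<^esub>\<close>, on which
  the remaining operators act term by term; for \<open>n = 0\<close> it is the constant
  \<open>1 + p + \<dots> + p^k\<close>, regarded as a multiple of \<open>J\<^bsub>L,0\<^esub> = 1\<close>.
\<close>

fun hecke_J_list :: "(nat \<times> nat) list \<Rightarrow> level \<Rightarrow> nat \<Rightarrow> complex \<Rightarrow> complex" where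
  "hecke_J_list [] L n \<tau> = niebur_J L n \<tau>"
| "hecke_J_list [(p, k)] L n \<tau> = hecke_J_prime_power p k L n \<tau>"
| "hecke_J_list ((p, k) # x # xs) L n \<tau> =
     (if n = 0 then of_nat (\<Sum>i\<le>k. p ^ i) * hecke_J_list (x # xs) L 0 \<tau>
      else \<Sum>j | p ^ j dvd gcd n (p ^ k).
             of_nat (p ^ j) *
             hecke_J_list (x # xs) (plicate_level (p ^ j) L) (p ^ k * n div p ^ (2 * j)) \<tau>)"

text \<open>The factors for distinct primes commute; the primes are taken in increasing order.\<close>

definition hecke_J :: "nat \<Rightarrow> level \<Rightarrow> nat \<Rightarrow> complex \<Rightarrow> complex" where
  "hecke_J m =
     hecke_J_list (map (\<lambda>p. (p, multiplicity p m)) (sorted_list_of_set (prime_factors m)))"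

text \<open>
  The coefficients \<open>a\<^sub>k\<close> in \<open>f = \<Sum>\<^sub>k a\<^sub>k J\<^bsub>L,k\<^esub>\<close>, which exist uniquely for
  \<open>f \<in> M0_inf (level_group L)\<close> by Niebur's theorem.
\<close>

definition niebur_coeffs :: "level \<Rightarrow> (complex \<Rightarrow> complex) \<Rightarrow> nat \<Rightarrow> complex" where
  "niebur_coeffs L f = (SOME a. finite {k. a k \<noteq> 0} \<and>
     (\<forall>\<tau>\<in>upper_half_plane. f \<tau> = (\<Sum>k | a k \<noteq> 0. a k * niebur_J L k \<tau>)))"

definition hecke_T :: "nat \<Rightarrow> level \<Rightarrow> (complex \<Rightarrow> complex) \<Rightarrow> complex \<Rightarrow> complex" where
  "hecke_T m L f \<tau> =
     (\<Sum>k | niebur_coeffs L f k \<noteq> 0. niebur_coeffs L f k * hecke_J m L k \<tau>)"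

definition plicate :: "nat \<Rightarrow> level \<Rightarrow> (complex \<Rightarrow> complex) \<Rightarrow> complex \<Rightarrow> complex" where
  "plicate m L f \<tau> =
     (\<Sum>k | niebur_coeffs L f k \<noteq> 0. niebur_coeffs L f k * niebur_J (plicate_level m L) k \<tau>)"

end

theory Submission
  imports Defs "HOL-Number_Theory.Number_Theory"
begin

text \<open>
  Summing over the cosets by their lower left entry turns \<open>niebur_G\<close> into a series over moduli of
  smoothly weighted Kloosterman sums. Kloosterman's fourth moment bound makes it converge beyond
  \<open>Re s = 1\<close>, so \<open>niebur_j\<close> is a genuine continuation, and identities between the series at
  \<open>Re s > 1\<close> pass to \<open>s = 1\<close>. One such identity comes from two decompositions of the integral
  matrices of determinant \<open>p Q\<close>, by right and by left multiplication with matrices of determinant \<open>p\<close>: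
  it is the relation \<open>j\<^bsub>n\<^esub> | T(p) = j\<^bsub>pn\<^esub> + p j\<^bsub>n/p\<^esub>\<close>, the last term at the level of the
  \<open>p\<close>-plicate.
  It propagates to prime powers and shows that the two ways of writing \<open>J | T(p\<^sup>k)\<close> differ by a
  constant. Hence, up to a constant, \<open>f | T(n)\<close> is a sum of functions
  \<open>f\<^bsup>(d)\<^esup>((a \<tau> + b) / c)\<close> with \<open>d\<close> dividing \<open>n\<close>, and such substitutions preserve weak
  holomorphy on congruence subgroups.
\<close>

section \<open>Kloosterman sums\<close>

text \<open>The single functions \<open>J\<close> are only harmonic, whereas the hypothesis speaks
  of the combinations \<open>plicate d L f\<close>. The composition \<open>T(m)\<close>, however, is
  defined by expanding \<open>J | T(p^k)\<close> into single functions \<open>J\<close> of other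
  levels and indices. The proof therefore runs against the definition: the expansion is folded back
  into averages over affine substitutions, under which the sum over \<open>k\<close> with the
  coefficients of \<open>f\<close> can be taken first. Folding back needs the Hecke relation at s =
  1, outside the region of absolute convergence, where \<open>niebur_j\<close> is a SOME that says
  nothing unless a continuation exists. The constant term \<open>niebur_c\<close> is likewise a
  SOME; working up to constants avoids it, and no Fourier expansion of \<open>niebur_j\<close> is
  used. The half-plane Re s > 15/16 comes from adding exponents of the modulus: 3/4 for the
  Kloosterman sum, 1/16 for a logarithm and -15/8 for the weight give -17/16, which converges even
  with the divisor function as a factor.\<close>

definition addchar :: "nat \<Rightarrow> int \<Rightarrow> complex" where
  "addchar c x = cis (2 * pi * of_int x / of_nat c)"

lemma norm_addchar [simp]: "norm (addchar c x) = 1"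
  by (simp add: addchar_def)

lemma addchar_0 [simp]: "addchar c 0 = 1"
  by (simp add: addchar_def)

lemma addchar_add: "addchar c (x + y) = addchar c x * addchar c y"
  by (simp add: addchar_def cis_mult add_divide_distrib distrib_left)

lemma cnj_addchar: "cnj (addchar c x) = addchar c (- x)"
  by (simp add: addchar_def cis_cnj)

lemma addchar_multiple: "c > 0 \<Longrightarrow> addchar c (int c * k) = 1"
  using cis_multiple_2pi[of "of_int k"] by (simp add: addchar_def mult.assoc)

lemma addchar_cong:
  assumes "c > 0" "[x = y] (mod int c)"
  shows "addchar c x = addchar c y"
proof -
  obtain k where "x = y + int c * k"
    using assms(2) by (metis cong_iff_lin cong_sym)
  then show ?thesis
    by (simp add: addchar_add addchar_multiple assms(1))
qed

lemma addchar_power: "addchar c x ^ k = addchar c (int k * x)"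
  by (induction k) (simp_all add: addchar_add algebra_simps)

lemma addchar_eq_1_iff:
  assumes "c > 0"
  shows "addchar c x = 1 \<longleftrightarrow> int c dvd x"
proof
  assume "addchar c x = 1"
  then have "cos (2 * pi * of_int x / of_nat c) = 1"
    by (simp add: addchar_def complex_eq_iff)
  then obtain k :: int where "2 * pi * of_int x / of_nat c = of_int k * 2 * pi"
    using cos_one_2pi_int by metis
  then have "real_of_int x = of_int k * of_nat c"
    using assms by (simp add: field_simps)
  then have "x = k * int c"
    by (metis of_int_eq_iff of_int_mult of_int_of_nat_eq)
  then show "int c dvd x" by simp
next
  assume "int c dvd x"
  then show "addchar c x = 1"
    using addchar_multiple[OF assms] by auto
qed

lemma sum_addchar:
  assumes "c > 0"
  shows "(\<Sum>a<c. addchar c (int a * x)) = (if int c dvd x then of_nat c else 0)"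
proof (cases "int c dvd x")
  case True
  then have "addchar c (int a * x) = 1" for a
    using addchar_eq_1_iff[OF assms] by simp
  then show ?thesis using True by simp
next
  case False
  then have "addchar c x \<noteq> 1" using addchar_eq_1_iff[OF assms] by simp
  then have "(\<Sum>a<c. addchar c x ^ a) = (addchar c x ^ c - 1) / (addchar c x - 1)"
    by (rule geometric_sum)
  then show ?thesis
    using False addchar_multiple[OF assms] by (simp add: addchar_power)
qed

lemma sum_int_lessThan: "(\<Sum>x\<in>{0..<int c}. f x) = (\<Sum>a<c. f (int a))"
proof -
  have "{0..<int c} = int ` {..<c}"
    by (metis image_int_atLeastLessThan lessThan_atLeast0 of_nat_0)
  then show ?thesis by (simp add: sum.reindex)
qed

text \<open>Orthogonality of the characters in a and in b, after the square is expanded.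
  \<open>P\<close> and \<open>R\<close> are arbitrary so that \<open>V\<close> may consist of pairs
  of units; the second moment over pairs is the fourth moment of Kloosterman sums.\<close>

lemma fourier_moment:
  assumes "c > 0" "finite V"
  shows "(\<Sum>a<c. \<Sum>b<c. (norm (\<Sum>v\<in>V. addchar c (int a * P v + int b * R v)))\<^sup>2) =
    (real c)\<^sup>2 * card {(v, w) \<in> V \<times> V. [P v = P w] (mod int c) \<and> [R v = R w] (mod int c)}"
    (is "?L = _ * real (card ?T)")
proof -
  have sq: "of_real ((norm z)\<^sup>2) = z * cnj z" for z by (rule complex_norm_square)
  have "complex_of_real ?L =
      (\<Sum>a<c. \<Sum>b<c. \<Sum>v\<in>V. \<Sum>w\<in>V. addchar c (int a * (P v - P w)) * addchar c (int b * (R v - R w)))"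
    unfolding of_real_sum sq cnj_sum sum_product cnj_addchar
    by (intro sum.cong refl, simp flip: addchar_add) (simp add: algebra_simps)
  also have "\<dots> = (\<Sum>a<c. \<Sum>v\<in>V. \<Sum>b<c. \<Sum>w\<in>V. addchar c (int a * (P v - P w)) * addchar c (int b * (R v - R w)))"
    by (intro sum.cong refl sum.swap)
  also have "\<dots> = (\<Sum>a<c. \<Sum>v\<in>V. \<Sum>w\<in>V. \<Sum>b<c. addchar c (int a * (P v - P w)) * addchar c (int b * (R v - R w)))"
    by (intro sum.cong refl sum.swap)
  also have "\<dots> = (\<Sum>v\<in>V. \<Sum>a<c. \<Sum>w\<in>V. \<Sum>b<c. addchar c (int a * (P v - P w)) * addchar c (int b * (R v - R w)))"
    by (intro sum.cong refl sum.swap)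
  also have "\<dots> = (\<Sum>v\<in>V. \<Sum>w\<in>V. \<Sum>a<c. \<Sum>b<c. addchar c (int a * (P v - P w)) * addchar c (int b * (R v - R w)))"
    by (intro sum.cong refl sum.swap)
  also have "\<dots> = (\<Sum>v\<in>V. \<Sum>w\<in>V. (\<Sum>a<c. addchar c (int a * (P v - P w))) *
                       (\<Sum>b<c. addchar c (int b * (R v - R w))))"
    unfolding sum_product by (rule refl)
  also have "\<dots> = (\<Sum>v\<in>V. \<Sum>w\<in>V. if (v, w) \<in> ?T then (of_nat c)\<^sup>2 else 0)"
    by (intro sum.cong refl)
       (auto simp: sum_addchar[OF assms(1)] cong_iff_dvd_diff power2_eq_square)
  also have "\<dots> = (\<Sum>z\<in>V \<times> V. if z \<in> ?T then (of_nat c)\<^sup>2 else 0)"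
    unfolding sum.cartesian_product by (intro sum.cong refl) (auto split: if_splits)
  also have "\<dots> = (\<Sum>z\<in>V \<times> V \<inter> ?T. (of_nat c)\<^sup>2 :: complex)"
    using assms(2) by (intro sum.inter_restrict[symmetric]) simp
  also have "V \<times> V \<inter> ?T = ?T" by auto
  also have "(\<Sum>z\<in>?T. (of_nat c)\<^sup>2 :: complex) = complex_of_real ((real c)\<^sup>2 * card ?T)"
    by simp
  finally show ?thesis
    by (simp only: of_real_eq_iff)
qed

section \<open>Units modulo c and a count of vanishing triple products\<close>

definition units_mod :: "nat \<Rightarrow> int set" where
  "units_mod c = {x \<in> {0..<int c}. coprime x (int c)}"

lemma finite_units_mod [simp]: "finite (units_mod c)"
  unfolding units_mod_def by (rule finite_subset[of _ "{0..<int c}"]) auto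

lemma units_modD: "x \<in> units_mod c \<Longrightarrow> coprime x (int c)" "x \<in> units_mod c \<Longrightarrow> 0 \<le> x"
  "x \<in> units_mod c \<Longrightarrow> x < int c"
  by (auto simp: units_mod_def)

text \<open>The modulus 1 is separate because its unit is 0 in \<open>units_mod\<close>, but 1 in
  \<open>totatives\<close>. The unit 0 is what makes C = 1 contribute to the later sum over bottom
  rows.\<close>

lemma card_units_mod:
  assumes "c > 0"
  shows "card (units_mod c) = totient c"
proof (cases "c = 1")
  case True
  then have "units_mod c = {0}" by (auto simp: units_mod_def)
  then show ?thesis using True by simp
next
  case False
  have "units_mod c = int ` totatives c"
  proof (intro equalityI subsetI)
    fix x assume x: "x \<in> units_mod c"
    then have "x \<noteq> 0" using False by (auto simp: units_mod_def)
    with x have "nat x \<in> totatives c" "x = int (nat x)"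
      by (auto simp: units_mod_def in_totatives_iff coprime_int_iff[symmetric])
    then show "x \<in> int ` totatives c" by blast
  next
    fix x assume "x \<in> int ` totatives c"
    then show "x \<in> units_mod c"
      using False assms by (auto simp: units_mod_def in_totatives_iff totatives_less)
  qed
  then show ?thesis
    by (simp add: card_image totient_def)
qed

lemma card_multiples_int:
  fixes c g :: nat
  assumes "g dvd c" "c > 0"
  shows "card {x \<in> {0..<int c}. int g dvd x} = c div g"
proof -
  have g: "g > 0" using assms by (auto intro: dvd_pos_nat)
  have "{x \<in> {0..<int c}. int g dvd x} = (\<lambda>k. int g * int k) ` {..<c div g}"
  proof (intro equalityI subsetI)
    fix x assume "x \<in> {x \<in> {0..<int c}. int g dvd x}"
    then obtain k where k: "x = int g * k" "0 \<le> x" "x < int c" by auto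
    then have "k \<ge> 0" using g by (simp add: zero_le_mult_iff)
    moreover have "int g * k < int g * int (c div g)"
      using k(1,3) assms by (metis dvd_mult_div_cancel of_nat_mult)
    ultimately show "x \<in> (\<lambda>k. int g * int k) ` {..<c div g}"
      using k(1) g by (intro image_eqI[of _ _ "nat k"]) auto
  next
    fix x assume "x \<in> (\<lambda>k. int g * int k) ` {..<c div g}"
    then obtain k where k: "x = int g * int k" "k < c div g" by auto
    then have "g * k < g * (c div g)" using g by simp
    then have "g * k < c" using assms by simp
    then have "int g * int k < int c" by (metis of_nat_less_iff of_nat_mult)
    with k show "x \<in> {x \<in> {0..<int c}. int g dvd x}" by auto
  qed
  moreover have "inj_on (\<lambda>k. int g * int k) {..<c div g}"
    using g by (auto intro: inj_onI)
  ultimately show ?thesis by (simp add: card_image)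
qed

definition divisor_count :: "nat \<Rightarrow> nat" where
  "divisor_count c = card {d. d dvd c}"

lemma dvd_gcd_mult:
  fixes c s t :: int
  assumes "c dvd s * t"
  shows "c dvd gcd s c * t"
proof -
  obtain x y where "x * s + y * c = gcd s c" using bezout_int by blast
  then have "gcd s c * t = x * (s * t) + c * (y * t)" by (simp add: algebra_simps flip: \<open>_ = gcd s c\<close>)
  then show ?thesis using assms by simp
qed

text \<open>Sort by g = gcd s c and h = gcd u c. There are c/g multiples of g and c/h multiples of
  h, and v must be divisible by c / gcd c (g h), which leaves gcd c (g h) <= g h values. Each pair
  (g, h) of divisors thus admits at most c^2 triples.\<close>

lemma card_triple_product_zero:
  fixes c :: nat
  assumes "c > 0"
  defines "I \<equiv> {0..<int c}"
  shows "card {(s, u, v) \<in> I \<times> I \<times> I. int c dvd s * u * v} \<le> (c * divisor_count c)\<^sup>2"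
    (is "card ?T \<le> _")
proof -
  define D where "D = {d. d dvd c}"
  have finD: "finite D" using assms by (simp add: D_def)
  define box where "box = (\<lambda>(g, h). {s \<in> I. int g dvd s} \<times> {u \<in> I. int h dvd u} \<times>
      {v \<in> I. int (c div gcd c (g * h)) dvd v})"
  have sub: "?T \<subseteq> (\<Union>p\<in>D \<times> D. box p)"
  proof safe
    fix s u v assume suv: "s \<in> I" "u \<in> I" "v \<in> I" and dv: "int c dvd s * u * v"
    define g where "g = nat (gcd s (int c))"
    define h where "h = nat (gcd u (int c))"
    have g: "int g = gcd s (int c)" and h: "int h = gcd u (int c)"
      by (simp_all add: g_def h_def)
    have gD: "g \<in> D" "h \<in> D"
      unfolding D_def mem_Collect_eq by (metis g gcd_dvd2 int_dvd_int_iff, metis h gcd_dvd2 int_dvd_int_iff)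
    have "int c dvd s * (u * v)" using dv by (simp add: mult.assoc)
    then have "int c dvd int g * (u * v)" unfolding g by (rule dvd_gcd_mult)
    then have "int c dvd u * (int g * v)" by (simp only: mult.left_commute)
    then have "int c dvd int h * (int g * v)" unfolding h by (rule dvd_gcd_mult)
    then have c1: "int c dvd int (g * h) * v" by (simp add: algebra_simps)
    let ?k = "gcd c (g * h)"
    have "int (c div ?k) dvd int (g * h div ?k) * v"
    proof -
      have "int ?k * int (c div ?k) dvd int ?k * (int (g * h div ?k) * v)"
        using c1 by (simp add: mult.assoc[symmetric] flip: of_nat_mult)
      then show ?thesis using assms by simp
    qed
    moreover have "coprime (int (c div ?k)) (int (g * h div ?k))"
      using assms div_gcd_coprime by (simp add: div_gcd_coprime)
    ultimately have "int (c div ?k) dvd v" using coprime_dvd_mult_right_iff by blast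
    moreover have "int g dvd s" "int h dvd u" unfolding g h by simp_all
    ultimately have "(s, u, v) \<in> box (g, h)" using suv by (simp add: box_def)
    then show "(s, u, v) \<in> (\<Union>p\<in>D \<times> D. box p)"
      using gD by blast
  qed
  have cardbox: "card (box p) \<le> c\<^sup>2" if "p \<in> D \<times> D" for p
  proof -
    obtain g h where p: "p = (g, h)" by (cases p)
    with that have p: "p = (g, h)" "g dvd c" "h dvd c" by (auto simp: D_def)
    let ?k = "gcd c (g * h)"
    have gh: "g > 0" "h > 0" using p assms by (auto intro: dvd_pos_nat)
    have "c div (c div ?k) = ?k"
      using assms by (simp add: div_div_eq_right)
    moreover have "c div ?k dvd c" by (metis dvd_triv_right dvd_mult_div_cancel gcd_dvd1)
    ultimately have "card (box p) = (c div g) * ((c div h) * ?k)"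
      using card_multiples_int[OF p(2) assms(1)] card_multiples_int[OF p(3) assms(1)]
        card_multiples_int[of "c div ?k" c] assms(1)
      by (simp add: p box_def card_cartesian_product I_def)
    also have "\<dots> \<le> (c div g) * ((c div h) * (g * h))"
      using gh by (intro mult_le_mono order.refl gcd_le2_nat) auto
    also have "\<dots> = ((c div g) * g) * ((c div h) * h)" by (simp add: algebra_simps)
    also have "\<dots> = c\<^sup>2" using p by (simp add: power2_eq_square)
    finally show ?thesis .
  qed
  have "finite I" by (simp add: I_def)
  then have finbox: "finite (box p)" for p by (cases p) (auto simp: box_def)
  have "card ?T \<le> card (\<Union>p\<in>D \<times> D. box p)"
    by (intro card_mono sub finite_UN_I finite_cartesian_product finD finbox)
  also have "\<dots> \<le> (\<Sum>p\<in>D \<times> D. card (box p))"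
    using finD by (intro card_UN_le) auto
  also have "\<dots> \<le> (\<Sum>p\<in>D \<times> D. c\<^sup>2)" by (intro sum_mono cardbox)
  also have "\<dots> = (c * divisor_count c)\<^sup>2"
    by (simp add: divisor_count_def D_def card_cartesian_product power2_eq_square)
  finally show ?thesis .
qed

section \<open>Kloosterman sums and their fourth moment\<close>

lemma inv_units:
  assumes "c > 0" "x \<in> units_mod c"
  shows "modular_inverse (int c) x \<in> units_mod c"
    "[x * modular_inverse (int c) x = 1] (mod int c)"
  using assms modular_inverse_int_nonneg[of "int c" x] modular_inverse_int_less[of "int c" x]
  by (auto simp: units_mod_def intro: cong_modular_inverse1)

definition kloosterman :: "nat \<Rightarrow> int \<Rightarrow> int \<Rightarrow> complex" where
  "kloosterman c m l = (\<Sum>x\<in>units_mod c. addchar c (m * modular_inverse (int c) x + l * x))"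

lemma units_mod_eqI:
  assumes "x \<in> units_mod c" "y \<in> units_mod c" "[x = y] (mod int c)"
  shows "x = y"
  using assms by (simp add: units_mod_def cong_def)

lemma kloosterman_cong:
  assumes "c > 0" "[m = m'] (mod int c)" "[l = l'] (mod int c)"
  shows "kloosterman c m l = kloosterman c m' l'"
  unfolding kloosterman_def
  by (intro sum.cong refl addchar_cong cong_add cong_mult cong_refl assms)

text \<open>Put s = x1 + x2, u = x3 - x1, v = x4 - x1. The relation between the inverses gives s (x3
  x4 - x1 x2) = 0, and the relation between the units turns the second factor into u v. So solutions
  map to triples with s u v = 0 modulo c.\<close>

lemma card_kloosterman_solutions:
  assumes c: "c > 0"
  defines "V \<equiv> units_mod c \<times> units_mod c"
  defines "P \<equiv> \<lambda>(x, y). modular_inverse (int c) x + modular_inverse (int c) y"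
  defines "R \<equiv> \<lambda>(x, y). x + y :: int"
  shows "card {(v, w) \<in> V \<times> V. [P v = P w] (mod int c) \<and> [R v = R w] (mod int c)}
    \<le> 2 * (c * divisor_count c)\<^sup>2" (is "card ?S \<le> _")
proof -
  define I where "I = {0..<int c}"
  let ?T = "{(s, u, v) \<in> I \<times> I \<times> I. int c dvd s * u * v}"
  let ?i = "modular_inverse (int c)"
  \<comment> \<open>The triple fixes 2 x1 modulo c, because x1 + x2 = x3 + x4 gives s - u - v = 2
    x1. The bit says on which side of c/2 the residue x1 lies and so fixes x1; it costs the factor
    2.\<close>
  define F where "F = (\<lambda>((x1, x2), (x3, x4)). (((x1 + x2) mod int c, (x3 - x1) mod int c, (x4 - x1) mod int c),
      2 * x1 < int c))"
  have "F ` ?S \<subseteq> ?T \<times> UNIV"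
  proof (rule image_subsetI)
    fix z assume z: "z \<in> ?S"
    obtain x1 x2 x3 x4 where zx: "z = ((x1, x2), (x3, x4))" by (metis prod.exhaust)
    from z have x: "x1 \<in> units_mod c" "x2 \<in> units_mod c" "x3 \<in> units_mod c" "x4 \<in> units_mod c"
      and cP: "[?i x1 + ?i x2 = ?i x3 + ?i x4] (mod int c)"
      and cR: "[x1 + x2 = x3 + x4] (mod int c)"
      by (auto simp: V_def P_def R_def zx)
    have mod_I: "z mod int c \<in> I" for z using c by (simp add: I_def)
    define y1 where "y1 = ?i x1"
    define y2 where "y2 = ?i x2"
    define y3 where "y3 = ?i x3"
    define y4 where "y4 = ?i x4"
    have inv: "[x1 * y1 = 1] (mod int c)" "[x2 * y2 = 1] (mod int c)"
       "[x3 * y3 = 1] (mod int c)" "[x4 * y4 = 1] (mod int c)"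
      using x inv_units[OF c] by (simp_all add: y1_def y2_def y3_def y4_def)
    have clear: "[(y + y') * (x * x') = x + x'] (mod int c)"
      if "[x * y = 1] (mod int c)" "[x' * y' = 1] (mod int c)" for x y x' y' :: int
    proof -
      have "[x' * (x * y) + x * (x' * y') = x' * 1 + x * 1] (mod int c)"
        by (intro cong_add cong_mult cong_refl that)
      then show ?thesis by (simp add: algebra_simps)
    qed
    \<comment> \<open>Multiply the relation between the inverses by x1 x2 x3 x4 to clear
      denominators.\<close>
    have "[(x1 + x2) * (x3 * x4) = ((y1 + y2) * (x1 * x2)) * (x3 * x4)] (mod int c)"
      by (intro cong_mult cong_refl cong_sym[OF clear] inv)
    moreover have "[(y1 + y2) * (x1 * x2 * (x3 * x4)) = (y3 + y4) * (x1 * x2 * (x3 * x4))] (mod int c)"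
      using cP by (intro cong_mult cong_refl) (simp add: y1_def y2_def y3_def y4_def)
    moreover have "[((y3 + y4) * (x3 * x4)) * (x1 * x2) = (x3 + x4) * (x1 * x2)] (mod int c)"
      by (intro cong_mult cong_refl clear inv)
    moreover have "[(x3 + x4) * (x1 * x2) = (x1 + x2) * (x1 * x2)] (mod int c)"
      by (intro cong_mult cong_refl cong_sym[OF cR])
    ultimately have e1: "[(x1 + x2) * (x3 * x4) = (x1 + x2) * (x1 * x2)] (mod int c)"
      by (simp add: cong_def mult_ac)
    have "[x3 * x4 - x1 * (x3 + x4) + x1 * x1 = x3 * x4 - x1 * (x1 + x2) + x1 * x1] (mod int c)"
      by (intro cong_add cong_diff cong_mult cong_refl cong_sym[OF cR])
    then have "[(x3 - x1) * (x4 - x1) = x3 * x4 - x1 * x2] (mod int c)"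
      by (simp add: algebra_simps)
    then have "[(x1 + x2) * ((x3 - x1) * (x4 - x1)) = (x1 + x2) * (x3 * x4 - x1 * x2)] (mod int c)"
      by (intro cong_mult cong_refl)
    moreover have "[(x1 + x2) * (x3 * x4 - x1 * x2) = 0] (mod int c)"
      using e1 by (simp add: right_diff_distrib cong_diff_iff_cong_0)
    ultimately have "[(x1 + x2) * ((x3 - x1) * (x4 - x1)) = 0] (mod int c)"
      by (rule cong_trans)
    moreover have "[((x1 + x2) mod int c) * (((x3 - x1) mod int c) * ((x4 - x1) mod int c)) =
        (x1 + x2) * ((x3 - x1) * (x4 - x1))] (mod int c)"
      by (intro cong_mult) (simp_all add: cong_def)
    ultimately have "[((x1 + x2) mod int c) * ((x3 - x1) mod int c) * ((x4 - x1) mod int c) = 0] (mod int c)"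
      unfolding mult.assoc by (meson cong_trans)
    then have "F ((x1, x2), (x3, x4)) \<in> ?T \<times> UNIV"
      by (simp add: F_def mod_I cong_0_iff)
    then show "F z \<in> ?T \<times> UNIV" by (simp only: zx)
  qed
  moreover have "inj_on F ?S"
  proof (rule inj_onI)
    fix z z' assume z: "z \<in> ?S" "z' \<in> ?S" and eq: "F z = F z'"
    obtain x1 x2 x3 x4 where zx: "z = ((x1, x2), (x3, x4))" by (metis prod.exhaust)
    obtain y1 y2 y3 y4 where zy: "z' = ((y1, y2), (y3, y4))" by (metis prod.exhaust)
    from z have x: "x1 \<in> units_mod c" "x2 \<in> units_mod c" "x3 \<in> units_mod c" "x4 \<in> units_mod c"
      "y1 \<in> units_mod c" "y2 \<in> units_mod c" "y3 \<in> units_mod c" "y4 \<in> units_mod c"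
      and cR: "[x1 + x2 = x3 + x4] (mod int c)" "[y1 + y2 = y3 + y4] (mod int c)"
      by (auto simp: V_def R_def zx zy)
    from eq have e: "[x1 + x2 = y1 + y2] (mod int c)" "[x3 - x1 = y3 - y1] (mod int c)"
       "[x4 - x1 = y4 - y1] (mod int c)" and b: "2 * x1 < int c \<longleftrightarrow> 2 * y1 < int c"
      by (auto simp: F_def zx zy cong_def)
    have "[x3 + x4 = y3 + y4] (mod int c)"
      using cR e(1) by (meson cong_sym cong_trans)
    then have "[(x3 + x4) - (x3 - x1) - (x4 - x1) = (y3 + y4) - (y3 - y1) - (y4 - y1)] (mod int c)"
      by (intro cong_diff e)
    then have "int c dvd 2 * x1 - 2 * y1" by (simp add: cong_iff_dvd_diff)
    moreover have "\<bar>2 * x1 - 2 * y1\<bar> < int c" using b x(1,5) by (auto simp: units_mod_def)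
    ultimately have "2 * x1 - 2 * y1 = 0" using dvd_imp_le_int[of "2 * x1 - 2 * y1" "int c"] by auto
    then have 1: "x1 = y1" by simp
    have "[x3 = y3] (mod int c)" "[x4 = y4] (mod int c)" "[x2 = y2] (mod int c)"
      using e cong_add[OF e(2) cong_refl[of x1]] cong_add[OF e(3) cong_refl[of x1]]
        cong_diff[OF e(1) cong_refl[of x1]] by (simp_all add: 1)
    then show "z = z'"
      using x 1 by (auto simp: zx zy intro: units_mod_eqI)
  qed
  moreover have "finite ?T" unfolding I_def by (rule finite_subset[of _ "{0..<int c} \<times> {0..<int c} \<times> {0..<int c}"]) auto
  ultimately have "card ?S \<le> card (?T \<times> (UNIV :: bool set))"
    by (intro card_inj_on_le) auto
  also have "\<dots> = 2 * card ?T" by (simp add: card_cartesian_product)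
  also have "\<dots> \<le> 2 * (c * divisor_count c)\<^sup>2"
    using card_triple_product_zero[OF c] by (simp add: I_def)
  finally show ?thesis .
qed

text \<open>The square of a Kloosterman sum is a character sum over pairs of units, so
  \<open>fourier_moment\<close> reduces the claim to the number of solutions just bounded.\<close>

lemma kloosterman_fourth_moment:
  assumes c: "c > 0"
  shows "(\<Sum>a<c. \<Sum>b<c. norm (kloosterman c (int a) (int b)) ^ 4) \<le> 2 * real c ^ 4 * (real (divisor_count c))\<^sup>2"
proof -
  let ?i = "modular_inverse (int c)"
  define V where "V \<equiv> units_mod c \<times> units_mod c"
  define P where "P \<equiv> \<lambda>(x, y). ?i x + ?i y"
  define R where "R \<equiv> \<lambda>(x, y). x + y :: int"
  have "norm (kloosterman c m l) ^ 4 = (norm (\<Sum>v\<in>V. addchar c (m * P v + l * R v)))\<^sup>2" for m l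
  proof -
    have "norm (kloosterman c m l) ^ 4 = (norm (kloosterman c m l * kloosterman c m l))\<^sup>2"
      by (simp add: norm_mult power2_eq_square power4_eq_xxxx)
    also have "kloosterman c m l * kloosterman c m l = (\<Sum>v\<in>V. addchar c (m * P v + l * R v))"
      unfolding kloosterman_def sum_product V_def sum.cartesian_product P_def R_def
      by (intro sum.cong refl) (auto simp: algebra_simps simp flip: addchar_add)
    finally show ?thesis .
  qed
  then have "(\<Sum>a<c. \<Sum>b<c. norm (kloosterman c (int a) (int b)) ^ 4) =
      (real c)\<^sup>2 * real (card {(v, w) \<in> V \<times> V. [P v = P w] (mod int c) \<and> [R v = R w] (mod int c)})"
    using fourier_moment[OF c, of V P R] by (simp add: V_def)
  also have "\<dots> \<le> (real c)\<^sup>2 * real (2 * (c * divisor_count c)\<^sup>2)"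
    using card_kloosterman_solutions[OF c] unfolding V_def P_def R_def
    by (intro mult_left_mono of_nat_mono) auto
  finally show ?thesis by (simp add: power2_eq_square power4_eq_xxxx algebra_simps)
qed

lemma bij_betw_units_mod_mult:
  assumes c: "c > 0" and u: "u \<in> units_mod c"
  shows "bij_betw (\<lambda>x. u * x mod int c) (units_mod c) (units_mod c)"
proof -
  have inj: "inj_on (\<lambda>x. u * x mod int c) (units_mod c)"
  proof (rule inj_onI)
    fix x y assume x: "x \<in> units_mod c" "y \<in> units_mod c" "u * x mod int c = u * y mod int c"
    then have "[u * x = u * y] (mod int c)" by (simp add: cong_def)
    then have "[x = y] (mod int c)" using units_modD(1)[OF u] by (simp add: cong_mult_lcancel)
    then show "x = y" using x units_mod_eqI by blast
  qed
  moreover have "(\<lambda>x. u * x mod int c) ` units_mod c \<subseteq> units_mod c"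
    using c u by (auto simp: units_mod_def)
  ultimately show ?thesis
    using endo_inj_surj[OF finite_units_mod] by (auto simp: bij_betw_def)
qed

text \<open>Substitute u x for x: the inverse of u x cancels the factor u of the first argument, and
  v cancels the u in the second term.\<close>

lemma kloosterman_orbit:
  assumes c: "c > 0" and u: "u \<in> units_mod c" "[u * v = 1] (mod int c)"
  shows "kloosterman c (m * u) (l * v) = kloosterman c m l"
proof -
  let ?i = "modular_inverse (int c)"
  have "kloosterman c (m * u) (l * v) =
      (\<Sum>x\<in>units_mod c. addchar c (m * u * ?i (u * x mod int c) + l * v * (u * x mod int c)))"
    unfolding kloosterman_def
    by (rule sum.reindex_bij_betw[OF bij_betw_units_mod_mult[OF c u(1)], symmetric])
  also have "\<dots> = kloosterman c m l"
    unfolding kloosterman_def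
  proof (intro sum.cong refl addchar_cong[OF c] cong_add)
    fix x assume x: "x \<in> units_mod c"
    have ux: "u * x mod int c \<in> units_mod c"
      using bij_betw_units_mod_mult[OF c u(1)] x by (auto dest: bij_betwE)
    have "[x * (u * ?i (u * x mod int c)) = 1] (mod int c)"
      using inv_units(2)[OF c ux] by (simp add: cong_def mod_simps mult_ac)
    moreover have "[x * ?i x = 1] (mod int c)" using inv_units(2)[OF c x] .
    ultimately have "[x * (u * ?i (u * x mod int c)) = x * ?i x] (mod int c)"
      by (meson cong_sym cong_trans)
    then have "[u * ?i (u * x mod int c) = ?i x] (mod int c)"
      using units_modD(1)[OF x] by (simp add: cong_mult_lcancel)
    then show "[m * u * ?i (u * x mod int c) = m * ?i x] (mod int c)"
      by (simp add: mult.assoc cong_mult)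
    have "[l * v * (u * x mod int c) = l * v * (u * x)] (mod int c)"
      by (intro cong_mult cong_refl) (simp add: cong_def)
    moreover have "[l * x * (u * v) = l * x * 1] (mod int c)"
      by (intro cong_mult cong_refl u)
    ultimately show "[l * v * (u * x mod int c) = l * x] (mod int c)"
      by (simp add: cong_def mult_ac)
  qed
  finally show ?thesis .
qed

text \<open>Summing \<open>totient d\<close> over the divisors d of c gives c, and no term exceeds
  \<open>totient c\<close>. In \<open>kloosterman_bound\<close> this bounds the orbit length from
  below.\<close>

lemma totient_divisor_count: "c \<le> totient c * divisor_count c"
proof (cases "c = 0")
  case False
  have "c = (\<Sum>d | d dvd c. totient d)" by (rule totient_divisor_sum[symmetric])
  also have "\<dots> \<le> (\<Sum>d | d dvd c. totient c)"
    using False by (intro sum_mono totient_dvd_mono) auto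
  also have "\<dots> = totient c * divisor_count c" by (simp add: divisor_count_def)
  finally show ?thesis .
qed auto

text \<open>
  Kloosterman's original argument: the absolute value is constant along an orbit of length
  \<open>totient c\<close> of \<open>(m, l) \<mapsto> (m u, l u\<^sup>-\<^sup>1)\<close>, on which the fourth moment is averaged. The exponent
  \<open>3/4\<close> suffices because the moduli enter with weight \<open>c powr (-2 Re s)\<close> and any saving over the
  trivial bound \<open>c\<close> gives convergence beyond \<open>Re s = 1\<close>.
\<close>

lemma kloosterman_bound:
  assumes c: "c > 0" and n: "n > 0" and q: "coprime q (int c)"
  shows "norm (kloosterman c (int n * q) l) \<le> 2 * n * real c powr (3/4) * divisor_count c"
proof -
  let ?i = "modular_inverse (int c)"
  let ?U = "units_mod c" and ?I = "{0..<int c}"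
  define k where "k = norm (kloosterman c (int n * q) l)"
  define f where "f = (\<lambda>(a, b). norm (kloosterman c a b) ^ 4)"
  define u0 where "u0 = q mod int c"
  have u0: "u0 \<in> ?U" using c q by (auto simp: u0_def units_mod_def)
  \<comment> \<open>The unit q is moved into the second argument along an orbit, so that the first
    argument becomes n itself.\<close>
  have "kloosterman c (int n * q) l = kloosterman c (int n * u0) (l * u0 * ?i u0)"
  proof (intro kloosterman_cong c)
    show "[int n * q = int n * u0] (mod int c)"
      by (intro cong_mult cong_refl) (simp add: u0_def cong_def)
    have "[l * 1 = l * (u0 * ?i u0)] (mod int c)"
      by (intro cong_mult cong_refl cong_sym[OF inv_units(2)] c u0)
    then show "[l = l * u0 * ?i u0] (mod int c)" by (simp add: mult.assoc)
  qed
  also have "\<dots> = kloosterman c (int n) (l * u0)"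
    by (rule kloosterman_orbit[OF c u0 inv_units(2)[OF c u0]])
  finally have k: "k = norm (kloosterman c (int n) (l * u0))" by (simp add: k_def)
  \<comment> \<open>The residue of n u alone does not determine u when n and c have a common factor.
    Recording the quotient, which is less than n, restores injectivity at the price of a factor
    n.\<close>
  define g where "g = (\<lambda>u. ((int n * u mod int c, l * u0 * ?i u mod int c), nat (int n * u div int c)))"
  have fg: "f (fst (g u)) = k ^ 4" if "u \<in> ?U" for u
  proof -
    have "kloosterman c (int n * u mod int c) (l * u0 * ?i u mod int c) = kloosterman c (int n * u) (l * u0 * ?i u)"
      by (intro kloosterman_cong c) (auto simp: cong_def)
    also have "\<dots> = kloosterman c (int n) (l * u0)"
      by (rule kloosterman_orbit[OF c that inv_units(2)[OF c that]])
    finally show ?thesis by (simp add: f_def g_def k)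
  qed
  have inj: "inj_on g ?U"
  proof (rule inj_onI)
    fix u v assume uv: "u \<in> ?U" "v \<in> ?U" "g u = g v"
    then have "int n * u mod int c = int n * v mod int c"
      "int n * u div int c = int n * v div int c"
      using c by (auto simp: g_def eq_nat_nat_iff pos_imp_zdiv_nonneg_iff units_mod_def)
    then have "int n * u = int n * v" by (metis mult_div_mod_eq)
    then show "u = v" using n by simp
  qed
  have sub: "g ` ?U \<subseteq> (?I \<times> ?I) \<times> {..<n}"
  proof
    fix z assume "z \<in> g ` ?U"
    then obtain u where u: "u \<in> ?U" "z = g u" by auto
    have "int n * u < int n * int c"
      using u n by (auto simp: units_mod_def)
    moreover have "int c * (int n * u div int c) \<le> int n * u"
      using c mult_div_mod_eq[of "int c" "int n * u"] pos_mod_sign[of "int c" "int n * u"] by linarith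
    ultimately have "int c * (int n * u div int c) < int c * int n" by (simp add: mult.commute)
    then have "int n * u div int c < int n" using c by simp
    then show "z \<in> (?I \<times> ?I) \<times> {..<n}" using u c n by (auto simp: g_def nat_less_iff)
  qed
  have "real (totient c) * k ^ 4 = (\<Sum>u\<in>?U. f (fst (g u)))"
    by (simp add: fg card_units_mod[OF c])
  also have "\<dots> = (\<Sum>z\<in>g ` ?U. f (fst z))"
    by (simp add: sum.reindex[OF inj])
  also have "\<dots> \<le> (\<Sum>z\<in>(?I \<times> ?I) \<times> {..<n}. f (fst z))"
    by (intro sum_mono2 sub) (auto simp: f_def)
  also have "\<dots> = real n * (\<Sum>y\<in>?I \<times> ?I. f y)"
    by (simp add: sum.cartesian_product[symmetric, of "\<lambda>y _. f y", simplified case_prod_unfold] sum_distrib_left)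
  also have "(\<Sum>y\<in>?I \<times> ?I. f y) = (\<Sum>a<c. \<Sum>b<c. norm (kloosterman c (int a) (int b)) ^ 4)"
    by (simp add: f_def sum.cartesian_product[symmetric] sum_int_lessThan)
  also have "real n * \<dots> \<le> real n * (2 * real c ^ 4 * (real (divisor_count c))\<^sup>2)"
    by (intro mult_left_mono kloosterman_fourth_moment c) auto
  finally have A: "real (totient c) * k ^ 4 \<le> real n * (2 * real c ^ 4 * (real (divisor_count c))\<^sup>2)" .
  let ?d = "real (divisor_count c)"
  have d1: "?d \<ge> 1"
  proof -
    have "divisor_count c > 0" using totient_divisor_count[of c] c by (intro Nat.gr0I) auto
    then show ?thesis by simp
  qed
  have "real c * k ^ 4 \<le> real (totient c * divisor_count c) * k ^ 4"
    using totient_divisor_count[of c] by (intro mult_right_mono of_nat_mono) (auto simp: k_def)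
  also have "\<dots> = ?d * (real (totient c) * k ^ 4)" by simp
  also have "\<dots> \<le> ?d * (real n * (2 * real c ^ 4 * ?d\<^sup>2))"
    by (intro mult_left_mono A) auto
  finally have "real c * k ^ 4 \<le> real c * (2 * n * real c ^ 3 * ?d ^ 3)"
    by (simp add: power2_eq_square power3_eq_cube power4_eq_xxxx algebra_simps)
  then have "k ^ 4 \<le> real (2 * n) * real c ^ 3 * ?d ^ 3" using c by simp
  \<comment> \<open>Raising 2 n and the divisor count to fourth powers is wasteful, but makes the
    fourth root explicit.\<close>
  also have "\<dots> \<le> real (2 * n) ^ 4 * real c ^ 3 * ?d ^ 4"
  proof (intro mult_mono)
    show "real (2 * n) \<le> real (2 * n) ^ 4" using n by (intro self_le_power) auto
    show "?d ^ 3 \<le> ?d ^ 4" using d1 by (intro power_increasing) auto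
  qed (use d1 in auto)
  also have "\<dots> = (2 * n * real c powr (3/4) * ?d) ^ 4"
    using c by (simp add: power_mult_distrib powr_power powr_numeral)
  finally have "k ^ 4 \<le> (2 * n * real c powr (3/4) * ?d) ^ 4" .
  then have "k \<le> 2 * n * real c powr (3/4) * ?d"
    by (subst (asm) power_mono_iff) (auto simp: k_def)
  then show ?thesis unfolding k_def by simp
qed

section \<open>From complete sums to smoothly weighted ones\<close>

text \<open>The cubic Taylor bound gives x - x^3/6, and x^2 <= 3 on the interval because pi/2 <
  1.6.\<close>

lemma sin_ge_half:
  fixes x :: real
  assumes "0 \<le> x" "x \<le> pi / 2"
  shows "x / 2 \<le> sin x"
proof -
  have "\<bar>sin x - (\<Sum>m<3. sin_coeff m * x ^ m)\<bar> \<le> inverse (fact 3) * \<bar>x\<bar> ^ 3"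
    by (rule Maclaurin_sin_bound)
  moreover have "(\<Sum>m<3. sin_coeff m * x ^ m) = x"
    by (simp add: numeral_3_eq_3 sin_coeff_def)
  ultimately have "\<bar>sin x - x\<bar> \<le> x ^ 3 / 6"
    using assms by (simp add: fact_numeral)
  then have "x - x ^ 3 / 6 \<le> sin x" by linarith
  moreover have "x * x\<^sup>2 \<le> x * 3"
  proof (rule mult_left_mono)
    have "x \<le> 1.6" using assms pi_less_4 pi_approx by simp
    then have "x\<^sup>2 \<le> 1.6\<^sup>2" using assms by (intro power_mono) auto
    then show "x\<^sup>2 \<le> 3" by (simp add: power2_eq_square)
  qed (use assms in auto)
  ultimately show ?thesis by (simp add: power3_eq_cube power2_eq_square)
qed

text \<open>The norm equals 2 sin (pi l / c), which is at least the distance of l/c to the nearest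
  integer. Adding the bounds for the two halves of the range gives one formula for both.\<close>

lemma norm_addchar_minus_1:
  assumes "0 < l" "l < c"
  shows "1 / norm (addchar c (int l) - 1) \<le> real c / real l + real c / real (c - l)"
proof -
  define t where "t = pi * real l / real c"
  have t: "0 < t" "t < pi" using assms by (auto simp: t_def field_simps)
  have "(norm (addchar c (int l) - 1))\<^sup>2 = (cos (2 * t) - 1)\<^sup>2 + (sin (2 * t))\<^sup>2"
    by (simp add: addchar_def t_def cmod_power2 mult.assoc)
  also have "\<dots> = 2 - 2 * cos (2 * t)"
    using sin_cos_squared_add[of "2 * t"] by (simp add: power2_diff)
  also have "\<dots> = (2 * sin t)\<^sup>2" by (simp add: cos_double_sin power_mult_distrib)
  finally have n: "norm (addchar c (int l) - 1) = 2 * sin t"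
    by (rule power2_eq_imp_eq) (use sin_gt_zero[OF t] in auto)
  have pos: "0 \<le> real c / real l" "0 \<le> real c / real (c - l)" by simp_all
  show ?thesis
  proof (cases "t \<le> pi / 2")
    case True
    have "real l / real c \<le> pi * (real l / real c)"
      using pi_ge_two by (intro mult_left_mono[of 1 pi "real l / real c", simplified mult_1_right, unfolded mult.commute[of _ pi]]) auto
    also have "\<dots> \<le> 2 * sin t" using sin_ge_half[of t] t True by (simp add: t_def)
    finally have "1 / (2 * sin t) \<le> 1 / (real l / real c)"
      using assms by (intro divide_left_mono) (use sin_gt_zero[OF t] in auto)
    then have "1 / (2 * sin t) \<le> real c / real l" by simp
    then show ?thesis unfolding n by (rule add_increasing2[OF pos(2)])
  next
    case False
    have pt: "pi - t = pi * (real (c - l) / real c)"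
      using assms by (simp add: t_def of_nat_diff field_simps)
    have "1 * (real (c - l) / real c) \<le> pi * (real (c - l) / real c)"
      using pi_ge_two by (intro mult_right_mono) auto
    also have "\<dots> \<le> 2 * sin t"
    proof -
      have "(pi - t) / 2 \<le> sin (pi - t)" using t False by (intro sin_ge_half) auto
      then have "pi - t \<le> 2 * sin t" by simp
      then show ?thesis by (simp only: pt)
    qed
    finally have "1 / (2 * sin t) \<le> 1 / (real (c - l) / real c)"
      using assms by (intro divide_left_mono) (use sin_gt_zero[OF t] in auto)
    then have "1 / (2 * sin t) \<le> real c / real (c - l)" by simp
    then show ?thesis unfolding n by (rule add_increasing[OF pos(1)])
  qed
qed

lemma sum_inverse_addchar_le:
  assumes "c > 0"
  shows "(\<Sum>l=1..<c. 1 / norm (addchar c (int l) - 1)) \<le> 2 * real c * harm c"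
proof -
  have 1: "(\<Sum>l=1..<c. 1 / real l) \<le> harm c"
    unfolding harm_def inverse_eq_divide by (intro sum_mono2) auto
  have 2: "(\<Sum>l=1..<c. 1 / real (c - l)) = (\<Sum>l=1..<c. 1 / real l)"
    by (rule sum.reindex_bij_witness[of _ "\<lambda>l. c - l" "\<lambda>l. c - l"]) auto
  have "(\<Sum>l=1..<c. 1 / norm (addchar c (int l) - 1)) \<le> (\<Sum>l=1..<c. real c / real l + real c / real (c - l))"
    by (intro sum_mono norm_addchar_minus_1) auto
  also have "\<dots> = real c * ((\<Sum>l=1..<c. 1 / real l) + (\<Sum>l=1..<c. 1 / real (c - l)))"
    by (simp add: sum.distrib sum_distrib_left distrib_left)
  also have "\<dots> \<le> real c * (harm c + harm c)"
    unfolding 2 by (intro mult_left_mono add_mono 1) auto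
  finally show ?thesis by simp
qed

text \<open>
  Completing the sum: the Fourier transform of the weight is bounded in \<open>\<ell>\<^sup>1\<close> up to a logarithm,
  so that the bound for complete sums carries over.
\<close>

lemma smooth_kloosterman_bound:
  assumes c: "c > 0" and n: "n > 0" and q: "coprime q (int c)"
    and M: "\<And>x. 0 \<le> x \<Longrightarrow> x < int c \<Longrightarrow> norm (h x) \<le> M"
    and per: "h (int c) = h 0"
    and D: "\<And>x. 0 \<le> x \<Longrightarrow> x < int c \<Longrightarrow> norm (h (x + 1) - h x) \<le> M / real c"
  shows "norm (\<Sum>x\<in>units_mod c. addchar c (int n * q * modular_inverse (int c) x) * h x)
    \<le> 2 * n * real c powr (3/4) * divisor_count c * (M * (1 + 2 * harm c))"
proof -
  \<comment> \<open>The discrete Fourier transform of the weight. Inverting it writes the weighted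
    sum as a combination of complete sums with coefficients \<open>H l\<close>.\<close>
  define H where "H l = (\<Sum>x<c. h (int x) * addchar c (- (int l * int x))) / of_nat c" for l :: nat
  have inversion: "h (int x) = (\<Sum>l<c. H l * addchar c (int l * int x))" if x: "x < c" for x
  proof -
    have "(\<Sum>l<c. H l * addchar c (int l * int x)) =
        (\<Sum>l<c. \<Sum>y<c. h (int y) * addchar c (int l * (int x - int y)) / of_nat c)"
      unfolding H_def sum_divide_distrib sum_distrib_right
      by (intro sum.cong refl) (simp add: right_diff_distrib mult.assoc flip: addchar_add)
    also have "\<dots> = (\<Sum>y<c. \<Sum>l<c. h (int y) * addchar c (int l * (int x - int y)) / of_nat c)"
      by (rule sum.swap)
    also have "\<dots> = (\<Sum>y<c. h (int y) * (\<Sum>l<c. addchar c (int l * (int x - int y))) / of_nat c)"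
      by (simp add: sum_divide_distrib sum_distrib_left)
    also have "\<dots> = (\<Sum>y<c. if y = x then h (int y) else 0)"
    proof (intro sum.cong refl)
      fix y assume y: "y \<in> {..<c}"
      have "int c dvd int x - int y \<longleftrightarrow> y = x"
        using x y by (auto simp flip: cong_iff_dvd_diff simp: cong_def)
      then show "h (int y) * (\<Sum>l<c. addchar c (int l * (int x - int y))) / of_nat c = (if y = x then h (int y) else 0)"
        using c by (simp add: sum_addchar)
    qed
    also have "\<dots> = h (int x)" using x by simp
    finally show ?thesis ..
  qed
  have Mpos: "M \<ge> 0" using order.trans[OF norm_ge_zero M[of 0]] c by simp
  have H0: "norm (H 0) \<le> M"
  proof -
    have "norm (\<Sum>x<c. h (int x)) \<le> real c * M"
      using M by (intro sum_norm_bound[of "{..<c}", simplified]) auto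
    then show ?thesis using c by (simp add: H_def norm_divide field_simps)
  qed
  have Hl: "norm (H l) \<le> M / real c * (1 / norm (addchar c (int l) - 1))" if l: "0 < l" "l < c" for l
  proof -
    let ?z = "addchar c (int l)"
    have ne: "?z \<noteq> 1" using l addchar_eq_1_iff[OF c] by (auto dest: zdvd_imp_le)
    \<comment> \<open>Summation by parts: the shift by one in the character makes w (x+1) - w x
      equal to the difference of h minus (z - 1) times h, both against the same character.
      Periodicity of h removes the boundary term.\<close>
    define w where "w x = h (int x) * addchar c (- (int l * (int x - 1)))" for x :: nat
    have "(\<Sum>x<c. w (Suc x) - w x) = w c - w 0" by (rule sum_lessThan_telescope)
    also have "\<dots> = 0"
    proof -
      have "addchar c (- (int l * (int c - 1))) = addchar c (int l)"
        by (intro addchar_cong c) (simp add: cong_iff_dvd_diff algebra_simps)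
      then show ?thesis using per by (simp add: w_def)
    qed
    finally have tele: "(\<Sum>x<c. w (Suc x) - w x) = 0" .
    have "(\<Sum>x<c. (h (int x + 1) - h (int x)) * addchar c (- (int l * int x))) =
        (\<Sum>x<c. (w (Suc x) - w x) + (?z - 1) * (h (int x) * addchar c (- (int l * int x))))"
    proof (intro sum.cong refl)
      fix x
      have "addchar c (- (int l * (int x - 1))) = addchar c (- (int l * int x)) * ?z"
        by (simp add: right_diff_distrib flip: addchar_add)
      then show "(h (int x + 1) - h (int x)) * addchar c (- (int l * int x)) =
          (w (Suc x) - w x) + (?z - 1) * (h (int x) * addchar c (- (int l * int x)))"
        by (simp add: w_def algebra_simps)
    qed
    also have "\<dots> = (?z - 1) * (of_nat c * H l)"
      using c by (simp add: sum.distrib tele sum_distrib_left[symmetric] H_def del: sum_subtractf)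
    finally have eq: "(?z - 1) * (of_nat c * H l) =
        (\<Sum>x<c. (h (int x + 1) - h (int x)) * addchar c (- (int l * int x)))" ..
    have "norm (?z - 1) * (real c * norm (H l)) = norm ((?z - 1) * (of_nat c * H l))"
      by (simp add: norm_mult)
    also have "\<dots> \<le> real c * (M / real c)"
      unfolding eq using D by (intro sum_norm_bound[of "{..<c}", simplified]) (auto simp: norm_mult)
    also have "\<dots> = M" using c by simp
    finally show ?thesis using c ne by (simp add: field_simps)
  qed
  have sumH: "(\<Sum>l<c. norm (H l)) \<le> M * (1 + 2 * harm c)"
  proof -
    have "{..<c} = insert 0 {1..<c}" using c by auto
    then have "(\<Sum>l<c. norm (H l)) = norm (H 0) + (\<Sum>l=1..<c. norm (H l))" by simp
    also have "\<dots> \<le> M + (\<Sum>l=1..<c. M / real c * (1 / norm (addchar c (int l) - 1)))"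
      by (intro add_mono H0 sum_mono Hl) auto
    also have "\<dots> = M + M / real c * (\<Sum>l=1..<c. 1 / norm (addchar c (int l) - 1))"
      by (simp add: sum_distrib_left)
    also have "\<dots> \<le> M + M / real c * (2 * real c * harm c)"
      using Mpos by (intro add_left_mono mult_left_mono sum_inverse_addchar_le c) auto
    finally show ?thesis using c by (simp add: algebra_simps)
  qed
  let ?i = "modular_inverse (int c)"
  have "(\<Sum>x\<in>units_mod c. addchar c (int n * q * ?i x) * h x) =
      (\<Sum>x\<in>units_mod c. \<Sum>l<c. H l * addchar c (int n * q * ?i x + int l * x))"
  proof (intro sum.cong refl)
    fix x assume "x \<in> units_mod c"
    then have "h x = (\<Sum>l<c. H l * addchar c (int l * x))"
      using inversion[of "nat x"] by (auto simp: units_mod_def)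
    then show "addchar c (int n * q * ?i x) * h x = (\<Sum>l<c. H l * addchar c (int n * q * ?i x + int l * x))"
      by (simp add: sum_distrib_left addchar_add mult_ac)
  qed
  also have "\<dots> = (\<Sum>l<c. H l * kloosterman c (int n * q) (int l))"
    unfolding kloosterman_def sum_distrib_left by (rule sum.swap)
  finally have "norm (\<Sum>x\<in>units_mod c. addchar c (int n * q * ?i x) * h x) \<le>
      (\<Sum>l<c. norm (H l * kloosterman c (int n * q) (int l)))"
    by (simp add: norm_sum)
  also have "\<dots> \<le> (\<Sum>l<c. norm (H l) * (2 * n * real c powr (3/4) * divisor_count c))"
    unfolding norm_mult using kloosterman_bound[OF c n q] by (intro sum_mono mult_left_mono) auto
  also have "\<dots> = (2 * n * real c powr (3/4) * divisor_count c) * (\<Sum>l<c. norm (H l))"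
    by (subst sum_distrib_right[symmetric]) (rule mult.commute)
  also have "\<dots> \<le> (2 * n * real c powr (3/4) * divisor_count c) * (M * (1 + 2 * harm c))"
    by (intro mult_left_mono sumH) auto
  finally show ?thesis by simp
qed

section \<open>The Bessel kernel\<close>

text \<open>The Weierstrass test along the net of finite subsets: on closed discs inside S the
  partial sums converge uniformly.\<close>

lemma holomorphic_on_infsum:
  fixes f :: "'a \<Rightarrow> complex \<Rightarrow> complex"
  assumes "open S" and hol: "\<And>i. i \<in> A \<Longrightarrow> f i holomorphic_on S"
    and M: "\<And>i z. i \<in> A \<Longrightarrow> z \<in> S \<Longrightarrow> norm (f i z) \<le> M i" "M summable_on A"
  shows "(\<lambda>z. \<Sum>\<^sub>\<infinity>i\<in>A. f i z) holomorphic_on S"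
proof -
  have "\<exists>r>0. (\<lambda>z. \<Sum>\<^sub>\<infinity>i\<in>A. f i z) holomorphic_on ball z r" if "z \<in> S" for z
  proof -
    obtain r where r: "r > 0" "cball z r \<subseteq> S"
      using \<open>open S\<close> \<open>z \<in> S\<close> open_contains_cball by blast
    have ulim: "uniform_limit (cball z r) (\<lambda>X w. \<Sum>i\<in>X. f i w) (\<lambda>w. \<Sum>\<^sub>\<infinity>i\<in>A. f i w) (finite_subsets_at_top A)"
      by (rule Weierstrass_m_test_general[OF M(1) M(2)]) (use r in auto)
    have cont: "eventually (\<lambda>X. continuous_on (cball z r) (\<lambda>w. \<Sum>i\<in>X. f i w) \<and>
        (\<lambda>w. \<Sum>i\<in>X. f i w) holomorphic_on ball z r) (finite_subsets_at_top A)"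
    proof (rule eventually_mono)
      show "eventually (\<lambda>X. finite X \<and> X \<subseteq> A) (finite_subsets_at_top A)"
        by (rule eventually_finite_subsets_at_top_weakI) auto
      fix X assume X: "finite X \<and> X \<subseteq> A"
      have "(\<lambda>w. \<Sum>i\<in>X. f i w) holomorphic_on cball z r"
        using X r hol by (intro holomorphic_on_sum) (auto intro: holomorphic_on_subset)
      then show "continuous_on (cball z r) (\<lambda>w. \<Sum>i\<in>X. f i w) \<and> (\<lambda>w. \<Sum>i\<in>X. f i w) holomorphic_on ball z r"
        using holomorphic_on_subset[OF _ ball_subset_cball] holomorphic_on_imp_continuous_on by blast
    qed
    show ?thesis
      by (rule holomorphic_uniform_limit[OF cont ulim]) (use r in auto)
  qed
  then have "(\<lambda>z. \<Sum>\<^sub>\<infinity>i\<in>A. f i z) field_differentiable at z" if "z \<in> S" for z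
    using that by (meson centre_in_ball holomorphic_on_imp_differentiable_at open_ball)
  then show ?thesis
    by (auto simp: holomorphic_on_def intro: field_differentiable_at_within)
qed

text \<open>The power series of \<open>I\<^bsub>s-1/2\<^esub>\<close> without its leading power and its factor \<open>1 / \<Gamma>(s + 1/2)\<close>.\<close>

definition bessel_coeff :: "complex \<Rightarrow> nat \<Rightarrow> complex" where
  "bessel_coeff s k = 1 / (fact k * pochhammer (s + 1/2) k)"

definition bessel_series :: "complex \<Rightarrow> complex \<Rightarrow> complex" where
  "bessel_series s z = (\<Sum>k. bessel_coeff s k * z ^ k)"

text \<open>For Re s > 1/2 the factor s + 1/2 + j has real part at least j + 1. This fixes the
  half-plane in which the Bessel series is estimated.\<close>

lemma norm_pochhammer_ge:
  fixes s :: complex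
  assumes "Re s > 1/2"
  shows "norm (pochhammer (s + 1/2) k) \<ge> fact k"
proof (induction k)
  case (Suc k)
  have "real (Suc k) \<le> Re (s + 1/2 + of_nat k)" using assms by simp
  also have "\<dots> \<le> norm (s + 1/2 + of_nat k)" by (rule complex_Re_le_cmod)
  finally have "fact k * real (Suc k) \<le> norm (pochhammer (s + 1/2) k) * norm (s + 1/2 + of_nat k)"
    using Suc by (intro mult_mono) auto
  then show ?case unfolding pochhammer_Suc norm_mult fact_Suc by (simp only: mult.commute)
qed auto

lemma pochhammer_half_nonzero:
  fixes s :: complex
  assumes "Re s > 1/2"
  shows "pochhammer (s + 1/2) k \<noteq> 0"
  using norm_pochhammer_ge[OF assms, of k] by (metis fact_gt_zero norm_zero not_le)

text \<open>The exponential series thus dominates the Bessel series and its termwise derivative,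
  uniformly in s.\<close>

lemma norm_bessel_coeff:
  assumes "Re s > 1/2"
  shows "norm (bessel_coeff s k) \<le> 1 / fact k" "norm (diffs (bessel_coeff s) k) \<le> 1 / fact k"
proof -
  have p: "norm (pochhammer (s + 1/2) k) \<ge> 1" for k
    using norm_pochhammer_ge[OF assms, of k] fact_ge_1[of k, where 'a = real] by linarith
  have "norm (bessel_coeff s k) = 1 / (fact k * norm (pochhammer (s + 1/2) k))" for k
    by (simp add: bessel_coeff_def norm_divide norm_mult)
  moreover have "1 / (fact k * norm (pochhammer (s + 1/2) k)) \<le> 1 / (fact k * 1)" for k
    using p by (intro divide_left_mono mult_left_mono mult_pos_pos)
       (auto simp: pochhammer_half_nonzero[OF assms])
  ultimately have c: "norm (bessel_coeff s k) \<le> 1 / fact k" for k by simp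
  show "norm (bessel_coeff s k) \<le> 1 / fact k" by (rule c)
  have "norm (diffs (bessel_coeff s) k) = real (Suc k) * norm (bessel_coeff s (Suc k))"
    unfolding diffs_def norm_mult by (simp only: norm_of_nat)
  also have "\<dots> \<le> real (Suc k) * (1 / fact (Suc k))"
    by (intro mult_left_mono c) auto
  also have "\<dots> = 1 / fact k" unfolding fact_Suc by (simp del: of_nat_Suc)
  finally show "norm (diffs (bessel_coeff s) k) \<le> 1 / fact k" .
qed

lemma summable_exp_dominated:
  fixes a :: "nat \<Rightarrow> complex"
  assumes "\<And>k. norm (a k) \<le> 1 / fact k"
  shows "summable (\<lambda>k. norm (a k * z ^ k))" "summable (\<lambda>k. a k * z ^ k)"
    "norm (\<Sum>k. a k * z ^ k) \<le> exp (norm z)"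
proof -
  have le: "norm (a k * z ^ k) \<le> norm z ^ k /\<^sub>R fact k" for k
    using mult_right_mono[OF assms[of k], of "norm z ^ k"]
    by (simp add: norm_mult norm_power divide_inverse mult.commute)
  have e: "(\<lambda>k. norm z ^ k /\<^sub>R fact k) sums exp (norm z)" by (rule exp_converges)
  show "summable (\<lambda>k. norm (a k * z ^ k))"
    by (rule summable_comparison_test'[OF sums_summable[OF e]]) (use le in auto)
  then show "summable (\<lambda>k. a k * z ^ k)" by (rule summable_norm_cancel)
  have "norm (\<Sum>k. a k * z ^ k) \<le> (\<Sum>k. norm z ^ k /\<^sub>R fact k)"
    by (rule norm_suminf_le[OF le sums_summable[OF e]])
  then show "norm (\<Sum>k. a k * z ^ k) \<le> exp (norm z)" using e by (simp add: sums_iff)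
qed

lemma norm_bessel_series:
  assumes "Re s > 1/2"
  shows "norm (bessel_series s z) \<le> exp (norm z)"
  unfolding bessel_series_def by (rule summable_exp_dominated(3)[OF norm_bessel_coeff(1)[OF assms]])

lemma bessel_series_deriv:
  assumes "Re s > 1/2"
  obtains d where "(bessel_series s has_field_derivative d) (at z)" "norm d \<le> exp (norm z)"
proof
  show "(bessel_series s has_field_derivative (\<Sum>k. diffs (bessel_coeff s) k * z ^ k)) (at z)"
    unfolding bessel_series_def
    by (rule termdiffs_strong_converges_everywhere)
       (rule summable_exp_dominated(2)[OF norm_bessel_coeff(1)[OF assms]])
  show "norm (\<Sum>k. diffs (bessel_coeff s) k * z ^ k) \<le> exp (norm z)"
    by (rule summable_exp_dominated(3)[OF norm_bessel_coeff(2)[OF assms]])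
qed

lemma holomorphic_bessel_series: "(\<lambda>s. bessel_series s z) holomorphic_on {s. Re s > 1/2}"
proof -
  have "(\<lambda>s. \<Sum>\<^sub>\<infinity>k\<in>UNIV. bessel_coeff s k * z ^ k) holomorphic_on {s. Re s > 1/2}"
  proof (rule holomorphic_on_infsum)
    show "open {s. 1/2 < Re s}" by (rule open_halfspace_Re_gt)
    show "(\<lambda>s. bessel_coeff s k * z ^ k) holomorphic_on {s. 1/2 < Re s}" for k
    proof -
      have "pochhammer (s + 1/2) k \<noteq> 0" if "1/2 < Re s" for s
        by (rule pochhammer_half_nonzero[OF that])
      then show ?thesis unfolding bessel_coeff_def pochhammer_prod
        by (intro holomorphic_intros) auto
    qed
    show "norm (bessel_coeff s k * z ^ k) \<le> norm z ^ k / fact k" if "s \<in> {s. 1/2 < Re s}" for s k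
      using mult_right_mono[OF norm_bessel_coeff(1)[of s k], of "norm z ^ k"] that
      by (simp add: norm_mult norm_power)
    show "(\<lambda>k. norm z ^ k / fact k) summable_on UNIV"
      using summable_norm_exp[of "norm z"]
      by (intro norm_summable_imp_summable_on) (simp add: divide_inverse mult.commute)
  qed
  moreover have "bessel_series s z = (\<Sum>\<^sub>\<infinity>k\<in>UNIV. bessel_coeff s k * z ^ k)" if "Re s > 1/2" for s
    unfolding bessel_series_def
    using norm_summable_imp_has_sum[OF summable_exp_dominated(1)[OF norm_bessel_coeff(1)[OF that]]
      summable_sums[OF summable_exp_dominated(2)[OF norm_bessel_coeff(1)[OF that]]], of z]
    by (simp add: infsumI)
  ultimately show ?thesis
    by (subst holomorphic_cong[OF refl]) auto
qed

text \<open>What remains of the seed after all factors depending on n and on the point are split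
  off. It is entire in s and is pulled out of every sum over cosets.\<close>

definition niebur_prefactor :: "complex \<Rightarrow> complex" where
  "niebur_prefactor s = of_real pi powr (s - 1/2) * rGamma (s + 1/2)"

lemma holomorphic_niebur_prefactor: "niebur_prefactor holomorphic_on A"
  unfolding niebur_prefactor_def by (intro holomorphic_intros) auto

text \<open>The square root of y times the leading power of the Bessel function is y to the power s.
  Writing it as exp (s ln y) makes the dependence on s visibly holomorphic.\<close>

lemma niebur_seed_eq:
  assumes "n > 0" "Im z > 0" "Re s > 1/2"
  defines "y \<equiv> real n * Im z"
  shows "niebur_seed n s z = niebur_prefactor s * (e_cis (- of_nat n * of_real (Re z)) *
    exp (s * of_real (ln y)) * bessel_series s (of_real ((pi * y)\<^sup>2)))"
proof -
  have y: "y > 0" using assms by simp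
  have piy: "complex_of_real (2 * pi * real n * Im z) / 2 = of_real (pi * y)" by (simp add: y_def)
  have summand: "rGamma (of_nat k + (s - 1/2) + 1) / fact k * (complex_of_real (pi * y)) powr (s - 1/2 + 2 * of_nat k) =
      rGamma (s + 1/2) * of_real (pi * y) powr (s - 1/2) * (bessel_coeff s k * of_real ((pi * y)\<^sup>2) ^ k)" for k
  proof -
    have "complex_of_real (pi * y) powr (s - 1/2 + 2 * of_nat k) =
        of_real (pi * y) powr (s - 1/2) * of_real (pi * y) powr (of_nat (2 * k))"
      by (simp add: powr_add)
    also have "complex_of_real (pi * y) powr (of_nat (2 * k)) = of_real (pi * y) ^ (2 * k)"
      using y by (subst powr_nat) auto
    also have "complex_of_real (pi * y) ^ (2 * k) = of_real ((pi * y)\<^sup>2) ^ k"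
      by (simp add: power_mult)
    finally have 1: "complex_of_real (pi * y) powr (s - 1/2 + 2 * of_nat k) =
        of_real (pi * y) powr (s - 1/2) * of_real ((pi * y)\<^sup>2) ^ k" .
    have "rGamma (s + 1/2) = pochhammer (s + 1/2) k * rGamma (s + 1/2 + of_nat k)"
      by (rule pochhammer_rGamma)
    moreover have "pochhammer (s + 1/2) k \<noteq> 0" by (rule pochhammer_half_nonzero[OF assms(3)])
    ultimately have 2: "rGamma (of_nat k + (s - 1/2) + 1) = rGamma (s + 1/2) / pochhammer (s + 1/2) k"
      by (simp add: field_simps)
    show ?thesis unfolding 1 2 bessel_coeff_def by (simp only: times_divide_eq_left times_divide_eq_right divide_divide_eq_left mult_1_left mult_ac)
  qed
  have B: "bessel_I (s - 1/2) (2 * pi * real n * Im z) =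
      rGamma (s + 1/2) * of_real (pi * y) powr (s - 1/2) * bessel_series s (of_real ((pi * y)\<^sup>2))"
    unfolding bessel_I_def piy summand bessel_series_def
    by (rule suminf_mult[OF summable_exp_dominated(2)[OF norm_bessel_coeff(1)[OF assms(3)]]])
  have S: "of_real (sqrt y) * complex_of_real (pi * y) powr (s - 1/2) =
      of_real pi powr (s - 1/2) * exp (s * of_real (ln y))"
  proof -
    have "complex_of_real (sqrt y) = exp (of_real (ln y) / 2)"
    proof -
      have "sqrt y = exp (ln y / 2)" using y by (simp add: ln_sqrt[symmetric])
      then have "complex_of_real (sqrt y) = of_real (exp (ln y / 2))" by (rule arg_cong)
      then show ?thesis by (simp add: exp_of_real[symmetric])
    qed
    moreover have "complex_of_real (pi * y) powr (s - 1/2) = of_real pi powr (s - 1/2) * exp ((s - 1/2) * of_real (ln y))"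
    proof -
      have "complex_of_real (pi * y) powr (s - 1/2) = of_real pi powr (s - 1/2) * of_real y powr (s - 1/2)"
        unfolding of_real_mult using y by (intro powr_times_real) auto
      also have "complex_of_real y powr (s - 1/2) = exp ((s - 1/2) * of_real (ln y))"
        using y by (simp add: powr_def Ln_of_real)
      finally show ?thesis .
    qed
    moreover have "exp (of_real (ln y) / 2) * exp ((s - 1/2) * of_real (ln y)) = exp (s * of_real (ln y))"
      unfolding exp_add[symmetric] by (simp add: algebra_simps)
    ultimately show ?thesis by (simp only: mult.left_commute[of "exp (complex_of_real (ln y) / 2)"])
  qed
  let ?E = "e_cis (- of_nat n * of_real (Re z))" and ?B = "bessel_series s (of_real ((pi * y)\<^sup>2))"
  have "niebur_seed n s z = ?E * of_real (sqrt y) *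
      (rGamma (s + 1/2) * of_real (pi * y) powr (s - 1/2) * ?B)"
    by (simp only: niebur_seed_def y_def[symmetric] B)
  also have "\<dots> = ?E * rGamma (s + 1/2) * (of_real (sqrt y) * complex_of_real (pi * y) powr (s - 1/2)) * ?B"
    by (simp only: mult_ac)
  also have "\<dots> = niebur_prefactor s * (?E * exp (s * of_real (ln y)) * ?B)"
    unfolding S niebur_prefactor_def by (simp only: mult_ac)
  finally show ?thesis .
qed

lemma holomorphic_niebur_seed:
  assumes "n > 0" "Im z > 0"
  shows "(\<lambda>s. niebur_seed n s z) holomorphic_on {s. Re s > 1/2}"
proof -
  have "(\<lambda>s. niebur_prefactor s * (e_cis (- of_nat n * of_real (Re z)) *
    exp (s * of_real (ln (real n * Im z))) * bessel_series s (of_real ((pi * (real n * Im z))\<^sup>2))))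
      holomorphic_on {s. Re s > 1/2}"
    by (intro holomorphic_intros holomorphic_niebur_prefactor holomorphic_bessel_series)
  then show ?thesis
    by (rule holomorphic_transform) (use assms in \<open>simp add: niebur_seed_eq\<close>)
qed

lemma niebur_seed_shift: "niebur_seed n s (z + of_int t) = niebur_seed n s z"
proof -
  have "e_cis (- of_nat n * of_real (Re (z + of_int t))) =
      e_cis (- of_nat n * of_real (Re z)) * exp (2 * of_real pi * \<i> * of_int (- int n * t))"
    by (simp add: e_cis_def algebra_simps flip: exp_add)
  also have "exp (2 * of_real pi * \<i> * of_int (- int n * t)) = 1"
    using exp_integer_2pi[of "of_int (- int n * t)"] by (simp add: mult_ac)
  finally show ?thesis by (simp add: niebur_seed_def)
qed

text \<open>
  The seed at \<open>X/C - l/(\<tau> + u)\<close>, \<open>l = 1/(Q C\<^sup>2)\<close>, is \<open>niebur_prefactor s * e(-nX/C)\<close> times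
  the following function at \<open>q = n l\<close>.
\<close>

definition seed_kernel :: "complex \<Rightarrow> complex \<Rightarrow> real \<Rightarrow> real \<Rightarrow> complex" where
  "seed_kernel \<tau> s q u = (let r = (Re \<tau> + u)\<^sup>2 + (Im \<tau>)\<^sup>2 in
     exp (2 * pi * \<i> * of_real (q * ((Re \<tau> + u) / r)) + s * of_real (ln (q * Im \<tau> / r))) *
     bessel_series s (of_real ((pi * q * Im \<tau> / r)\<^sup>2)))"

lemma niebur_seed_kernel:
  fixes X :: int
  assumes "n > 0" "Im \<tau> > 0" "Re s > 1/2" "l > 0"
  shows "niebur_seed n s (of_real x - of_real l / (\<tau> + of_real u)) =
    niebur_prefactor s * (e_cis (of_real (- real n * x)) * seed_kernel \<tau> s (real n * l) u)"
proof -
  define r where "r = (Re \<tau> + u)\<^sup>2 + (Im \<tau>)\<^sup>2"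
  have r: "r > 0" using assms by (simp add: r_def add_nonneg_pos)
  define z where "z = of_real x - of_real l / (\<tau> + of_real u)"
  define v where "v = (Re \<tau> + u) / r"
  have re: "Re z = x - l * v"
    by (simp add: v_def z_def r_def Re_divide cmod_power2)
  have im: "Im z = l * Im \<tau> / r"
    by (simp add: z_def r_def Im_divide cmod_power2)
  have "Im z > 0" using assms r by (simp add: im)
  have ny: "real n * Im z = real n * l * Im \<tau> / r" by (simp add: im)
  have e: "e_cis (- of_nat n * of_real (Re z)) =
      e_cis (of_real (- real n * x)) * exp (2 * pi * \<i> * of_real (real n * l * v))"
    by (simp add: e_cis_def re algebra_simps flip: exp_add)
  show ?thesis
    unfolding z_def[symmetric] niebur_seed_eq[OF assms(1) \<open>Im z > 0\<close> assms(3)] seed_kernel_def Let_def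
      r_def[symmetric] v_def[symmetric] exp_add e ny
    by (simp only: mult_ac times_divide_eq_right times_divide_eq_left)
qed

lemma holomorphic_seed_kernel: "(\<lambda>s. seed_kernel \<tau> s q u) holomorphic_on {s. Re s > 1/2}"
  unfolding seed_kernel_def Let_def
  by (intro holomorphic_intros holomorphic_bessel_series)

text \<open>The exponential factor has modulus exactly \<open>w u\<close>. The Bessel factor, its
  derivative and the derivative of the exponent are bounded in u, because r >= y^2 and r >= 2 |x| y.
  So the derivative decays in u as fast as the function.\<close>

lemma seed_kernel_bounds:
  assumes y: "Im \<tau> > 0" and s: "Re s > 1/2" "norm s \<le> R" and l: "0 < q" "q \<le> L"
  defines "y \<equiv> Im \<tau>"
  defines "K \<equiv> exp ((pi * L / y)\<^sup>2)"
  \<comment> \<open>Product rule: the first summand bounds the derivative of the exponent times the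
    Bessel factor, the second the derivative of the Bessel factor.\<close>
  defines "K' \<equiv> K * (6 * pi * L / y\<^sup>2 + R / y) + K * ((pi * L)\<^sup>2 * (2 / y^3))"
  defines "w \<equiv> \<lambda>u. (q * y / ((Re \<tau> + u)\<^sup>2 + y\<^sup>2)) powr Re s"
  shows "norm (seed_kernel \<tau> s q u) \<le> K * w u"
    and "\<exists>d. (seed_kernel \<tau> s q has_vector_derivative d) (at u) \<and> norm d \<le> K' * w u"
proof -
  define x where "x = Re \<tau> + u"
  define r where "r = x\<^sup>2 + y\<^sup>2"
  have y0: "y > 0" using y by (simp add: y_def)
  have ry: "y\<^sup>2 \<le> r" and xr: "x\<^sup>2 \<le> r" by (simp_all add: r_def)
  have r: "r > 0" using y0 ry by (smt (verit) zero_less_power)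
  have R0: "R \<ge> 0" using s norm_ge_zero order.trans by blast
  have yr: "y / r \<le> 1 / y" using y0 ry r by (simp add: field_simps power2_eq_square)
  have xyr: "\<bar>x\<bar> / r \<le> 1 / (2 * y)"
  proof -
    have "2 * \<bar>x\<bar> * y \<le> r" using sum_squares_bound[of "\<bar>x\<bar>" y] by (simp add: r_def)
    then show ?thesis using y0 r by (simp add: field_simps)
  qed
  define t where "t = (pi * q * y / r)\<^sup>2"
  have t: "0 \<le> t" "t \<le> (pi * L / y)\<^sup>2"
  proof -
    have "pi * q * (y / r) \<le> pi * L * (1 / y)"
      using l yr y0 r by (intro mult_mono) auto
    then show "t \<le> (pi * L / y)\<^sup>2" unfolding t_def
      using l y0 r by (intro power_mono) auto
  qed (simp add: t_def)
  have B: "norm (bessel_series s (of_real t)) \<le> K"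
    using norm_bessel_series[OF s(1), of "of_real t"] t by (simp add: K_def) (meson exp_le_cancel_iff order.trans)
  define F where "F = 2 * pi * \<i> * of_real (q * (x / r)) + s * of_real (ln (q * y / r))"
  have nF: "norm (exp F) = w u"
    using l y0 r by (simp add: F_def w_def powr_def r_def x_def)
  show "norm (seed_kernel \<tau> s q u) \<le> K * w u"
    using mult_left_mono[OF B, of "norm (exp F)"]
    by (simp add: seed_kernel_def Let_def norm_mult nF[symmetric] F_def t_def r_def x_def y_def mult.commute)
  obtain b where b: "(bessel_series s has_field_derivative b) (at (of_real t))" "norm b \<le> exp (norm (complex_of_real t))"
    using bessel_series_deriv[OF s(1)] by metis
  have bK: "norm b \<le> K" using b(2) t by (simp add: K_def) (meson exp_le_cancel_iff order.trans)
  define rho where "rho = (\<lambda>v. (Re \<tau> + v)\<^sup>2 + y\<^sup>2)"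
  have rho_u: "rho u = r" by (simp add: rho_def r_def x_def)
  have drho: "(rho has_real_derivative 2 * x) (at u)"
    unfolding rho_def by (auto intro!: derivative_eq_intros simp: x_def)
  define p where "p = q * ((r - x * (2 * x)) / (r * r))"
  define m where "m = - (2 * x / r)"
  define t' where "t' = 2 * (pi * q * y / r) * (- (pi * q * y * (2 * x)) / (r * r))"
  have d1: "((\<lambda>v. q * ((Re \<tau> + v) / rho v)) has_real_derivative p) (at u)"
    using r by (auto intro!: derivative_eq_intros drho simp: rho_u p_def x_def right_diff_distrib mult.assoc)
  have d2: "((\<lambda>v. ln (q * y / rho v)) has_real_derivative m) (at u)"
    using r l y0 by (auto intro!: derivative_eq_intros drho simp: rho_u m_def field_simps)
  have d3: "((\<lambda>v. (pi * q * y / rho v)\<^sup>2) has_real_derivative t') (at u)"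
    using r by (auto intro!: derivative_eq_intros drho simp: rho_u t'_def mult_ac)
  define F' where "F' = 2 * pi * \<i> * of_real p + s * of_real m"
  have dF: "((\<lambda>v. 2 * pi * \<i> * of_real (q * ((Re \<tau> + v) / rho v)) + s * of_real (ln (q * y / rho v)))
      has_vector_derivative F') (at u)"
    unfolding F'_def
    by (intro has_vector_derivative_add has_vector_derivative_mult_right has_vector_derivative_of_real
        d1 d2)
  have dexp: "((\<lambda>v. exp (2 * pi * \<i> * of_real (q * ((Re \<tau> + v) / rho v)) + s * of_real (ln (q * y / rho v))))
      has_vector_derivative F' * exp F) (at u)"
    using field_vector_diff_chain_at[OF dF DERIV_exp] by (simp add: o_def F_def rho_u x_def)
  have dB: "((\<lambda>v. bessel_series s (of_real ((pi * q * y / rho v)\<^sup>2))) has_vector_derivative of_real t' * b) (at u)"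
    using field_vector_diff_chain_at[OF has_vector_derivative_of_real[OF d3], of "bessel_series s" b] b(1)
    by (simp add: o_def rho_u t_def)
  have deriv: "(seed_kernel \<tau> s q has_vector_derivative
      exp F * (of_real t' * b) + F' * exp F * bessel_series s (of_real t)) (at u)"
  proof -
    have "seed_kernel \<tau> s q = (\<lambda>v. exp (2 * pi * \<i> * of_real (q * ((Re \<tau> + v) / rho v)) +
        s * of_real (ln (q * y / rho v))) * bessel_series s (of_real ((pi * q * y / rho v)\<^sup>2)))"
      by (rule ext) (simp only: seed_kernel_def Let_def rho_def y_def)
    then show ?thesis
      using has_vector_derivative_mult[OF dexp dB] by (simp only: rho_u t_def F_def x_def)
  qed
  have "\<bar>p\<bar> \<le> L * (3 / y\<^sup>2)"
  proof -
    have "x * (2 * x) = 2 * x\<^sup>2" by (simp add: power2_eq_square)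
    then have "\<bar>r - x * (2 * x)\<bar> \<le> 3 * r"
      using xr r zero_le_power2[of x] by linarith
    then have "\<bar>(r - x * (2 * x)) / (r * r)\<bar> \<le> (3 * r) / (r * r)"
      using r unfolding abs_divide by (intro divide_mono) auto
    also have "\<dots> = 3 / r" using r by simp
    also have "\<dots> \<le> 3 / y\<^sup>2" using ry y0 r by (intro divide_left_mono) auto
    finally show ?thesis using l unfolding p_def abs_mult by (intro mult_mono) auto
  qed
  moreover have m: "\<bar>m\<bar> \<le> 1 / y" using xyr r by (simp add: m_def abs_mult)
  ultimately have "2 * pi * \<bar>p\<bar> \<le> 2 * pi * (L * (3 / y\<^sup>2))" "norm s * \<bar>m\<bar> \<le> R * (1 / y)"
    using s(2) R0 by (intro mult_left_mono mult_mono; simp)+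
  moreover have "norm F' \<le> 2 * pi * \<bar>p\<bar> + norm s * \<bar>m\<bar>"
    unfolding F'_def by (rule order.trans[OF norm_triangle_ineq]) (simp add: norm_mult)
  ultimately have "norm F' \<le> 2 * pi * (L * (3 / y\<^sup>2)) + R * (1 / y)" by linarith
  then have nF': "norm F' \<le> 6 * pi * L / y\<^sup>2 + R / y" by (simp add: algebra_simps)
  have nt': "\<bar>t'\<bar> \<le> (pi * L)\<^sup>2 * (2 / y^3)"
  proof -
    have "\<bar>t'\<bar> = (pi * q)\<^sup>2 * ((y / r) * ((y / r) * (4 * (\<bar>x\<bar> / r))))"
      using l y0 r by (simp add: t'_def abs_mult power2_eq_square field_simps)
    also have "\<dots> \<le> (pi * L)\<^sup>2 * ((1 / y) * ((1 / y) * (4 * (1 / (2 * y)))))"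
      using l y0 r yr xyr by (intro mult_mono power_mono) auto
    also have "\<dots> = (pi * L)\<^sup>2 * (2 / y^3)" by (simp add: power3_eq_cube)
    finally show ?thesis .
  qed
  have "norm (exp F * (of_real t' * b) + F' * exp F * bessel_series s (of_real t))
      \<le> w u * (\<bar>t'\<bar> * norm b) + norm F' * w u * norm (bessel_series s (of_real t))"
    by (rule order.trans[OF norm_triangle_ineq]) (simp add: norm_mult nF del: norm_exp_eq_Re)
  also have "\<dots> \<le> w u * ((pi * L)\<^sup>2 * (2 / y^3) * K) + (6 * pi * L / y\<^sup>2 + R / y) * w u * K"
    using nt' bK nF' B y0 l R0
    by (intro add_mono mult_mono order.refl) (auto simp: w_def K_def)
  also have "\<dots> = K' * w u" by (simp add: K'_def algebra_simps)
  finally show "\<exists>d. (seed_kernel \<tau> s q has_vector_derivative d) (at u) \<and> norm d \<le> K' * w u"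
    using deriv by blast
qed


section \<open>Sums of the kernel over integer translates\<close>

text \<open>The decay of the kernel under integer translation at Re s = 3/4. It is of order |k| to
  the power -3/2 and hence summable, with room to the left of s = 1.\<close>

definition shift_weight :: "int \<Rightarrow> real" where
  "shift_weight k = (1 + (real_of_int k)\<^sup>2) powr (- (3/4))"

lemma summable_shift_weight: "shift_weight summable_on UNIV"
proof -
  have nat: "(\<lambda>k::nat. shift_weight (int k)) summable_on UNIV"
  proof (rule norm_summable_imp_summable_on)
    have "summable (\<lambda>k. real k powr (- (3/2)))" by (simp add: summable_real_powr_iff)
    then show "summable (\<lambda>k. norm (shift_weight (int k)))"
    proof (rule summable_comparison_test_ev[rotated])
      show "eventually (\<lambda>k. norm (norm (shift_weight (int k))) \<le> real k powr (- (3/2))) sequentially"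
        using eventually_gt_at_top[of 0]
      proof eventually_elim
        case (elim k)
        have "(1 + (real k)\<^sup>2) powr (- (3/4)) \<le> ((real k)\<^sup>2) powr (- (3/4))"
          using elim by (intro powr_mono2') auto
        also have "\<dots> = real k powr (- (3/2))"
          using elim by (simp add: powr_powr flip: powr_numeral)
        finally show ?case by (simp add: shift_weight_def)
      qed
    qed
  qed
  have "shift_weight summable_on range int"
    using nat by (subst summable_on_reindex) (auto simp: o_def)
  moreover have "shift_weight summable_on range (\<lambda>k. - int k)"
    using nat by (subst summable_on_reindex) (auto simp: o_def shift_weight_def inj_on_def)
  ultimately have "shift_weight summable_on (range int \<union> range (\<lambda>k. - int k))"
    by (rule summable_on_union)
  moreover have "range int \<union> range (\<lambda>k. - int k) = UNIV"
  proof -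
    have "k \<in> range int \<union> range (\<lambda>k. - int k)" for k :: int
      by (cases k rule: int_cases2) auto
    then show ?thesis by blast
  qed
  ultimately show ?thesis by simp
qed

text \<open>One constant has to serve all moduli C, for which q = n / (Q C^2) varies in (0, n]; the
  decay in C is kept in the factor \<open>q powr Re s\<close>. The interval for u contains all d / C
  with 0 <= d <= C.\<close>

lemma seed_kernel_uniform_bounds:
  assumes y: "Im \<tau> > 0" and L: "L > 0"
  obtains K where "K \<ge> 0"
    "\<And>s q k u. Re s \<ge> 3/4 \<Longrightarrow> norm s \<le> R \<Longrightarrow> 0 < q \<Longrightarrow> q \<le> L \<Longrightarrow> u \<in> {0..2} \<Longrightarrow>
        norm (seed_kernel \<tau> s q (u + of_int k)) \<le> K * q powr Re s * shift_weight k"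
    "\<And>s q k u v. Re s \<ge> 3/4 \<Longrightarrow> norm s \<le> R \<Longrightarrow> 0 < q \<Longrightarrow> q \<le> L \<Longrightarrow> u \<in> {0..2} \<Longrightarrow> v \<in> {0..2} \<Longrightarrow>
        norm (seed_kernel \<tau> s q (u + of_int k) - seed_kernel \<tau> s q (v + of_int k))
          \<le> K * q powr Re s * shift_weight k * \<bar>u - v\<bar>"
proof -
  define y where "y = Im \<tau>"
  have y0: "y > 0" using y by (simp add: y_def)
  define K1 where "K1 = exp ((pi * L / y)\<^sup>2)"
  \<comment> \<open>Keeps the constants nonnegative for a negative bound R as well.\<close>
  define R' where "R' = max R 0"
  define K2 where "K2 = K1 * (6 * pi * L / y\<^sup>2 + R' / y) + K1 * ((pi * L)\<^sup>2 * (2 / y^3))"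
  \<comment> \<open>From k^2 <= 2 v^2 + 2 (Re \<tau> + u)^2 with v = Re \<tau> + u + k follows 1 +
    k^2 <= 2 r + A r / y^2, that is y / r <= B / (1 + k^2). The maximum with 1 in \<open>W\<close>
    makes the power monotone in the exponent.\<close>
  define A where "A = 2 * (\<bar>Re \<tau>\<bar> + 2)\<^sup>2 + 1"
  define B where "B = y * (2 + A / y\<^sup>2)"
  define W where "W = (max 1 B) powr R'"
  have K12: "K1 \<ge> 0" "K2 \<ge> 0" using y0 L by (auto simp: K1_def K2_def R'_def)
  have W0: "W \<ge> 0" by (simp add: W_def)
  have w: "(q * y / ((Re \<tau> + (u + of_int k))\<^sup>2 + y\<^sup>2)) powr Re s \<le> W * q powr Re s * shift_weight k"
    if s: "Re s \<ge> 3/4" "norm s \<le> R" and q: "0 < q" and u: "u \<in> {0..2}" for s q u and k :: int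
  proof -
    define v where "v = Re \<tau> + (u + of_int k)"
    define r where "r = v\<^sup>2 + y\<^sup>2"
    have r: "r > 0" using y0 by (simp add: r_def add_nonneg_pos)
    have "(real_of_int k)\<^sup>2 = (v - (Re \<tau> + u))\<^sup>2" by (simp add: v_def)
    also have "\<dots> \<le> 2 * v\<^sup>2 + 2 * (Re \<tau> + u)\<^sup>2"
      using zero_le_power2[of "v + (Re \<tau> + u)"] by (simp add: power2_eq_square algebra_simps)
    also have "(Re \<tau> + u)\<^sup>2 \<le> (\<bar>Re \<tau>\<bar> + 2)\<^sup>2"
      using u by (intro power2_le_iff_abs_le[THEN iffD2]) auto
    finally have "1 + (real_of_int k)\<^sup>2 \<le> 2 * v\<^sup>2 + A * 1" by (simp add: A_def)
    also have "\<dots> \<le> 2 * r + A * (r / y\<^sup>2)"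
      using y0 by (intro add_mono mult_left_mono) (auto simp: r_def A_def field_simps)
    finally have "y / r * (1 + (real_of_int k)\<^sup>2) \<le> y / r * (2 * r + A * (r / y\<^sup>2))"
      using y0 r by (intro mult_left_mono) auto
    also have "\<dots> = B" using r by (simp add: B_def algebra_simps)
    finally have "y / r \<le> B / (1 + (real_of_int k)\<^sup>2)"
      by (simp add: field_simps add_pos_nonneg)
    also have "\<dots> \<le> max 1 B * (1 / (1 + (real_of_int k)\<^sup>2))"
      by (simp add: divide_right_mono)
    finally have yr: "y / r \<le> max 1 B * (1 / (1 + (real_of_int k)\<^sup>2))" .
    have sR: "Re s \<le> R'" using s complex_Re_le_cmod[of s] by (simp add: R'_def)
    have split: "(q * y / r) powr Re s = q powr Re s * (y / r) powr Re s"
      using q y0 r by (simp add: powr_mult flip: times_divide_eq_right)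
    have "(y / r) powr Re s \<le> (max 1 B * (1 / (1 + (real_of_int k)\<^sup>2))) powr Re s"
      using yr y0 r s by (intro powr_mono2) auto
    also have "\<dots> = max 1 B powr Re s * (1 / (1 + (real_of_int k)\<^sup>2)) powr Re s"
      by (intro powr_mult)
    also have "\<dots> \<le> W * shift_weight k"
    proof (intro mult_mono)
      show "max 1 B powr Re s \<le> W" unfolding W_def using sR by (intro powr_mono) auto
      have "(1 / (1 + (real_of_int k)\<^sup>2)) powr Re s \<le> (1 / (1 + (real_of_int k)\<^sup>2)) powr (3/4)"
        using s by (intro powr_mono') (auto simp: field_simps add_pos_nonneg)
      also have "\<dots> = shift_weight k"
        by (simp add: shift_weight_def powr_divide powr_minus_divide)
      finally show "(1 / (1 + (real_of_int k)\<^sup>2)) powr Re s \<le> shift_weight k" .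
    qed (auto simp: W0 shift_weight_def)
    finally have "q powr Re s * (y / r) powr Re s \<le> q powr Re s * (W * shift_weight k)"
      by (intro mult_left_mono) auto
    then show ?thesis unfolding split[symmetric] by (simp add: r_def v_def mult_ac)
  qed
  have R': "norm s \<le> R'" if "norm s \<le> R" for s :: complex using that by (simp add: R'_def)
  have b1: "norm (seed_kernel \<tau> s q (u + of_int k)) \<le> K1 * (W * q powr Re s * shift_weight k)"
    if "Re s \<ge> 3/4" "norm s \<le> R" "0 < q" "q \<le> L" "u \<in> {0..2}" for s q u and k :: int
  proof -
    have "norm (seed_kernel \<tau> s q (u + of_int k)) \<le>
        K1 * (q * y / ((Re \<tau> + (u + of_int k))\<^sup>2 + y\<^sup>2)) powr Re s"
      using seed_kernel_bounds(1)[OF y, of s R' q L "u + of_int k"] that R' by (simp add: K1_def y_def)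
    also have "\<dots> \<le> K1 * (W * q powr Re s * shift_weight k)"
      using that by (intro mult_left_mono w K12)
    finally show ?thesis .
  qed
  have b2: "norm (seed_kernel \<tau> s q (u + of_int k) - seed_kernel \<tau> s q (v + of_int k))
      \<le> K2 * (W * q powr Re s * shift_weight k) * \<bar>u - v\<bar>"
    if s: "Re s \<ge> 3/4" "norm s \<le> R" "0 < q" "q \<le> L" and uv: "u \<in> {0..2}" "v \<in> {0..2}" for s q u v and k :: int
  proof -
    define M where "M = K2 * (W * q powr Re s * shift_weight k)"
    have "\<exists>d. (seed_kernel \<tau> s q has_vector_derivative d) (at z) \<and> norm d \<le> M"
      if z: "z \<in> {of_int k..2 + of_int k}" for z
    proof -
      have "\<exists>d. (seed_kernel \<tau> s q has_vector_derivative d) (at z) \<and>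
          norm d \<le> K2 * (q * y / ((Re \<tau> + z)\<^sup>2 + y\<^sup>2)) powr Re s"
        using seed_kernel_bounds(2)[OF y, of s R' q L z] s R' by (simp add: K1_def K2_def y_def)
      moreover have "K2 * (q * y / ((Re \<tau> + z)\<^sup>2 + y\<^sup>2)) powr Re s \<le> M"
        unfolding M_def using w[OF s(1,2,3), of "z - of_int k" k] z by (intro mult_left_mono K12) auto
      ultimately show ?thesis using order.trans by blast
    qed
    then obtain d where d: "\<And>z. z \<in> {of_int k..2 + of_int k} \<Longrightarrow>
        (seed_kernel \<tau> s q has_vector_derivative d z) (at z) \<and> norm (d z) \<le> M"
      by metis
    have "norm (seed_kernel \<tau> s q (u + of_int k) - seed_kernel \<tau> s q (v + of_int k)) \<le>
        M * norm ((u + of_int k) - (v + of_int k))"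
    proof (rule differentiable_bound[of "{of_int k..2 + of_int k}" _ "\<lambda>z h. h *\<^sub>R d z"])
      show "(seed_kernel \<tau> s q has_derivative (\<lambda>h. h *\<^sub>R d z)) (at z within {of_int k..2 + of_int k})"
        if "z \<in> {of_int k..2 + of_int k}" for z
        using d[OF that] by (auto simp: has_vector_derivative_def intro: has_derivative_at_withinI)
      show "onorm (\<lambda>h. h *\<^sub>R d z) \<le> M" if "z \<in> {of_int k..2 + of_int k}" for z
        using d[OF that] by (simp add: onorm_scaleR_left onorm_id)
    qed (use uv in auto)
    then show ?thesis by (simp add: M_def)
  qed
  show thesis
  proof (rule that[of "max K1 K2 * W"])
    show "max K1 K2 * W \<ge> 0" using K12 W0 by simp
    have p: "0 \<le> q powr Re s * shift_weight k" for q s k by (simp add: shift_weight_def)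
    show "norm (seed_kernel \<tau> s q (u + of_int k)) \<le> max K1 K2 * W * q powr Re s * shift_weight k"
      if "Re s \<ge> 3/4" "norm s \<le> R" "0 < q" "q \<le> L" "u \<in> {0..2}" for s q u and k :: int
    proof -
      have "K1 * (W * q powr Re s * shift_weight k) \<le> max K1 K2 * (W * q powr Re s * shift_weight k)"
        using W0 p[of q s k] by (intro mult_right_mono) (auto simp: mult.assoc)
      then show ?thesis using b1[OF that, of k] by (simp add: mult.assoc)
    qed
    show "norm (seed_kernel \<tau> s q (u + of_int k) - seed_kernel \<tau> s q (v + of_int k))
          \<le> max K1 K2 * W * q powr Re s * shift_weight k * \<bar>u - v\<bar>"
      if "Re s \<ge> 3/4" "norm s \<le> R" "0 < q" "q \<le> L" "u \<in> {0..2}" "v \<in> {0..2}" for s q u v and k :: int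
    proof -
      have "K2 * (W * q powr Re s * shift_weight k) * \<bar>u - v\<bar> \<le> max K1 K2 * (W * q powr Re s * shift_weight k) * \<bar>u - v\<bar>"
        using W0 p[of q s k] by (intro mult_right_mono) (auto simp: mult.assoc)
      then show ?thesis using b2[OF that, of k] by (simp add: mult.assoc)
    qed
  qed
qed

section \<open>Convergence of the series over moduli\<close>

text \<open>The harmonic number is at most 1 + ln C, and ln C <= 16 C^(1/16). Hence 1 + 2 (1 + 16 t)
  <= 35 t with t = C^(1/16) >= 1.\<close>

lemma harm_le_powr:
  assumes "C > 0"
  shows "1 + 2 * harm C \<le> 35 * real C powr (1/16)"
proof -
  have "harm (Suc (C - 1)) - ln (real (Suc (C - 1))) \<le> harm (Suc 0) - ln (real (Suc 0))"
    using decseq_harm_diff_ln unfolding decseq_def by (meson le0)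
  then have "harm C \<le> 1 + ln (real C)" using assms by (simp add: harm_expand)
  moreover have "ln (real C) \<le> real C powr (1/16) / (1/16)"
    using assms by (intro ln_powr_bound) auto
  moreover have "1 \<le> real C powr (1/16)" using assms by (intro ge_one_powr_ge_zero) auto
  ultimately show ?thesis by simp
qed

text \<open>The Dirichlet series of the divisor function is the square of the zeta series: sum over
  pairs (a, b) and group them by the product a b = C.\<close>

lemma summable_divisor_count:
  "(\<lambda>C. real (divisor_count C) * real C powr (- (17/16))) summable_on {0<..}"
proof -
  let ?f = "\<lambda>C. real C powr (- (17/16))"
  have f: "?f summable_on A" for A
    by (rule summable_on_subset_banach[of _ UNIV])
       (auto intro!: norm_summable_imp_summable_on simp: summable_real_powr_iff)
  have "(\<lambda>(a, b). ?f a * ?f b) summable_on {0<..} \<times> {0<..}"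
    by (rule summable_on_SigmaI[where g = "\<lambda>a. ?f a * infsum ?f {0<..}"])
       (auto intro!: has_sum_cmult_right summable_on_cmult_left f has_sum_infsum)
  also have "?this \<longleftrightarrow> (\<lambda>(C, d). ?f C) summable_on Sigma {0<..} (\<lambda>C. {d. d dvd C})"
    by (rule summable_on_reindex_bij_witness[of _ "\<lambda>(C, d). (d, C div d)" "\<lambda>(a, b). (a * b, a)"])
       (auto simp: powr_mult dvd_div_eq_0_iff intro: Nat.gr0I)
  finally have "(\<lambda>C. infsum (\<lambda>d. case (C, d) of (C, d) \<Rightarrow> ?f C) {d. d dvd C}) summable_on {0<..}"
    by (rule summable_on_SigmaD) auto
  then show ?thesis
    by (rule summable_on_cong[THEN iffD1, rotated]) (auto simp: divisor_count_def)
qed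

definition kernel_sum :: "complex \<Rightarrow> complex \<Rightarrow> real \<Rightarrow> real \<Rightarrow> complex" where
  "kernel_sum \<tau> s q u = (\<Sum>\<^sub>\<infinity>k. seed_kernel \<tau> s q (u + of_int k))"

text \<open>The phase e(-n X / C), where X is inverse to Q d modulo C; X / C is the real part of the
  image of the cusp under the matrix with bottom row Q (C, d).\<close>

definition twist :: "nat \<Rightarrow> nat \<Rightarrow> nat \<Rightarrow> int \<Rightarrow> complex" where
  "twist n Q C d = addchar C (int n * (- modular_inverse (int C) (int Q)) * modular_inverse (int C) d)"

text \<open>All bottom rows with given C together: a Kloosterman phase against a smooth weight that
  has period 1 in d / C. The cancellation that carries the series past Re s = 1 takes place inside a
  block.\<close>

definition block :: "nat \<Rightarrow> complex \<Rightarrow> nat \<Rightarrow> nat \<Rightarrow> complex \<Rightarrow> complex" where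
  "block n \<tau> Q C s = (\<Sum>d\<in>units_mod C. twist n Q C d *
     kernel_sum \<tau> s (real n / (real Q * (real C)\<^sup>2)) (of_int d / real C))"

lemma norm_twist [simp]: "norm (twist n Q C d) = 1"
  by (simp add: twist_def)

text \<open>The continuation concerns s alone, so all constants may depend on the point and on
  n.\<close>

locale niebur_point =
  fixes \<tau> :: complex and n :: nat
  assumes tau: "Im \<tau> > 0" and n: "n > 0"
begin

text \<open>Choosing the constant once, as a function of R, lets the bounds of the following lemmas
  share it and serve as majorants.\<close>

definition bound_const :: "real \<Rightarrow> real" where
  "bound_const R = (SOME K. K \<ge> 0 \<and>
    (\<forall>s q k u. Re s \<ge> 3/4 \<longrightarrow> norm s \<le> R \<longrightarrow> 0 < q \<longrightarrow> q \<le> real n \<longrightarrow> u \<in> {0..2} \<longrightarrow>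
        norm (seed_kernel \<tau> s q (u + of_int k)) \<le> K * q powr Re s * shift_weight k) \<and>
    (\<forall>s q k u v. Re s \<ge> 3/4 \<longrightarrow> norm s \<le> R \<longrightarrow> 0 < q \<longrightarrow> q \<le> real n \<longrightarrow> u \<in> {0..2} \<longrightarrow> v \<in> {0..2} \<longrightarrow>
        norm (seed_kernel \<tau> s q (u + of_int k) - seed_kernel \<tau> s q (v + of_int k))
          \<le> K * q powr Re s * shift_weight k * \<bar>u - v\<bar>))"

lemma bound_const:
  shows bound_const_nonneg: "bound_const R \<ge> 0"
    and bound_const_le: "\<And>s q k u. Re s \<ge> 3/4 \<Longrightarrow> norm s \<le> R \<Longrightarrow> 0 < q \<Longrightarrow> q \<le> real n \<Longrightarrow> u \<in> {0..2} \<Longrightarrow>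
        norm (seed_kernel \<tau> s q (u + of_int k)) \<le> bound_const R * q powr Re s * shift_weight k"
    and bound_const_lipschitz: "\<And>s q k u v. Re s \<ge> 3/4 \<Longrightarrow> norm s \<le> R \<Longrightarrow> 0 < q \<Longrightarrow> q \<le> real n \<Longrightarrow> u \<in> {0..2} \<Longrightarrow> v \<in> {0..2} \<Longrightarrow>
        norm (seed_kernel \<tau> s q (u + of_int k) - seed_kernel \<tau> s q (v + of_int k))
          \<le> bound_const R * q powr Re s * shift_weight k * \<bar>u - v\<bar>"
proof -
  have "real n > 0" using n by simp
  obtain K where "K \<ge> 0 \<and>
    (\<forall>s q k u. Re s \<ge> 3/4 \<longrightarrow> norm s \<le> R \<longrightarrow> 0 < q \<longrightarrow> q \<le> real n \<longrightarrow> u \<in> {0..2} \<longrightarrow>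
        norm (seed_kernel \<tau> s q (u + of_int k)) \<le> K * q powr Re s * shift_weight k) \<and>
    (\<forall>s q k u v. Re s \<ge> 3/4 \<longrightarrow> norm s \<le> R \<longrightarrow> 0 < q \<longrightarrow> q \<le> real n \<longrightarrow> u \<in> {0..2} \<longrightarrow> v \<in> {0..2} \<longrightarrow>
        norm (seed_kernel \<tau> s q (u + of_int k) - seed_kernel \<tau> s q (v + of_int k))
          \<le> K * q powr Re s * shift_weight k * \<bar>u - v\<bar>)"
    by (rule seed_kernel_uniform_bounds[OF tau \<open>real n > 0\<close>, of R]) blast
  from someI[of "\<lambda>K. K \<ge> 0 \<and>
    (\<forall>s q k u. Re s \<ge> 3/4 \<longrightarrow> norm s \<le> R \<longrightarrow> 0 < q \<longrightarrow> q \<le> real n \<longrightarrow> u \<in> {0..2} \<longrightarrow>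
        norm (seed_kernel \<tau> s q (u + of_int k)) \<le> K * q powr Re s * shift_weight k) \<and>
    (\<forall>s q k u v. Re s \<ge> 3/4 \<longrightarrow> norm s \<le> R \<longrightarrow> 0 < q \<longrightarrow> q \<le> real n \<longrightarrow> u \<in> {0..2} \<longrightarrow> v \<in> {0..2} \<longrightarrow>
        norm (seed_kernel \<tau> s q (u + of_int k) - seed_kernel \<tau> s q (v + of_int k))
          \<le> K * q powr Re s * shift_weight k * \<bar>u - v\<bar>)", OF this, folded bound_const_def]
  show "bound_const R \<ge> 0"
    "\<And>s q k u. Re s \<ge> 3/4 \<Longrightarrow> norm s \<le> R \<Longrightarrow> 0 < q \<Longrightarrow> q \<le> real n \<Longrightarrow> u \<in> {0..2} \<Longrightarrow>
        norm (seed_kernel \<tau> s q (u + of_int k)) \<le> bound_const R * q powr Re s * shift_weight k"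
    "\<And>s q k u v. Re s \<ge> 3/4 \<Longrightarrow> norm s \<le> R \<Longrightarrow> 0 < q \<Longrightarrow> q \<le> real n \<Longrightarrow> u \<in> {0..2} \<Longrightarrow> v \<in> {0..2} \<Longrightarrow>
        norm (seed_kernel \<tau> s q (u + of_int k) - seed_kernel \<tau> s q (v + of_int k))
          \<le> bound_const R * q powr Re s * shift_weight k * \<bar>u - v\<bar>"
    by blast+
qed

definition shift_total :: real where "shift_total = infsum shift_weight UNIV"

lemma has_sum_shift_weight: "(shift_weight has_sum shift_total) UNIV"
  unfolding shift_total_def by (rule has_sum_infsum[OF summable_shift_weight])

lemma shift_weight_nonneg: "shift_weight k \<ge> 0"
  by (simp add: shift_weight_def)

lemma shift_total_nonneg: "shift_total \<ge> 0"
  unfolding shift_total_def by (intro infsum_nonneg shift_weight_nonneg)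

lemma kernel_abs_summable:
  assumes "Re s \<ge> 3/4" "0 < q" "q \<le> real n" "u \<in> {0..2}"
  shows "(\<lambda>k. norm (seed_kernel \<tau> s q (u + of_int k))) summable_on UNIV"
proof (rule Infinite_Sum.abs_summable_on_comparison_test')
  show "(\<lambda>k. bound_const (norm s) * q powr Re s * shift_weight k) summable_on UNIV"
    by (intro summable_on_cmult_right summable_shift_weight)
qed (use bound_const_le[OF assms(1) order.refl assms(2-4)] in auto)

lemma kernel_summable:
  assumes "Re s \<ge> 3/4" "0 < q" "q \<le> real n" "u \<in> {0..2}"
  shows "(\<lambda>k. seed_kernel \<tau> s q (u + of_int k)) summable_on UNIV"
  by (rule abs_summable_summable[OF kernel_abs_summable[OF assms]])

lemma norm_kernel_sum:
  assumes "Re s \<ge> 3/4" "norm s \<le> R" "0 < q" "q \<le> real n" "u \<in> {0..2}"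
  shows "norm (kernel_sum \<tau> s q u) \<le> bound_const R * q powr Re s * shift_total"
  unfolding kernel_sum_def
proof (rule norm_infsum_le)
  show "((\<lambda>k. seed_kernel \<tau> s q (u + of_int k)) has_sum
      (\<Sum>\<^sub>\<infinity>k. seed_kernel \<tau> s q (u + of_int k))) UNIV"
    by (intro has_sum_infsum kernel_summable assms)
  show "((\<lambda>k. bound_const R * q powr Re s * shift_weight k) has_sum bound_const R * q powr Re s * shift_total) UNIV"
    by (intro has_sum_cmult_right has_sum_shift_weight)
qed (use bound_const_le assms in auto)

text \<open>Neighbouring arguments d / C are 1 / C apart, so this supplies the bound on differences
  that \<open>smooth_kloosterman_bound\<close> asks for.\<close>

lemma kernel_sum_lipschitz:
  assumes "Re s \<ge> 3/4" "norm s \<le> R" "0 < q" "q \<le> real n" "u \<in> {0..2}" "v \<in> {0..2}"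
  shows "norm (kernel_sum \<tau> s q u - kernel_sum \<tau> s q v) \<le> bound_const R * q powr Re s * shift_total * \<bar>u - v\<bar>"
proof -
  have "((\<lambda>k. seed_kernel \<tau> s q (u + of_int k) + - seed_kernel \<tau> s q (v + of_int k)) has_sum
      kernel_sum \<tau> s q u + - kernel_sum \<tau> s q v) UNIV"
    unfolding kernel_sum_def
    by (intro has_sum_add has_sum_uminusI has_sum_infsum kernel_summable assms)
  then have "((\<lambda>k. seed_kernel \<tau> s q (u + of_int k) - seed_kernel \<tau> s q (v + of_int k)) has_sum
      kernel_sum \<tau> s q u - kernel_sum \<tau> s q v) UNIV"
    by simp
  moreover have "((\<lambda>k. bound_const R * q powr Re s * shift_weight k * \<bar>u - v\<bar>) has_sum
      bound_const R * q powr Re s * shift_total * \<bar>u - v\<bar>) UNIV"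
    by (intro has_sum_cmult_left has_sum_cmult_right has_sum_shift_weight)
  ultimately show ?thesis
    by (rule norm_infsum_le) (use bound_const_lipschitz assms in auto)
qed

lemma kernel_sum_periodic: "kernel_sum \<tau> s q (u + 1) = kernel_sum \<tau> s q u"
proof -
  have "(\<Sum>\<^sub>\<infinity>k. seed_kernel \<tau> s q (u + of_int (k + 1))) = (\<Sum>\<^sub>\<infinity>k. seed_kernel \<tau> s q (u + of_int k))"
    by (rule infsum_reindex_bij_betw[of "\<lambda>k. k + 1" UNIV UNIV "\<lambda>k. seed_kernel \<tau> s q (u + of_int k)"])
       (rule bij_betwI[of _ _ _ "\<lambda>k. k - 1"], auto)
  then show ?thesis by (simp add: kernel_sum_def algebra_simps)
qed

lemma open_strip: "open {s. Re s > a \<and> norm s < R}"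
proof -
  have "open ({s. Re s > a} \<inter> ball 0 R)"
    by (intro open_Int open_halfspace_Re_gt open_ball)
  also have "{s. Re s > a} \<inter> ball 0 R = {s. Re s > a \<and> norm s < R}" by auto
  finally show ?thesis .
qed

lemma holomorphic_kernel_sum:
  assumes "0 < q" "q \<le> real n" "u \<in> {0..2}"
  shows "(\<lambda>s. kernel_sum \<tau> s q u) holomorphic_on {s. Re s > 3/4 \<and> norm s < R}"
  unfolding kernel_sum_def
proof (rule holomorphic_on_infsum[OF open_strip])
  show "(\<lambda>s. seed_kernel \<tau> s q (u + of_int k)) holomorphic_on {s. Re s > 3/4 \<and> norm s < R}" for k
    by (rule holomorphic_on_subset[OF holomorphic_seed_kernel]) auto
  show "norm (seed_kernel \<tau> s q (u + of_int k)) \<le> bound_const R * (max 1 q powr R) * shift_weight k"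
    if "s \<in> {s. Re s > 3/4 \<and> norm s < R}" for s k
  proof -
    have s: "Re s \<ge> 3/4" "norm s \<le> R" "Re s \<le> R"
      using that complex_Re_le_cmod[of s] by auto
    have "q powr Re s \<le> max 1 q powr Re s" using assms s by (intro powr_mono2) auto
    also have "\<dots> \<le> max 1 q powr R" using s by (intro powr_mono) auto
    finally have "bound_const R * q powr Re s * shift_weight k \<le> bound_const R * (max 1 q powr R) * shift_weight k"
      by (intro mult_right_mono mult_left_mono bound_const_nonneg shift_weight_nonneg)
    then show ?thesis using bound_const_le[OF s(1,2) assms, of k] by linarith
  qed
  show "(\<lambda>k. bound_const R * (max 1 q powr R) * shift_weight k) summable_on UNIV"
    by (intro summable_on_cmult_right summable_shift_weight)
qed

context
  fixes Q :: nat assumes Q: "Q > 0"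
begin

lemma scale_bounds:
  assumes "C > 0"
  shows "0 < real n / (real Q * (real C)\<^sup>2)" "real n / (real Q * (real C)\<^sup>2) \<le> real n"
    "Re s \<ge> 0 \<Longrightarrow> (real n / (real Q * (real C)\<^sup>2)) powr Re s \<le> real n powr Re s * real C powr (- 2 * Re s)"
proof -
  have QC: "real Q * (real C)\<^sup>2 \<ge> 1" "(real C)\<^sup>2 \<le> real Q * (real C)\<^sup>2"
    using assms Q by (auto simp: mult_ge1_I intro: mult_left_le)
  show "0 < real n / (real Q * (real C)\<^sup>2)" using n Q assms by simp
  show "real n / (real Q * (real C)\<^sup>2) \<le> real n" using QC n by (simp add: field_simps mult_left_le)
  assume s: "Re s \<ge> 0"
  have "real n / (real Q * (real C)\<^sup>2) \<le> real n * (real C powr (-2))"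
    using QC assms Q n by (simp add: powr_minus divide_simps powr_numeral)
  then have "(real n / (real Q * (real C)\<^sup>2)) powr Re s \<le> (real n * (real C powr (-2))) powr Re s"
    using s n by (intro powr_mono2) auto
  also have "\<dots> = real n powr Re s * real C powr (- 2 * Re s)"
    by (simp add: powr_mult powr_powr)
  finally show "(real n / (real Q * (real C)\<^sup>2)) powr Re s \<le> real n powr Re s * real C powr (- 2 * Re s)" .
qed

lemma units_mod_quotient: "d \<in> units_mod C \<Longrightarrow> of_int d / real C \<in> {0..2}"
  by (auto simp: units_mod_def field_simps)

text \<open>The exponents of C are 3/4 from the Kloosterman bound, 1/16 from the harmonic number and
  -15/8 from \<open>q powr Re s\<close> with Re s >= 15/16; they add up to -17/16. The factor 70 is
  2 times 35.\<close>

lemma norm_block: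
  assumes C: "C > 0" "coprime C Q" and s: "Re s \<ge> 15/16" "norm s \<le> R"
  shows "norm (block n \<tau> Q C s) \<le> 70 * real n * bound_const R * real n powr R * shift_total *
    (real (divisor_count C) * real C powr (- (17/16)))"
proof -
  let ?q = "real n / (real Q * (real C)\<^sup>2)"
  define M where "M = bound_const R * ?q powr Re s * shift_total"
  have s': "Re s \<ge> 3/4" "Re s \<ge> 0" "Re s \<le> R" using s complex_Re_le_cmod[of s] by auto
  have M0: "M \<ge> 0" by (simp add: M_def bound_const_nonneg shift_total_nonneg)
  have cop: "coprime (- modular_inverse (int C) (int Q)) (int C)"
    using C by (simp add: coprime_commute[of C])
  have "norm (block n \<tau> Q C s) \<le> 2 * real n * real C powr (3/4) * divisor_count C * (M * (1 + 2 * harm C))"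
    unfolding block_def twist_def
  proof (rule smooth_kloosterman_bound[OF C(1) n cop])
    show "norm (kernel_sum \<tau> s ?q (of_int x / real C)) \<le> M" if "0 \<le> x" "x < int C" for x
      unfolding M_def using that C
      by (intro norm_kernel_sum s' s scale_bounds) (auto simp: field_simps)
    show "kernel_sum \<tau> s ?q (of_int (int C) / real C) = kernel_sum \<tau> s ?q (of_int 0 / real C)"
      using kernel_sum_periodic[of s ?q 0] C by simp
    show "norm (kernel_sum \<tau> s ?q (of_int (x + 1) / real C) - kernel_sum \<tau> s ?q (of_int x / real C)) \<le> M / real C"
      if "0 \<le> x" "x < int C" for x
    proof -
      have "norm (kernel_sum \<tau> s ?q (of_int (x + 1) / real C) - kernel_sum \<tau> s ?q (of_int x / real C)) \<le>
          M * \<bar>of_int (x + 1) / real C - of_int x / real C\<bar>"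
        unfolding M_def using that C
        by (intro kernel_sum_lipschitz s' s scale_bounds) (auto simp: field_simps)
      then show ?thesis using C by (simp add: diff_divide_distrib[symmetric])
    qed
  qed
  also have "\<dots> \<le> 2 * real n * real C powr (3/4) * divisor_count C * (M * (35 * real C powr (1/16)))"
    by (intro mult_left_mono harm_le_powr C M0) auto
  also have "\<dots> = 70 * n * divisor_count C * (real C powr (3/4) * real C powr (1/16)) * M"
    by (simp add: mult_ac)
  also have "M \<le> bound_const R * (real n powr R * real C powr (- (15/8))) * shift_total"
  proof -
    have "?q powr Re s \<le> real n powr Re s * real C powr (- 2 * Re s)"
      by (intro scale_bounds C s')
    also have "\<dots> \<le> real n powr R * real C powr (- (15/8))"
      using n C s s' by (intro mult_mono powr_mono) auto
    finally show ?thesis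
      unfolding M_def by (intro mult_right_mono mult_left_mono bound_const_nonneg shift_total_nonneg)
  qed
  finally have "norm (block n \<tau> Q C s) \<le> 70 * n * divisor_count C * (real C powr (3/4) * real C powr (1/16)) *
      (bound_const R * (real n powr R * real C powr (- (15/8))) * shift_total)"
    by (simp add: mult_left_mono)
  also have "\<dots> = 70 * real n * bound_const R * real n powr R * shift_total *
    (real (divisor_count C) * (real C powr (3/4) * real C powr (1/16) * real C powr (- (15/8))))"
    by (simp add: mult_ac)
  also have "real C powr (3/4) * real C powr (1/16) * real C powr (- (15/8)) = real C powr (- (17/16))"
    by (simp add: powr_add[symmetric])
  finally show ?thesis .
qed

lemma holomorphic_block:
  assumes "C > 0"
  shows "block n \<tau> Q C holomorphic_on {s. Re s > 3/4 \<and> norm s < R}"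
  unfolding block_def[abs_def]
  by (intro holomorphic_intros holomorphic_kernel_sum scale_bounds assms units_mod_quotient)

text \<open>The majorant depends on a bound R for the norm of s, so the half-plane is exhausted by
  its bounded parts.\<close>

lemma holomorphic_block_sum:
  assumes "\<And>C. C \<in> A \<Longrightarrow> C > 0 \<and> coprime C Q"
  shows "(\<lambda>s. \<Sum>\<^sub>\<infinity>C\<in>A. block n \<tau> Q C s) holomorphic_on {s. Re s > 15/16}"
proof -
  have "(\<lambda>s. \<Sum>\<^sub>\<infinity>C\<in>A. block n \<tau> Q C s) holomorphic_on {s. Re s > 15/16 \<and> norm s < R}" for R
  proof (rule holomorphic_on_infsum[OF open_strip])
    show "block n \<tau> Q C holomorphic_on {s. Re s > 15/16 \<and> norm s < R}" if "C \<in> A" for C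
      using that assms by (intro holomorphic_on_subset[OF holomorphic_block[of C R]]) auto
    show "norm (block n \<tau> Q C s) \<le> 70 * real n * bound_const R * real n powr R * shift_total *
        (real (divisor_count C) * real C powr (- (17/16)))"
      if "C \<in> A" "s \<in> {s. Re s > 15/16 \<and> norm s < R}" for C s
      using that assms by (intro norm_block) auto
    have "(\<lambda>C. real (divisor_count C) * real C powr (- (17/16))) summable_on A"
      by (rule summable_on_subset_banach[OF summable_divisor_count]) (use assms in auto)
    then show "(\<lambda>C. 70 * real n * bound_const R * real n powr R * shift_total *
        (real (divisor_count C) * real C powr (- (17/16)))) summable_on A"
      by (rule summable_on_cmult_right)
  qed
  then have "(\<lambda>s. \<Sum>\<^sub>\<infinity>C\<in>A. block n \<tau> Q C s) holomorphic_on (\<Union>R\<in>UNIV. {s. Re s > 15/16 \<and> norm s < R})"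
    by (intro holomorphic_on_UN_open open_strip)
  moreover have "(\<Union>R\<in>UNIV. {s. Re s > 15/16 \<and> norm s < R}) = {s. Re s > 15/16}"
    using gt_ex by (fastforce simp: set_eq_iff)
  ultimately show ?thesis by simp
qed

text \<open>For Re s > 1 the trivial bound suffices: at most C units give terms of size C^(1 - 2 Re
  s). Absolute convergence then allows any order of summation, which links the sum over cosets to
  the sum over blocks.\<close>

lemma has_sum_block:
  assumes s: "Re s > 1" and A: "\<And>C. C \<in> A \<Longrightarrow> C > 0 \<and> coprime C Q"
  shows "((\<lambda>(C, d, k). twist n Q C d *
      seed_kernel \<tau> s (real n / (real Q * (real C)\<^sup>2)) (of_int d / real C + of_int k)) has_sum
     (\<Sum>\<^sub>\<infinity>C\<in>A. block n \<tau> Q C s)) (Sigma A (\<lambda>C. units_mod C \<times> UNIV))"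
    (is "(?f has_sum _) ?S")
proof -
  define q where "q C = real n / (real Q * (real C)\<^sup>2)" for C
  define f where "f = (\<lambda>(C, d, k). twist n Q C d * seed_kernel \<tau> s (q C) (of_int d / real C + of_int k))"
  have s': "Re s \<ge> 3/4" "Re s \<ge> 0" using s by auto
  define B where "B = bound_const (norm s) * real n powr Re s"
  have B0: "B \<ge> 0" by (simp add: B_def bound_const_nonneg)
  define b where "b = (\<lambda>(C, d :: int, k). B * real C powr (- 2 * Re s) * shift_weight k)"
  have fb: "norm (f z) \<le> b z" if z: "z \<in> ?S" for z
  proof -
    obtain C d k where z': "z = (C, d, k)" by (metis prod.exhaust)
    with z have C: "C > 0" "d \<in> units_mod C" using A by auto
    have "norm (f z) \<le> bound_const (norm s) * q C powr Re s * shift_weight k"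
      unfolding z' f_def prod.case norm_mult norm_twist mult_1_left q_def
      by (intro bound_const_le s' order.refl scale_bounds C units_mod_quotient)
    also have "\<dots> \<le> bound_const (norm s) * (real n powr Re s * real C powr (- 2 * Re s)) * shift_weight k"
      unfolding q_def
      by (intro mult_right_mono mult_left_mono scale_bounds C s' bound_const_nonneg shift_weight_nonneg)
    also have "\<dots> = b z" by (simp add: b_def z' B_def mult.assoc)
    finally show ?thesis .
  qed
  have "b summable_on ?S"
  proof (rule summable_on_SigmaI)
    show "((\<lambda>y. b (C, y)) has_sum real (card (units_mod C)) * (B * real C powr (- 2 * Re s) * shift_total)) (units_mod C \<times> UNIV)" for C
    proof (rule has_sum_SigmaI[where g = "\<lambda>_. B * real C powr (- 2 * Re s) * shift_total"])
      show "((\<lambda>y. b (C, x, y)) has_sum B * real C powr (- 2 * Re s) * shift_total) UNIV" for x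
        unfolding b_def prod.case by (intro has_sum_cmult_right has_sum_shift_weight)
      show "((\<lambda>_. B * real C powr (- 2 * Re s) * shift_total) has_sum
          real (card (units_mod C)) * (B * real C powr (- 2 * Re s) * shift_total)) (units_mod C)"
        by (simp add: has_sum_finite_iff)
      show "(\<lambda>y. b (C, y)) summable_on units_mod C \<times> UNIV"
        by (rule summable_on_SigmaI[where g = "\<lambda>_. B * real C powr (- 2 * Re s) * shift_total"])
           (auto simp: b_def B0 shift_weight_nonneg intro!: has_sum_cmult_right has_sum_shift_weight)
    qed
    show "(\<lambda>C. real (card (units_mod C)) * (B * real C powr (- 2 * Re s) * shift_total)) summable_on A"
    proof (rule summable_on_comparison_test)
      have "(\<lambda>C. real C powr (1 - 2 * Re s)) summable_on A"
        by (rule summable_on_subset_banach[of _ UNIV])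
           (use s in \<open>auto intro!: norm_summable_imp_summable_on simp: summable_real_powr_iff\<close>)
      then show "(\<lambda>C. B * shift_total * real C powr (1 - 2 * Re s)) summable_on A"
        by (rule summable_on_cmult_right)
      show "real (card (units_mod C)) * (B * real C powr (- 2 * Re s) * shift_total) \<le>
          B * shift_total * real C powr (1 - 2 * Re s)" if "C \<in> A" for C
      proof -
        have C: "C > 0" using A[OF that] by simp
        have "card (units_mod C) \<le> card {0..<int C}"
          by (intro card_mono) (auto simp: units_mod_def)
        then have "real (card (units_mod C)) * (B * real C powr (- 2 * Re s) * shift_total) \<le>
            real C * (B * real C powr (- 2 * Re s) * shift_total)"
          by (intro mult_right_mono) (auto simp: B0 shift_total_nonneg)
        also have "\<dots> = B * shift_total * (real C powr 1 * real C powr (- 2 * Re s))"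
          using C by simp
        also have "real C powr 1 * real C powr (- 2 * Re s) = real C powr (1 - 2 * Re s)"
          unfolding powr_add[symmetric] by simp
        finally show ?thesis .
      qed
    qed (auto simp: B0 shift_total_nonneg)
  qed (auto simp: b_def B0 shift_weight_nonneg)
  then have "(\<lambda>z. norm (f z)) summable_on ?S"
    by (rule Infinite_Sum.abs_summable_on_comparison_test') (rule fb)
  then have summable: "f summable_on ?S" by (rule abs_summable_summable)
  have inner: "((\<lambda>y. f (C, y)) has_sum block n \<tau> Q C s) (units_mod C \<times> UNIV)" if "C \<in> A" for C
  proof (rule has_sum_SigmaI)
    have C: "C > 0" using A[OF that] by simp
    show "((\<lambda>k. f (C, d, k)) has_sum twist n Q C d * kernel_sum \<tau> s (q C) (of_int d / real C)) UNIV"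
      if "d \<in> units_mod C" for d
      unfolding f_def prod.case kernel_sum_def q_def
      by (intro has_sum_cmult_right has_sum_infsum kernel_summable s' scale_bounds C units_mod_quotient that)
    show "((\<lambda>d. twist n Q C d * kernel_sum \<tau> s (q C) (of_int d / real C)) has_sum block n \<tau> Q C s) (units_mod C)"
      by (simp add: block_def q_def has_sum_finite_iff)
    show "(\<lambda>y. f (C, y)) summable_on units_mod C \<times> UNIV"
      using summable_on_SigmaD1[of "\<lambda>x y. f (x, y)" A "\<lambda>C. units_mod C \<times> UNIV" C] summable that
      by (simp add: case_prod_unfold)
  qed
  have "(f has_sum infsum f ?S) ?S" by (rule has_sum_infsum[OF summable])
  moreover from this have "((\<lambda>C. block n \<tau> Q C s) has_sum infsum f ?S) A"
    by (rule has_sum_SigmaD) (rule inner)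
  then have "(\<Sum>\<^sub>\<infinity>C\<in>A. block n \<tau> Q C s) = infsum f ?S" by (rule infsumI)
  ultimately show ?thesis by (simp add: f_def q_def)
qed

end

end

section \<open>Atkin--Lehner groups\<close>

no_notation fps_nth (infixl "$" 75)

section \<open>Real matrices and the group \<open>SL2R\<close>\<close>

lemma mat2_nth [simp]:
  "mat2 a b c d $ 1 $ 1 = a" "mat2 a b c d $ 1 $ 2 = b" "mat2 a b c d $ 2 $ 1 = c" "mat2 a b c d $ 2 $ 2 = d"
  by (simp_all add: mat2_def)

lemma mat2_eqI:
  assumes "A $ 1 $ 1 = B $ 1 $ 1" "A $ 1 $ 2 = B $ 1 $ 2" "A $ 2 $ 1 = B $ 2 $ 1" "A $ 2 $ 2 = B $ 2 $ 2"
  shows "A = (B :: real^2^2)"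
  using assms by (simp add: vec_eq_iff forall_2)

lemma mat2_eta: "mat2 (A $ 1 $ 1) (A $ 1 $ 2) (A $ 2 $ 1) (A $ 2 $ 2) = A"
  by (rule mat2_eqI) simp_all

lemma mat2_mult: "mat2 a b c d ** mat2 a' b' c' d' =
    mat2 (a * a' + b * c') (a * b' + b * d') (c * a' + d * c') (c * b' + d * d')"
  by (rule mat2_eqI) (simp_all add: matrix_matrix_mult_def sum_2)

lemma det_mat2 [simp]: "det (mat2 a b c d) = a * d - b * c"
  by (simp add: det_2)

lemma mat_1_mat2: "mat 1 = mat2 1 0 0 1"
  by (rule mat2_eqI) (simp_all add: mat_def)

lemma scaleR_mat2: "k *\<^sub>R mat2 a b c d = mat2 (k * a) (k * b) (k * c) (k * d)"
  by (rule mat2_eqI) simp_all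

lemma uminus_mat2: "- mat2 a b c d = mat2 (- a) (- b) (- c) (- d)"
  by (rule mat2_eqI) simp_all

lemma group_SL2R: "group SL2R"
proof (rule groupI)
  fix x assume x: "x \<in> carrier SL2R"
  define y where "y = mat2 (x $ 2 $ 2) (- x $ 1 $ 2) (- x $ 2 $ 1) (x $ 1 $ 1)"
  have "det x = 1" using x by (simp add: SL2R_def)
  then have d: "x $ 1 $ 1 * x $ 2 $ 2 - x $ 1 $ 2 * x $ 2 $ 1 = 1" by (simp add: det_2)
  have "y ** mat2 (x $ 1 $ 1) (x $ 1 $ 2) (x $ 2 $ 1) (x $ 2 $ 2) = mat 1"
    unfolding y_def mat2_mult mat_1_mat2 using d by (intro mat2_eqI) (simp_all add: algebra_simps)
  moreover have "det y = 1" using d by (simp add: y_def algebra_simps)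
  ultimately show "\<exists>y\<in>carrier SL2R. y \<otimes>\<^bsub>SL2R\<^esub> x = \<one>\<^bsub>SL2R\<^esub>"
    by (intro bexI[of _ y]) (simp_all add: SL2R_def mat2_eta)
qed (auto simp: SL2R_def det_mul matrix_mul_assoc)

interpretation SL2R: group SL2R by (rule group_SL2R)

lemma carrier_SL2R: "A \<in> carrier SL2R \<longleftrightarrow> det A = 1"
  and mult_SL2R: "A \<otimes>\<^bsub>SL2R\<^esub> B = A ** B"
  and one_SL2R: "\<one>\<^bsub>SL2R\<^esub> = mat 1"
  by (simp_all add: SL2R_def)

section \<open>Integral matrices behind the Atkin-Lehner cosets\<close>

type_synonym imat = "int \<times> int \<times> int \<times> int"

text \<open>Integral matrices \<open>(a b; c d)\<close>, taken projectively: the group elements are \<open>to_mat Q M\<close>.\<close>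

definition mob :: "imat \<Rightarrow> complex \<Rightarrow> complex" where
  "mob = (\<lambda>(a, b, c, d) \<tau>. (of_int a * \<tau> + of_int b) / (of_int c * \<tau> + of_int d))"

text \<open>The determinant D is kept apart from Q because the Hecke relation is about the matrices
  of this shape with determinant p Q.\<close>

definition al_set :: "nat \<Rightarrow> nat \<Rightarrow> int \<Rightarrow> imat set" where
  "al_set N Q D = {(a, b, c, d). int Q dvd a \<and> int N dvd c \<and> int Q dvd d \<and> a * d - b * c = D}"

definition to_mat :: "nat \<Rightarrow> imat \<Rightarrow> real^2^2" where
  "to_mat Q = (\<lambda>(a, b, c, d). mat2 (of_int a / sqrt Q) (of_int b / sqrt Q) (of_int c / sqrt Q) (of_int d / sqrt Q))"

lemma atkin_lehner_eq:
  assumes "Q > 0"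
  shows "atkin_lehner N Q = to_mat Q ` al_set N Q (int Q)"
proof (intro equalityI subsetI)
  fix A assume "A \<in> atkin_lehner N Q"
  then obtain x y z w :: int where
    A: "A = (1 / sqrt (real Q)) *\<^sub>R mat2 (real Q * of_int x) (of_int y) (real N * of_int z) (real Q * of_int w)"
    and d: "det (mat2 (real Q * of_int x) (of_int y) (real N * of_int z) (real Q * of_int w)) = real Q"
    unfolding atkin_lehner_def by blast
  from d have "real_of_int (int Q * x * (int Q * w) - y * (int N * z)) = real_of_int (int Q)"
    by (simp add: algebra_simps)
  then have "int Q * x * (int Q * w) - y * (int N * z) = int Q" by (simp only: of_int_eq_iff)
  then have "(int Q * x, y, int N * z, int Q * w) \<in> al_set N Q (int Q)" by (simp add: al_set_def)
  moreover have "A = to_mat Q (int Q * x, y, int N * z, int Q * w)"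
    by (simp add: A to_mat_def scaleR_mat2)
  ultimately show "A \<in> to_mat Q ` al_set N Q (int Q)" by blast
next
  fix A assume "A \<in> to_mat Q ` al_set N Q (int Q)"
  then obtain a b c d where M: "(a, b, c, d) \<in> al_set N Q (int Q)" and A: "A = to_mat Q (a, b, c, d)"
    by auto
  then obtain x z w where xzw: "a = int Q * x" "c = int N * z" "d = int Q * w"
    by (auto simp: al_set_def elim!: dvdE)
  have "real_of_int (a * d - b * c) = real_of_int (int Q)" using M by (simp only: al_set_def) auto
  then have "det (mat2 (real Q * of_int x) (of_int b) (real N * of_int z) (real Q * of_int w)) = real Q"
    by (simp add: xzw algebra_simps)
  moreover have "A = (1 / sqrt (real Q)) *\<^sub>R mat2 (real Q * of_int x) (of_int b) (real N * of_int z) (real Q * of_int w)"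
    by (simp add: A to_mat_def scaleR_mat2 xzw)
  ultimately show "A \<in> atkin_lehner N Q" unfolding atkin_lehner_def by blast
qed

lemma Gamma0_eq: "Gamma0 N = to_mat 1 ` al_set N 1 1"
proof (intro equalityI subsetI)
  fix A assume A: "A \<in> Gamma0 N"
  then obtain z :: int where z: "A $ 2 $ 1 = real N * of_int z" by (auto simp: Gamma0_def)
  from A have "A $ 1 $ 1 \<in> \<int>" "A $ 1 $ 2 \<in> \<int>" "A $ 2 $ 2 \<in> \<int>" and det: "det A = 1"
    by (auto simp: Gamma0_def SL2Z_def)
  then obtain a b d :: int where e: "A $ 1 $ 1 = of_int a" "A $ 1 $ 2 = of_int b" "A $ 2 $ 2 = of_int d"
    by (auto elim!: Ints_cases)
  have "real_of_int (a * d - b * (int N * z)) = of_int 1"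
    using det by (simp add: det_2 e z)
  then have "a * d - b * (int N * z) = 1" by (simp only: of_int_eq_iff)
  then have "(a, b, int N * z, d) \<in> al_set N 1 1" by (simp add: al_set_def)
  moreover have "A = to_mat 1 (a, b, int N * z, d)"
    by (rule mat2_eqI) (simp_all add: to_mat_def e z)
  ultimately show "A \<in> to_mat 1 ` al_set N 1 1" by blast
next
  fix A assume "A \<in> to_mat 1 ` al_set N 1 1"
  then obtain a b c d where M: "(a, b, c, d) \<in> al_set N 1 1" and A: "A = to_mat 1 (a, b, c, d)"
    by auto
  then obtain z where c: "c = int N * z" by (auto simp: al_set_def)
  have "real_of_int (a * d - b * c) = of_int 1" using M by (simp only: al_set_def) auto
  then have "det A = 1" by (simp add: A to_mat_def)
  then show "A \<in> Gamma0 N"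
    by (auto simp: A to_mat_def Gamma0_def SL2Z_def forall_2 c)
qed

lemma det_to_mat:
  assumes "Q > 0" "(a, b, c, d) \<in> al_set N Q' D"
  shows "det (to_mat Q (a, b, c, d)) = of_int D / real Q"
proof -
  have D: "D = a * d - b * c" using assms by (simp add: al_set_def)
  show ?thesis using assms(1) by (simp add: to_mat_def D diff_divide_distrib)
qed

text \<open>The group law on exact divisors: Q Q' / gcd^2, the symmetric difference of the sets of
  primes.\<close>

definition al_prod :: "nat \<Rightarrow> nat \<Rightarrow> nat" where
  "al_prod Q Q' = (Q div gcd Q Q') * (Q' div gcd Q Q')"

lemma al_decompose:
  assumes "Q > 0" "Q dvd N" "Q' dvd N" "N > 0"
  obtains g a b m where "Q = g * a" "Q' = g * b" "coprime a b" "N = g * a * b * m" "gcd Q Q' = g"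
    "al_prod Q Q' = a * b" "g > 0" "a > 0" "b > 0" "m > 0"
proof -
  define g where "g = gcd Q Q'"
  have g: "g > 0" using assms by (simp add: g_def)
  obtain a b where ab: "Q = g * a" "Q' = g * b" unfolding g_def by (metis gcd_dvd1 gcd_dvd2 dvd_def)
  have cop: "coprime a b" using assms(1) div_gcd_coprime[of Q Q'] g ab g_def[symmetric] by auto
  have "lcm Q Q' dvd N" using assms by simp
  moreover have "lcm Q Q' = g * a * b"
    using g g_def[symmetric] by (simp add: lcm_nat_def ab mult_ac)
  ultimately obtain m where m: "N = g * a * b * m" by (metis dvd_def)
  have "al_prod Q Q' = a * b"
    unfolding al_prod_def g_def[symmetric] using g by (simp add: ab)
  moreover have "a > 0" "b > 0" "m > 0" using assms(1,4) ab(1) m by (auto intro!: Nat.gr0I)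
  ultimately show thesis using that[OF ab cop m g_def[symmetric]] g by blast
qed

text \<open>With g = gcd Q Q', Q = g a and Q' = g b, every entry of the product is divisible by g,
  and sqrt Q sqrt Q' = g sqrt (a b). Dividing by g leaves the integral matrix P of determinant a
  b.\<close>

lemma al_set_mult:
  assumes Q: "Q > 0" "Q dvd N" "Q' dvd N" "N > 0"
    and M: "M \<in> al_set N Q (int Q)" "M' \<in> al_set N Q' (int Q')"
  shows "to_mat Q M ** to_mat Q' M' \<in> to_mat (al_prod Q Q') ` al_set N (al_prod Q Q') (int (al_prod Q Q'))"
proof -
  from al_decompose[OF Q] obtain g a b m where dec: "Q = g * a" "Q' = g * b" "N = g * a * b * m"
    "al_prod Q Q' = a * b" "g > 0" "a > 0" "b > 0" by metis
  obtain x y z w where M1: "M = (int Q * x, y, int N * z, int Q * w)"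
    using M(1) by (cases M) (auto simp: al_set_def elim!: dvdE)
  obtain x' y' z' w' where M2: "M' = (int Q' * x', y', int N * z', int Q' * w')"
    using M(2) by (cases M') (auto simp: al_set_def elim!: dvdE)
  have d1: "int Q * x * (int Q * w) - y * (int N * z) = int Q"
    and d2: "int Q' * x' * (int Q' * w') - y' * (int N * z') = int Q'"
    using M by (auto simp: M1 M2 al_set_def)
  define G A B R where "G = int g" and "A = int a" and "B = int b" and "R = int m"
  have G: "G > 0" "A > 0" "B > 0" using dec by (simp_all add: G_def A_def B_def)
  define P where "P = (A * B * (G * x * x' + y * R * z'), A * x * y' + B * y * w',
      int N * (B * z * x' + A * w * z'), A * B * (R * z * y' + G * w * w'))"
  have N: "int N = G * A * B * R" and QG: "int Q = G * A" "int Q' = G * B"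
    by (simp_all add: dec G_def A_def B_def R_def)
  have d1': "G * A * x * w - y * (B * R * z) = 1"
  proof -
    have "(G * A) * (G * A * x * w - y * (B * R * z)) = (G * A) * 1"
      using d1 unfolding N QG by (simp add: algebra_simps)
    then show ?thesis using G by simp
  qed
  have d2': "G * B * x' * w' - y' * (A * R * z') = 1"
  proof -
    have "(G * B) * (G * B * x' * w' - y' * (A * R * z')) = (G * B) * 1"
      using d2 unfolding N QG by (simp add: algebra_simps)
    then show ?thesis using G by simp
  qed
  have "A * B * (G * x * x' + y * R * z') * (A * B * (R * z * y' + G * w * w')) -
      (A * x * y' + B * y * w') * (int N * (B * z * x' + A * w * z')) =
      A * B * ((G * A * x * w - y * (B * R * z)) * (G * B * x' * w' - y' * (A * R * z')))"
    unfolding N by (simp add: algebra_simps)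
  also have "\<dots> = A * B" by (simp only: d1' d2' mult_1_right)
  finally have "P \<in> al_set N (a * b) (int (a * b))"
    by (auto simp: P_def al_set_def A_def B_def intro: dvd_mult2)
  moreover have "to_mat Q M ** to_mat Q' M' = to_mat (a * b) P"
  proof -
    have sq: "sqrt (real Q) * sqrt (real Q') = of_int G * sqrt (real (a * b))"
    proof -
      have "real Q * real Q' = (of_int G)\<^sup>2 * real (a * b)" by (simp add: dec G_def power2_eq_square)
      then show ?thesis using G by (simp add: real_sqrt_mult[symmetric]) (simp add: real_sqrt_mult)
    qed
    have div: "u / sqrt (real Q) * (v / sqrt (real Q')) + u' / sqrt (real Q) * (v' / sqrt (real Q')) = r / sqrt (real (a * b))"
      if "u * v + u' * v' = of_int G * r" for u v u' v' r
    proof -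
      have "u / sqrt (real Q) * (v / sqrt (real Q')) + u' / sqrt (real Q) * (v' / sqrt (real Q')) =
          (u * v + u' * v') / (sqrt (real Q) * sqrt (real Q'))"
        by (simp add: add_divide_distrib)
      also have "\<dots> = r / sqrt (real (a * b))" unfolding sq that using G by simp
      finally show ?thesis .
    qed
    have rN: "real N = of_int G * of_int A * of_int B * of_int R" "real Q = of_int G * of_int A" "real Q' = of_int G * of_int B"
      using N QG by (metis of_int_mult of_int_of_nat_eq)+
    show ?thesis
      unfolding M1 M2 P_def to_mat_def prod.case mat2_mult
      by (intro arg_cong4[of _ _ _ _ _ _ _ _ mat2] div) (simp_all add: rN algebra_simps)
  qed
  ultimately show ?thesis unfolding dec(4) by (simp only: image_eqI)
qed


lemma al_set_inverse:
  assumes "Q > 0" "(a, b, c, d) \<in> al_set N Q (int Q)"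
  shows "(d, - b, - c, a) \<in> al_set N Q (int Q)"
    "to_mat Q (d, - b, - c, a) ** to_mat Q (a, b, c, d) = mat 1"
proof -
  have e: "a * d - b * c = int Q" using assms by (simp add: al_set_def)
  show "(d, - b, - c, a) \<in> al_set N Q (int Q)"
    using assms by (auto simp: al_set_def algebra_simps)
  have "real_of_int (a * d - b * c) = real_of_int (int Q)" by (simp only: e)
  then have r: "of_int a * of_int d - of_int b * of_int c = real Q" by simp
  have s: "sqrt (real Q) * sqrt (real Q) = real Q" "real Q \<noteq> 0" using assms by simp_all
  show "to_mat Q (d, - b, - c, a) ** to_mat Q (a, b, c, d) = mat 1"
    unfolding to_mat_def prod.case mat2_mult mat_1_mat2
    using r s by (intro mat2_eqI) (simp_all add: field_simps)
qed

lemma al_set_nonempty: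
  assumes "exact_divisor Q N" "N > 0"
  obtains M where "M \<in> al_set N Q (int Q)"
proof -
  have "coprime (int Q) (int (N div Q))" using assms by (simp add: exact_divisor_def)
  then obtain u v where uv: "u * int Q + v * int (N div Q) = 1"
    using bezout_int[of "int Q" "int (N div Q)"] by auto
  define K where "K = int (N div Q)"
  have K: "int N = int Q * K"
    unfolding K_def using assms by (metis exact_divisor_def dvd_mult_div_cancel of_nat_mult)
  have "int Q * (int Q * u) - (- v) * int N = int Q * (u * int Q + v * K)"
    unfolding K by (simp add: algebra_simps)
  then have "int Q * (int Q * u) - (- v) * int N = int Q"
    using uv by (simp add: K_def)
  then have "(int Q, - v, int N, int Q * u) \<in> al_set N Q (int Q)" by (simp add: al_set_def)
  then show thesis by (rule that)
qed

text \<open>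
  \<open>al_prod Q Q'\<close> is the index of the product of two Atkin--Lehner involutions, so the condition
  makes the union of their cosets a group and hence equal to \<open>N+S\<close>.
\<close>

definition good_level :: "level \<Rightarrow> bool" where
  "good_level = (\<lambda>(N, S). N > 0 \<and> S \<subseteq> {Q. exact_divisor Q N \<and> Q > 1} \<and>
     (\<forall>Q\<in>insert 1 S. \<forall>Q'\<in>insert 1 S. al_prod Q Q' \<in> insert 1 S))"

lemma good_levelD:
  assumes "good_level (N, S)" "Q \<in> insert 1 S"
  shows "N > 0" "exact_divisor Q N" "Q > 0" "Q dvd N"
  using assms by (auto simp: good_level_def exact_divisor_def)

lemma good_level_finite:
  assumes "good_level (N, S)"
  shows "finite S"
proof (rule finite_subset)
  show "S \<subseteq> {Q. Q dvd N}" using assms by (auto simp: good_level_def exact_divisor_def)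
  show "finite {Q. Q dvd N}" using assms by (intro finite_divisors_nat) (simp add: good_level_def)
qed

lemma to_mat_carrier:
  assumes "Q > 0"
  shows "to_mat Q ` al_set N Q (int Q) \<subseteq> carrier SL2R"
  using assms det_to_mat[OF assms] by (force simp: carrier_SL2R)

lemma level_group_generate:
  "level_group (N, S) = generate SL2R (Gamma0 N \<union> (\<Union>Q\<in>S. atkin_lehner N Q))"
  by (simp add: level_group_def)

lemma level_group_subgroup:
  assumes "S \<subseteq> {Q. Q > 0}"
  shows "subgroup (level_group (N, S)) SL2R"
  unfolding level_group_def prod.case
proof (rule SL2R.generate_is_subgroup)
  show "Gamma0 N \<union> (\<Union>Q\<in>S. atkin_lehner N Q) \<subseteq> carrier SL2R"
  proof -
    have "atkin_lehner N Q \<subseteq> carrier SL2R" if "Q \<in> S" for Q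
      using that assms to_mat_carrier[of Q N] atkin_lehner_eq[of Q N] by auto
    then show ?thesis using to_mat_carrier[of 1 N] by (auto simp: Gamma0_eq)
  qed
qed

text \<open>The generators already form a group: products stay in the union by
  \<open>al_set_mult\<close> and the closure condition of \<open>good_level\<close>, and inverses
  stay in the same coset.\<close>

lemma level_group_eq:
  assumes good: "good_level (N, S)"
  shows "level_group (N, S) = (\<Union>Q\<in>insert 1 S. to_mat Q ` al_set N Q (int Q))" (is "_ = ?U")
proof
  have gens: "Gamma0 N \<union> (\<Union>Q\<in>S. atkin_lehner N Q) = ?U"
  proof -
    have "(\<Union>Q\<in>S. atkin_lehner N Q) = (\<Union>Q\<in>S. to_mat Q ` al_set N Q (int Q))"
      using good_levelD(3)[OF good] by (intro SUP_cong refl atkin_lehner_eq) auto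
    then show ?thesis by (simp add: Gamma0_eq)
  qed
  have mult: "A ** B \<in> ?U" if "A \<in> ?U" "B \<in> ?U" for A B
  proof -
    from that obtain Q M Q' M' where Q: "Q \<in> insert 1 S" "M \<in> al_set N Q (int Q)" "A = to_mat Q M"
      "Q' \<in> insert 1 S" "M' \<in> al_set N Q' (int Q')" "B = to_mat Q' M'" by blast
    have "al_prod Q Q' \<in> insert 1 S" using good Q(1,4) unfolding good_level_def by blast
    moreover have "A ** B \<in> to_mat (al_prod Q Q') ` al_set N (al_prod Q Q') (int (al_prod Q Q'))"
      unfolding Q(3,6)
      by (intro al_set_mult good_levelD[OF good Q(1)] good_levelD[OF good Q(4)] Q)
    ultimately show ?thesis by (rule UN_I)
  qed
  have carrier: "?U \<subseteq> carrier SL2R"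
    by (intro UN_least to_mat_carrier) (rule good_levelD(3)[OF good])
  have "subgroup ?U SL2R"
  proof (rule SL2R.subgroupI)
    obtain M where "M \<in> al_set N 1 (int 1)"
      using al_set_nonempty[of 1 N] good_levelD[OF good, of 1] by blast
    then have "to_mat 1 M \<in> ?U" by simp
    then show "?U \<noteq> {}" by (metis empty_iff)
    show "inv\<^bsub>SL2R\<^esub> A \<in> ?U" if A: "A \<in> ?U" for A
    proof -
      from A obtain Q M where "Q \<in> insert 1 S" "M \<in> al_set N Q (int Q)" "A = to_mat Q M"
        by blast
      then obtain a b c d where Q: "Q \<in> insert 1 S" "(a, b, c, d) \<in> al_set N Q (int Q)" "A = to_mat Q (a, b, c, d)"
        by (cases M) auto
      note inv = al_set_inverse[OF good_levelD(3)[OF good Q(1)] Q(2)]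
      have U: "to_mat Q (d, - b, - c, a) \<in> ?U" using inv(1) Q(1) by blast
      have "inv\<^bsub>SL2R\<^esub> A = to_mat Q (d, - b, - c, a)"
      proof (rule SL2R.inv_equality)
        show "to_mat Q (d, - b, - c, a) \<otimes>\<^bsub>SL2R\<^esub> A = \<one>\<^bsub>SL2R\<^esub>"
          by (simp only: mult_SL2R one_SL2R Q(3) inv(2))
      qed (use A U carrier in blast)+
      then show ?thesis using U by simp
    qed
    show "A \<otimes>\<^bsub>SL2R\<^esub> B \<in> ?U" if "A \<in> ?U" "B \<in> ?U" for A B
      using mult[OF that] by (simp add: mult_SL2R)
  qed (rule carrier)
  then show "level_group (N, S) \<subseteq> ?U"
    unfolding level_group_def prod.case gens by (intro SL2R.generate_subgroup_incl) auto
  show "?U \<subseteq> level_group (N, S)"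
    unfolding level_group_def prod.case gens by (auto intro: generate.incl)
qed

lemma al_prod_exact:
  assumes "exact_divisor Q N" "exact_divisor Q' N" "N > 0"
  shows "exact_divisor (al_prod Q Q') N" "al_prod Q Q' > 0"
proof -
  have "Q > 0" using assms by (auto simp: exact_divisor_def intro: Nat.gr0I)
  from al_decompose[OF this, of N Q'] assms
  obtain g a b m where dec: "Q = g * a" "Q' = g * b" "coprime a b" "N = g * a * b * m"
    "al_prod Q Q' = a * b" "g > 0" "a > 0" "b > 0" unfolding exact_divisor_def by metis
  have "N div Q = b * m" "N div Q' = a * m" "N div (a * b) = g * m"
    using dec by (simp_all add: mult_ac)
  then have "coprime (g * a) (b * m)" "coprime (g * b) (a * m)"
    using assms dec by (auto simp: exact_divisor_def)
  then have "coprime (a * b) (g * m)" using dec(3) by (auto simp: ac_simps)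
  then show "exact_divisor (al_prod Q Q') N"
    unfolding exact_divisor_def dec(5) \<open>N div (a * b) = g * m\<close> by (simp add: dec(4))
  show "al_prod Q Q' > 0" using dec by simp
qed

text \<open>Adjoining R = \<open>al_prod Q Q'\<close> to S does not change the group: a product P of
  elements for Q and Q' has index R, and each W of index R is (W P^-1) P with W P^-1 in
  \<open>Gamma0 N\<close>, as \<open>al_prod R R\<close> = 1. Maximality then puts R into S.\<close>

lemma largest_imp_good:
  assumes N: "N > 0" and largest: "largest_divisor_set N S"
  shows "good_level (N, S)"
proof -
  have S: "S \<subseteq> {Q. exact_divisor Q N \<and> Q > 1}"
    and max: "\<And>S'. S' \<subseteq> {Q. exact_divisor Q N \<and> Q > 1} \<Longrightarrow>
       level_group (N, S') = level_group (N, S) \<Longrightarrow> S' \<subseteq> S"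
    using largest by (auto simp: largest_divisor_set_def)
  have Spos: "S \<subseteq> {Q. Q > 0}" using S by auto
  let ?G = "level_group (N, S)"
  have sub: "subgroup ?G SL2R" by (rule level_group_subgroup[OF Spos])
  have inG: "to_mat Q M \<in> ?G" if "Q \<in> insert 1 S" "M \<in> al_set N Q (int Q)" for Q M
    using that Spos
    by (auto simp: level_group_def Gamma0_eq atkin_lehner_eq subset_iff intro!: generate.incl)
  have "al_prod Q Q' \<in> insert 1 S" if Q: "Q \<in> insert 1 S" "Q' \<in> insert 1 S" for Q Q'
  proof -
    define R where "R = al_prod Q Q'"
    have ex: "exact_divisor Q N" "exact_divisor Q' N" using Q S by (auto simp: exact_divisor_def)
    then have dv: "Q > 0" "Q dvd N" "Q' > 0" "Q' dvd N" using N by (auto simp: exact_divisor_def intro: Nat.gr0I)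
    have R: "exact_divisor R N" "R > 0" using al_prod_exact[OF ex N] by (simp_all add: R_def)
    then have Rd: "R dvd N" by (simp add: exact_divisor_def)
    have RR: "al_prod R R = 1" using R by (simp add: al_prod_def)
    have "atkin_lehner N R \<subseteq> ?G"
    proof
      fix W assume "W \<in> atkin_lehner N R"
      then obtain M where M: "M \<in> al_set N R (int R)" "W = to_mat R M"
        using R by (auto simp: atkin_lehner_eq)
      obtain M1 M2 where M12: "M1 \<in> al_set N Q (int Q)" "M2 \<in> al_set N Q' (int Q')"
        using al_set_nonempty ex N by metis
      define P where "P = to_mat Q M1 ** to_mat Q' M2"
      have PG: "P \<in> ?G"
        using inG[OF Q(1) M12(1)] inG[OF Q(2) M12(2)] subgroup.m_closed[OF sub]
        by (simp add: P_def mult_SL2R)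
      have "P \<in> to_mat R ` al_set N R (int R)"
        using al_set_mult[OF dv(1,2,4) N M12] by (simp add: P_def R_def)
      then obtain a b c d where p: "(a, b, c, d) \<in> al_set N R (int R)" "P = to_mat R (a, b, c, d)" by auto
      note inv = al_set_inverse[OF R(2) p(1)]
      have "W ** to_mat R (d, - b, - c, a) \<in> to_mat 1 ` al_set N 1 (int 1)"
        using al_set_mult[OF R(2) Rd Rd N M(1) inv(1)] by (simp add: RR M(2))
      then have "W ** to_mat R (d, - b, - c, a) \<in> ?G" using inG by auto
      then have "(W ** to_mat R (d, - b, - c, a)) ** P \<in> ?G"
        using PG subgroup.m_closed[OF sub] by (simp add: mult_SL2R)
      moreover have "(W ** to_mat R (d, - b, - c, a)) ** P = W"
        using inv(2) by (simp add: p(2) flip: matrix_mul_assoc)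
      ultimately show "W \<in> ?G" by simp
    qed
    moreover have "Gamma0 N \<union> (\<Union>Q\<in>S. atkin_lehner N Q) \<subseteq> ?G"
      unfolding level_group_def by (auto intro: generate.incl)
    ultimately have "Gamma0 N \<union> (\<Union>Q\<in>insert R S. atkin_lehner N Q) \<subseteq> ?G" by auto
    then have "level_group (N, insert R S) \<subseteq> ?G"
      unfolding level_group_generate[of N "insert R S"]
      by (rule SL2R.generate_subgroup_incl[OF _ sub])
    moreover have "?G \<subseteq> level_group (N, insert R S)"
      unfolding level_group_def prod.case by (rule SL2R.mono_generate) auto
    ultimately have eq: "level_group (N, insert R S) = ?G" by blast
    show ?thesis
    proof (cases "R = 1")
      case False
      then have "insert R S \<subseteq> S" using R S by (intro max eq) auto
      then show ?thesis by (simp add: R_def)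
    qed (simp add: R_def)
  qed
  then show ?thesis using N S by (simp add: good_level_def)
qed

text \<open>Makes the cosets for different Q disjoint, so that sums over N+S split over Q. If a
  prime l divided Q but not Q', comparing the upper right entries in y^2 Q' = y'^2 Q would give l |
  y, and then l would divide det M / Q = 1.\<close>

lemma to_mat_inj_exact:
  assumes ex: "exact_divisor Q N" "exact_divisor Q' N" "N > 0"
    and M: "M \<in> al_set N Q (int Q)" "M' \<in> al_set N Q' (int Q')" and eq: "to_mat Q M = to_mat Q' M'"
  shows "Q = Q'" "M = M'"
proof -
  have dvd: "Q dvd Q'" if ex: "exact_divisor Q N" "exact_divisor Q' N"
    and M: "M \<in> al_set N Q (int Q)" "M' \<in> al_set N Q' (int Q')" and eq: "to_mat Q M = to_mat Q' M'"
    for Q Q' M M'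
  proof -
    have Qp: "Q > 0" "Q' > 0" using ex \<open>N > 0\<close> by (auto simp: exact_divisor_def intro: Nat.gr0I)
    from al_decompose[of Q N Q'] ex \<open>N > 0\<close> Qp
    obtain g a b m where dec: "Q = g * a" "Q' = g * b" "coprime a b" "N = g * a * b * m"
      "g > 0" "a > 0" "b > 0" unfolding exact_divisor_def by metis
    have "N = Q' * (a * m)" using dec by (simp add: mult_ac)
    then have "N div Q' = a * m" using Qp by simp
    then have cop: "coprime Q' a" using ex(2) by (simp add: exact_divisor_def)
    have "a = 1"
    proof (rule ccontr)
      assume "a \<noteq> 1"
      then obtain l where l: "prime l" "l dvd a" by (metis prime_factor_nat)
      have lQ: "l dvd Q" using l dec by simp
      have lQ': "\<not> l dvd Q'" using cop l by (meson coprime_common_divisor not_prime_unit)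
      obtain x y z w where xyzw: "M = (x, y, z, w)" by (metis prod.exhaust)
      obtain x' y' z' w' where xyzw': "M' = (x', y', z', w')" by (metis prod.exhaust)
      have "of_int y / sqrt (real Q) = of_int y' / sqrt (real Q')"
        using arg_cong[OF eq, of "\<lambda>A. A $ 1 $ 2"] by (simp add: xyzw xyzw' to_mat_def)
      then have "of_int y * sqrt (real Q') = of_int y' * sqrt (real Q)"
        using Qp by (simp add: field_simps)
      then have "(of_int y * sqrt (real Q'))\<^sup>2 = (of_int y' * sqrt (real Q))\<^sup>2" by simp
      then have "real_of_int (y\<^sup>2 * int Q') = of_int (y'\<^sup>2 * int Q)"
        by (simp add: power_mult_distrib)
      then have "y\<^sup>2 * int Q' = y'\<^sup>2 * int Q" by (simp only: of_int_eq_iff)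
      then have "int l dvd y\<^sup>2 * int Q'" using lQ by simp
      then have ly: "int l dvd y" using l lQ'
        by (metis prime_dvd_mult_iff prime_dvd_power prime_nat_int_transfer int_dvd_int_iff)
      have "(int Q) dvd x" "int N dvd z" "int Q dvd w" "x * w - y * z = int Q"
        using M(1) by (auto simp: xyzw al_set_def)
      then obtain x1 w1 z1 where "x = int Q * x1" "w = int Q * w1" "z = int N * z1" by (auto elim!: dvdE)
      moreover obtain N1 where "int N = int Q * N1" using ex(1) by (metis exact_divisor_def dvd_def of_nat_mult)
      ultimately have "int Q * (int Q * x1 * w1 - y * N1 * z1) = int Q * 1"
        using \<open>x * w - y * z = int Q\<close> by (simp add: algebra_simps)
      then have "int Q * x1 * w1 - y * N1 * z1 = 1" using Qp by simp
      moreover have "int l dvd int Q * x1 * w1 - y * N1 * z1" using lQ ly by simp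
      ultimately have "int l dvd 1" by simp
      then show False using l by (simp add: prime_nat_iff)
    qed
    then show ?thesis by (simp add: dec)
  qed
  show QQ: "Q = Q'" using dvd[OF ex(1,2) M eq] dvd[OF ex(2,1) M(2,1) eq[symmetric]] by (rule dvd_antisym)
  have "Q > 0" using ex by (auto simp: exact_divisor_def intro: Nat.gr0I)
  then show "M = M'"
    using arg_cong[OF eq, of "\<lambda>A. A $ 1 $ 1"] arg_cong[OF eq, of "\<lambda>A. A $ 1 $ 2"]
      arg_cong[OF eq, of "\<lambda>A. A $ 2 $ 1"] arg_cong[OF eq, of "\<lambda>A. A $ 2 $ 2"]
    by (cases M; cases M') (auto simp: to_mat_def QQ)
qed


section \<open>Cosets of \<open>Gamma_inf\<close> and systems of representatives\<close>

text \<open>Left multiplication by an element of \<open>Gamma_inf\<close>: a sign e and a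
  translation by t.\<close>

definition mequiv :: "imat \<Rightarrow> imat \<Rightarrow> bool" where
  "mequiv = (\<lambda>(a, b, c, d) (a', b', c', d'). \<exists>e t. (e = 1 \<or> e = - 1) \<and>
     a' = e * (a + t * c) \<and> b' = e * (b + t * d) \<and> c' = e * c \<and> d' = e * d)"

lemma mequivI:
  assumes "e = 1 \<or> e = - 1" "a' = e * (a + t * c)" "b' = e * (b + t * d)" "c' = e * c" "d' = e * d"
  shows "mequiv (a, b, c, d) (a', b', c', d')"
  using assms unfolding mequiv_def by blast

lemma mequivE:
  assumes "mequiv (a, b, c, d) (a', b', c', d')"
  obtains e t where "e = 1 \<or> e = - 1" "a' = e * (a + t * c)" "b' = e * (b + t * d)" "c' = e * c" "d' = e * d"
  using assms unfolding mequiv_def by blast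

lemma mequiv_refl: "mequiv M M"
  by (cases M) (auto intro: mequivI[of 1 _ _ 0])

lemma mequiv_sym:
  assumes "mequiv M M'" shows "mequiv M' M"
proof -
  obtain a b c d a' b' c' d' where M: "M = (a, b, c, d)" "M' = (a', b', c', d')" by (metis prod.exhaust)
  from assms obtain e t where e: "e = 1 \<or> e = - 1" and
    eq: "a' = e * (a + t * c)" "b' = e * (b + t * d)" "c' = e * c" "d' = e * d"
    unfolding M by (rule mequivE)
  show ?thesis unfolding M
    by (rule mequivI[of e _ _ "- t"]) (use e eq in \<open>auto simp: algebra_simps\<close>)
qed

lemma mequiv_trans:
  assumes "mequiv M M'" "mequiv M' M''" shows "mequiv M M''"
proof -
  obtain a b c d a' b' c' d' a'' b'' c'' d'' where
    M: "M = (a, b, c, d)" "M' = (a', b', c', d')" "M'' = (a'', b'', c'', d'')" by (metis prod.exhaust)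
  from assms(1) obtain e t where e: "e = 1 \<or> e = - 1" and
    eq: "a' = e * (a + t * c)" "b' = e * (b + t * d)" "c' = e * c" "d' = e * d"
    unfolding M by (rule mequivE)
  from assms(2) obtain f u where f: "f = 1 \<or> f = - 1" and
    eq': "a'' = f * (a' + u * c')" "b'' = f * (b' + u * d')" "c'' = f * c'" "d'' = f * d'"
    unfolding M by (rule mequivE)
  show ?thesis unfolding M
    by (rule mequivI[of "e * f" _ _ "t + u"]) (use e f eq eq' in \<open>auto simp: algebra_simps\<close>)
qed

lemma mequiv_det:
  assumes "mequiv (a, b, c, d) (a', b', c', d')"
  shows "a' * d' - b' * c' = a * d - b * c"
  using assms by (auto elim!: mequivE simp: algebra_simps)

lemma al_set_mequiv:
  assumes "M \<in> al_set N Q D" "mequiv M M'" "Q dvd N"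
  shows "M' \<in> al_set N Q D"
proof -
  obtain a b c d a' b' c' d' where M: "M = (a, b, c, d)" "M' = (a', b', c', d')" by (metis prod.exhaust)
  from assms(2) obtain e t where e: "e = 1 \<or> e = - 1" and
    eq: "a' = e * (a + t * c)" "b' = e * (b + t * d)" "c' = e * c" "d' = e * d"
    unfolding M by (rule mequivE)
  have "int Q dvd c" using assms(1,3) by (auto simp: M al_set_def intro: dvd_trans[of "int Q" "int N"])
  then show ?thesis
    using assms(1) e mequiv_det[OF assms(2)[unfolded M]] unfolding M eq al_set_def by auto
qed

definition is_reps :: "imat set \<Rightarrow> imat set \<Rightarrow> bool" where
  "is_reps R X \<longleftrightarrow> R \<subseteq> X \<and> (\<forall>M\<in>X. \<exists>!M'. M' \<in> R \<and> mequiv M M')"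

lemma is_repsI:
  assumes "R \<subseteq> X" "\<And>M. M \<in> X \<Longrightarrow> \<exists>M'\<in>R. mequiv M M'"
    "\<And>M M'. M \<in> R \<Longrightarrow> M' \<in> R \<Longrightarrow> mequiv M M' \<Longrightarrow> M = M'"
  shows "is_reps R X"
  unfolding is_reps_def
proof (intro conjI ballI)
  fix M assume "M \<in> X"
  then obtain M' where "M' \<in> R" "mequiv M M'" using assms(2) by blast
  then show "\<exists>!M'. M' \<in> R \<and> mequiv M M'"
    using assms(3) mequiv_sym mequiv_trans by blast
qed (rule assms(1))

lemma is_reps_unique:
  assumes "is_reps R X" "M \<in> R" "M' \<in> R" "mequiv M M'"
  shows "M = M'"
  using assms mequiv_refl unfolding is_reps_def by blast

lemma is_reps_ex:
  assumes "is_reps R X" "M \<in> X"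
  obtains M' where "M' \<in> R" "mequiv M M'"
  using assms unfolding is_reps_def by blast

text \<open>The exchange of representatives on which the Hecke relation rests. It is stated for
  \<open>has_sum\<close>, so that convergence passes from one system to the other together with the
  value.\<close>

lemma is_reps_has_sum:
  assumes R: "is_reps R X" and R': "is_reps R' X"
    and inv: "\<And>M M'. M \<in> X \<Longrightarrow> M' \<in> X \<Longrightarrow> mequiv M M' \<Longrightarrow> \<Phi> M = \<Phi> M'"
  shows "(\<Phi> has_sum S) R \<longleftrightarrow> (\<Phi> has_sum S) R'"
proof -
  define h where "h M = (THE M'. M' \<in> R' \<and> mequiv M M')" for M
  define k where "k M = (THE M'. M' \<in> R \<and> mequiv M M')" for M
  have h: "h M \<in> R'" "mequiv M (h M)" if "M \<in> X" for M
    using theI'[of "\<lambda>M'. M' \<in> R' \<and> mequiv M M'"] R' that unfolding h_def is_reps_def by blast+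
  have k: "k M \<in> R" "mequiv M (k M)" if "M \<in> X" for M
    using theI'[of "\<lambda>M'. M' \<in> R \<and> mequiv M M'"] R that unfolding k_def is_reps_def by blast+
  have sub: "R \<subseteq> X" "R' \<subseteq> X" using R R' by (auto simp: is_reps_def)
  show ?thesis
  proof (rule has_sum_reindex_bij_witness[of _ k h])
    fix M assume M: "M \<in> R"
    then have MX: "M \<in> X" using sub by blast
    then have hX: "h M \<in> X" using h sub by blast
    show "h M \<in> R'" using h MX by blast
    show "k (h M) = M"
      using is_reps_unique[OF R _ M] k[OF hX] h[OF MX] mequiv_sym mequiv_trans by meson
    show "\<Phi> (h M) = \<Phi> M" using inv[OF MX hX h(2)[OF MX]] by simp
  next
    fix M assume M: "M \<in> R'"
    then have MX: "M \<in> X" using sub by blast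
    then have kX: "k M \<in> X" using k sub by blast
    show "k M \<in> R" using k MX by blast
    show "h (k M) = M"
      using is_reps_unique[OF R' _ M] h[OF kX] k[OF MX] mequiv_sym mequiv_trans by meson
  qed simp
qed

lemma Im_mob:
  assumes "(a, b, c, d) \<in> al_set N Q D" "D > 0" "Im \<tau> > 0"
  shows "of_int c * \<tau> + of_int d \<noteq> 0" "Im (mob (a, b, c, d) \<tau>) > 0"
proof -
  have det: "a * d - b * c = D" using assms by (simp add: al_set_def)
  show nz: "of_int c * \<tau> + of_int d \<noteq> 0"
  proof
    assume *: "of_int c * \<tau> + of_int d = 0"
    then have "Im (of_int c * \<tau> + of_int d) = 0" by simp
    then have "c = 0" using assms(3) by simp
    then have "d = 0" using * by simp
    then show False using det \<open>c = 0\<close> assms(2) by simp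
  qed
  have "Im (mob (a, b, c, d) \<tau>) = of_int D * Im \<tau> / (norm (of_int c * \<tau> + of_int d))\<^sup>2"
  proof -
    have D: "real_of_int D = of_int a * of_int d - of_int b * of_int c"
      unfolding det[symmetric] by simp
    show ?thesis unfolding D by (simp add: mob_def Im_divide cmod_power2 algebra_simps)
  qed
  then show "Im (mob (a, b, c, d) \<tau>) > 0"
    using nz assms by simp
qed

lemma niebur_seed_mequiv:
  assumes "M \<in> al_set N Q D" "D > 0" "Im \<tau> > 0" "mequiv M M'"
  shows "niebur_seed n s (mob M \<tau>) = niebur_seed n s (mob M' \<tau>)"
proof -
  obtain a b c d a' b' c' d' where M: "M = (a, b, c, d)" "M' = (a', b', c', d')" by (metis prod.exhaust)
  from assms(4) obtain e t where e: "e = 1 \<or> e = - 1" and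
    eq: "a' = e * (a + t * c)" "b' = e * (b + t * d)" "c' = e * c" "d' = e * d"
    unfolding M by (rule mequivE)
  have nz: "of_int c * \<tau> + of_int d \<noteq> 0" using Im_mob(1) assms unfolding M by blast
  have "mob M' \<tau> = (of_int e * (of_int (a + t * c) * \<tau> + of_int (b + t * d))) / (of_int e * (of_int c * \<tau> + of_int d))"
    by (simp add: M eq mob_def algebra_simps)
  also have "\<dots> = (of_int (a + t * c) * \<tau> + of_int (b + t * d)) / (of_int c * \<tau> + of_int d)"
    using e by (intro mult_divide_mult_cancel_left) auto
  also have "\<dots> = mob M \<tau> + of_int t"
    using nz by (simp add: M mob_def field_simps)
  finally show ?thesis by (simp add: niebur_seed_shift)
qed

lemma moebius_to_mat:
  assumes "Q > 0"
  shows "moebius (to_mat Q M) \<tau> = mob M \<tau>"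
proof -
  obtain a b c d where M: "M = (a, b, c, d)" by (metis prod.exhaust)
  let ?r = "complex_of_real (sqrt (real Q))"
  have r: "?r \<noteq> 0" using assms by simp
  have "moebius (to_mat Q M) \<tau> = ((of_int a * \<tau> + of_int b) / ?r) / ((of_int c * \<tau> + of_int d) / ?r)"
    by (simp add: moebius_def to_mat_def M add_divide_distrib)
  then show ?thesis using r by (simp add: mob_def M)
qed

lemma Gamma_inf_to_mat:
  "A \<in> (\<lambda>U. U ** to_mat Q M) ` Gamma_inf \<longleftrightarrow> (\<exists>M'. mequiv M M' \<and> A = to_mat Q M')"
proof -
  obtain a b c d where M: "M = (a, b, c, d)" by (metis prod.exhaust)
  have 1: "mat2 1 (of_int t) 0 1 ** to_mat Q M = to_mat Q (a + t * c, b + t * d, c, d)" for t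
    by (simp add: to_mat_def M mat2_mult add_divide_distrib)
  have 2: "- mat2 1 (of_int t) 0 1 ** to_mat Q M = to_mat Q (- (a + t * c), - (b + t * d), - c, - d)" for t
    unfolding uminus_mat2 by (simp add: to_mat_def M mat2_mult add_divide_distrib diff_divide_distrib)
  show ?thesis
  proof
    assume "A \<in> (\<lambda>U. U ** to_mat Q M) ` Gamma_inf"
    then obtain t :: int where "A = mat2 1 (of_int t) 0 1 ** to_mat Q M \<or> A = - mat2 1 (of_int t) 0 1 ** to_mat Q M"
      by (auto simp: Gamma_inf_def)
    then show "\<exists>M'. mequiv M M' \<and> A = to_mat Q M'"
    proof
      assume "A = mat2 1 (of_int t) 0 1 ** to_mat Q M"
      then show ?thesis unfolding 1
        by (intro exI[of _ "(a + t * c, b + t * d, c, d)"]) (auto simp: M intro: mequivI[of 1 _ _ t])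
    next
      assume "A = - mat2 1 (of_int t) 0 1 ** to_mat Q M"
      then show ?thesis unfolding 2
        by (intro exI[of _ "(- (a + t * c), - (b + t * d), - c, - d)"]) (auto simp: M intro: mequivI[of "-1" _ _ t])
    qed
  next
    assume "\<exists>M'. mequiv M M' \<and> A = to_mat Q M'"
    then obtain a' b' c' d' where M': "mequiv M (a', b', c', d')" "A = to_mat Q (a', b', c', d')" by auto
    from M'(1) obtain e t where e: "e = 1 \<or> e = - 1" and
      eq: "a' = e * (a + t * c)" "b' = e * (b + t * d)" "c' = e * c" "d' = e * d"
      unfolding M by (rule mequivE)
    from e show "A \<in> (\<lambda>U. U ** to_mat Q M) ` Gamma_inf"
    proof
      assume "e = 1"
      then have "A = mat2 1 (of_int t) 0 1 ** to_mat Q M" unfolding 1 M'(2) eq by simp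
      then show ?thesis by (auto simp: Gamma_inf_def)
    next
      assume "e = - 1"
      then have "A = - mat2 1 (of_int t) 0 1 ** to_mat Q M" unfolding 2 M'(2) eq by (simp add: algebra_simps)
      then show ?thesis by (auto simp: Gamma_inf_def)
    qed
  qed
qed

text \<open>Pairs of an index Q and a representative correspond bijectively to the cosets in the
  definition. The representative picked there by SOME differs from the chosen one by an element of
  \<open>Gamma_inf\<close>, under which the seed is invariant.\<close>

lemma niebur_G_eq:
  assumes good: "good_level (N, S)" and tau: "Im \<tau> > 0"
    and R: "\<And>Q. Q \<in> insert 1 S \<Longrightarrow> is_reps (R Q) (al_set N Q (int Q))"
    and sums: "\<And>Q. Q \<in> insert 1 S \<Longrightarrow> ((\<lambda>M. niebur_seed n s (mob M \<tau>)) has_sum g Q) (R Q)"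
  shows "niebur_G (N, S) n \<tau> s = 2 * of_real pi * (\<Sum>Q\<in>insert 1 S. g Q)"
proof -
  let ?G = "level_group (N, S)"
  let ?cosets = "rcosets\<^bsub>SL2R\<lparr>carrier := ?G\<rparr>\<^esub> Gamma_inf"
  define co where "co = (\<lambda>(Q, M). (\<lambda>U. U ** to_mat Q M) ` Gamma_inf)"
  have co_mem: "A \<in> co (Q, M) \<longleftrightarrow> (\<exists>M'. mequiv M M' \<and> A = to_mat Q M')" for A Q M
    by (simp add: co_def Gamma_inf_to_mat)
  have co_eq: "co (Q, M) = co (Q, M')" if "mequiv M M'" for Q M M'
    using that mequiv_sym mequiv_trans unfolding set_eq_iff co_mem by blast
  have cosets: "?cosets = {(\<lambda>U. U ** A) ` Gamma_inf | A. A \<in> ?G}"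
    by (auto simp: RCOSETS_def r_coset_def mult_SL2R SL2R_def)
  have RX: "M \<in> al_set N Q (int Q)" if "Q \<in> insert 1 S" "M \<in> R Q" for Q M
    using R[OF that(1)] that(2) by (auto simp: is_reps_def)
  let ?I = "Sigma (insert 1 S) R"
  have bij: "bij_betw co ?I ?cosets"
    unfolding bij_betw_def
  proof
    show "inj_on co ?I"
    proof (rule inj_onI)
      fix z z' assume z: "z \<in> ?I" "z' \<in> ?I" "co z = co z'"
      obtain Q M Q' M' where zz: "z = (Q, M)" "z' = (Q', M')" by (metis prod.exhaust)
      have Q: "Q \<in> insert 1 S" "M \<in> R Q" "Q' \<in> insert 1 S" "M' \<in> R Q'" using z by (auto simp: zz)
      have "to_mat Q' M' \<in> co (Q, M)" using z(3) unfolding zz co_mem[symmetric] by (metis co_mem mequiv_refl)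
      then obtain M1 where M1: "mequiv M M1" "to_mat Q' M' = to_mat Q M1" unfolding co_mem by blast
      have "M1 \<in> al_set N Q (int Q)"
        using al_set_mequiv[OF RX[OF Q(1,2)] M1(1)] good_levelD(4)[OF good Q(1)] by blast
      from to_mat_inj_exact[OF good_levelD(2)[OF good Q(1)] good_levelD(2)[OF good Q(3)]
          good_levelD(1)[OF good Q(1)] this RX[OF Q(3,4)] M1(2)[symmetric]]
      have "Q = Q'" "M1 = M'" by auto
      then have "M = M'" using is_reps_unique[OF R[OF Q(1)] Q(2)] Q(4) M1(1) by blast
      then show "z = z'" using \<open>Q = Q'\<close> by (simp add: zz)
    qed
    show "co ` ?I = ?cosets"
    proof (intro equalityI subsetI)
      fix C assume "C \<in> co ` ?I"
      then obtain z where "z \<in> ?I" "C = co z" by blast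
      then obtain Q M where Q: "Q \<in> insert 1 S" "M \<in> R Q" "C = co (Q, M)" by (cases z) blast
      then have "to_mat Q M \<in> ?G" using RX unfolding level_group_eq[OF good] by blast
      then show "C \<in> ?cosets" unfolding cosets Q(3) co_def by auto
    next
      fix C assume "C \<in> ?cosets"
      then obtain A where A: "A \<in> ?G" "C = (\<lambda>U. U ** A) ` Gamma_inf" unfolding cosets by blast
      then obtain Q M where Q: "Q \<in> insert 1 S" "M \<in> al_set N Q (int Q)" "A = to_mat Q M"
        unfolding level_group_eq[OF good] by blast
      obtain M' where M': "M' \<in> R Q" "mequiv M M'" using is_reps_ex[OF R[OF Q(1)] Q(2)] .
      have "C = co (Q, M')" using co_eq[OF M'(2), of Q] by (simp add: A(2) Q(3) co_def)
      then show "C \<in> co ` ?I" using Q(1) M'(1) by blast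
    qed
  qed
  have val: "niebur_seed n s (moebius (SOME \<gamma>. \<gamma> \<in> co z) \<tau>) = niebur_seed n s (mob (snd z) \<tau>)" if z: "z \<in> ?I" for z
  proof -
    obtain Q M where zz: "z = (Q, M)" by (metis prod.exhaust)
    have Q: "Q \<in> insert 1 S" "M \<in> R Q" using z by (auto simp: zz)
    have "to_mat Q M \<in> co z" unfolding zz co_mem using mequiv_refl by blast
    then have "(SOME \<gamma>. \<gamma> \<in> co z) \<in> co z" by (rule someI)
    then obtain M' where M': "mequiv M M'" "(SOME \<gamma>. \<gamma> \<in> co z) = to_mat Q M'"
      unfolding zz co_mem by blast
    have "Q > 0" using good_levelD(3)[OF good Q(1)] .
    then show ?thesis
      unfolding M'(2) moebius_to_mat[OF \<open>Q > 0\<close>] using niebur_seed_mequiv[OF RX[OF Q] _ tau M'(1)] by (simp add: zz)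
  qed
  have "((\<lambda>z. niebur_seed n s (mob (snd z) \<tau>)) has_sum (\<Sum>Q\<in>insert 1 S. g Q)) (\<Union>Q\<in>insert 1 S. Pair Q ` R Q)"
  proof (rule sum_has_sum)
    show "finite (insert 1 S)" using good_level_finite[OF good] by simp
    show "((\<lambda>z. niebur_seed n s (mob (snd z) \<tau>)) has_sum g Q) (Pair Q ` R Q)" if "Q \<in> insert 1 S" for Q
      using sums[OF that] by (subst has_sum_reindex) (auto simp: o_def inj_on_def)
  qed auto
  also have "(\<Union>Q\<in>insert 1 S. Pair Q ` R Q) = ?I" by auto
  finally have "((\<lambda>z. niebur_seed n s (moebius (SOME \<gamma>. \<gamma> \<in> co z) \<tau>)) has_sum (\<Sum>Q\<in>insert 1 S. g Q)) ?I"
    by (subst has_sum_cong[OF val])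
  then have "((\<lambda>C. niebur_seed n s (moebius (SOME \<gamma>. \<gamma> \<in> C) \<tau>)) has_sum (\<Sum>Q\<in>insert 1 S. g Q)) ?cosets"
    by (subst (asm) has_sum_reindex_bij_betw[OF bij])
  then show ?thesis unfolding niebur_G_def by (simp add: infsumI)
qed

section \<open>Analytic continuation of the Niebur series\<close>

text \<open>
  A coset is determined by its bottom row \<open>Q (C, d + k C)\<close>, where \<open>0 \<le> d < C\<close>; the sum over \<open>k\<close>
  is \<open>kernel_sum\<close>, the sum over \<open>d\<close> a smoothly weighted Kloosterman sum.
\<close>

definition rep_col :: "nat \<Rightarrow> nat \<Rightarrow> int \<Rightarrow> int" where
  "rep_col Q C d = modular_inverse (int C) (int Q) * modular_inverse (int C) d"

text \<open>\<open>rep_col\<close> inverts Q d modulo C, so the upper right entry forced by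
  determinant Q is an integer and the division is exact.\<close>

definition rep_mat :: "nat \<Rightarrow> nat \<times> int \<times> int \<Rightarrow> imat" where
  "rep_mat Q = (\<lambda>(C, d, k). (int Q * rep_col Q C d,
     (int Q * (d + k * int C) * rep_col Q C d - 1) div int C, int Q * int C, int Q * (d + k * int C)))"

text \<open>The values C = c / Q for lower left entries c > 0 divisible by N. Coprimality with Q is
  forced by the determinant, which after division by Q reads Q x w - b C = 1.\<close>

definition denominators :: "nat \<Rightarrow> nat \<Rightarrow> nat set" where
  "denominators N Q = {C. C > 0 \<and> N div Q dvd C \<and> coprime C Q}"

definition rep_index :: "nat \<Rightarrow> nat \<Rightarrow> (nat \<times> int \<times> int) set" where
  "rep_index N Q = Sigma (denominators N Q) (\<lambda>C. units_mod C \<times> UNIV)"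

text \<open>A vanishing lower left entry is possible for Q = 1 only and gives the coset of the
  identity.\<close>

definition std_reps :: "nat \<Rightarrow> nat \<Rightarrow> imat set" where
  "std_reps N Q = rep_mat Q ` rep_index N Q \<union> (if Q = 1 then {(1, 0, 0, 1)} else {})"

section \<open>Explicit representatives and the seed on them\<close>

lemma rep_col_cong:
  assumes "C > 0" "coprime C Q" "d \<in> units_mod C"
  shows "[int Q * (d + k * int C) * rep_col Q C d = 1] (mod int C)"
proof -
  have "[int Q * modular_inverse (int C) (int Q) = 1] (mod int C)"
    using assms by (intro cong_modular_inverse1) (simp add: coprime_commute)
  moreover have "[(d + k * int C) * modular_inverse (int C) d = d * modular_inverse (int C) d] (mod int C)"
    by (intro cong_mult cong_refl) (simp add: cong_def)
  moreover have "[d * modular_inverse (int C) d = 1] (mod int C)"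
    by (rule inv_units(2)[OF assms(1,3)])
  ultimately have "[(int Q * modular_inverse (int C) (int Q)) * ((d + k * int C) * modular_inverse (int C) d) = 1 * 1] (mod int C)"
    by (intro cong_mult) (auto intro: cong_trans)
  then show ?thesis by (simp add: rep_col_def mult_ac)
qed

lemma rep_mat_det:
  assumes "C > 0" "coprime C Q" "d \<in> units_mod C"
  shows "(int Q * (d + k * int C) * rep_col Q C d - 1) div int C * int C = int Q * (d + k * int C) * rep_col Q C d - 1"
  using rep_col_cong[OF assms, of k] by (simp add: cong_iff_dvd_diff)

lemma rep_mat_in:
  assumes "z \<in> rep_index N Q" "Q dvd N"
  shows "rep_mat Q z \<in> al_set N Q (int Q)"
proof -
  obtain C d k where z: "z = (C, d, k)" by (metis prod.exhaust)
  have C: "C > 0" "N div Q dvd C" "coprime C Q" "d \<in> units_mod C"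
    using assms by (auto simp: z rep_index_def denominators_def)
  have "int N = int Q * int (N div Q)" using assms(2) by (metis dvd_mult_div_cancel of_nat_mult)
  moreover have "int (N div Q) dvd int C" using C by simp
  ultimately have "int N dvd int Q * int C" by simp
  moreover have "int Q * rep_col Q C d * (int Q * (d + k * int C)) -
     (int Q * (d + k * int C) * rep_col Q C d - 1) div int C * (int Q * int C) = int Q"
  proof -
    let ?b = "(int Q * (d + k * int C) * rep_col Q C d - 1) div int C"
    have "int Q * rep_col Q C d * (int Q * (d + k * int C)) - ?b * (int Q * int C) =
        int Q * (int Q * (d + k * int C) * rep_col Q C d - ?b * int C)"
      by (simp add: algebra_simps)
    then show ?thesis unfolding rep_mat_det[OF C(1,3,4)] by simp
  qed
  ultimately show ?thesis by (simp add: z rep_mat_def al_set_def)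
qed

lemma rep_mat_bottom_inj:
  assumes Q: "Q > 0" and z: "z \<in> rep_index N Q" "z' \<in> rep_index N Q"
    and eq: "rep_mat Q z = (a, b, c, d)" "rep_mat Q z' = (a', b', c, d)"
  shows "z = z'"
proof -
  obtain C d1 k C' d2 k' where zz: "z = (C, d1, k)" "z' = (C', d2, k')" by (metis prod.exhaust)
  have C: "C > 0" "d1 \<in> units_mod C" "d2 \<in> units_mod C'" using z by (auto simp: zz rep_index_def denominators_def)
  have "int Q * int C = int Q * int C'" "int Q * (d1 + k * int C) = int Q * (d2 + k' * int C')"
    using eq by (auto simp: zz rep_mat_def)
  then have CC: "C = C'" and w: "d1 + k * int C = d2 + k' * int C'" using Q by auto
  have "(d1 + k * int C) mod int C = d1" "(d2 + k' * int C') mod int C' = d2"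
    using C(2,3) by (simp_all add: units_mod_def)
  then have "d1 = d2" using w CC by metis
  then show ?thesis using w CC C by (simp add: zz)
qed

lemma inj_rep_mat:
  assumes "Q > 0" shows "inj_on (rep_mat Q) (rep_index N Q)"
  using rep_mat_bottom_inj[OF assms] by (intro inj_onI) (metis prod.exhaust)

text \<open>Change the sign to get c > 0 and divide d / Q by C with remainder. The upper left entry
  divided by Q and \<open>rep_col\<close> are both inverse to the same unit modulo C; they differ by
  a multiple t C, which is a translation from the left.\<close>

lemma std_reps_is_reps:
  assumes ex: "exact_divisor Q N" and N: "N > 0"
  shows "is_reps (std_reps N Q) (al_set N Q (int Q))"
proof (rule is_repsI)
  have Q: "Q > 0" "Q dvd N" using assms by (auto simp: exact_divisor_def intro: Nat.gr0I)
  have NQ: "int N = int Q * int (N div Q)" using Q by (metis dvd_mult_div_cancel of_nat_mult)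
  show "std_reps N Q \<subseteq> al_set N Q (int Q)"
  proof -
    have "(1, 0, 0, 1) \<in> al_set N 1 (int 1)" by (simp add: al_set_def)
    moreover have "rep_mat Q ` rep_index N Q \<subseteq> al_set N Q (int Q)"
      using rep_mat_in[OF _ Q(2)] by blast
    ultimately show ?thesis by (auto simp: std_reps_def)
  qed
  show "\<exists>M'\<in>std_reps N Q. mequiv M M'" if M: "M \<in> al_set N Q (int Q)" for M
  proof -
    obtain a b c d where abcd: "M = (a, b, c, d)" by (metis prod.exhaust)
    have dv: "int Q dvd a" "int N dvd c" "int Q dvd d" and det: "a * d - b * c = int Q"
      using M by (auto simp: abcd al_set_def)
    show ?thesis
    proof (cases "c = 0")
      case True
      then have ad: "a * d = int Q" using det by simp
      \<comment> \<open>Both diagonal entries are multiples of Q while their product is Q.\<close>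
      have "int Q * int Q dvd int Q" using mult_dvd_mono[OF dv(1,3)] ad by simp
      then have Q1: "Q = 1" using Q by (metis of_nat_mult of_nat_dvd_iff dvd_mult_cancel1 nat_dvd_1_iff_1)
      then have "a * d = 1" using ad by simp
      then have ad1: "(a = 1 \<and> d = 1) \<or> (a = - 1 \<and> d = - 1)" by (metis zmult_eq_1_iff)
      have "mequiv M (1, 0, 0, 1)"
        unfolding abcd by (rule mequivI[of d _ _ "- b * d"]) (use ad1 True in auto)
      then show ?thesis using Q1 by (auto simp: std_reps_def)
    next
      case False
      define e where "e = sgn c"
      have e: "e = 1 \<or> e = - 1" "e * c > 0" "e * e = 1" using False by (auto simp: e_def sgn_if)
      obtain x0 where x0: "e * a = int Q * x0" using dv(1) by (metis dvd_def dvd_mult)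
      obtain w0 where w0: "e * d = int Q * w0" using dv(3) by (metis dvd_def dvd_mult)
      obtain z0 where z0: "e * c = int N * z0" using dv(2) by (metis dvd_def dvd_mult)
      have "z0 > 0" using e(2) z0 N by (simp add: zero_less_mult_iff)
      define C where "C = N div Q * nat z0"
      have Cz: "int C = int (N div Q) * z0" using \<open>z0 > 0\<close> by (simp add: C_def)
      have "N div Q > 0" using Q N by (simp add: dvd_imp_le div_greater_zero_iff)
      then have C0: "C > 0" using \<open>z0 > 0\<close> by (simp add: C_def)
      have c: "e * c = int Q * int C" unfolding z0 NQ Cz by simp
      have "int Q * (int Q * x0 * w0 - e * b * int C) = (e * a) * (e * d) - (e * b) * (e * c)"
        unfolding x0 w0 c by (simp add: algebra_simps)
      also have "\<dots> = (e * e) * (a * d - b * c)" by (simp add: algebra_simps)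
      also have "\<dots> = int Q" using e det by simp
      finally have u: "int Q * x0 * w0 - e * b * int C = 1" using Q by simp
      have copQ: "coprime (int Q) (int C)" and copw: "coprime w0 (int C)"
      proof -
        have "int Q * (x0 * w0) + int C * (- (e * b)) = 1" "w0 * (int Q * x0) + int C * (- (e * b)) = 1"
          using u by (simp_all add: algebra_simps)
        then show "coprime (int Q) (int C)" "coprime w0 (int C)"
          by (metis coprime_iff_gcd_eq_1 dvd_add dvd_mult2 gcd_dvd1 gcd_dvd2 gcd_unique is_unit_gcd)+
      qed
      define d0 where "d0 = w0 mod int C"
      define k where "k = w0 div int C"
      have w0dk: "w0 = d0 + k * int C" by (simp add: d0_def k_def)
      have d0: "d0 \<in> units_mod C" using C0 copw by (simp add: units_mod_def d0_def)
      have idx: "(C, d0, k) \<in> rep_index N Q"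
      proof -
        have "coprime C Q" using copQ by (simp add: coprime_commute)
        moreover have "N div Q dvd C" by (simp add: C_def)
        ultimately show ?thesis using C0 d0 by (simp add: rep_index_def denominators_def)
      qed
      define X where "X = rep_col Q C d0"
      have cX: "[int Q * w0 * X = 1] (mod int C)"
        using rep_col_cong[OF C0 _ d0, of Q k] copQ by (simp add: X_def w0dk coprime_commute)
      have "[int Q * w0 * x0 = 1] (mod int C)"
        using u by (simp add: cong_iff_dvd_diff) (metis add_diff_cancel_left' diff_add_cancel dvd_triv_right mult.commute mult.left_commute)
      then have "[int Q * w0 * x0 = int Q * w0 * X] (mod int C)" using cX by (meson cong_sym cong_trans)
      moreover have "coprime (int Q * w0) (int C)" using copQ copw by simp
      ultimately have "[x0 = X] (mod int C)" by (simp add: cong_mult_lcancel)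
      then obtain t where t: "X = x0 + t * int C" by (metis cong_iff_lin mult.commute)
      define b' where "b' = (int Q * w0 * X - 1) div int C"
      have b'C: "b' * int C = int Q * w0 * X - 1"
        using cX by (simp add: b'_def cong_iff_dvd_diff)
      have rep: "rep_mat Q (C, d0, k) = (int Q * X, b', int Q * int C, int Q * w0)"
        by (simp add: rep_mat_def X_def b'_def w0dk)
      have "mequiv (a, b, c, d) (int Q * X, b', int Q * int C, int Q * w0)"
      proof (rule mequivI[OF e(1), of _ _ t])
        show "int Q * X = e * (a + t * c)"
          unfolding distrib_left mult.left_commute[of e t] x0 c t by (simp add: algebra_simps)
        have "int C * b' = int Q * w0 * (x0 + t * int C) - 1" using b'C by (simp add: t mult.commute)
        also have "\<dots> = int C * (e * b + t * (int Q * w0))" using u by (simp add: algebra_simps)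
        finally have "b' = e * b + t * (int Q * w0)" using C0 by simp
        then show "b' = e * (b + t * d)" unfolding w0[symmetric] by (simp add: algebra_simps)
      qed (simp_all add: c w0)
      then have "mequiv M (rep_mat Q (C, d0, k))" by (simp only: rep abcd)
      moreover have "rep_mat Q (C, d0, k) \<in> std_reps N Q" using idx by (simp add: std_reps_def)
      ultimately show ?thesis by blast
    qed
  qed
  show "M = M'" if M: "M \<in> std_reps N Q" "M' \<in> std_reps N Q" "mequiv M M'" for M M'
  proof -
    obtain a b c d a' b' c' d' where MM: "M = (a, b, c, d)" "M' = (a', b', c', d')" by (metis prod.exhaust)
    have cases: "(\<exists>z\<in>rep_index N Q. M = rep_mat Q z \<and> fst (snd (snd M)) > 0) \<or> M = (1, 0, 0, 1)"
      if "M \<in> std_reps N Q" for M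
      using that Q by (auto simp: std_reps_def rep_mat_def rep_index_def denominators_def split: if_splits)
    from M(3) obtain e t where e: "e = 1 \<or> e = - 1" and
      eq: "a' = e * (a + t * c)" "b' = e * (b + t * d)" "c' = e * c" "d' = e * d"
      unfolding MM by (rule mequivE)
    from cases[OF M(1)] cases[OF M(2)] show ?thesis
    proof (elim disjE bexE conjE)
      fix z z' assume z: "z \<in> rep_index N Q" "M = rep_mat Q z" "fst (snd (snd M)) > 0"
        and z': "z' \<in> rep_index N Q" "M' = rep_mat Q z'" "fst (snd (snd M')) > 0"
      have "e = 1" using e z(3) z'(3) eq by (auto simp: MM)
      then have "z = z'" using rep_mat_bottom_inj[OF Q(1) z(1) z'(1), of a b c d a' b'] z z' eq by (simp add: MM)
      then show ?thesis using z z' by simp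
    next
      assume "0 < fst (snd (snd M))" "M' = (1, 0, 0, 1)"
      then show ?thesis using e eq by (auto simp: MM)
    next
      assume "0 < fst (snd (snd M'))" "M = (1, 0, 0, 1)"
      then show ?thesis using e eq by (auto simp: MM)
    qed simp
  qed
qed


text \<open>The identity (a z + b) / (c z + d) = a / c - det / (c (c z + d)) with c = Q C brings the
  argument into the form treated by \<open>niebur_seed_kernel\<close>, with l = 1 / (Q C^2) and u =
  d / C + k.\<close>

lemma rep_mat_seed:
  assumes n: "n > 0" and tau: "Im \<tau> > 0" and s: "Re s > 1/2" and Q: "Q > 0"
    and z: "(C, d, k) \<in> rep_index N Q"
  shows "niebur_seed n s (mob (rep_mat Q (C, d, k)) \<tau>) = niebur_prefactor s *
    (twist n Q C d * seed_kernel \<tau> s (real n / (real Q * (real C)\<^sup>2)) (of_int d / real C + of_int k))"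
proof -
  have C: "C > 0" "coprime C Q" "d \<in> units_mod C" using z by (auto simp: rep_index_def denominators_def)
  define X where "X = rep_col Q C d"
  define w where "w = d + k * int C"
  define b where "b = (int Q * w * X - 1) div int C"
  have bC: "b * int C = int Q * w * X - 1"
    using rep_mat_det[OF C, of k] by (simp add: b_def w_def X_def)
  have bC': "(of_int b * of_nat C :: complex) = of_nat Q * of_int w * of_int X - 1"
    using arg_cong[OF bC, of "of_int :: int \<Rightarrow> complex"] by simp
  define l where "l = 1 / (real Q * (real C)\<^sup>2)"
  define u where "u = of_int d / real C + of_int k"
  have l: "l > 0" using Q C by (simp add: l_def)
  have CQ: "(of_nat C :: complex) \<noteq> 0" "(of_nat Q :: complex) \<noteq> 0" using C Q by simp_all
  have uw: "complex_of_real u = of_int w / of_nat C" using CQ by (simp add: u_def w_def field_simps)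
  have nz: "\<tau> + of_real u \<noteq> 0"
    using tau by (auto simp: complex_eq_iff)
  have "\<tau> + of_int w / of_nat C \<noteq> 0" using nz uw by simp
  then have nz': "of_nat C * \<tau> + of_int w \<noteq> 0" using CQ by (auto simp: field_simps add_eq_0_iff)
  have "mob (rep_mat Q (C, d, k)) \<tau> = (of_nat Q * of_int X * \<tau> + of_int b) / (of_nat Q * (of_nat C * \<tau> + of_int w))"
    by (simp add: mob_def rep_mat_def X_def w_def b_def algebra_simps)
  also have "\<dots> = of_real (of_int X / real C) - of_real l / (\<tau> + of_real u)"
  proof -
    have "of_real l / (\<tau> + of_real u) = 1 / (of_nat Q * of_nat C * (of_nat C * \<tau> + of_int w))"
      using CQ nz' by (simp add: l_def uw field_simps power2_eq_square)
    moreover have "(of_nat Q * of_int X * \<tau> + of_int b) / (of_nat Q * (of_nat C * \<tau> + of_int w)) =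
        of_int X / of_nat C - 1 / (of_nat Q * of_nat C * (of_nat C * \<tau> + of_int w))"
    proof -
      have "of_nat C * (of_nat Q * of_int X * \<tau> + of_int b) =
          of_int X * (of_nat Q * (of_nat C * \<tau> + of_int w)) - (1 :: complex)"
        using bC' by (simp add: algebra_simps)
      then have "(of_nat Q * of_int X * \<tau> + of_int b) =
          (of_int X * (of_nat Q * (of_nat C * \<tau> + of_int w)) - 1) / of_nat C"
        using CQ by (simp add: field_simps)
      then show ?thesis using CQ nz' by (simp add: diff_divide_distrib divide_divide_eq_left mult_ac)
    qed
    ultimately show ?thesis by simp
  qed
  finally have mob: "mob (rep_mat Q (C, d, k)) \<tau> = of_real (of_int X / real C) - of_real l / (\<tau> + of_real u)" .
  have "e_cis (of_real (- real n * (of_int X / real C))) = twist n Q C d"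
  proof -
    have "twist n Q C d = exp (\<i> * of_real (2 * pi * of_int (int n * - modular_inverse (int C) (int Q) * modular_inverse (int C) d) / real C))"
      by (simp add: twist_def addchar_def cis_conv_exp)
    also have "int n * - modular_inverse (int C) (int Q) * modular_inverse (int C) d = - int n * X"
      by (simp add: X_def rep_col_def)
    finally show ?thesis by (simp add: e_cis_def mult_ac)
  qed
  moreover have "real n * l = real n / (real Q * (real C)\<^sup>2)" by (simp add: l_def)
  ultimately show ?thesis
    unfolding mob niebur_seed_kernel[OF n tau s l] by (simp add: u_def)
qed

section \<open>Continuation of the contribution of each Q\<close>

text \<open>The contribution of the coset of Q, written with blocks instead of single cosets, so
  that it stays meaningful for Re s > 15/16.\<close>

definition level_sum :: "nat \<Rightarrow> complex \<Rightarrow> nat \<Rightarrow> nat \<Rightarrow> complex \<Rightarrow> complex" where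
  "level_sum n \<tau> N Q s = niebur_prefactor s * (\<Sum>\<^sub>\<infinity>C\<in>denominators N Q. block n \<tau> Q C s) +
     (if Q = 1 then niebur_seed n s \<tau> else 0)"

lemma std_reps_has_sum:
  assumes n: "n > 0" and tau: "Im \<tau> > 0" and s: "Re s > 1" and Q: "Q > 0"
  shows "((\<lambda>M. niebur_seed n s (mob M \<tau>)) has_sum level_sum n \<tau> N Q s) (std_reps N Q)"
proof -
  interpret niebur_point \<tau> n by unfold_locales fact+
  have "((\<lambda>(C, d, k). twist n Q C d *
      seed_kernel \<tau> s (real n / (real Q * (real C)\<^sup>2)) (of_int d / real C + of_int k)) has_sum
     (\<Sum>\<^sub>\<infinity>C\<in>denominators N Q. block n \<tau> Q C s)) (rep_index N Q)"
    unfolding rep_index_def by (intro has_sum_block Q s) (auto simp: denominators_def)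
  from has_sum_cmult_right[OF this, of "niebur_prefactor s"]
  have "((\<lambda>z. niebur_seed n s (mob (rep_mat Q z) \<tau>)) has_sum
      niebur_prefactor s * (\<Sum>\<^sub>\<infinity>C\<in>denominators N Q. block n \<tau> Q C s)) (rep_index N Q)"
    by (rule has_sum_cong[THEN iffD1, rotated])
       (use s in \<open>auto simp: rep_mat_seed[OF n tau _ Q]\<close>)
  then have 1: "((\<lambda>M. niebur_seed n s (mob M \<tau>)) has_sum
      niebur_prefactor s * (\<Sum>\<^sub>\<infinity>C\<in>denominators N Q. block n \<tau> Q C s)) (rep_mat Q ` rep_index N Q)"
    by (subst has_sum_reindex[OF inj_rep_mat[OF Q]]) (simp add: o_def)
  have 2: "((\<lambda>M. niebur_seed n s (mob M \<tau>)) has_sum (if Q = 1 then niebur_seed n s \<tau> else 0))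
      (if Q = 1 then {(1, 0, 0, 1)} else {})"
    by (auto simp: has_sum_finite_iff mob_def)
  show ?thesis
    unfolding level_sum_def std_reps_def
    by (rule has_sum_Un_disjoint[OF 1 2])
       (use Q in \<open>auto simp: rep_mat_def rep_index_def denominators_def split: if_splits\<close>)
qed

lemma holomorphic_level_sum:
  assumes n: "n > 0" and tau: "Im \<tau> > 0" and Q: "Q > 0"
  shows "level_sum n \<tau> N Q holomorphic_on {s. Re s > 15/16}"
proof -
  interpret niebur_point \<tau> n by unfold_locales fact+
  have "(\<lambda>s. niebur_seed n s \<tau>) holomorphic_on {s. Re s > 15/16}"
    by (rule holomorphic_on_subset[OF holomorphic_niebur_seed[OF n tau]]) auto
  moreover have "(\<lambda>s. \<Sum>\<^sub>\<infinity>C\<in>denominators N Q. block n \<tau> Q C s) holomorphic_on {s. Re s > 15/16}"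
    by (intro holomorphic_block_sum Q) (auto simp: denominators_def)
  ultimately show ?thesis
    unfolding level_sum_def[abs_def]
    by (cases "Q = 1") (auto intro!: holomorphic_intros holomorphic_niebur_prefactor)
qed

lemma niebur_G_level_sum:
  assumes "good_level (N, S)" "n > 0" "Im \<tau> > 0" "Re s > 1"
  shows "niebur_G (N, S) n \<tau> s = 2 * of_real pi * (\<Sum>Q\<in>insert 1 S. level_sum n \<tau> N Q s)"
  using assms good_levelD[OF assms(1)]
  by (intro niebur_G_eq[where R = "std_reps N"] std_reps_is_reps std_reps_has_sum) auto

lemma niebur_j_continuation:
  assumes good: "good_level L" and n: "n > 0" and tau: "Im \<tau> > 0"
  shows "\<exists>F. F holomorphic_on {s. Re s > 15/16} \<and> (\<forall>s. Re s > 1 \<longrightarrow> F s = niebur_G L n \<tau> s) \<and>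
    F 1 = niebur_j L n \<tau>"
proof -
  obtain N S where L: "L = (N, S)" by (metis prod.exhaust)
  define F where "F s = 2 * of_real pi * (\<Sum>Q\<in>insert 1 S. level_sum n \<tau> N Q s)" for s
  have hol: "F holomorphic_on {s. Re s > 15/16}"
    unfolding F_def[abs_def] using good_levelD(3)[OF good[unfolded L]]
    by (intro holomorphic_intros holomorphic_level_sum n tau) auto
  have F: "F s = niebur_G L n \<tau> s" if "Re s > 1" for s
    unfolding F_def L using niebur_G_level_sum[OF good[unfolded L] n tau that] by simp
  define P where "P F \<longleftrightarrow> (\<exists>\<sigma><1. F holomorphic_on {s. Re s > \<sigma>} \<and>
      (\<forall>s. Re s > 1 \<longrightarrow> F s = niebur_G L n \<tau> s))" for F
  have "P F" unfolding P_def using hol F by (intro exI[of _ "15/16"]) auto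
  then have "P (SOME F. P F)" by (rule someI[of P])
  then obtain \<sigma> where sigma: "\<sigma> < 1" "(SOME F. P F) holomorphic_on {s. Re s > \<sigma>}"
    "\<And>s. Re s > 1 \<Longrightarrow> (SOME F. P F) s = niebur_G L n \<tau> s" unfolding P_def by blast
  \<comment> \<open>The half-plane of the function picked by SOME is unknown; the two continuations
    are compared on the intersection of both half-planes, which still contains 1.\<close>
  let ?H = "{s. Re s > max \<sigma> (15/16)}"
  have "(SOME F. P F) 1 = F 1"
  proof (rule analytic_continuation_open[where f = "SOME F. P F" and g = F and z = 1 and s = "{s. Re s > 1}" and s' = ?H])
    show "{s. Re s > 1} \<noteq> {}" by (auto intro: exI[of _ 2])
    show "open ?H" by (rule open_halfspace_Re_gt)
    show "connected ?H" by (intro convex_connected convex_halfspace_Re_gt)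
    show "(SOME F. P F) holomorphic_on ?H" by (rule holomorphic_on_subset[OF sigma(2)]) auto
    show "F holomorphic_on ?H" by (rule holomorphic_on_subset[OF hol]) auto
  qed (use sigma F in \<open>auto simp: open_halfspace_Re_gt\<close>)
  moreover have "(SOME F. P F) 1 = niebur_j L n \<tau>"
    unfolding niebur_j_def P_def ..
  ultimately show ?thesis using hol F by (intro exI[of _ F]) auto
qed

section \<open>The Hecke relation for a prime\<close>

text \<open>The four maps multiply by matrices of determinant p: \<open>right_shift\<close> and
  \<open>left_shift\<close> by (1, \<beta>; 0, p), \<open>right_scale\<close> and
  \<open>left_scale\<close> by (p, 0; 0, 1), on the side in the name.\<close>

definition right_shift :: "nat \<Rightarrow> int \<Rightarrow> imat \<Rightarrow> imat" where
  "right_shift p \<beta> = (\<lambda>(a, b, c, d). (a, a * \<beta> + int p * b, c, c * \<beta> + int p * d))"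

definition right_scale :: "nat \<Rightarrow> imat \<Rightarrow> imat" where
  "right_scale p = (\<lambda>(a, b, c, d). (int p * a, b, int p * c, d))"

definition left_scale :: "nat \<Rightarrow> imat \<Rightarrow> imat" where
  "left_scale p = (\<lambda>(a, b, c, d). (int p * a, int p * b, c, d))"

definition left_shift :: "nat \<Rightarrow> int \<Rightarrow> imat \<Rightarrow> imat" where
  "left_shift p \<beta> = (\<lambda>(a, b, c, d). (a + \<beta> * c, b + \<beta> * d, int p * c, int p * d))"

lemma mob_right_shift:
  assumes "p > 0"
  shows "mob (right_shift p \<beta> M) \<tau> = mob M ((\<tau> + of_int \<beta>) / of_nat p)"
proof -
  obtain a b c d where M: "M = (a, b, c, d)" by (metis prod.exhaust)
  have p: "(of_nat p :: complex) \<noteq> 0" using assms by simp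
  have n: "of_nat p * (x * ((\<tau> + of_int \<beta>) / of_nat p) + y) = x * \<tau> + (x * of_int \<beta> + of_nat p * y)" for x y
    using p by (simp add: field_simps)
  have "mob M ((\<tau> + of_int \<beta>) / of_nat p) =
      (of_nat p * (of_int a * ((\<tau> + of_int \<beta>) / of_nat p) + of_int b)) /
      (of_nat p * (of_int c * ((\<tau> + of_int \<beta>) / of_nat p) + of_int d))"
    unfolding mult_divide_mult_cancel_left[OF p] by (simp only: M mob_def prod.case)
  also have "\<dots> = mob (right_shift p \<beta> M) \<tau>"
    unfolding n by (simp add: M mob_def right_shift_def)
  finally show ?thesis ..
qed

lemma mob_right_scale: "mob (right_scale p M) \<tau> = mob M (of_nat p * \<tau>)"
  by (cases M) (simp add: mob_def right_scale_def mult_ac)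

lemma mob_left_scale: "mob (left_scale p M) \<tau> = of_nat p * mob M \<tau>"
  by (cases M) (simp add: mob_def left_scale_def algebra_simps add_divide_distrib)

lemma mob_left_shift:
  assumes "of_int c * \<tau> + of_int d \<noteq> 0" "p > 0"
  shows "mob (left_shift p \<beta> (a, b, c, d)) \<tau> = (mob (a, b, c, d) \<tau> + of_int \<beta>) / of_nat p"
proof -
  have "mob (left_shift p \<beta> (a, b, c, d)) \<tau> =
      ((of_int a * \<tau> + of_int b) + of_int \<beta> * (of_int c * \<tau> + of_int d)) / (of_nat p * (of_int c * \<tau> + of_int d))"
    by (simp add: mob_def left_shift_def algebra_simps)
  also have "\<dots> = (mob (a, b, c, d) \<tau> + of_int \<beta>) / of_nat p"
    using assms by (simp add: mob_def field_simps)
  finally show ?thesis .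
qed

lemma solve_mod_prime:
  fixes u v :: int
  assumes "prime p" "\<not> int p dvd u"
  obtains x where "x \<in> {0..<int p}" "int p dvd v - u * x"
proof -
  have p: "p > 0" using assms by (simp add: prime_gt_0_nat)
  have "coprime u (int p)"
    using assms by (metis coprime_commute prime_imp_coprime prime_nat_int_transfer)
  then obtain x where x: "[u * x = 1] (mod int p)" using cong_solve_coprime_int by blast
  have "[u * (x * v mod int p) = u * (x * v)] (mod int p)"
    by (intro cong_mult cong_refl) (simp add: cong_def)
  moreover have "[(u * x) * v = 1 * v] (mod int p)" by (intro cong_mult x cong_refl)
  ultimately have "[v = u * (x * v mod int p)] (mod int p)"
    by (metis cong_sym cong_trans mult.assoc mult_1)
  then show thesis
    using p by (intro that[of "x * v mod int p"]) (auto simp: cong_iff_dvd_diff)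
qed

lemma residue_unique:
  assumes "\<beta> \<in> {0..<int p}" "\<beta>' \<in> {0..<int p}" "int p dvd \<beta> - \<beta>'"
  shows "\<beta> = \<beta>'"
  using assms by (metis atLeastLessThan_iff cong_iff_dvd_diff cong_less_imp_eq_int)

lemma mequiv_right_shift:
  assumes "p > 0"
  shows "mequiv (right_shift p \<beta> M) (right_shift p \<beta> M') \<longleftrightarrow> mequiv M M'"
proof -
  obtain a b c d a' b' c' d' where M: "M = (a, b, c, d)" "M' = (a', b', c', d')" by (metis prod.exhaust)
  show ?thesis
  proof
    assume "mequiv (right_shift p \<beta> M) (right_shift p \<beta> M')"
    then obtain e t where e: "e = 1 \<or> e = - 1" and eq: "a' = e * (a + t * c)"
      "a' * \<beta> + int p * b' = e * ((a * \<beta> + int p * b) + t * (c * \<beta> + int p * d))" "c' = e * c"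
      "c' * \<beta> + int p * d' = e * (c * \<beta> + int p * d)"
      unfolding M right_shift_def prod.case by (rule mequivE)
    have "int p * b' = int p * (e * (b + t * d))" using eq by (simp add: algebra_simps)
    moreover have "int p * d' = int p * (e * d)" using eq by (simp add: algebra_simps)
    ultimately have "b' = e * (b + t * d)" "d' = e * d" using assms by simp_all
    with eq show "mequiv M M'" unfolding M by - (rule mequivI[OF e], assumption+)
  next
    assume "mequiv M M'"
    then obtain e t where e: "e = 1 \<or> e = - 1" and
      eq: "a' = e * (a + t * c)" "b' = e * (b + t * d)" "c' = e * c" "d' = e * d"
      unfolding M by (rule mequivE)
    show "mequiv (right_shift p \<beta> M) (right_shift p \<beta> M')"
      unfolding M right_shift_def prod.case
      by (rule mequivI[of e _ _ t]) (use e eq in \<open>auto simp: algebra_simps\<close>)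
  qed
qed

lemma mequiv_right_scale:
  assumes "p > 0"
  shows "mequiv (right_scale p M) (right_scale p M') \<longleftrightarrow> mequiv M M'"
proof -
  obtain a b c d a' b' c' d' where M: "M = (a, b, c, d)" "M' = (a', b', c', d')" by (metis prod.exhaust)
  show ?thesis
  proof
    assume "mequiv (right_scale p M) (right_scale p M')"
    then obtain e t where e: "e = 1 \<or> e = - 1" and eq: "int p * a' = e * (int p * a + t * (int p * c))"
      "b' = e * (b + t * d)" "int p * c' = e * (int p * c)" "d' = e * d"
      unfolding M right_scale_def prod.case by (rule mequivE)
    have "int p * a' = int p * (e * (a + t * c))" "int p * c' = int p * (e * c)"
      using eq by (simp_all add: algebra_simps)
    then have "a' = e * (a + t * c)" "c' = e * c" using assms by simp_all
    with eq show "mequiv M M'" unfolding M by - (rule mequivI[OF e], assumption+)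
  next
    assume "mequiv M M'"
    then obtain e t where e: "e = 1 \<or> e = - 1" and
      eq: "a' = e * (a + t * c)" "b' = e * (b + t * d)" "c' = e * c" "d' = e * d"
      unfolding M by (rule mequivE)
    show "mequiv (right_scale p M) (right_scale p M')"
      unfolding M right_scale_def prod.case
      by (rule mequivI[of e _ _ t]) (use e eq in \<open>auto simp: algebra_simps\<close>)
  qed
qed

lemma mequiv_left_scaleI:
  assumes "mequiv M M'"
  shows "mequiv (left_scale p M) (left_scale p M')"
proof -
  obtain a b c d a' b' c' d' where M: "M = (a, b, c, d)" "M' = (a', b', c', d')" by (metis prod.exhaust)
  obtain e t where e: "e = 1 \<or> e = - 1" and
    eq: "a' = e * (a + t * c)" "b' = e * (b + t * d)" "c' = e * c" "d' = e * d"
    using assms unfolding M by (rule mequivE)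
  show ?thesis
    unfolding M left_scale_def prod.case
    by (rule mequivI[of e _ _ "int p * t"]) (use e eq in \<open>auto simp: algebra_simps\<close>)
qed

text \<open>The maps \<open>f i\<close> are right multiplications, which commute with the left action of \<open>\<Gamma>\<^sub>\<infinity>\<close>.\<close>

lemma is_reps_right:
  assumes I: "\<And>i. i \<in> I \<Longrightarrow> is_reps (R' i) (Y' i)"
    and eqv: "\<And>i M M'. i \<in> I \<Longrightarrow> mequiv (f i M) (f i M') \<longleftrightarrow> mequiv M M'"
    and sub: "\<And>i M. i \<in> I \<Longrightarrow> M \<in> Y' i \<Longrightarrow> f i M \<in> X"
    and ex: "\<And>M. M \<in> X \<Longrightarrow> \<exists>i\<in>I. \<exists>M0\<in>Y' i. M = f i M0"
    and disj: "\<And>i j M M'. i \<in> I \<Longrightarrow> j \<in> I \<Longrightarrow> M \<in> Y' i \<Longrightarrow> M' \<in> Y' j \<Longrightarrow> mequiv (f i M) (f j M') \<Longrightarrow> i = j"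
  shows "is_reps (\<Union>i\<in>I. f i ` R' i) X"
proof (rule is_repsI)
  have RY: "M \<in> Y' i" if "i \<in> I" "M \<in> R' i" for i M using I[OF that(1)] that(2) by (auto simp: is_reps_def)
  show "(\<Union>i\<in>I. f i ` R' i) \<subseteq> X" using RY sub by blast
  show "\<exists>M'\<in>\<Union>i\<in>I. f i ` R' i. mequiv M M'" if "M \<in> X" for M
  proof -
    obtain i M0 where i: "i \<in> I" "M0 \<in> Y' i" "M = f i M0" using ex[OF \<open>M \<in> X\<close>] by blast
    obtain M1 where "M1 \<in> R' i" "mequiv M0 M1" using is_reps_ex[OF I[OF i(1)] i(2)] .
    then show ?thesis using eqv[OF i(1)] i by blast
  qed
  show "M = M'" if "M \<in> (\<Union>i\<in>I. f i ` R' i)" "M' \<in> (\<Union>i\<in>I. f i ` R' i)" "mequiv M M'" for M M'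
  proof -
    from that obtain i j M1 M2 where i: "i \<in> I" "M1 \<in> R' i" "M = f i M1" "j \<in> I" "M2 \<in> R' j" "M' = f j M2"
      by blast
    have "i = j" using disj[OF i(1,4) RY[OF i(1,2)] RY[OF i(4,5)]] that(3) i by blast
    then show ?thesis
      using is_reps_unique[OF I[OF i(1)] i(2), of M2] eqv[OF i(1)] that(3) i by blast
  qed
qed

text \<open>Conjugation by (p, 0; 0, 1) turns a translation by t into one by p t. Classes are
  therefore preserved, but separated only where p is known to divide the translation; this is the
  assumption \<open>cancel\<close>.\<close>

lemma is_reps_left_scale:
  assumes R: "is_reps R Y"
    and sub: "\<And>M. M \<in> Y \<Longrightarrow> left_scale p M \<in> X"
    and ex: "\<And>M. M \<in> X \<Longrightarrow> \<exists>M0\<in>Y. mequiv M (left_scale p M0)"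
    and cancel: "\<And>M M'. M \<in> Y \<Longrightarrow> M' \<in> Y \<Longrightarrow> mequiv (left_scale p M) (left_scale p M') \<Longrightarrow> mequiv M M'"
  shows "is_reps (left_scale p ` R) X"
proof (rule is_repsI)
  have RY: "M \<in> Y" if "M \<in> R" for M using R that by (auto simp: is_reps_def)
  show "left_scale p ` R \<subseteq> X" using RY sub by blast
  show "\<exists>M'\<in>left_scale p ` R. mequiv M M'" if "M \<in> X" for M
  proof -
    obtain M0 where i: "M0 \<in> Y" "mequiv M (left_scale p M0)" using ex[OF \<open>M \<in> X\<close>] by blast
    obtain M1 where "M1 \<in> R" "mequiv M0 M1" using is_reps_ex[OF R i(1)] .
    then show ?thesis using mequiv_left_scaleI[of M0 M1 p] mequiv_trans[OF i(2)] by blast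
  qed
  show "M = M'" if M: "M \<in> left_scale p ` R" "M' \<in> left_scale p ` R" "mequiv M M'" for M M'
    using M cancel RY is_reps_unique[OF R] by blast
qed

text \<open>Assumption \<open>t\<close> collects everything known about the translation. For p not
  dividing Q its divisibility follows from the bottom row, for p dividing Q from the upper left
  entries.\<close>

lemma left_scale_cancel:
  assumes p: "p > 0" and t: "\<And>t. int p dvd t * c \<Longrightarrow> int p dvd t * d \<Longrightarrow> (\<exists>e. (e = 1 \<or> e = -1) \<and> int p * a' = e * (int p * a + t * c)) \<Longrightarrow> int p dvd t"
    and eqv: "mequiv (left_scale p (a, b, c, d)) (left_scale p (a', b', c', d'))"
  shows "mequiv (a, b, c, d) (a', b', c', d')"
proof -
  from eqv obtain e t where e: "e = 1 \<or> e = - 1" and eq: "int p * a' = e * (int p * a + t * c)"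
    "int p * b' = e * (int p * b + t * d)" "c' = e * c" "d' = e * d"
    unfolding left_scale_def prod.case by (rule mequivE)
  have "t * c = int p * (e * a' - a)" "t * d = int p * (e * b' - b)"
    using e eq(1,2) by (auto simp: algebra_simps)
  then have "int p dvd t * c" "int p dvd t * d" by simp_all
  then have "int p dvd t" using t e eq(1) by blast
  then obtain u where u: "t = int p * u" by blast
  have "int p * a' = int p * (e * (a + u * c))" "int p * b' = int p * (e * (b + u * d))"
    using eq u by (simp_all add: algebra_simps)
  then have "a' = e * (a + u * c)" "b' = e * (b + u * d)" using p by simp_all
  with eq show ?thesis by - (rule mequivI[OF e], assumption+)
qed

lemma is_reps_Un:
  assumes "is_reps R X" "is_reps R' X'" "\<And>M M'. M \<in> X \<Longrightarrow> M' \<in> X' \<Longrightarrow> \<not> mequiv M M'"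
  shows "is_reps (R \<union> R') (X \<union> X')"
proof (rule is_repsI)
  show "R \<union> R' \<subseteq> X \<union> X'" using assms by (auto simp: is_reps_def)
  show "\<exists>M'\<in>R \<union> R'. mequiv M M'" if "M \<in> X \<union> X'" for M
    using that assms(1,2) unfolding is_reps_def by blast
  have sub: "R \<subseteq> X" "R' \<subseteq> X'" using assms by (auto simp: is_reps_def)
  show "M = M'" if M: "M \<in> R \<union> R'" "M' \<in> R \<union> R'" and eqv: "mequiv M M'" for M M'
  proof -
    have "\<not> (M \<in> R \<and> M' \<in> R')" using assms(3) sub eqv by blast
    moreover have "\<not> (M \<in> R' \<and> M' \<in> R)" using assms(3)[of M' M] sub mequiv_sym[OF eqv] by blast
    ultimately have "(M \<in> R \<and> M' \<in> R) \<or> (M \<in> R' \<and> M' \<in> R')" using M by blast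
    then show ?thesis
      using is_reps_unique[OF assms(1) _ _ eqv] is_reps_unique[OF assms(2) _ _ eqv] by blast
  qed
qed


lemma al_set_right_shift:
  assumes "M \<in> al_set N Q D" "Q dvd N"
  shows "right_shift p \<beta> M \<in> al_set N Q (int p * D)"
proof -
  obtain a b c d where M: "M = (a, b, c, d)" by (metis prod.exhaust)
  have "int Q dvd c" using assms by (auto simp: M al_set_def intro: dvd_trans[of "int Q" "int N"])
  moreover have D: "D = a * d - b * c" using assms by (simp add: M al_set_def)
  have "a * (c * \<beta> + int p * d) - (a * \<beta> + int p * b) * c = int p * D"
    unfolding D by (simp add: algebra_simps)
  ultimately show ?thesis using assms(1) by (auto simp: M al_set_def right_shift_def)
qed

lemma al_set_left_scale:
  assumes "M \<in> al_set N Q D"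
  shows "left_scale p M \<in> al_set N Q (int p * D)"
proof -
  obtain a b c d where M: "M = (a, b, c, d)" by (metis prod.exhaust)
  have D: "D = a * d - b * c" using assms by (simp add: M al_set_def)
  have "int p * a * d - int p * b * c = int p * D"
    unfolding D by (simp add: algebra_simps)
  then show ?thesis using assms by (auto simp: M al_set_def left_scale_def)
qed

lemma right_shift_residue_unique:
  assumes p: "prime p" and M: "M \<in> al_set N Q (int Q)" "M' \<in> al_set N Q (int Q)"
    and Q: "\<not> int p dvd int Q"
    and b: "\<beta> \<in> {0..<int p}" "\<beta>' \<in> {0..<int p}"
    and eqv: "mequiv (right_shift p \<beta> M) (right_shift p \<beta>' M')"
  shows "\<beta> = \<beta>'"
proof -
  obtain a b c d a' b' c' d' where MM: "M = (a, b, c, d)" "M' = (a', b', c', d')" by (metis prod.exhaust)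
  have pp: "prime (int p)" using p by simp
  from eqv obtain e t where e: "e = 1 \<or> e = - 1" and eq: "a' = e * (a + t * c)"
      "a' * \<beta>' + int p * b' = e * ((a * \<beta> + int p * b) + t * (c * \<beta> + int p * d))" "c' = e * c"
      "c' * \<beta>' + int p * d' = e * (c * \<beta> + int p * d)"
    unfolding MM right_shift_def prod.case by (rule mequivE)
  have "a' * (\<beta> - \<beta>') = int p * (b' - e * (b + t * d))" using eq by (simp add: algebra_simps)
  then have 1: "int p dvd a' * (\<beta> - \<beta>')" by simp
  have "c' * (\<beta> - \<beta>') = int p * (d' - e * d)" using eq by (simp add: algebra_simps)
  then have 2: "int p dvd c' * (\<beta> - \<beta>')" by simp
  have "\<not> (int p dvd a' \<and> int p dvd c')"
  proof
    assume "int p dvd a' \<and> int p dvd c'"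
    then have "int p dvd a' * d' - b' * c'" by simp
    then show False using M Q by (auto simp: MM al_set_def)
  qed
  then have "int p dvd \<beta> - \<beta>'" using 1 2 pp by (auto simp: prime_dvd_mult_iff)
  then show ?thesis by (rule residue_unique[OF b])
qed

section \<open>The two decompositions of the matrices of determinant p Q\<close>

definition reduced_level :: "nat \<Rightarrow> nat \<Rightarrow> nat" where
  "reduced_level p N = N div gcd p N"

context
  fixes p N Q :: nat
  assumes p: "prime p" and N: "N > 0" and QN: "Q dvd N" and pQ: "\<not> p dvd Q"
begin

text \<open>This equivalence is why the p-plicate enters: dividing a column or row by p relaxes the
  condition N | c to the one of the reduced level.\<close>

lemma dvd_reduced_level: "int N dvd int p * c \<longleftrightarrow> int (reduced_level p N) dvd c" "reduced_level p N dvd N" "Q dvd reduced_level p N"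
proof -
  have g: "gcd p N > 0" "gcd p N dvd N" "gcd p N dvd p" using N by auto
  have NN: "N = gcd p N * reduced_level p N" by (simp add: reduced_level_def)
  then show "reduced_level p N dvd N" by (metis dvd_triv_right)
  define p1 where "p1 = p div gcd p N"
  have pp: "p = gcd p N * p1" by (simp add: p1_def)
  have cop: "coprime p1 (reduced_level p N)" unfolding p1_def reduced_level_def using N by (intro div_gcd_coprime) auto
  show "int N dvd int p * c \<longleftrightarrow> int (reduced_level p N) dvd c"
  proof -
    have "int N dvd int p * c \<longleftrightarrow> int (gcd p N) * int (reduced_level p N) dvd int (gcd p N) * (int p1 * c)"
      using NN pp by (metis mult.assoc of_nat_mult)
    also have "\<dots> \<longleftrightarrow> int (reduced_level p N) dvd int p1 * c"
      unfolding dvd_mult_cancel_left using N by simp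
    also have "\<dots> \<longleftrightarrow> int (reduced_level p N) dvd c" using cop by (simp add: coprime_dvd_mult_right_iff coprime_commute)
    finally show ?thesis .
  qed
  have "coprime Q (gcd p N)"
    using p pQ by (metis coprime_commute coprime_divisors dvd_refl g(3) prime_imp_coprime)
  then show "Q dvd reduced_level p N" using QN NN by (metis coprime_dvd_mult_right_iff)
qed

private lemma dvd_mult_prime_iff: "int Q dvd int p * x \<longleftrightarrow> int Q dvd x"
proof -
  have "coprime (int Q) (int p)" using p pQ by (metis coprime_commute coprime_int_iff prime_imp_coprime)
  then show ?thesis by (simp add: coprime_dvd_mult_right_iff)
qed

private lemma prime_int_p: "prime (int p)"
  using p by simp

private lemma prime_pos: "int p > 0" "p > 0"
  using p by (simp_all add: prime_gt_0_nat)

text \<open>Split by the first column. If p divides it, dividing it out leaves determinant Q at the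
  reduced level. Otherwise exactly one multiple \<beta> of the first column makes the second
  divisible by p.\<close>

lemma hecke_reps_right:
  assumes R: "is_reps R (al_set N Q (int Q))" and R': "is_reps R' (al_set (reduced_level p N) Q (int Q))"
  shows "is_reps ((\<Union>\<beta>\<in>{0..<int p}. right_shift p \<beta> ` R) \<union> right_scale p ` R') (al_set N Q (int p * int Q))"
    and "(\<Union>\<beta>\<in>{0..<int p}. right_shift p \<beta> ` R) \<inter> right_scale p ` R' = {}"
proof -
  define Z where "Z = {M \<in> al_set N Q (int p * int Q). int p dvd fst M \<and> int p dvd fst (snd (snd M))}"
  define Y where "Y = al_set N Q (int p * int Q) - Z"
  have notp: "\<not> (int p dvd a \<and> int p dvd c)" if "(a, b, c, d) \<in> al_set N Q (int Q)" for a b c d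
  proof
    assume "int p dvd a \<and> int p dvd c"
    then have "int p dvd a * d - b * c" by simp
    then show False using that pQ by (simp add: al_set_def)
  qed
  have Y: "is_reps (\<Union>\<beta>\<in>{0..<int p}. right_shift p \<beta> ` R) Y"
  proof (rule is_reps_right[where Y' = "\<lambda>_. al_set N Q (int Q)"])
    show "right_shift p \<beta> M \<in> Y" if "M \<in> al_set N Q (int Q)" for \<beta> M
    proof -
      obtain a b c d where M: "M = (a, b, c, d)" by (metis prod.exhaust)
      show ?thesis using al_set_right_shift[OF that QN, of p \<beta>] notp[of a b c d] that
        by (auto simp: Y_def Z_def M right_shift_def)
    qed
    show "\<exists>\<beta>\<in>{0..<int p}. \<exists>M0\<in>al_set N Q (int Q). M = right_shift p \<beta> M0" if "M \<in> Y" for M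
    proof -
      obtain a b c d where M: "M = (a, b, c, d)" by (metis prod.exhaust)
      have al: "int Q dvd a" "int N dvd c" "int Q dvd d" "a * d - b * c = int p * int Q"
        and nd: "\<not> int p dvd a \<or> \<not> int p dvd c"
        using that by (auto simp: Y_def Z_def M al_set_def)
      \<comment> \<open>Solve the congruence whose coefficient is prime to p; the determinant,
        divisible by p, then yields the other one.\<close>
      have "\<exists>\<beta>\<in>{0..<int p}. int p dvd b - a * \<beta> \<and> int p dvd d - c * \<beta>"
      proof (cases "int p dvd a")
        case False
        obtain \<beta> where b: "\<beta> \<in> {0..<int p}" "int p dvd b - a * \<beta>"
          using solve_mod_prime[OF p False] by blast
        have "a * (d - c * \<beta>) = int p * int Q + c * (b - a * \<beta>)" using al by (simp add: algebra_simps)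
        then have "int p dvd a * (d - c * \<beta>)" using b by simp
        then show ?thesis using b False prime_int_p by (auto simp: prime_dvd_mult_iff)
      next
        case True
        then have c: "\<not> int p dvd c" using nd by blast
        obtain \<beta> where b: "\<beta> \<in> {0..<int p}" "int p dvd d - c * \<beta>"
          using solve_mod_prime[OF p c] by blast
        have "c * (b - a * \<beta>) = a * (d - c * \<beta>) - int p * int Q" using al by (simp add: algebra_simps)
        then have "int p dvd c * (b - a * \<beta>)" using b by simp
        then show ?thesis using b c prime_int_p by (auto simp: prime_dvd_mult_iff)
      qed
      then obtain \<beta> b0 d0 where b: "\<beta> \<in> {0..<int p}" "b - a * \<beta> = int p * b0" "d - c * \<beta> = int p * d0" by (auto elim!: dvdE)
      have "int Q dvd c" using al QN by (meson dvd_trans of_nat_dvd_iff)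
      then have "int Q dvd int p * d0" unfolding b(3)[symmetric] using al by simp
      then have "int Q dvd d0" by (simp add: dvd_mult_prime_iff)
      moreover have "a * d0 - b0 * c = int Q"
      proof -
        have "int p * (a * d0 - b0 * c) = a * (int p * d0) - (int p * b0) * c" by (simp add: algebra_simps)
        also have "\<dots> = int p * int Q" unfolding b(2,3)[symmetric] using al by (simp add: algebra_simps)
        finally show ?thesis using prime_pos by simp
      qed
      ultimately have "(a, b0, c, d0) \<in> al_set N Q (int Q)" using al by (simp add: al_set_def)
      moreover have "M = right_shift p \<beta> (a, b0, c, d0)"
        using b by (simp add: M right_shift_def algebra_simps)
      ultimately show ?thesis using b(1) by blast
    qed
    show "\<beta> = \<beta>'" if "\<beta> \<in> {0..<int p}" "\<beta>' \<in> {0..<int p}" "M \<in> al_set N Q (int Q)" "M' \<in> al_set N Q (int Q)"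
      "mequiv (right_shift p \<beta> M) (right_shift p \<beta>' M')" for \<beta> \<beta>' M M'
      using right_shift_residue_unique[OF p that(3,4) _ that(1,2,5)] pQ by simp
  qed (use R mequiv_right_shift[OF prime_pos(2)] in auto)
  have Z: "is_reps (\<Union>i\<in>{()}. right_scale p ` R') Z"
  proof (rule is_reps_right[where Y' = "\<lambda>_. al_set (reduced_level p N) Q (int Q)" and f = "\<lambda>_. right_scale p"])
    show "right_scale p M \<in> Z" if "M \<in> al_set (reduced_level p N) Q (int Q)" for M
    proof -
      obtain a b c d where M: "M = (a, b, c, d)" by (metis prod.exhaust)
      have D: "int Q = a * d - b * c" using that by (simp add: M al_set_def)
      have "int p * a * d - b * (int p * c) = int p * int Q" unfolding D by (simp add: algebra_simps)
      then show ?thesis using that by (auto simp: M Z_def al_set_def right_scale_def dvd_reduced_level)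
    qed
    show "\<exists>i\<in>{()}. \<exists>M0\<in>al_set (reduced_level p N) Q (int Q). M = right_scale p M0" if "M \<in> Z" for M
    proof -
      obtain a b c d where M: "M = (a, b, c, d)" by (metis prod.exhaust)
      have al: "int Q dvd a" "int N dvd c" "int Q dvd d" "a * d - b * c = int p * int Q" "int p dvd a" "int p dvd c"
        using that by (auto simp: Z_def M al_set_def)
      then obtain a0 c0 where ac: "a = int p * a0" "c = int p * c0" by (auto elim!: dvdE)
      have "int p * (a0 * d - b * c0) = int p * int Q" using al(4) by (simp add: ac algebra_simps)
      then have "a0 * d - b * c0 = int Q" using prime_pos by simp
      then have "(a0, b, c0, d) \<in> al_set (reduced_level p N) Q (int Q)" using al(1-3) by (simp add: al_set_def ac dvd_mult_prime_iff dvd_reduced_level)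
      then show ?thesis by (force simp: M ac right_scale_def)
    qed
  qed (use R' mequiv_right_scale[OF prime_pos(2)] in auto)
  have disj: "\<not> mequiv M M'" if "M \<in> Y" "M' \<in> Z" for M M'
  proof
    assume eqv: "mequiv M M'"
    obtain a b c d a' b' c' d' where MM: "M = (a, b, c, d)" "M' = (a', b', c', d')" by (metis prod.exhaust)
    from mequiv_sym[OF eqv] obtain e t where
      "a = e * (a' + t * c')" "c = e * c'" unfolding MM by (rule mequivE)
    then have "int p dvd a" "int p dvd c" using that(2) by (auto simp: Z_def MM)
    then show False using that(1) by (auto simp: Y_def Z_def MM)
  qed
  have "Y \<union> Z = al_set N Q (int p * int Q)" by (auto simp: Y_def Z_def)
  then show "is_reps ((\<Union>\<beta>\<in>{0..<int p}. right_shift p \<beta> ` R) \<union> right_scale p ` R') (al_set N Q (int p * int Q))"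
    using is_reps_Un[OF Y Z disj] by simp
  show "(\<Union>\<beta>\<in>{0..<int p}. right_shift p \<beta> ` R) \<inter> right_scale p ` R' = {}"
  proof -
    have "(\<Union>\<beta>\<in>{0..<int p}. right_shift p \<beta> ` R) \<subseteq> Y" "right_scale p ` R' \<subseteq> Z"
      using Y Z unfolding is_reps_def by simp_all
    moreover have "Y \<inter> Z = {}" by (auto simp: Y_def)
    ultimately show ?thesis by blast
  qed
qed

lemma left_shift_mequiv:
  assumes R': "is_reps R' (al_set (reduced_level p N) Q (int Q))" and M: "M \<in> R'" "M' \<in> R'"
    and b: "\<beta> \<in> {0..<int p}" "\<beta>' \<in> {0..<int p}"
    and eqv: "mequiv (left_shift p \<beta> M) (left_shift p \<beta>' M')"
  shows "M = M' \<and> \<beta> = \<beta>'"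
proof -
  obtain a b c d a' b' c' d' where MM: "M = (a, b, c, d)" "M' = (a', b', c', d')" by (metis prod.exhaust)
  from eqv obtain e t where e: "e = 1 \<or> e = - 1" and eq: "a' + \<beta>' * c' = e * (a + \<beta> * c + t * (int p * c))"
      "b' + \<beta>' * d' = e * (b + \<beta> * d + t * (int p * d))" "int p * c' = e * (int p * c)"
      "int p * d' = e * (int p * d)"
    unfolding MM left_shift_def prod.case by (rule mequivE)
  have "int p * c' = int p * (e * c)" "int p * d' = int p * (e * d)" using eq by (simp_all add: algebra_simps)
  then have cd: "c' = e * c" "d' = e * d" using prime_pos by simp_all
  have ab: "a' = e * (a + (\<beta> + t * int p - \<beta>') * c)" "b' = e * (b + (\<beta> + t * int p - \<beta>') * d)"
    using eq(1,2) unfolding cd by (simp_all add: algebra_simps)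
  have "mequiv M M'" unfolding MM using e ab cd by (rule mequivI)
  then have MM': "M = M'" using is_reps_unique[OF R' M] by blast
  have nz: "c \<noteq> 0 \<or> d \<noteq> 0"
  proof (rule ccontr)
    assume "\<not> (c \<noteq> 0 \<or> d \<noteq> 0)"
    moreover have "a * d - b * c = int Q" using R' M by (auto simp: is_reps_def MM al_set_def)
    ultimately have "int Q = 0" by simp
    then show False using QN N by simp
  qed
  have e1: "e = 1" using e cd nz MM' by (auto simp: MM)
  have "(\<beta> + t * int p - \<beta>') * c = 0" "(\<beta> + t * int p - \<beta>') * d = 0"
    using ab MM' by (auto simp: MM e1)
  then have "\<beta> + t * int p - \<beta>' = 0" using nz by (metis mult_eq_0_iff)
  then have "\<beta> - \<beta>' = int p * (- t)" by (simp add: algebra_simps)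
  then have "int p dvd \<beta> - \<beta>'" by simp
  then show ?thesis using MM' residue_unique[OF b] by blast
qed

text \<open>The mirror image, split by the bottom row. If p divides it, dividing it out leads to the
  reduced level, and translations modulo p are recorded by \<beta>. Otherwise a left translation
  makes the top row divisible by p.\<close>

lemma hecke_reps_left:
  assumes R: "is_reps R (al_set N Q (int Q))" and R': "is_reps R' (al_set (reduced_level p N) Q (int Q))"
  shows "is_reps (left_scale p ` R \<union> (\<Union>\<beta>\<in>{0..<int p}. left_shift p \<beta> ` R')) (al_set N Q (int p * int Q))"
    and "left_scale p ` R \<inter> (\<Union>\<beta>\<in>{0..<int p}. left_shift p \<beta> ` R') = {}"
proof -
  define Z where "Z = {M \<in> al_set N Q (int p * int Q). int p dvd fst (snd (snd M)) \<and> int p dvd snd (snd (snd M))}"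
  define Y where "Y = al_set N Q (int p * int Q) - Z"
  have notp: "\<not> (int p dvd c \<and> int p dvd d)" if "(a, b, c, d) \<in> al_set N Q (int Q)" for a b c d
  proof
    assume "int p dvd c \<and> int p dvd d"
    then have "int p dvd a * d - b * c" by simp
    then show False using that pQ by (simp add: al_set_def)
  qed
  have Y: "is_reps (left_scale p ` R) Y"
  proof (rule is_reps_left_scale[OF R])
    show "left_scale p M \<in> Y" if "M \<in> al_set N Q (int Q)" for M
    proof -
      obtain a b c d where M: "M = (a, b, c, d)" by (metis prod.exhaust)
      show ?thesis using al_set_left_scale[OF that, of p] notp[of a b c d] that
        by (auto simp: Y_def Z_def M left_scale_def)
    qed
    show "\<exists>M0\<in>al_set N Q (int Q). mequiv M (left_scale p M0)" if "M \<in> Y" for M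
    proof -
      obtain a b c d where M: "M = (a, b, c, d)" by (metis prod.exhaust)
      have al: "int Q dvd a" "int N dvd c" "int Q dvd d" "a * d - b * c = int p * int Q"
        and nd: "\<not> int p dvd c \<or> \<not> int p dvd d"
        using that by (auto simp: Y_def Z_def M al_set_def)
      have "\<exists>t. int p dvd a - c * t \<and> int p dvd b - d * t"
      proof (cases "int p dvd c")
        case False
        obtain t where t: "int p dvd a - c * t" using solve_mod_prime[OF p False] by blast
        have "c * (b - d * t) = d * (a - c * t) - int p * int Q" using al by (simp add: algebra_simps)
        then have "int p dvd c * (b - d * t)" using t by simp
        then show ?thesis using t False prime_int_p by (auto simp: prime_dvd_mult_iff)
      next
        case True
        then have d: "\<not> int p dvd d" using nd by blast
        obtain t where t: "int p dvd b - d * t" using solve_mod_prime[OF p d] by blast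
        have "d * (a - c * t) = int p * int Q + c * (b - d * t)" using al by (simp add: algebra_simps)
        then have "int p dvd d * (a - c * t)" using t by simp
        then show ?thesis using t d prime_int_p by (auto simp: prime_dvd_mult_iff)
      qed
      then obtain t a0 b0 where t: "a - c * t = int p * a0" "b - d * t = int p * b0" by (auto elim!: dvdE)
      have "int Q dvd c" using al QN by (meson dvd_trans of_nat_dvd_iff)
      then have "int Q dvd int p * a0" unfolding t(1)[symmetric] using al by simp
      then have "int Q dvd a0" by (simp add: dvd_mult_prime_iff)
      moreover have "a0 * d - b0 * c = int Q"
      proof -
        have "int p * (a0 * d - b0 * c) = (int p * a0) * d - (int p * b0) * c" by (simp add: algebra_simps)
        also have "\<dots> = int p * int Q" unfolding t[symmetric] using al by (simp add: algebra_simps)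
        finally show ?thesis using prime_pos by simp
      qed
      ultimately have "(a0, b0, c, d) \<in> al_set N Q (int Q)" using al by (simp add: al_set_def)
      moreover have "mequiv M (left_scale p (a0, b0, c, d))"
        unfolding M left_scale_def prod.case
        by (rule mequivI[of 1 _ _ "- t"]) (use t in \<open>auto simp: algebra_simps\<close>)
      ultimately show ?thesis by blast
    qed
    show "mequiv M M'" if M: "M \<in> al_set N Q (int Q)" and eqv: "mequiv (left_scale p M) (left_scale p M')" for M M'
    proof -
      obtain a b c d a' b' c' d' where MM: "M = (a, b, c, d)" "M' = (a', b', c', d')" by (metis prod.exhaust)
      have "int p dvd t" if "int p dvd t * c" "int p dvd t * d" for t
        using that notp[of a b c d] M prime_int_p by (auto simp: MM prime_dvd_mult_iff)
      then show ?thesis using eqv unfolding MM by (intro left_scale_cancel[OF prime_pos(2)])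
    qed
  qed
  have Z: "is_reps (\<Union>\<beta>\<in>{0..<int p}. left_shift p \<beta> ` R') Z"
  proof (rule is_repsI)
    show "(\<Union>\<beta>\<in>{0..<int p}. left_shift p \<beta> ` R') \<subseteq> Z"
    proof (rule subsetI)
      fix M assume "M \<in> (\<Union>\<beta>\<in>{0..<int p}. left_shift p \<beta> ` R')"
      then obtain \<beta> M0 where M0: "M0 \<in> R'" "M = left_shift p \<beta> M0" by blast
      obtain a b c d where abcd: "M0 = (a, b, c, d)" by (metis prod.exhaust)
      from M0(1) have al: "int Q dvd a" "int (reduced_level p N) dvd c" "int Q dvd d" "a * d - b * c = int Q"
        using R' by (auto simp: abcd is_reps_def al_set_def)
      have "int Q dvd c" using al dvd_reduced_level(3) by (meson dvd_trans of_nat_dvd_iff)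
      moreover have "(a + \<beta> * c) * (int p * d) - (b + \<beta> * d) * (int p * c) = int p * int Q"
        unfolding al(4)[symmetric] by (simp add: algebra_simps)
      ultimately show "M \<in> Z"
        unfolding M0(2) abcd using al by (auto simp: Z_def left_shift_def al_set_def dvd_reduced_level)
    qed
    show "\<exists>M'\<in>\<Union>\<beta>\<in>{0..<int p}. left_shift p \<beta> ` R'. mequiv M M'" if "M \<in> Z" for M
    proof -
      obtain a b c d where M: "M = (a, b, c, d)" by (metis prod.exhaust)
      have al: "int Q dvd a" "int N dvd c" "int Q dvd d" "a * d - b * c = int p * int Q" "int p dvd c" "int p dvd d"
        using that by (auto simp: Z_def M al_set_def)
      then obtain c0 d0 where cd: "c = int p * c0" "d = int p * d0" by (auto elim!: dvdE)
      have "int p * (a * d0 - b * c0) = int p * int Q" using al(4) by (simp add: cd algebra_simps)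
      then have "a * d0 - b * c0 = int Q" using prime_pos by simp
      then have "(a, b, c0, d0) \<in> al_set (reduced_level p N) Q (int Q)" using al(1-3) by (simp add: al_set_def cd dvd_mult_prime_iff dvd_reduced_level)
      then obtain M1 where M1: "M1 \<in> R'" "mequiv (a, b, c0, d0) M1" by (rule is_reps_ex[OF R'])
      obtain a1 b1 c1 d1 where M1': "M1 = (a1, b1, c1, d1)" by (metis prod.exhaust)
      from M1(2) obtain e t where e: "e = 1 \<or> e = - 1" and eq: "a1 = e * (a + t * c0)"
        "b1 = e * (b + t * d0)" "c1 = e * c0" "d1 = e * d0"
        unfolding M1' by (rule mequivE)
      \<comment> \<open>The translation t that leads to the chosen representative is undone modulo p
        by \<beta>; the remaining multiple of p is a translation by u after multiplication by (1,
        \<beta>; 0, p).\<close>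
      define \<beta> where "\<beta> = (- t) mod int p"
      have b: "\<beta> \<in> {0..<int p}" using prime_pos by (simp add: \<beta>_def)
      have "int p dvd t + \<beta>"
      proof -
        have "[\<beta> = - t] (mod int p)" by (simp add: \<beta>_def cong_def)
        then show ?thesis by (simp add: cong_iff_dvd_diff add.commute)
      qed
      then obtain u where u: "t + \<beta> = int p * u" by blast
      have "mequiv M (left_shift p \<beta> M1)"
        unfolding M M1' left_shift_def prod.case
      proof (rule mequivI[OF e, of _ _ u])
        have "a1 + \<beta> * c1 = e * (a + (t + \<beta>) * c0)" unfolding eq by (simp add: algebra_simps)
        then show "a1 + \<beta> * c1 = e * (a + u * c)" unfolding u cd by (simp add: mult_ac)
        have "b1 + \<beta> * d1 = e * (b + (t + \<beta>) * d0)" unfolding eq by (simp add: algebra_simps)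
        then show "b1 + \<beta> * d1 = e * (b + u * d)" unfolding u cd by (simp add: mult_ac)
      qed (simp_all add: eq cd)
      then show ?thesis using b M1(1) by blast
    qed
    show "M = M'" if "M \<in> (\<Union>\<beta>\<in>{0..<int p}. left_shift p \<beta> ` R')"
      "M' \<in> (\<Union>\<beta>\<in>{0..<int p}. left_shift p \<beta> ` R')" "mequiv M M'" for M M'
      using that left_shift_mequiv[OF R'] by blast
  qed
  have disj: "\<not> mequiv M M'" if "M \<in> Y" "M' \<in> Z" for M M'
  proof
    assume eqv: "mequiv M M'"
    obtain a b c d a' b' c' d' where MM: "M = (a, b, c, d)" "M' = (a', b', c', d')" by (metis prod.exhaust)
    from mequiv_sym[OF eqv] obtain e t where
      "c = e * c'" "d = e * d'" unfolding MM by (rule mequivE)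
    then have "int p dvd c" "int p dvd d" using that(2) by (auto simp: Z_def MM)
    then show False using that(1) by (auto simp: Y_def Z_def MM)
  qed
  have YZ: "Y \<union> Z = al_set N Q (int p * int Q)" by (auto simp: Y_def Z_def)
  show "is_reps (left_scale p ` R \<union> (\<Union>\<beta>\<in>{0..<int p}. left_shift p \<beta> ` R')) (al_set N Q (int p * int Q))"
    using is_reps_Un[OF Y Z disj] unfolding YZ .
  show "left_scale p ` R \<inter> (\<Union>\<beta>\<in>{0..<int p}. left_shift p \<beta> ` R') = {}"
  proof -
    have "left_scale p ` R \<subseteq> Y" "(\<Union>\<beta>\<in>{0..<int p}. left_shift p \<beta> ` R') \<subseteq> Z"
      using Y Z unfolding is_reps_def by simp_all
    moreover have "Y \<inter> Z = {}" by (auto simp: Y_def)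
    ultimately show ?thesis by blast
  qed
qed

end

section \<open>The Hecke relation for one index Q\<close>

text \<open>The seed depends on n and z through n z only; this turns \<open>left_scale\<close> into
  the index p n.\<close>

lemma niebur_seed_scale: "niebur_seed n s (of_nat p * z) = niebur_seed (p * n) s z"
  by (simp add: niebur_seed_def mult_ac)

text \<open>Translation affects only the character in Re z, so the average is a complete character
  sum. It produces the term with n / p and its factor p.\<close>

lemma niebur_seed_average:
  assumes p: "p > 0"
  shows "(\<Sum>\<beta>\<in>{0..<int p}. niebur_seed n s ((z + of_int \<beta>) / of_nat p)) =
    (if p dvd n then of_nat p * niebur_seed (n div p) s z else 0)"
proof -
  have "niebur_seed n s ((z + of_int \<beta>) / of_nat p) =
      addchar p (\<beta> * - int n) * (e_cis (- of_nat n * of_real (Re z) / of_nat p) *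
        of_real (sqrt (real n * (Im z / real p))) * bessel_I (s - 1/2) (2 * pi * real n * (Im z / real p)))" for \<beta>
  proof -
    have "e_cis (- of_nat n * of_real (Re ((z + of_int \<beta>) / of_nat p))) =
        addchar p (\<beta> * - int n) * e_cis (- of_nat n * of_real (Re z) / of_nat p)"
      by (simp add: addchar_def cis_conv_exp e_cis_def add_divide_distrib algebra_simps flip: exp_add)
    then show ?thesis by (simp add: niebur_seed_def)
  qed
  then have "(\<Sum>\<beta>\<in>{0..<int p}. niebur_seed n s ((z + of_int \<beta>) / of_nat p)) =
      (\<Sum>\<beta>\<in>{0..<int p}. addchar p (\<beta> * - int n)) * (e_cis (- of_nat n * of_real (Re z) / of_nat p) *
        of_real (sqrt (real n * (Im z / real p))) * bessel_I (s - 1/2) (2 * pi * real n * (Im z / real p)))"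
    by (simp only: sum_distrib_right)
  also have "(\<Sum>\<beta>\<in>{0..<int p}. addchar p (\<beta> * - int n)) = (if p dvd n then of_nat p else 0)"
    unfolding sum_int_lessThan sum_addchar[OF p] by simp
  finally show ?thesis
    using p by (auto simp: niebur_seed_def mult.assoc elim!: dvdE)
qed

lemma has_sum_right_shift:
  assumes p: "p > 0" and R: "is_reps R X"
    and "((\<lambda>M. niebur_seed n s (mob M ((\<tau> + of_int \<beta>) / of_nat p))) has_sum S) R"
  shows "((\<lambda>M. niebur_seed n s (mob M \<tau>)) has_sum S) (right_shift p \<beta> ` R)"
proof -
  have "inj_on (right_shift p \<beta>) R"
    using is_reps_unique[OF R] mequiv_right_shift[OF p] by (metis inj_onI mequiv_refl)
  then show ?thesis
    using assms(3) by (subst has_sum_reindex) (simp_all add: o_def mob_right_shift[OF p])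
qed

lemma has_sum_left_scale:
  assumes p: "p > 0" and "((\<lambda>M. niebur_seed (p * n) s (mob M \<tau>)) has_sum S) R"
  shows "((\<lambda>M. niebur_seed n s (mob M \<tau>)) has_sum S) (left_scale p ` R)"
proof -
  have "inj_on (left_scale p) R"
    using p by (auto simp: inj_on_def left_scale_def)
  then show ?thesis
    using assms(2) by (subst has_sum_reindex) (simp_all add: o_def mob_left_scale niebur_seed_scale)
qed

lemma Im_hecke_point: "Im \<tau> > 0 \<Longrightarrow> p > 0 \<Longrightarrow> Im ((\<tau> + of_int \<beta>) / of_nat p) > 0"
  by simp

lemma exact_divisor_reduced_level:
  assumes "prime p" "N > 0" "exact_divisor Q N" "\<not> p dvd Q"
  shows "exact_divisor Q (reduced_level p N)" "reduced_level p N > 0"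
proof -
  have Q: "Q dvd N" using assms by (simp add: exact_divisor_def)
  have 1: "reduced_level p N dvd N" "Q dvd reduced_level p N" using dvd_reduced_level(2,3)[OF assms(1,2) Q assms(4)] by simp_all
  then have "reduced_level p N div Q dvd N div Q" using div_dvd_div[of Q "reduced_level p N" N] Q by simp
  then show "exact_divisor Q (reduced_level p N)" using assms(3) 1(2) unfolding exact_divisor_def
    by (meson coprime_divisors dvd_refl)
  show "reduced_level p N > 0" using 1(1) assms(2) by (auto intro: dvd_pos_nat)
qed

text \<open>One sum over the matrices of determinant p Q modulo \<open>Gamma_inf\<close>:
  representatives from the right give the left-hand side, those from the left the right-hand
  side.\<close>

lemma level_sum_hecke:
  assumes p: "prime p" and N: "N > 0" and ex: "exact_divisor Q N" and pQ: "\<not> p dvd Q"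
    and n: "n > 0" and tau: "Im \<tau> > 0" and s: "Re s > 1"
  shows "(\<Sum>\<beta>\<in>{0..<int p}. level_sum n ((\<tau> + of_int \<beta>) / of_nat p) N Q s) + level_sum n (of_nat p * \<tau>) (reduced_level p N) Q s =
    level_sum (p * n) \<tau> N Q s + (if p dvd n then of_nat p * level_sum (n div p) \<tau> (reduced_level p N) Q s else 0)"
proof -
  have pp: "p > 0" using p by (simp add: prime_gt_0_nat)
  have Q: "Q dvd N" "Q > 0" using ex N by (auto simp: exact_divisor_def intro: Nat.gr0I)
  note ex1 = exact_divisor_reduced_level[OF p N ex pQ]
  define R where "R = std_reps N Q"
  define R' where "R' = std_reps (reduced_level p N) Q"
  have R: "is_reps R (al_set N Q (int Q))" unfolding R_def by (rule std_reps_is_reps[OF ex N])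
  have R': "is_reps R' (al_set (reduced_level p N) Q (int Q))" unfolding R'_def by (rule std_reps_is_reps[OF ex1])
  define \<Phi> where "\<Phi> M = niebur_seed n s (mob M \<tau>)" for M
  define X where "X = al_set N Q (int p * int Q)"
  have inv: "\<Phi> M = \<Phi> M'" if "M \<in> X" "mequiv M M'" for M M'
    unfolding \<Phi>_def using that pp Q tau by (intro niebur_seed_mequiv[of M N Q "int p * int Q"]) (auto simp: X_def)
  let ?A = "\<Union>\<beta>\<in>{0..<int p}. right_shift p \<beta> ` R"
  let ?B = "\<Union>\<beta>\<in>{0..<int p}. left_shift p \<beta> ` R'"
  define T where "T = (\<Sum>\<beta>\<in>{0..<int p}. level_sum n ((\<tau> + of_int \<beta>) / of_nat p) N Q s) + level_sum n (of_nat p * \<tau>) (reduced_level p N) Q s"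
  have "(\<Phi> has_sum (\<Sum>\<beta>\<in>{0..<int p}. level_sum n ((\<tau> + of_int \<beta>) / of_nat p) N Q s)) ?A"
  proof (rule sum_has_sum)
    show "(\<Phi> has_sum level_sum n ((\<tau> + of_int \<beta>) / of_nat p) N Q s) (right_shift p \<beta> ` R)" for \<beta>
      unfolding \<Phi>_def
      by (rule has_sum_right_shift[OF pp R])
         (unfold R_def, intro std_reps_has_sum n s Q Im_hecke_point tau pp)
    show "right_shift p \<beta> ` R \<inter> right_shift p \<beta>' ` R = {}"
      if "\<beta> \<in> {0..<int p}" "\<beta>' \<in> {0..<int p}" "\<beta> \<noteq> \<beta>'" for \<beta> \<beta>'
    proof (rule ccontr)
      assume "right_shift p \<beta> ` R \<inter> right_shift p \<beta>' ` R \<noteq> {}"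
      then obtain M M' where M: "M \<in> R" "M' \<in> R" "right_shift p \<beta> M = right_shift p \<beta>' M'" by blast
      then have "M \<in> al_set N Q (int Q)" "M' \<in> al_set N Q (int Q)" using R by (auto simp: is_reps_def)
      then show False
        using right_shift_residue_unique[OF p _ _ _ that(1,2), of M N Q M'] M(3) mequiv_refl pQ that(3) by auto
    qed
  qed simp
  moreover have "(\<Phi> has_sum level_sum n (of_nat p * \<tau>) (reduced_level p N) Q s) (right_scale p ` R')"
  proof -
    have "inj_on (right_scale p) R'" using pp by (auto simp: inj_on_def right_scale_def)
    moreover have "Im (of_nat p * \<tau>) > 0" using tau pp by simp
    then have "((\<lambda>M. niebur_seed n s (mob M (of_nat p * \<tau>))) has_sum level_sum n (of_nat p * \<tau>) (reduced_level p N) Q s) R'"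
      unfolding R'_def by (intro std_reps_has_sum n s Q)
    ultimately show ?thesis by (subst has_sum_reindex) (simp_all add: o_def \<Phi>_def mob_right_scale)
  qed
  ultimately have "(\<Phi> has_sum T) (?A \<union> right_scale p ` R')"
    unfolding T_def by (rule has_sum_Un_disjoint) (rule hecke_reps_right(2)[OF p N Q(1) pQ R R'])
  then have "(\<Phi> has_sum T) (left_scale p ` R \<union> ?B)"
    using is_reps_has_sum[OF hecke_reps_right(1)[OF p N Q(1) pQ R R'] hecke_reps_left(1)[OF p N Q(1) pQ R R'], of \<Phi> T] inv
    by (simp add: X_def)
  moreover have L: "(\<Phi> has_sum level_sum (p * n) \<tau> N Q s) (left_scale p ` R)"
    unfolding \<Phi>_def R_def using pp n by (intro has_sum_left_scale std_reps_has_sum Q s tau) auto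
  \<comment> \<open>The part from \<open>left_shift\<close> is obtained by subtraction, so its
    summability comes for free; it is grouped over \<beta> afterwards.\<close>
  ultimately have "(\<Phi> has_sum (T - level_sum (p * n) \<tau> N Q s)) ((left_scale p ` R \<union> ?B) - left_scale p ` R)"
    by (intro has_sum_Diff) auto
  also have "(left_scale p ` R \<union> ?B) - left_scale p ` R = ?B"
    using hecke_reps_left(2)[OF p N Q(1) pQ R R'] by blast
  also have "?B = (\<lambda>(M, \<beta>). left_shift p \<beta> M) ` (R' \<times> {0..<int p})"
  proof (intro equalityI subsetI)
    fix z assume "z \<in> ?B"
    then obtain \<beta> M where "\<beta> \<in> {0..<int p}" "M \<in> R'" "z = left_shift p \<beta> M" by blast
    then show "z \<in> (\<lambda>(M, \<beta>). left_shift p \<beta> M) ` (R' \<times> {0..<int p})"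
      by (intro image_eqI[of _ _ "(M, \<beta>)"]) auto
  qed auto
  finally have "(\<Phi> has_sum (T - level_sum (p * n) \<tau> N Q s)) ((\<lambda>(M, \<beta>). left_shift p \<beta> M) ` (R' \<times> {0..<int p}))" .
  moreover have "inj_on (\<lambda>(M, \<beta>). left_shift p \<beta> M) (R' \<times> {0..<int p})"
  proof (rule inj_onI)
    fix z z' assume z: "z \<in> R' \<times> {0..<int p}" "z' \<in> R' \<times> {0..<int p}"
      "(case z of (M, \<beta>) \<Rightarrow> left_shift p \<beta> M) = (case z' of (M, \<beta>) \<Rightarrow> left_shift p \<beta> M)"
    obtain M \<beta> M' \<beta>' where zz: "z = (M, \<beta>)" "z' = (M', \<beta>')" by (metis prod.exhaust)
    have "M = M' \<and> \<beta> = \<beta>'"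
      using z mequiv_refl[of "left_shift p \<beta> M"]
      by (intro left_shift_mequiv[OF p N Q(1) pQ R']) (auto simp: zz)
    then show "z = z'" by (simp add: zz)
  qed
  ultimately have "((\<lambda>z. \<Phi> (left_shift p (snd z) (fst z))) has_sum (T - level_sum (p * n) \<tau> N Q s)) (R' \<times> {0..<int p})"
    by (simp add: has_sum_reindex o_def case_prod_unfold)
  then have "((\<lambda>M. \<Sum>\<beta>\<in>{0..<int p}. \<Phi> (left_shift p \<beta> M)) has_sum (T - level_sum (p * n) \<tau> N Q s)) R'"
    by (rule has_sum_SigmaD) (simp add: has_sum_finite_iff)
  also have "?this \<longleftrightarrow> ((\<lambda>M. if p dvd n then of_nat p * niebur_seed (n div p) s (mob M \<tau>) else 0) has_sum
      (T - level_sum (p * n) \<tau> N Q s)) R'"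
  proof (rule has_sum_cong)
    fix M assume "M \<in> R'"
    then have M: "M \<in> al_set (reduced_level p N) Q (int Q)" using R' by (auto simp: is_reps_def)
    obtain a b c d where abcd: "M = (a, b, c, d)" by (metis prod.exhaust)
    have nz: "of_int c * \<tau> + of_int d \<noteq> 0" using Im_mob(1)[OF M[unfolded abcd] _ tau] Q by simp
    show "(\<Sum>\<beta>\<in>{0..<int p}. \<Phi> (left_shift p \<beta> M)) = (if p dvd n then of_nat p * niebur_seed (n div p) s (mob M \<tau>) else 0)"
      unfolding \<Phi>_def abcd mob_left_shift[OF nz pp] by (rule niebur_seed_average[OF pp])
  qed
  finally have A: "((\<lambda>M. if p dvd n then of_nat p * niebur_seed (n div p) s (mob M \<tau>) else 0) has_sum
      (T - level_sum (p * n) \<tau> N Q s)) R'" .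
  have "((\<lambda>M. if p dvd n then of_nat p * niebur_seed (n div p) s (mob M \<tau>) else 0) has_sum
      (if p dvd n then of_nat p * level_sum (n div p) \<tau> (reduced_level p N) Q s else 0)) R'"
  proof (cases "p dvd n")
    case True
    then have "n div p > 0" using n pp by (simp add: dvd_imp_le div_greater_zero_iff)
    then show ?thesis using True
      by (simp add: R'_def) (intro has_sum_cmult_right std_reps_has_sum tau s Q, simp)
  qed simp
  from has_sum_unique[OF A this] show ?thesis by (simp add: T_def algebra_simps)
qed

text \<open>For p | Q the index Q drops out of the p-plicate, and no term at the reduced level
  arises. Both constructions now yield the same subset \<open>X\<close> of the matrices of
  determinant p Q: p divides the upper right entry, because p | Q, and p N does not divide the lower
  left one.\<close>

lemma level_sum_hecke_dvd:
  assumes p: "prime p" and N: "N > 0" and ex: "exact_divisor Q N" and pQ: "p dvd Q"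
    and n: "n > 0" and tau: "Im \<tau> > 0" and s: "Re s > 1"
  shows "(\<Sum>\<beta>\<in>{0..<int p}. level_sum n ((\<tau> + of_int \<beta>) / of_nat p) N Q s) = level_sum (p * n) \<tau> N Q s"
proof -
  have pp: "p > 0" using p by (simp add: prime_gt_0_nat)
  have pi: "prime (int p)" using p by simp
  have Q: "Q dvd N" "Q > 0" using ex N by (auto simp: exact_divisor_def intro: Nat.gr0I)
  define K where "K = int (N div Q)"
  have NK: "int N = int Q * K" unfolding K_def using Q by (metis dvd_mult_div_cancel of_nat_mult)
  have K0: "K \<noteq> 0" using NK N by auto
  have "coprime Q (N div Q)" using ex by (simp add: exact_divisor_def)
  then have "\<not> p dvd N div Q" using p pQ by (meson coprime_common_divisor not_prime_unit)
  then have pK: "\<not> int p dvd K" by (simp add: K_def)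
  have pQ': "int p dvd int Q" using pQ by simp
  define R where "R = std_reps N Q"
  have R: "is_reps R (al_set N Q (int Q))" unfolding R_def by (rule std_reps_is_reps[OF ex N])
  define X where "X = {M \<in> al_set N Q (int p * int Q). int p dvd fst (snd M) \<and> \<not> int p * int N dvd fst (snd (snd M))}"
  have alE: "\<exists>x z w. M = (int Q * x, b, int Q * K * z, int Q * w)" if "M = (a, b, c, d)" "M \<in> al_set N Q D" for M a b c d D
    using that by (auto simp: al_set_def NK elim!: dvdE)
  have pNz: "int p * int N dvd int Q * K * z \<longleftrightarrow> int p dvd z" for z
    unfolding NK using K0 Q by (simp add: mult.commute[of "int p"])
  have det1: "int Q * x * w - b * (K * z) = D" if "(int Q * x, b, int Q * K * z, int Q * w) \<in> al_set N Q (D * int Q)" for x b z w D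
  proof -
    have "int Q * (int Q * x * w - b * (K * z)) = int Q * D" using that by (simp add: al_set_def algebra_simps)
    then show ?thesis using Q by simp
  qed
  \<comment> \<open>Otherwise p would divide det / Q = 1, since it divides Q as well.\<close>
  have zb: "\<not> int p dvd z" if "(int Q * x, b, int Q * K * z, int Q * w) \<in> al_set N Q (int Q)" for x b z w
  proof
    assume "int p dvd z"
    then have "int p dvd int Q * x * w - b * (K * z)" using pQ' by simp
    then have "int p dvd 1" using det1[of x b z w 1] that by simp
    then show False using p by (simp add: prime_nat_iff)
  qed
  have reps1: "is_reps (\<Union>\<beta>\<in>{0..<int p}. right_shift p \<beta> ` R) X"
  proof (rule is_reps_right[where Y' = "\<lambda>_. al_set N Q (int Q)"])
    show "right_shift p \<beta> M \<in> X" if M: "M \<in> al_set N Q (int Q)" for \<beta> M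
    proof -
      obtain x b z w where M': "M = (int Q * x, b, int Q * K * z, int Q * w)" using alE[OF _ M] by (metis prod.exhaust)
      show ?thesis using al_set_right_shift[OF M Q(1), of p \<beta>] zb[of x b z w] M pQ'
        by (simp add: X_def M' right_shift_def pNz)
    qed
    show "\<exists>\<beta>\<in>{0..<int p}. \<exists>M0\<in>al_set N Q (int Q). M = right_shift p \<beta> M0" if M: "M \<in> X" for M
    proof -
      have Mal: "M \<in> al_set N Q (int p * int Q)" using M by (simp add: X_def)
      obtain x b z w where M': "M = (int Q * x, b, int Q * K * z, int Q * w)" using alE[OF _ Mal] by (metis prod.exhaust)
      have b: "int p dvd b" and z: "\<not> int p dvd z" using M by (auto simp: X_def M' pNz)
      have "\<not> int p dvd K * z" using z pK pi by (simp add: prime_dvd_mult_iff)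
      then obtain \<beta> where be: "\<beta> \<in> {0..<int p}" "int p dvd w - K * z * \<beta>" using solve_mod_prime[OF p] by blast
      have "int p dvd b - int Q * x * \<beta>" using b pQ' by simp
      then obtain b0 where b0: "b - int Q * x * \<beta> = int p * b0" by blast
      obtain w0 where w0: "w - K * z * \<beta> = int p * w0" using be(2) by blast
      have "int p * (int Q * x * w0 - b0 * (K * z)) = int Q * x * (int p * w0) - (int p * b0) * (K * z)"
        by (simp add: algebra_simps)
      also have "\<dots> = int Q * x * w - b * (K * z)" unfolding w0[symmetric] b0[symmetric] by (simp add: algebra_simps)
      also have "\<dots> = int p" using det1[of x b z w "int p"] Mal by (simp add: M')
      finally have "int Q * x * w0 - b0 * (K * z) = 1" using pp by simp
      then have "int Q * (int Q * x * w0 - b0 * (K * z)) = int Q" by simp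
      then have "(int Q * x, b0, int Q * K * z, int Q * w0) \<in> al_set N Q (int Q)"
        by (simp add: al_set_def NK algebra_simps)
      moreover have "M = right_shift p \<beta> (int Q * x, b0, int Q * K * z, int Q * w0)"
      proof -
        have "w = K * z * \<beta> + int p * w0" using w0 by simp
        then show ?thesis using b0 by (simp add: M' right_shift_def algebra_simps)
      qed
      ultimately show ?thesis using be(1) by blast
    qed
    show "\<beta> = \<beta>'" if b: "\<beta> \<in> {0..<int p}" "\<beta>' \<in> {0..<int p}" and M: "M \<in> al_set N Q (int Q)" "M' \<in> al_set N Q (int Q)"
      and eqv: "mequiv (right_shift p \<beta> M) (right_shift p \<beta>' M')" for \<beta> \<beta>' M M'
    proof -
      obtain x b z w where M1: "M = (int Q * x, b, int Q * K * z, int Q * w)" using alE[OF _ M(1)] by (metis prod.exhaust)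
      obtain x' b' z' w' where M2: "M' = (int Q * x', b', int Q * K * z', int Q * w')" using alE[OF _ M(2)] by (metis prod.exhaust)
      from eqv obtain e where eq: "int Q * K * z' = e * (int Q * K * z)"
        "int Q * K * z' * \<beta>' + int p * (int Q * w') = e * (int Q * K * z * \<beta> + int p * (int Q * w))"
        unfolding M1 M2 right_shift_def prod.case by (rule mequivE)
      have "int Q * (K * z' * (\<beta> - \<beta>')) = (int Q * K * z') * \<beta> - int Q * K * z' * \<beta>'" by (simp add: algebra_simps)
      also have "\<dots> = e * (int Q * K * z) * \<beta> - (e * (int Q * K * z * \<beta> + int p * (int Q * w)) - int p * (int Q * w'))"
        using eq by (metis add_diff_cancel_right')
      also have "\<dots> = int Q * (int p * (w' - e * w))" by (simp add: algebra_simps)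
      finally have "K * z' * (\<beta> - \<beta>') = int p * (w' - e * w)" using Q by simp
      then have "int p dvd K * z' * (\<beta> - \<beta>')" by simp
      then have "int p dvd \<beta> - \<beta>'" using pK zb[of x' b' z' w'] M(2) pi by (simp add: M2 prime_dvd_mult_iff)
      then show ?thesis by (rule residue_unique[OF b])
    qed
  qed (use R mequiv_right_shift[OF pp] in auto)
  have reps2: "is_reps (left_scale p ` R) X"
  proof (rule is_reps_left_scale[OF R])
    show "left_scale p M \<in> X" if M: "M \<in> al_set N Q (int Q)" for M
    proof -
      obtain x b z w where M': "M = (int Q * x, b, int Q * K * z, int Q * w)" using alE[OF _ M] by (metis prod.exhaust)
      show ?thesis using al_set_left_scale[OF M, of p] zb[of x b z w] M
        by (simp add: X_def M' left_scale_def pNz)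
    qed
    show "\<exists>M0\<in>al_set N Q (int Q). mequiv M (left_scale p M0)" if M: "M \<in> X" for M
    proof -
      have Mal: "M \<in> al_set N Q (int p * int Q)" using M by (simp add: X_def)
      obtain x b z w where M': "M = (int Q * x, b, int Q * K * z, int Q * w)" using alE[OF _ Mal] by (metis prod.exhaust)
      have b: "int p dvd b" and z: "\<not> int p dvd z" using M by (auto simp: X_def M' pNz)
      have "\<not> int p dvd K * z" using z pK pi by (simp add: prime_dvd_mult_iff)
      then obtain t where t: "int p dvd x - K * z * t" using solve_mod_prime[OF p] by blast
      then obtain x0 where x0: "x - K * z * t = int p * x0" by blast
      have "int p dvd b - int Q * w * t" using b pQ' by simp
      then obtain b0 where b0: "b - int Q * w * t = int p * b0" by blast
      have "int p * (int Q * x0 * w - b0 * (K * z)) = int Q * (int p * x0) * w - (int p * b0) * (K * z)"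
        by (simp add: algebra_simps)
      also have "\<dots> = int Q * x * w - b * (K * z)" unfolding x0[symmetric] b0[symmetric] by (simp add: algebra_simps)
      also have "\<dots> = int p" using det1[of x b z w "int p"] Mal by (simp add: M')
      finally have "int Q * x0 * w - b0 * (K * z) = 1" using pp by simp
      then have "int Q * (int Q * x0 * w - b0 * (K * z)) = int Q" by simp
      then have "(int Q * x0, b0, int Q * K * z, int Q * w) \<in> al_set N Q (int Q)"
        by (simp add: al_set_def NK algebra_simps)
      moreover have "mequiv M (left_scale p (int Q * x0, b0, int Q * K * z, int Q * w))"
        unfolding M' left_scale_def prod.case
      proof (rule mequivI[of 1 _ _ "- t"])
        have "int p * (int Q * x0) = int Q * (int p * x0)" by simp
        then show "int p * (int Q * x0) = 1 * (int Q * x + - t * (int Q * K * z))"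
          unfolding x0[symmetric] by (simp add: algebra_simps)
        show "int p * b0 = 1 * (b + - t * (int Q * w))" unfolding b0[symmetric] by (simp add: algebra_simps)
      qed simp_all
      ultimately show ?thesis by blast
    qed
    show "mequiv M M'" if M: "M \<in> al_set N Q (int Q)" "M' \<in> al_set N Q (int Q)"
      and eqv: "mequiv (left_scale p M) (left_scale p M')" for M M'
    proof -
      obtain x b z w where M1: "M = (int Q * x, b, int Q * K * z, int Q * w)" using alE[OF _ M(1)] by (metis prod.exhaust)
      obtain x' b' z' w' where M2: "M' = (int Q * x', b', int Q * K * z', int Q * w')" using alE[OF _ M(2)] by (metis prod.exhaust)
      show ?thesis unfolding M1 M2
      proof (rule left_scale_cancel[OF pp])
        fix t assume "\<exists>e. (e = 1 \<or> e = - 1) \<and> int p * (int Q * x') = e * (int p * (int Q * x) + t * (int Q * K * z))"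
        then obtain e where e: "e = 1 \<or> e = - 1" "int p * (int Q * x') = e * (int p * (int Q * x) + t * (int Q * K * z))"
          by blast
        have "int Q * (t * (K * z)) = int Q * (int p * (e * x' - x))"
          using e by (auto simp: algebra_simps)
        then have "t * (K * z) = int p * (e * x' - x)" using Q by simp
        then have "int p dvd t * (K * z)" by simp
        then show "int p dvd t" using pK zb[of x b z w] M(1) pi by (simp add: M1 prime_dvd_mult_iff)
      qed (use eqv in \<open>simp add: M1 M2\<close>)
    qed
  qed
  define \<Phi> where "\<Phi> M = niebur_seed n s (mob M \<tau>)" for M
  have inv: "\<Phi> M = \<Phi> M'" if "M \<in> X" "mequiv M M'" for M M'
    unfolding \<Phi>_def using that pp Q tau by (intro niebur_seed_mequiv[of M N Q "int p * int Q"]) (auto simp: X_def)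
  have "(\<Phi> has_sum (\<Sum>\<beta>\<in>{0..<int p}. level_sum n ((\<tau> + of_int \<beta>) / of_nat p) N Q s)) (\<Union>\<beta>\<in>{0..<int p}. right_shift p \<beta> ` R)"
  proof (rule sum_has_sum)
    show "(\<Phi> has_sum level_sum n ((\<tau> + of_int \<beta>) / of_nat p) N Q s) (right_shift p \<beta> ` R)" for \<beta>
      unfolding \<Phi>_def
      by (rule has_sum_right_shift[OF pp R])
         (unfold R_def, intro std_reps_has_sum n s Q Im_hecke_point tau pp)
    show "right_shift p \<beta> ` R \<inter> right_shift p \<beta>' ` R = {}"
      if b: "\<beta> \<in> {0..<int p}" "\<beta>' \<in> {0..<int p}" "\<beta> \<noteq> \<beta>'" for \<beta> \<beta>'
    proof (rule ccontr)
      assume "right_shift p \<beta> ` R \<inter> right_shift p \<beta>' ` R \<noteq> {}"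
      then obtain M M' where M: "M \<in> R" "M' \<in> R" "right_shift p \<beta> M = right_shift p \<beta>' M'" by blast
      then have al: "M \<in> al_set N Q (int Q)" "M' \<in> al_set N Q (int Q)" using R by (auto simp: is_reps_def)
      obtain x b z w where M1: "M = (int Q * x, b, int Q * K * z, int Q * w)" using alE[OF _ al(1)] by (metis prod.exhaust)
      obtain x' b' z' w' where M2: "M' = (int Q * x', b', int Q * K * z', int Q * w')" using alE[OF _ al(2)] by (metis prod.exhaust)
      have zz: "z' = z" and eq: "int Q * K * z * \<beta> + int p * (int Q * w) = int Q * K * z' * \<beta>' + int p * (int Q * w')"
        using M(3) K0 Q by (auto simp: M1 M2 right_shift_def)
      have "int Q * (K * z * (\<beta> - \<beta>')) = int Q * (int p * (w' - w))"
        using eq unfolding zz by (simp add: algebra_simps)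
      then have "K * z * (\<beta> - \<beta>') = int p * (w' - w)" using Q by simp
      then have "int p dvd K * z * (\<beta> - \<beta>')" by simp
      then have "int p dvd \<beta> - \<beta>'" using pK zb[of x b z w] al(1) pi by (simp add: M1 prime_dvd_mult_iff)
      then show False using residue_unique[OF b(1,2)] b(3) by blast
    qed
  qed simp
  then have "(\<Phi> has_sum (\<Sum>\<beta>\<in>{0..<int p}. level_sum n ((\<tau> + of_int \<beta>) / of_nat p) N Q s)) (left_scale p ` R)"
    using is_reps_has_sum[OF reps1 reps2, of \<Phi>] inv by simp
  moreover have "(\<Phi> has_sum level_sum (p * n) \<tau> N Q s) (left_scale p ` R)"
    unfolding \<Phi>_def R_def using pp n by (intro has_sum_left_scale std_reps_has_sum Q s tau) auto
  ultimately show ?thesis by (rule has_sum_unique)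
qed

section \<open>Plicates of levels\<close>

lemma plicate_prime_eq: "plicate_prime p (N, S) = (reduced_level p N, {Q \<in> S. Q dvd reduced_level p N})"
  by (simp add: plicate_prime_def reduced_level_def)

text \<open>If p divides an exact divisor Q, then N / Q is prime to p, so the p removed from N is
  missing in Q.\<close>

lemma dvd_reduced_level_iff:
  assumes p: "prime p" and N: "N > 0" and ex: "exact_divisor Q N"
  shows "Q dvd reduced_level p N \<longleftrightarrow> \<not> p dvd Q"
proof
  assume Q: "Q dvd reduced_level p N"
  show "\<not> p dvd Q"
  proof
    assume pQ: "p dvd Q"
    then have pN: "p dvd N" using ex by (meson dvd_trans exact_divisor_def)
    then have "gcd p N = p" by (simp add: gcd_nat.absorb1)
    then have NN: "N = p * reduced_level p N" using pN by (simp add: reduced_level_def)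
    obtain k where k: "reduced_level p N = Q * k" using Q by blast
    have Qp: "Q > 0" using ex N by (auto simp: exact_divisor_def intro: Nat.gr0I)
    have "N = Q * (p * k)" using NN k by (simp add: mult_ac)
    then have "N div Q = p * k" using Qp by simp
    then have "p dvd N div Q" by simp
    then show False using ex pQ p by (meson coprime_common_divisor exact_divisor_def not_prime_unit)
  qed
next
  assume "\<not> p dvd Q"
  then show "Q dvd reduced_level p N" using dvd_reduced_level(3)[OF p N] ex by (simp add: exact_divisor_def)
qed

lemma good_plicate_divisors:
  assumes good: "good_level (N, S)" and p: "prime p"
  shows "insert 1 {Q \<in> S. Q dvd reduced_level p N} = {Q \<in> insert 1 S. \<not> p dvd Q}"
  using dvd_reduced_level_iff[OF p good_levelD(1)[OF good, of 1] good_levelD(2)[OF good]] p not_prime_unit by auto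

lemma good_plicate_prime:
  assumes good: "good_level L" and p: "prime p"
  shows "good_level (plicate_prime p L)"
proof -
  obtain N S where L: "L = (N, S)" by (metis prod.exhaust)
  note good = good[unfolded L]
  have N: "N > 0" using good_levelD(1)[OF good, of 1] by simp
  define S' where "S' = {Q \<in> S. Q dvd reduced_level p N}"
  have S': "insert 1 S' = {Q \<in> insert 1 S. \<not> p dvd Q}"
    unfolding S'_def by (rule good_plicate_divisors[OF good p])
  have "reduced_level p N > 0" using N by (simp add: reduced_level_def div_greater_zero_iff dvd_imp_le)
  moreover have "S' \<subseteq> {Q. exact_divisor Q (reduced_level p N) \<and> Q > 1}"
    using exact_divisor_reduced_level(1)[OF p N] good dvd_reduced_level_iff[OF p N] by (auto simp: S'_def good_level_def)
  moreover have "al_prod Q Q' \<in> insert 1 S'" if "Q \<in> insert 1 S'" "Q' \<in> insert 1 S'" for Q Q'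
  proof -
    have Q: "Q \<in> insert 1 S" "Q' \<in> insert 1 S" "\<not> p dvd Q" "\<not> p dvd Q'" using that unfolding S' by auto
    have "al_prod Q Q' \<in> insert 1 S" using good Q(1,2) unfolding good_level_def by blast
    moreover have "al_prod Q Q' dvd Q * Q'"
      unfolding al_prod_def by (intro mult_dvd_mono) (metis dvd_triv_right dvd_mult_div_cancel gcd_dvd1 gcd_dvd2)+
    then have "\<not> p dvd al_prod Q Q'" using Q(3,4) p by (meson dvd_trans prime_dvd_mult_iff)
    ultimately show ?thesis unfolding S' by blast
  qed
  ultimately show ?thesis unfolding L plicate_prime_eq S'_def[symmetric] good_level_def by simp
qed

lemma reduced_level_commute:
  assumes "prime p" "prime q"
  shows "reduced_level p (reduced_level q N) = reduced_level q (reduced_level p N)"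
proof (cases "p = q \<or> N = 0")
  case False
  then have pq: "\<not> p dvd q" "\<not> q dvd p" and N: "N > 0"
    using assms by (auto simp: prime_nat_iff)
  have g: "gcd r M = (if r dvd M then r else 1)" if "prime r" for r M :: nat
    using that by (auto simp: gcd_nat.absorb1 prime_imp_coprime coprime_iff_gcd_eq_1[symmetric])
  have "p dvd N div q \<longleftrightarrow> p dvd N" if "q dvd N"
    using that assms pq by (metis dvd_mult_div_cancel dvd_mult prime_dvd_mult_iff)
  moreover have "q dvd N div p \<longleftrightarrow> q dvd N" if "p dvd N"
    using that assms pq by (metis dvd_mult_div_cancel dvd_mult prime_dvd_mult_iff)
  ultimately show ?thesis
    unfolding reduced_level_def g[OF assms(1)] g[OF assms(2)]
    by (auto simp: div_mult2_eq[symmetric] mult.commute)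
qed (auto simp: reduced_level_def)

lemma reduced_level_dvd: "reduced_level p N dvd N"
  unfolding reduced_level_def by (metis dvd_triv_right dvd_mult_div_cancel gcd_dvd2)

lemma plicate_prime_commute:
  assumes "prime p" "prime q"
  shows "plicate_prime p (plicate_prime q L) = plicate_prime q (plicate_prime p L)"
proof -
  obtain N S where L: "L = (N, S)" by (metis prod.exhaust)
  have "(Q dvd reduced_level q N \<and> Q dvd reduced_level p (reduced_level q N)) = (Q dvd reduced_level p N \<and> Q dvd reduced_level q (reduced_level p N))" for Q
    using reduced_level_commute[OF assms, of N] reduced_level_dvd dvd_trans by metis
  then show ?thesis unfolding L plicate_prime_eq reduced_level_commute[OF assms] by auto
qed

text \<open>The steps for different primes commute, so the copies of p may be taken last, wherever
  the sorted list has them.\<close>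

lemma plicate_level_mult_power:
  assumes p: "prime p" and d: "d > 0"
  shows "plicate_level (d * p ^ i) L = (plicate_prime p ^^ i) (plicate_level d L)"
proof -
  let ?xs = "sorted_list_of_multiset (prime_factorization d) @ replicate i p"
  have "prime_factorization (d * p ^ i) = prime_factorization d + replicate_mset i p"
    using p d by (simp add: prime_factorization_mult prime_gt_0_nat prime_factorization_prime_power)
  then have "mset (sorted_list_of_multiset (prime_factorization (d * p ^ i))) = mset ?xs"
    by (simp add: mset_replicate)
  moreover have "plicate_prime x \<circ> plicate_prime y = plicate_prime y \<circ> plicate_prime x"
    if "x \<in> set (sorted_list_of_multiset (prime_factorization (d * p ^ i)))"
      "y \<in> set (sorted_list_of_multiset (prime_factorization (d * p ^ i)))" for x y
    using that plicate_prime_commute[of x y] by (auto simp: fun_eq_iff in_prime_factors_iff)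
  ultimately have "fold plicate_prime (sorted_list_of_multiset (prime_factorization (d * p ^ i))) = fold plicate_prime ?xs"
    by (intro fold_multiset_equiv) auto
  moreover have "fold plicate_prime (replicate i p) = plicate_prime p ^^ i"
    by (induction i) (auto simp: funpow_swap1 fun_eq_iff)
  ultimately show ?thesis by (simp add: plicate_level_def)
qed

lemma plicate_level_1 [simp]: "plicate_level (Suc 0) L = L"
  by (simp add: plicate_level_def)

lemma plicate_level_power:
  assumes "prime p"
  shows "plicate_level (p ^ i) L = (plicate_prime p ^^ i) L"
  using plicate_level_mult_power[OF assms, of 1 i L] by simp

lemma good_plicate_funpow: "good_level L \<Longrightarrow> prime p \<Longrightarrow> good_level ((plicate_prime p ^^ i) L)"
  by (induction i) (auto intro: good_plicate_prime)

section \<open>Periodicity, and the relation for whole levels at s = 1\<close>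

text \<open>Right multiplication by the unit translation permutes the matrices and commutes with
  \<open>mequiv\<close>, hence maps representatives to representatives. Periodicity is needed later
  in \<open>U_star_dilate\<close>.\<close>

lemma level_sum_periodic:
  assumes N: "N > 0" and ex: "exact_divisor Q N" and n: "n > 0" and tau: "Im \<tau> > 0" and s: "Re s > 1"
  shows "level_sum n (\<tau> + 1) N Q s = level_sum n \<tau> N Q s"
proof -
  have Q: "Q dvd N" "Q > 0" using ex N by (auto simp: exact_divisor_def intro: Nat.gr0I)
  define R where "R = std_reps N Q"
  have R: "is_reps R (al_set N Q (int Q))" unfolding R_def by (rule std_reps_is_reps[OF ex N])
  have "is_reps (\<Union>i\<in>{()}. right_shift 1 1 ` R) (al_set N Q (int Q))"
  proof (rule is_reps_right[where Y' = "\<lambda>_. al_set N Q (int Q)" and f = "\<lambda>_. right_shift 1 1"])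
    show "right_shift 1 1 M \<in> al_set N Q (int Q)" if "M \<in> al_set N Q (int Q)" for M
      using al_set_right_shift[OF that Q(1), of 1 1] by simp
    show "\<exists>i\<in>{()}. \<exists>M0\<in>al_set N Q (int Q). M = right_shift 1 1 M0" if "M \<in> al_set N Q (int Q)" for M
      using al_set_right_shift[OF that Q(1), of 1 "-1"]
      by (intro bexI[of _ "()"] bexI[of _ "right_shift 1 (-1) M"]) (auto simp: right_shift_def split: prod.split)
  qed (use R mequiv_right_shift[of 1] in auto)
  then have R1: "is_reps (right_shift 1 1 ` R) (al_set N Q (int Q))" by simp
  have "((\<lambda>M. niebur_seed n s (mob M \<tau>)) has_sum level_sum n (\<tau> + 1) N Q s) (right_shift 1 1 ` R)"
  proof (rule has_sum_right_shift[OF _ R])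
    have "((\<lambda>M. niebur_seed n s (mob M (\<tau> + 1))) has_sum level_sum n (\<tau> + 1) N Q s) R"
      unfolding R_def using tau by (intro std_reps_has_sum n s Q) simp
    then show "((\<lambda>M. niebur_seed n s (mob M ((\<tau> + of_int 1) / of_nat 1))) has_sum level_sum n (\<tau> + 1) N Q s) R"
      by simp
  qed simp
  moreover have "((\<lambda>M. niebur_seed n s (mob M \<tau>)) has_sum level_sum n \<tau> N Q s) (right_shift 1 1 ` R)"
  proof -
    have "((\<lambda>M. niebur_seed n s (mob M \<tau>)) has_sum level_sum n \<tau> N Q s) R"
      unfolding R_def by (intro std_reps_has_sum n s Q tau)
    then show ?thesis
      using is_reps_has_sum[OF R R1, of "\<lambda>M. niebur_seed n s (mob M \<tau>)"] niebur_seed_mequiv[of _ N Q "int Q" \<tau>] Q tau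
      by simp
  qed
  ultimately show ?thesis by (rule has_sum_unique)
qed

lemma continuation_eq_at_1:
  assumes "F holomorphic_on {s. Re s > 15/16}" "G holomorphic_on {s. Re s > 15/16}"
    "\<And>s. Re s > 1 \<Longrightarrow> F s = G s"
  shows "F 1 = G (1 :: complex)"
proof (rule analytic_continuation_open[where f = F and g = G and z = 1 and s = "{s. Re s > 1}" and s' = "{s. Re s > 15/16}"])
  show "{s. Re s > 1} \<noteq> {}" by (auto intro: exI[of _ 2])
  show "connected {s. Re s > 15/16}" by (intro convex_connected convex_halfspace_Re_gt)
  show "open {s. Re s > 1}" "open {s. Re s > 15/16}" by (rule open_halfspace_Re_gt)+
qed (use assms in auto)

lemma niebur_j_periodic:
  assumes good: "good_level L" and n: "n > 0" and tau: "Im \<tau> > 0"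
  shows "niebur_j L n (\<tau> + 1) = niebur_j L n \<tau>"
proof -
  obtain N S where L: "L = (N, S)" by (metis prod.exhaust)
  have tau1: "Im (\<tau> + 1) > 0" using tau by simp
  obtain F where F: "F holomorphic_on {s. Re s > 15/16}" "\<And>s. Re s > 1 \<Longrightarrow> F s = niebur_G L n \<tau> s" "F 1 = niebur_j L n \<tau>"
    using niebur_j_continuation[OF good n tau] by blast
  obtain F' where F': "F' holomorphic_on {s. Re s > 15/16}" "\<And>s. Re s > 1 \<Longrightarrow> F' s = niebur_G L n (\<tau> + 1) s" "F' 1 = niebur_j L n (\<tau> + 1)"
    using niebur_j_continuation[OF good n tau1] by blast
  have eq: "niebur_G L n (\<tau> + 1) s = niebur_G L n \<tau> s" if "Re s > 1" for s
    unfolding L niebur_G_level_sum[OF good[unfolded L] n tau that] niebur_G_level_sum[OF good[unfolded L] n tau1 that]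
    using level_sum_periodic good_levelD[OF good[unfolded L]] n tau that by simp
  have "F' 1 = F 1"
  proof (rule continuation_eq_at_1[OF F'(1) F(1)])
    show "F' s = F s" if "Re s > 1" for s by (simp only: F'(2)[OF that] F(2)[OF that] eq[OF that])
  qed
  then show ?thesis by (simp only: F'(3) F(3))
qed

text \<open>The indices Q divisible by p occur at level L only and obey
  \<open>level_sum_hecke_dvd\<close>; the others occur at both levels.\<close>

lemma niebur_G_hecke:
  assumes good: "good_level L" and p: "prime p" and n: "n > 0" and tau: "Im \<tau> > 0" and s: "Re s > 1"
  shows "(\<Sum>b<p. niebur_G L n ((\<tau> + of_nat b) / of_nat p) s) + niebur_G (plicate_prime p L) n (of_nat p * \<tau>) s =
    niebur_G L (p * n) \<tau> s + (if p dvd n then of_nat p * niebur_G (plicate_prime p L) (n div p) \<tau> s else 0)"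
proof -
  obtain N S where L: "L = (N, S)" by (metis prod.exhaust)
  note goodL = good[unfolded L]
  have N: "N > 0" using good_levelD(1)[OF goodL, of 1] by simp
  have pp: "p > 0" using p by (simp add: prime_gt_0_nat)
  define I where "I = insert 1 S"
  define I' where "I' = {Q \<in> I. \<not> p dvd Q}"
  have fin: "finite I" using good_level_finite[OF goodL] by (simp add: I_def)
  have D: "plicate_prime p L = (reduced_level p N, {Q \<in> S. Q dvd reduced_level p N})" by (simp add: L plicate_prime_eq)
  have goodD: "good_level (reduced_level p N, {Q \<in> S. Q dvd reduced_level p N})" using good_plicate_prime[OF good p] by (simp add: D)
  have ID: "insert 1 {Q \<in> S. Q dvd reduced_level p N} = I'"
    unfolding I'_def I_def by (rule good_plicate_divisors[OF goodL p])
  have G: "niebur_G L m z s = 2 * of_real pi * (\<Sum>Q\<in>I. level_sum m z N Q s)" if "m > 0" "Im z > 0" for m z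
    unfolding L I_def by (rule niebur_G_level_sum[OF goodL that s])
  have GD: "niebur_G (plicate_prime p L) m z s = 2 * of_real pi * (\<Sum>Q\<in>I'. level_sum m z (reduced_level p N) Q s)" if "m > 0" "Im z > 0" for m z
    unfolding D ID[symmetric] by (rule niebur_G_level_sum[OF goodD that s])
  have I'sum: "(\<Sum>Q\<in>I'. h Q) = (\<Sum>Q\<in>I. if p dvd Q then 0 else h Q)" for h :: "nat \<Rightarrow> complex"
    unfolding I'_def using fin by (subst sum.inter_filter) (auto intro!: sum.cong)
  define lhs where "lhs Q = (\<Sum>b<p. level_sum n ((\<tau> + of_nat b) / of_nat p) N Q s) +
      (if p dvd Q then 0 else level_sum n (of_nat p * \<tau>) (reduced_level p N) Q s)" for Q
  define rhs where "rhs Q = level_sum (p * n) \<tau> N Q s +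
      (if p dvd Q then 0 else if p dvd n then of_nat p * level_sum (n div p) \<tau> (reduced_level p N) Q s else 0)" for Q
  have "lhs Q = rhs Q" if "Q \<in> I" for Q
  proof -
    have ex: "exact_divisor Q N" using good_levelD(2)[OF goodL] that by (simp add: I_def)
    show ?thesis
    proof (cases "p dvd Q")
      case True
      then show ?thesis
        using level_sum_hecke_dvd[OF p N ex True n tau s] by (simp add: lhs_def rhs_def sum_int_lessThan)
    next
      case False
      then show ?thesis
        using level_sum_hecke[OF p N ex False n tau s] by (simp add: lhs_def rhs_def sum_int_lessThan)
    qed
  qed
  then have "(\<Sum>Q\<in>I. lhs Q) = (\<Sum>Q\<in>I. rhs Q)" by (rule sum.cong[OF refl])
  then have key: "2 * of_real pi * (\<Sum>Q\<in>I. lhs Q) = 2 * of_real pi * (\<Sum>Q\<in>I. rhs Q)" by simp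
  have "2 * of_real pi * (\<Sum>Q\<in>I. lhs Q) =
      (\<Sum>b<p. niebur_G L n ((\<tau> + of_nat b) / of_nat p) s) + niebur_G (plicate_prime p L) n (of_nat p * \<tau>) s"
  proof -
    have "(\<Sum>b<p. niebur_G L n ((\<tau> + of_nat b) / of_nat p) s) =
        (\<Sum>b<p. 2 * of_real pi * (\<Sum>Q\<in>I. level_sum n ((\<tau> + of_nat b) / of_nat p) N Q s))"
      using tau pp by (intro sum.cong refl G n) simp
    also have "\<dots> = 2 * of_real pi * (\<Sum>Q\<in>I. \<Sum>b<p. level_sum n ((\<tau> + of_nat b) / of_nat p) N Q s)"
      by (subst sum.swap) (simp add: sum_distrib_left)
    finally show ?thesis
      using tau pp n by (subst GD) (auto simp: lhs_def sum.distrib I'sum distrib_left)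
  qed
  moreover have "2 * of_real pi * (\<Sum>Q\<in>I. rhs Q) =
      niebur_G L (p * n) \<tau> s + (if p dvd n then of_nat p * niebur_G (plicate_prime p L) (n div p) \<tau> s else 0)"
  proof (cases "p dvd n")
    case True
    then have "n div p > 0" using n pp by (simp add: dvd_imp_le div_greater_zero_iff)
    then show ?thesis
      using True n pp tau by (simp add: G GD rhs_def sum.distrib I'sum distrib_left sum_distrib_left)
        (auto intro!: sum.cong)
  next
    case False
    then have "rhs Q = level_sum (p * n) \<tau> N Q s" for Q by (simp add: rhs_def)
    then show ?thesis using False n pp tau by (simp add: G)
  qed
  ultimately show ?thesis using key by simp
qed

lemma niebur_j_hecke:
  assumes good: "good_level L" and p: "prime p" and n: "n > 0" and tau: "Im \<tau> > 0"
  shows "U_star p (niebur_j L n) \<tau> + niebur_j (plicate_prime p L) n (of_nat p * \<tau>) =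
    niebur_j L (p * n) \<tau> + (if p dvd n then of_nat p * niebur_j (plicate_prime p L) (n div p) \<tau> else 0)"
proof -
  have pp: "p > 0" using p by (simp add: prime_gt_0_nat)
  note goodD = good_plicate_prime[OF good p]
  let ?H = "{s. Re s > 15/16}"
  have ex: "\<exists>F. F holomorphic_on ?H \<and> (\<forall>s. Re s > 1 \<longrightarrow> F s = niebur_G L' m z s) \<and> F 1 = niebur_j L' m z"
    if "good_level L'" "m > 0" "Im z > 0" for L' m z using niebur_j_continuation[OF that] .
  have "\<forall>b. \<exists>F. F holomorphic_on ?H \<and> (\<forall>s. Re s > 1 \<longrightarrow> F s = niebur_G L n ((\<tau> + of_nat b) / of_nat p) s) \<and>
      F 1 = niebur_j L n ((\<tau> + of_nat b) / of_nat p)"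
    using ex[OF good n] tau pp by simp
  then obtain F1 where F1: "\<And>b. F1 b holomorphic_on ?H"
    "\<And>b s. Re s > 1 \<Longrightarrow> F1 b s = niebur_G L n ((\<tau> + of_nat b) / of_nat p) s"
    "\<And>b. F1 b 1 = niebur_j L n ((\<tau> + of_nat b) / of_nat p)" by metis
  obtain F2 where F2: "F2 holomorphic_on ?H" "\<And>s. Re s > 1 \<Longrightarrow> F2 s = niebur_G (plicate_prime p L) n (of_nat p * \<tau>) s"
    "F2 1 = niebur_j (plicate_prime p L) n (of_nat p * \<tau>)"
    using ex[OF goodD n, of "of_nat p * \<tau>"] tau pp by auto
  obtain F3 where F3: "F3 holomorphic_on ?H" "\<And>s. Re s > 1 \<Longrightarrow> F3 s = niebur_G L (p * n) \<tau> s"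
    "F3 1 = niebur_j L (p * n) \<tau>"
    using ex[OF good, of "p * n" \<tau>] tau pp n by auto
  obtain F4 where F4: "F4 holomorphic_on ?H"
    "\<And>s. Re s > 1 \<Longrightarrow> F4 s = (if p dvd n then of_nat p * niebur_G (plicate_prime p L) (n div p) \<tau> s else 0)"
    "F4 1 = (if p dvd n then of_nat p * niebur_j (plicate_prime p L) (n div p) \<tau> else 0)"
  proof (cases "p dvd n")
    case True
    then have "n div p > 0" using n pp by (simp add: dvd_imp_le div_greater_zero_iff)
    from ex[OF goodD this tau] obtain F where "F holomorphic_on ?H"
      "\<And>s. Re s > 1 \<Longrightarrow> F s = niebur_G (plicate_prime p L) (n div p) \<tau> s" "F 1 = niebur_j (plicate_prime p L) (n div p) \<tau>"
      by blast
    then show ?thesis using True by (intro that[of "\<lambda>s. of_nat p * F s"]) (auto intro!: holomorphic_intros)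
  next
    case False
    then show ?thesis by (intro that[of "\<lambda>_. 0"]) auto
  qed
  have "(\<Sum>b<p. F1 b 1) + F2 1 = F3 1 + F4 1"
  proof (rule continuation_eq_at_1[of "\<lambda>s. (\<Sum>b<p. F1 b s) + F2 s" "\<lambda>s. F3 s + F4 s"])
    show "(\<Sum>b<p. F1 b s) + F2 s = F3 s + F4 s" if s: "Re s > 1" for s
      using niebur_G_hecke[OF good p n tau s] by (simp only: F1(2)[OF s] F2(2)[OF s] F3(2)[OF s] F4(2)[OF s])
  qed (intro holomorphic_intros F1 F2 F3 F4)+
  then show ?thesis by (simp only: U_star_def F1(3) F2(3) F3(3) F4(3))
qed

section \<open>Weakly holomorphic functions on congruence subgroups\<close>

text \<open>The family \<Gamma>(M) is chosen because it is stable under the operations needed: two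
  members contain a common third one, and conjugation by an integral matrix of determinant D maps
  \<Gamma>(M D) into \<Gamma>(M).\<close>

definition principal :: "nat \<Rightarrow> (real^2^2) set" where
  "principal M = {A. det A = 1 \<and> (\<exists>a b c d :: int. A = mat2 (1 + real M * of_int a) (real M * of_int b)
     (real M * of_int c) (1 + real M * of_int d))}"

lemma SL2Z_iff: "A \<in> SL2Z \<longleftrightarrow> (\<exists>a b c d :: int. A = mat2 (of_int a) (of_int b) (of_int c) (of_int d) \<and> a * d - b * c = 1)"
proof
  assume A: "A \<in> SL2Z"
  then have "A $ 1 $ 1 \<in> \<int>" "A $ 1 $ 2 \<in> \<int>" "A $ 2 $ 1 \<in> \<int>" "A $ 2 $ 2 \<in> \<int>" and det: "det A = 1"
    by (auto simp: SL2Z_def)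
  then obtain a b c d :: int where e: "A $ 1 $ 1 = of_int a" "A $ 1 $ 2 = of_int b" "A $ 2 $ 1 = of_int c" "A $ 2 $ 2 = of_int d"
    by (auto elim!: Ints_cases)
  have "real_of_int (a * d - b * c) = of_int 1" using det by (simp add: det_2 e)
  then have "a * d - b * c = 1" by (simp only: of_int_eq_iff)
  moreover have "A = mat2 (of_int a) (of_int b) (of_int c) (of_int d)" by (rule mat2_eqI) (simp_all add: e)
  ultimately show "\<exists>a b c d :: int. A = mat2 (of_int a) (of_int b) (of_int c) (of_int d) \<and> a * d - b * c = 1" by blast
next
  assume "\<exists>a b c d :: int. A = mat2 (of_int a) (of_int b) (of_int c) (of_int d) \<and> a * d - b * c = 1"
  then obtain a b c d :: int where A: "A = mat2 (of_int a) (of_int b) (of_int c) (of_int d)" "a * d - b * c = 1" by blast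
  have "real_of_int (a * d - b * c) = 1" by (simp only: A(2) of_int_1)
  then show "A \<in> SL2Z" by (auto simp: A(1) SL2Z_def forall_2)
qed

lemma SL2ZI:
  fixes a b c d :: int
  assumes "a * d - b * c = 1"
  shows "mat2 (of_int a) (of_int b) (of_int c) (of_int d) \<in> SL2Z"
  unfolding SL2Z_iff using assms by blast

lemma principal_subset_SL2Z: "principal M \<subseteq> SL2Z"
  by (auto simp: principal_def SL2Z_def forall_2)

lemma principal_mono:
  assumes "M dvd M'" shows "principal M' \<subseteq> principal M"
proof
  fix A assume "A \<in> principal M'"
  then obtain a b c d :: int where A: "det A = 1"
    "A = mat2 (1 + real M' * of_int a) (real M' * of_int b) (real M' * of_int c) (1 + real M' * of_int d)"
    by (auto simp: principal_def)
  obtain k where "M' = M * k" using assms by blast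
  then have "A = mat2 (1 + real M * of_int (int k * a)) (real M * of_int (int k * b))
      (real M * of_int (int k * c)) (1 + real M * of_int (int k * d))"
    by (simp add: A(2) mult.assoc)
  then show "A \<in> principal M" using A(1) unfolding principal_def by blast
qed

lemma principal_subset_Gamma0: "principal N \<subseteq> Gamma0 N"
  using principal_subset_SL2Z by (fastforce simp: Gamma0_def principal_def)

lemma inv_SL2R:
  assumes "det A = 1"
  shows "inv\<^bsub>SL2R\<^esub> A = mat2 (A $ 2 $ 2) (- A $ 1 $ 2) (- A $ 2 $ 1) (A $ 1 $ 1)"
proof (rule SL2R.inv_equality)
  have d: "A $ 1 $ 1 * A $ 2 $ 2 - A $ 1 $ 2 * A $ 2 $ 1 = 1" using assms by (simp add: det_2)
  have "mat2 (A $ 2 $ 2) (- A $ 1 $ 2) (- A $ 2 $ 1) (A $ 1 $ 1) ** mat2 (A $ 1 $ 1) (A $ 1 $ 2) (A $ 2 $ 1) (A $ 2 $ 2) = mat 1"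
    unfolding mat2_mult mat_1_mat2 using d by (intro mat2_eqI) (simp_all add: algebra_simps)
  then show "mat2 (A $ 2 $ 2) (- A $ 1 $ 2) (- A $ 2 $ 1) (A $ 1 $ 1) \<otimes>\<^bsub>SL2R\<^esub> A = \<one>\<^bsub>SL2R\<^esub>"
    by (simp add: SL2R_def mat2_eta)
  show "mat2 (A $ 2 $ 2) (- A $ 1 $ 2) (- A $ 2 $ 1) (A $ 1 $ 1) \<in> carrier SL2R"
    using d by (simp add: carrier_SL2R algebra_simps)
qed (use assms in \<open>simp add: carrier_SL2R\<close>)

lemma subgroup_SL2Z: "subgroup SL2Z SL2R"
proof (rule SL2R.subgroupI)
  show "SL2Z \<subseteq> carrier SL2R" by (auto simp: SL2Z_def carrier_SL2R)
  show "SL2Z \<noteq> {}"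
  proof -
    have "mat2 (of_int 1) (of_int 0) (of_int 0) (of_int 1) \<in> SL2Z" by (rule SL2ZI) simp
    then show ?thesis by blast
  qed
  show "inv\<^bsub>SL2R\<^esub> A \<in> SL2Z" if "A \<in> SL2Z" for A
    using that inv_SL2R[of A] by (auto simp: SL2Z_def forall_2 det_2 mult.commute)
  show "A \<otimes>\<^bsub>SL2R\<^esub> B \<in> SL2Z" if "A \<in> SL2Z" "B \<in> SL2Z" for A B
  proof -
    have "det (A ** B) = 1" using that by (simp add: SL2Z_def det_mul)
    moreover have "\<forall>i j. (A ** B) $ i $ j \<in> \<int>"
      using that by (auto simp: SL2Z_def matrix_matrix_mult_def sum_2)
    ultimately show ?thesis by (simp add: SL2Z_def mult_SL2R)
  qed
qed

lemma subgroup_principal: "subgroup (principal M) SL2R"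
proof (rule SL2R.subgroupI)
  show "principal M \<subseteq> carrier SL2R" by (auto simp: principal_def carrier_SL2R)
  show "principal M \<noteq> {}"
  proof -
    have "mat2 (1 + real M * of_int 0) (real M * of_int 0) (real M * of_int 0) (1 + real M * of_int 0) \<in> principal M"
      unfolding principal_def by fastforce
    then show ?thesis by blast
  qed
  show "inv\<^bsub>SL2R\<^esub> A \<in> principal M" if A: "A \<in> principal M" for A
  proof -
    obtain a b c d :: int where A: "det A = 1"
      "A = mat2 (1 + real M * of_int a) (real M * of_int b) (real M * of_int c) (1 + real M * of_int d)"
      using A by (auto simp: principal_def)
    have "inv\<^bsub>SL2R\<^esub> A = mat2 (1 + real M * of_int d) (real M * of_int (- b)) (real M * of_int (- c)) (1 + real M * of_int a)"
      unfolding inv_SL2R[OF A(1)] by (simp add: A(2))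
    moreover have "det (inv\<^bsub>SL2R\<^esub> A) = 1"
      unfolding inv_SL2R[OF A(1)] using A(1) by (simp add: det_2 mult.commute)
    ultimately show ?thesis unfolding principal_def by blast
  qed
  show "A \<otimes>\<^bsub>SL2R\<^esub> B \<in> principal M" if AB: "A \<in> principal M" "B \<in> principal M" for A B
  proof -
    obtain a b c d :: int where A: "det A = 1"
      "A = mat2 (1 + real M * of_int a) (real M * of_int b) (real M * of_int c) (1 + real M * of_int d)"
      using AB by (auto simp: principal_def)
    obtain a' b' c' d' :: int where B: "det B = 1"
      "B = mat2 (1 + real M * of_int a') (real M * of_int b') (real M * of_int c') (1 + real M * of_int d')"
      using AB by (auto simp: principal_def)
    have "A ** B = mat2 (1 + real M * of_int (a + a' + int M * (a * a' + b * c')))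
        (real M * of_int (b' + b + int M * (a * b' + b * d')))
        (real M * of_int (c + c' + int M * (c * a' + d * c')))
        (1 + real M * of_int (d + d' + int M * (c * b' + d * d')))"
      unfolding A(2) B(2) mat2_mult by (rule mat2_eqI) (simp_all add: algebra_simps)
    moreover have "det (A ** B) = 1" using A B by (simp add: det_mul)
    ultimately show ?thesis unfolding mult_SL2R principal_def by blast
  qed
qed

text \<open>Cosets are separated by the entries modulo M: if A and B agree there, then B A^-1 is
  congruent to the identity.\<close>

lemma finite_index_principal:
  assumes "M > 0"
  shows "finite (rcosets\<^bsub>SL2R\<lparr>carrier := SL2Z\<rparr>\<^esub> principal M)"
proof -
  let ?G = "SL2R\<lparr>carrier := SL2Z\<rparr>"
  interpret G: group ?G by (rule subgroup.subgroup_is_group[OF subgroup_SL2Z group_SL2R])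
  have sub: "subgroup (principal M) ?G"
    by (rule SL2R.subgroup_incl[OF subgroup_principal subgroup_SL2Z principal_subset_SL2Z])
  \<comment> \<open>The floor recovers the integers from real entries.\<close>
  define red where "red A = (\<lfloor>A $ 1 $ 1\<rfloor> mod int M, \<lfloor>A $ 1 $ 2\<rfloor> mod int M, \<lfloor>A $ 2 $ 1\<rfloor> mod int M, \<lfloor>A $ 2 $ 2\<rfloor> mod int M)"
    for A :: "real^2^2"
  have eq: "principal M #>\<^bsub>?G\<^esub> A = principal M #>\<^bsub>?G\<^esub> B" if AB: "A \<in> SL2Z" "B \<in> SL2Z" "red A = red B" for A B
  proof -
    obtain a b c d :: int where A: "A = mat2 (of_int a) (of_int b) (of_int c) (of_int d)" "a * d - b * c = 1"
      using AB(1) unfolding SL2Z_iff by blast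
    obtain a' b' c' d' :: int where B: "B = mat2 (of_int a') (of_int b') (of_int c') (of_int d')" "a' * d' - b' * c' = 1"
      using AB(2) unfolding SL2Z_iff by blast
    have "a' mod int M = a mod int M" "b' mod int M = b mod int M" "c' mod int M = c mod int M" "d' mod int M = d mod int M"
      using AB(3) by (simp_all add: red_def A B)
    then obtain x y z w where xyzw: "a' = a + int M * x" "b' = b + int M * y" "c' = c + int M * z" "d' = d + int M * w"
      unfolding mod_eq_dvd_iff by (auto elim!: dvdE simp: algebra_simps) (metis add.commute diff_add_cancel)
    define P where "P = B ** mat2 (of_int d) (of_int (- b)) (of_int (- c)) (of_int a)"
    have ad: "real_of_int a * of_int d - of_int b * of_int c = 1"
      using arg_cong[OF A(2), of real_of_int] by simp
    have "P = mat2 (1 + real M * of_int (x * d - y * c)) (real M * of_int (y * a - x * b))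
        (real M * of_int (z * d - w * c)) (1 + real M * of_int (w * a - z * b))"
      unfolding P_def B(1) mat2_mult xyzw using ad by (intro mat2_eqI) (simp_all add: algebra_simps)
    moreover have "det P = 1"
      using arg_cong[OF A(2), of real_of_int] arg_cong[OF B(2), of real_of_int]
      by (simp add: P_def det_mul B(1) algebra_simps)
    ultimately have P: "P \<in> principal M" unfolding principal_def by blast
    have "mat2 (of_int d) (of_int (- b)) (of_int (- c)) (of_int a) ** A = mat 1"
      unfolding A(1) mat2_mult mat_1_mat2 using ad by (intro mat2_eqI) (simp_all add: algebra_simps)
    then have "B = P ** A" unfolding P_def by (simp flip: matrix_mul_assoc)
    then have "B \<in> principal M #>\<^bsub>?G\<^esub> A" using P by (auto simp: r_coset_def mult_SL2R)
    then show ?thesis using AB(1) by (intro G.repr_independence sub) simp_all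
  qed
  have "rcosets\<^bsub>?G\<^esub> principal M = (\<lambda>A. principal M #>\<^bsub>?G\<^esub> A) ` SL2Z"
    by (auto simp: RCOSETS_def)
  also have "\<dots> \<subseteq> (\<lambda>r. principal M #>\<^bsub>?G\<^esub> (SOME A. A \<in> SL2Z \<and> red A = r)) ` (red ` SL2Z)"
  proof
    fix C assume "C \<in> (\<lambda>A. principal M #>\<^bsub>?G\<^esub> A) ` SL2Z"
    then obtain A where A: "A \<in> SL2Z" "C = principal M #>\<^bsub>?G\<^esub> A" by blast
    define B where "B = (SOME B. B \<in> SL2Z \<and> red B = red A)"
    have "B \<in> SL2Z \<and> red B = red A" unfolding B_def by (rule someI[of _ A]) (use A in simp)
    then have "C = principal M #>\<^bsub>?G\<^esub> B" using eq[of A B] A by simp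
    then show "C \<in> (\<lambda>r. principal M #>\<^bsub>?G\<^esub> (SOME A. A \<in> SL2Z \<and> red A = r)) ` (red ` SL2Z)"
      using A(1) unfolding B_def by blast
  qed
  finally show ?thesis
  proof (rule finite_subset)
    have "red ` SL2Z \<subseteq> {0..<int M} \<times> {0..<int M} \<times> {0..<int M} \<times> {0..<int M}"
      using assms by (auto simp: red_def)
    then have "finite (red ` SL2Z)" by (rule finite_subset) simp
    then show "finite ((\<lambda>r. principal M #>\<^bsub>?G\<^esub> (SOME A. A \<in> SL2Z \<and> red A = r)) ` (red ` SL2Z))" by simp
  qed
qed

text \<open>Fixing the kind of subgroup gives two such functions a common group, so that sums can be
  formed.\<close>

definition congruence_function :: "(complex \<Rightarrow> complex) \<Rightarrow> bool" where
  "congruence_function f \<longleftrightarrow> (\<exists>M>0. weakly_holomorphic_on_group (principal M) f)"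

lemma congruence_imp_weakly_holomorphic:
  assumes "congruence_function f" shows "weakly_holomorphic f"
proof -
  obtain M where "M > 0" "weakly_holomorphic_on_group (principal M) f"
    using assms by (auto simp: congruence_function_def)
  then show ?thesis
    unfolding weakly_holomorphic_def using finite_index_principal
      SL2R.subgroup_incl[OF subgroup_principal subgroup_SL2Z principal_subset_SL2Z] by blast
qed

lemma moebius_mult:
  assumes "of_real (B $ 2 $ 1) * \<tau> + of_real (B $ 2 $ 2) \<noteq> 0"
  shows "moebius A (moebius B \<tau>) = moebius (A ** B) \<tau>"
proof -
  let ?D = "of_real (B $ 2 $ 1) * \<tau> + of_real (B $ 2 $ 2)"
  let ?N = "of_real (B $ 1 $ 1) * \<tau> + of_real (B $ 1 $ 2)"
  have "moebius A (moebius B \<tau>) =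
      (of_real (A $ 1 $ 1) * (?N / ?D) + of_real (A $ 1 $ 2)) / (of_real (A $ 2 $ 1) * (?N / ?D) + of_real (A $ 2 $ 2))"
    by (simp add: moebius_def)
  also have "\<dots> = (?D * (of_real (A $ 1 $ 1) * (?N / ?D) + of_real (A $ 1 $ 2))) /
      (?D * (of_real (A $ 2 $ 1) * (?N / ?D) + of_real (A $ 2 $ 2)))"
    by (rule mult_divide_mult_cancel_left[OF assms, symmetric])
  also have "\<dots> = (of_real (A $ 1 $ 1) * ?N + of_real (A $ 1 $ 2) * ?D) / (of_real (A $ 2 $ 1) * ?N + of_real (A $ 2 $ 2) * ?D)"
  proof -
    have "D * (a * (N / D) + b) = a * N + b * D" if "D \<noteq> 0" for D N a b :: complex
      using that by (simp add: field_simps)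
    from this[OF assms] show ?thesis by (simp only:)
  qed
  also have "\<dots> = moebius (A ** B) \<tau>"
    by (simp add: moebius_def matrix_matrix_mult_def sum_2 algebra_simps)
  finally show ?thesis .
qed

lemma denominator_nonzero:
  assumes "Im \<tau> > 0" "c \<noteq> 0 \<or> d \<noteq> (0::real)"
  shows "of_real c * \<tau> + of_real d \<noteq> 0"
  using assms by (auto simp: complex_eq_iff)

lemma Im_moebius:
  assumes "det A = 1" "Im \<tau> > 0"
  shows "Im (moebius A \<tau>) > 0"
proof -
  have d: "A $ 1 $ 1 * A $ 2 $ 2 - A $ 1 $ 2 * A $ 2 $ 1 = 1" using assms by (simp add: det_2)
  then have "A $ 2 $ 1 \<noteq> 0 \<or> A $ 2 $ 2 \<noteq> 0" by auto
  then have nz: "of_real (A $ 2 $ 1) * \<tau> + of_real (A $ 2 $ 2) \<noteq> 0" using denominator_nonzero assms by blast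
  have "Im (moebius A \<tau>) = (A $ 1 $ 1 * A $ 2 $ 2 - A $ 1 $ 2 * A $ 2 $ 1) * Im \<tau> / (norm (of_real (A $ 2 $ 1) * \<tau> + of_real (A $ 2 $ 2)))\<^sup>2"
    by (simp add: moebius_def Im_divide cmod_power2 algebra_simps)
  then show ?thesis using nz assms d by simp
qed

section \<open>Expansions at the cusp under affine substitution and addition\<close>

lemma meromorphic_at_iinf_cong:
  assumes "meromorphic_at_iinf g" "\<And>\<tau>. Im \<tau> > 0 \<Longrightarrow> f \<tau> = g \<tau>"
  shows "meromorphic_at_iinf f"
  using assms unfolding meromorphic_at_iinf_def upper_half_plane_def by simp

lemma e_cis_power: "e_cis z ^ k = e_cis (of_nat k * z)"
  by (simp add: e_cis_def exp_of_nat_mult[symmetric] mult_ac)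

lemma e_cis_add: "e_cis (z + w) = e_cis z * e_cis w"
  by (simp add: e_cis_def distrib_left exp_add)

text \<open>In the local parameter of width d h the substitution reads z -> w z^a with a root of
  unity w.\<close>

lemma meromorphic_at_iinf_affine:
  fixes b :: int
  assumes g: "meromorphic_at_iinf g" and a: "a > 0" and d: "d > 0"
  shows "meromorphic_at_iinf (\<lambda>\<tau>. g ((of_nat a * \<tau> + of_int b) / of_nat d))"
proof -
  obtain h g' where h: "h > 0" "g' meromorphic_on {0}" and eq: "\<And>\<tau>. Im \<tau> > 0 \<Longrightarrow> g \<tau> = g' (e_cis (\<tau> / of_nat h))"
    using g unfolding meromorphic_at_iinf_def upper_half_plane_def by auto
  define w where "w = e_cis (of_int b / (of_nat d * of_nat h))"
  show ?thesis unfolding meromorphic_at_iinf_def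
  proof (intro exI conjI ballI)
    show "d * h > 0" using d h by simp
    show "(\<lambda>z. g' (w * z ^ a)) meromorphic_on {0}"
      by (rule meromorphic_on_compose[OF h(2)]) (use a in \<open>auto intro!: analytic_intros\<close>)
    fix \<tau> assume "\<tau> \<in> upper_half_plane"
    then have "Im ((of_nat a * \<tau> + of_int b) / of_nat d) > 0" using a d by (simp add: upper_half_plane_def)
    then have "g ((of_nat a * \<tau> + of_int b) / of_nat d) = g' (e_cis ((of_nat a * \<tau> + of_int b) / of_nat d / of_nat h))"
      by (rule eq)
    also have "e_cis ((of_nat a * \<tau> + of_int b) / of_nat d / of_nat h) = w * e_cis (\<tau> / of_nat (d * h)) ^ a"
      unfolding w_def e_cis_power e_cis_add[symmetric] by (simp add: add_divide_distrib add.commute)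
    finally show "g ((of_nat a * \<tau> + of_int b) / of_nat d) = g' (w * e_cis (\<tau> / of_nat (d * h)) ^ a)" .
  qed
qed

text \<open>Two functions may have different widths; raising the local parameter to a power brings
  both to the product of the widths.\<close>

lemma meromorphic_at_iinf_rescale:
  assumes "meromorphic_at_iinf g"
  obtains h g' where "h > 0" "\<And>k. k > 0 \<Longrightarrow> (\<lambda>z. g' (z ^ k)) meromorphic_on {0}"
    "\<And>\<tau> k. Im \<tau> > 0 \<Longrightarrow> k > 0 \<Longrightarrow> g \<tau> = g' (e_cis (\<tau> / of_nat (h * k)) ^ k)"
proof -
  obtain h g' where h: "h > 0" "g' meromorphic_on {0}" and eq: "\<And>\<tau>. Im \<tau> > 0 \<Longrightarrow> g \<tau> = g' (e_cis (\<tau> / of_nat h))"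
    using assms unfolding meromorphic_at_iinf_def upper_half_plane_def by auto
  show thesis
  proof (rule that[OF h(1), of g'])
    show "(\<lambda>z. g' (z ^ k)) meromorphic_on {0}" if "k > 0" for k
      by (rule meromorphic_on_compose[OF h(2)]) (use that in \<open>auto intro!: analytic_intros\<close>)
    show "g \<tau> = g' (e_cis (\<tau> / of_nat (h * k)) ^ k)" if "Im \<tau> > 0" "k > 0" for \<tau> k
      using eq[OF that(1)] that(2) h by (simp add: e_cis_power)
  qed
qed

lemma meromorphic_at_iinf_add:
  assumes "meromorphic_at_iinf f" "meromorphic_at_iinf g"
  shows "meromorphic_at_iinf (\<lambda>\<tau>. f \<tau> + g \<tau>)"
proof -
  obtain h f' where f: "h > 0" "\<And>k. k > 0 \<Longrightarrow> (\<lambda>z. f' (z ^ k)) meromorphic_on {0}"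
    "\<And>\<tau> k. Im \<tau> > 0 \<Longrightarrow> k > 0 \<Longrightarrow> f \<tau> = f' (e_cis (\<tau> / of_nat (h * k)) ^ k)"
    using meromorphic_at_iinf_rescale[OF assms(1)] by metis
  obtain k g' where g: "k > 0" "\<And>l. l > 0 \<Longrightarrow> (\<lambda>z. g' (z ^ l)) meromorphic_on {0}"
    "\<And>\<tau> l. Im \<tau> > 0 \<Longrightarrow> l > 0 \<Longrightarrow> g \<tau> = g' (e_cis (\<tau> / of_nat (k * l)) ^ l)"
    using meromorphic_at_iinf_rescale[OF assms(2)] by metis
  show ?thesis unfolding meromorphic_at_iinf_def upper_half_plane_def
  proof (intro exI conjI ballI)
    show "h * k > 0" using f g by simp
    show "(\<lambda>z. f' (z ^ k) + g' (z ^ h)) meromorphic_on {0}"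
      using f g by (intro meromorphic_intros) auto
    show "f \<tau> + g \<tau> = f' (e_cis (\<tau> / of_nat (h * k)) ^ k) + g' (e_cis (\<tau> / of_nat (h * k)) ^ h)"
      if "\<tau> \<in> {\<tau>. Im \<tau> > 0}" for \<tau>
      using f(3)[of \<tau> k] g(3)[of \<tau> h] that f(1) g(1) by (simp add: mult.commute)
  qed
qed

lemma meromorphic_at_iinf_const: "meromorphic_at_iinf (\<lambda>_. c)"
  unfolding meromorphic_at_iinf_def
  by (intro exI[of _ 1] conjI exI[of _ "\<lambda>_. c"]) (auto intro!: meromorphic_intros)

section \<open>Closure properties of congruence functions\<close>

lemma weakly_holomorphic_on_group_subset:
  "weakly_holomorphic_on_group G f \<Longrightarrow> H \<subseteq> G \<Longrightarrow> weakly_holomorphic_on_group H f"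
  by (auto simp: weakly_holomorphic_on_group_def)

lemma congruence_function_cong:
  assumes f: "congruence_function f" and eq: "\<And>\<tau>. Im \<tau> > 0 \<Longrightarrow> g \<tau> = f \<tau>"
  shows "congruence_function g"
proof -
  obtain M where M: "M > 0" "weakly_holomorphic_on_group (principal M) f"
    using f by (auto simp: congruence_function_def)
  have "g holomorphic_on upper_half_plane"
    using M eq by (auto simp: weakly_holomorphic_on_group_def upper_half_plane_def intro: holomorphic_transform)
  moreover have "g (moebius \<gamma> \<tau>) = g \<tau>" if "\<gamma> \<in> principal M" "\<tau> \<in> upper_half_plane" for \<gamma> \<tau>
    using that M(2) eq Im_moebius[of \<gamma> \<tau>] by (auto simp: weakly_holomorphic_on_group_def upper_half_plane_def principal_def)
  moreover have "meromorphic_at_iinf (\<lambda>\<tau>. g (moebius \<alpha> \<tau>))" if "\<alpha> \<in> SL2Z" for \<alpha>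
    by (rule meromorphic_at_iinf_cong[of "\<lambda>\<tau>. f (moebius \<alpha> \<tau>)"])
       (use that M(2) eq Im_moebius in \<open>auto simp: weakly_holomorphic_on_group_def SL2Z_def\<close>)
  ultimately show ?thesis using M(1) unfolding congruence_function_def weakly_holomorphic_on_group_def by blast
qed

lemma congruence_function_add:
  assumes "congruence_function f" "congruence_function g"
  shows "congruence_function (\<lambda>\<tau>. f \<tau> + g \<tau>)"
proof -
  obtain M where M: "M > 0" "weakly_holomorphic_on_group (principal M) f"
    using assms by (auto simp: congruence_function_def)
  obtain M' where M': "M' > 0" "weakly_holomorphic_on_group (principal M') g"
    using assms by (auto simp: congruence_function_def)
  have "weakly_holomorphic_on_group (principal (M * M')) f" "weakly_holomorphic_on_group (principal (M * M')) g"
    using weakly_holomorphic_on_group_subset[OF M(2)] weakly_holomorphic_on_group_subset[OF M'(2)] principal_mono by simp_all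
  then have "weakly_holomorphic_on_group (principal (M * M')) (\<lambda>\<tau>. f \<tau> + g \<tau>)"
    by (auto simp: weakly_holomorphic_on_group_def intro!: holomorphic_intros meromorphic_at_iinf_add)
  then show ?thesis using M(1) M'(1) unfolding congruence_function_def by (intro exI[of _ "M * M'"]) simp
qed

lemma congruence_function_const: "congruence_function (\<lambda>_. c)"
  unfolding congruence_function_def weakly_holomorphic_on_group_def
  by (intro exI[of _ 1]) (auto intro!: holomorphic_intros meromorphic_at_iinf_const)

lemma congruence_function_sum:
  assumes "\<And>i. i \<in> I \<Longrightarrow> congruence_function (f i)"
  shows "congruence_function (\<lambda>\<tau>. \<Sum>i\<in>I. f i \<tau>)"
  using assms
  by (induction I rule: infinite_finite_induct)
     (auto intro: congruence_function_const congruence_function_add)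

text \<open>Divide the first column by its gcd and complete it to a matrix of determinant 1. This
  moves an affine substitution past a cusp matrix, so that the expansion of the composite is one of
  f at another cusp.\<close>

lemma hermite_form:
  fixes x y z w :: int
  assumes D: "x * w - y * z > 0"
  obtains \<alpha> a b d where "\<alpha> \<in> SL2Z" "a > 0" "d > 0"
    "mat2 (of_int x) (of_int y) (of_int z) (of_int w) = \<alpha> ** mat2 (real a) (of_int b) 0 (real d)"
proof -
  define g where "g = gcd x z"
  have "x \<noteq> 0 \<or> z \<noteq> 0" using D by auto
  then have g: "g > 0" by (simp add: g_def)
  obtain x0 z0 where xz: "x = g * x0" "z = g * z0" unfolding g_def by (meson dvd_def gcd_dvd1 gcd_dvd2)
  obtain u v where "u * x + v * z = g" unfolding g_def using bezout_int by blast
  then have "g * (u * x0 + v * z0) = g * 1" by (simp add: xz algebra_simps)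
  then have uv: "u * x0 + v * z0 = 1" using g by simp
  define d where "d = x0 * w - z0 * y"
  have "g * d > 0" using D by (simp add: d_def xz algebra_simps)
  then have d: "d > 0" using g by (simp add: zero_less_mult_iff)
  define b where "b = u * y + v * w"
  have e: "y = x0 * b - v * d" "w = z0 * b + u * d"
  proof -
    have "x0 * b - v * d = y * (u * x0 + v * z0)" "z0 * b + u * d = w * (u * x0 + v * z0)"
      by (simp_all add: b_def d_def algebra_simps)
    then show "y = x0 * b - v * d" "w = z0 * b + u * d" by (simp_all add: uv)
  qed
  have e': "y = b * x0 - d * v" "w = b * z0 + d * u" using e by (simp_all add: mult.commute)
  show thesis
  proof (rule that)
    show "mat2 (of_int x0) (of_int (- v)) (of_int z0) (of_int u) \<in> SL2Z"
      using uv by (intro SL2ZI) (simp add: algebra_simps)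
    show "nat g > 0" "nat d > 0" using g d by simp_all
    show "mat2 (of_int x) (of_int y) (of_int z) (of_int w) =
        mat2 (of_int x0) (of_int (- v)) (of_int z0) (of_int u) ** mat2 (real (nat g)) (of_int b) 0 (real (nat d))"
    proof -
      have "real (nat g) = of_int g" "real (nat d) = of_int d" using g d by simp_all
      then show ?thesis unfolding mat2_mult
        by (intro mat2_eqI) (simp_all add: xz(1), simp_all add: xz(2) mult.commute
          flip: of_int_mult of_int_diff of_int_add of_int_minus, (rule e')+)
    qed
  qed
qed

text \<open>The modulus grows by a d, the determinant of the substitution, which pays for the
  denominators of conjugation by it.\<close>

lemma congruence_function_affine:
  fixes b :: int
  assumes f: "congruence_function f" and a: "a > 0" and d: "d > 0"
  shows "congruence_function (\<lambda>\<tau>. f ((of_nat a * \<tau> + of_int b) / of_nat d))"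
proof -
  obtain M where M: "M > 0" "weakly_holomorphic_on_group (principal M) f"
    using f by (auto simp: congruence_function_def)
  have hol: "f holomorphic_on upper_half_plane"
    and inv: "\<And>\<gamma> \<tau>. \<gamma> \<in> principal M \<Longrightarrow> Im \<tau> > 0 \<Longrightarrow> f (moebius \<gamma> \<tau>) = f \<tau>"
    and cusp: "\<And>\<alpha>. \<alpha> \<in> SL2Z \<Longrightarrow> meromorphic_at_iinf (\<lambda>\<tau>. f (moebius \<alpha> \<tau>))"
    using M(2) by (auto simp: weakly_holomorphic_on_group_def upper_half_plane_def)
  define \<delta> where "\<delta> = mat2 (real a) (of_int b) 0 (real d)"
  have del: "moebius \<delta> \<tau> = (of_nat a * \<tau> + of_int b) / of_nat d" for \<tau>
    by (simp add: moebius_def \<delta>_def)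
  have Im_del: "Im (moebius \<delta> \<tau>) > 0" if "Im \<tau> > 0" for \<tau> using that a d by (simp add: del)
  have "weakly_holomorphic_on_group (principal (M * (a * d))) (\<lambda>\<tau>. f (moebius \<delta> \<tau>))"
    unfolding weakly_holomorphic_on_group_def
  proof (intro conjI ballI)
    have "(\<lambda>\<tau>. moebius \<delta> \<tau>) holomorphic_on upper_half_plane"
      unfolding del using d by (intro holomorphic_intros) auto
    moreover have "moebius \<delta> ` upper_half_plane \<subseteq> upper_half_plane" using Im_del by (auto simp: upper_half_plane_def)
    ultimately show "(\<lambda>\<tau>. f (moebius \<delta> \<tau>)) holomorphic_on upper_half_plane"
      using holomorphic_on_compose_gen[OF _ hol, of "moebius \<delta>"] by (simp add: o_def)
  next
    fix \<gamma> \<tau> assume \<gamma>: "\<gamma> \<in> principal (M * (a * d))" and tau: "\<tau> \<in> upper_half_plane"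
    have tau: "Im \<tau> > 0" using tau by (simp add: upper_half_plane_def)
    obtain p q r t :: int where g: "det \<gamma> = 1"
      "\<gamma> = mat2 (1 + real (M * (a * d)) * of_int p) (real (M * (a * d)) * of_int q)
        (real (M * (a * d)) * of_int r) (1 + real (M * (a * d)) * of_int t)"
      using \<gamma> by (auto simp: principal_def)
    define A D where "A = int a" and "D = int d"
    \<comment> \<open>This is \<delta> \<gamma> \<delta>^-1 written out.\<close>
    define \<gamma>' where "\<gamma>' = mat2 (1 + real M * of_int (A * D * p + D * b * r))
      (real M * of_int (A * A * q + A * b * t - A * b * p - b * b * r))
      (real M * of_int (D * D * r)) (1 + real M * of_int (A * D * t - b * D * r))"
    have comm: "\<gamma>' ** \<delta> = \<delta> ** \<gamma>"
      unfolding \<gamma>'_def \<delta>_def g(2) mat2_mult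
      by (rule mat2_eqI) (simp_all add: A_def D_def algebra_simps)
    have "det \<gamma>' * det \<delta> = det \<delta> * det \<gamma>" using arg_cong[OF comm, of det] by (simp add: det_mul)
    moreover have "det \<delta> \<noteq> 0" using a d by (simp add: \<delta>_def)
    ultimately have "det \<gamma>' = 1" using g(1) by simp
    then have g': "\<gamma>' \<in> principal M" unfolding principal_def \<gamma>'_def by blast
    have nz: "of_real (\<delta> $ 2 $ 1) * \<tau> + of_real (\<delta> $ 2 $ 2) \<noteq> 0" using d by (simp add: \<delta>_def)
    have "\<gamma> $ 2 $ 1 \<noteq> 0 \<or> \<gamma> $ 2 $ 2 \<noteq> 0" using g(1) by (auto simp: det_2)
    then have nz': "of_real (\<gamma> $ 2 $ 1) * \<tau> + of_real (\<gamma> $ 2 $ 2) \<noteq> 0" by (rule denominator_nonzero[OF tau])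
    have "moebius \<delta> (moebius \<gamma> \<tau>) = moebius \<gamma>' (moebius \<delta> \<tau>)"
      unfolding moebius_mult[OF nz] moebius_mult[OF nz'] comm ..
    then show "f (moebius \<delta> (moebius \<gamma> \<tau>)) = f (moebius \<delta> \<tau>)"
      using inv[OF g' Im_del[OF tau]] by simp
  next
    fix \<alpha> assume \<alpha>: "\<alpha> \<in> SL2Z"
    then obtain x y z w :: int where al: "\<alpha> = mat2 (of_int x) (of_int y) (of_int z) (of_int w)" "x * w - y * z = 1"
      unfolding SL2Z_iff by blast
    define A D where "A = int a" and "D = int d"
    have prod: "\<delta> ** \<alpha> = mat2 (of_int (A * x + b * z)) (of_int (A * y + b * w)) (of_int (D * z)) (of_int (D * w))"
      unfolding \<delta>_def al(1) mat2_mult by (simp add: A_def D_def)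
    have "(A * x + b * z) * (D * w) - (A * y + b * w) * (D * z) = A * D * (x * w - y * z)"
      by (simp add: algebra_simps)
    also have "\<dots> > 0" using a d by (simp add: al(2) A_def D_def)
    finally have pos: "(A * x + b * z) * (D * w) - (A * y + b * w) * (D * z) > 0" .
    obtain \<alpha>' a' b' d' where H: "\<alpha>' \<in> SL2Z" "a' > 0" "d' > 0"
      "mat2 (of_int (A * x + b * z)) (of_int (A * y + b * w)) (of_int (D * z)) (of_int (D * w)) = \<alpha>' ** mat2 (real a') (of_int b') 0 (real d')"
      by (rule hermite_form[OF pos])
    show "meromorphic_at_iinf (\<lambda>\<tau>. f (moebius \<delta> (moebius \<alpha> \<tau>)))"
    proof (rule meromorphic_at_iinf_cong)
      show "meromorphic_at_iinf (\<lambda>\<tau>. f (moebius \<alpha>' ((of_nat a' * \<tau> + of_int b') / of_nat d')))"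
        by (rule meromorphic_at_iinf_affine[OF cusp[OF H(1)] H(2,3)])
      fix \<tau> :: complex assume tau: "Im \<tau> > 0"
      have "\<alpha> $ 2 $ 1 \<noteq> 0 \<or> \<alpha> $ 2 $ 2 \<noteq> 0" using al by auto
      then have nz: "of_real (\<alpha> $ 2 $ 1) * \<tau> + of_real (\<alpha> $ 2 $ 2) \<noteq> 0" by (rule denominator_nonzero[OF tau])
      let ?\<delta>' = "mat2 (real a') (of_int b') 0 (real d')"
      have nz': "of_real (?\<delta>' $ 2 $ 1) * \<tau> + of_real (?\<delta>' $ 2 $ 2) \<noteq> 0" using H(3) by simp
      have "moebius \<delta> (moebius \<alpha> \<tau>) = moebius \<alpha>' (moebius ?\<delta>' \<tau>)"
        unfolding moebius_mult[OF nz] moebius_mult[OF nz'] prod H(4) ..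
      also have "moebius ?\<delta>' \<tau> = (of_nat a' * \<tau> + of_int b') / of_nat d'" by (simp add: moebius_def)
      finally show "f (moebius \<delta> (moebius \<alpha> \<tau>)) = f (moebius \<alpha>' ((of_nat a' * \<tau> + of_int b') / of_nat d'))" by simp
    qed
  qed
  then show ?thesis
    using M(1) a d unfolding congruence_function_def del by (intro exI[of _ "M * (a * d)"]) simp
qed

section \<open>Composition of Hecke operators\<close>

text \<open>\<open>T(p^k)\<close> evaluates at the plicates of a level, so it cannot act on a single
  function; it acts on a function of the level. This form makes composition meaningful.\<close>

definition hecke_family :: "nat \<Rightarrow> nat \<Rightarrow> (level \<Rightarrow> complex \<Rightarrow> complex) \<Rightarrow> level \<Rightarrow> complex \<Rightarrow> complex" where
  "hecke_family p k F L \<tau> =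
     (\<Sum>i\<le>k. U_star (p ^ (k - i)) (F ((plicate_prime p ^^ i) L)) (of_nat (p ^ i) * \<tau>))"

lemma U_star_1 [simp]: "U_star (Suc 0) f z = f z"
  by (simp add: U_star_def)

lemma sum_residues:
  fixes g :: "nat \<Rightarrow> complex"
  shows "(\<Sum>j<l * m. g j) = (\<Sum>\<beta><l. \<Sum>b<m. g (\<beta> * m + b))"
proof -
  have "sum g {\<beta> * m..<\<beta> * m + m} = (\<Sum>b<m. g (\<beta> * m + b))" for \<beta>
    using sum.shift_bounds_nat_ivl[of g 0 "\<beta> * m" m] by (simp add: lessThan_atLeast0 add.commute)
  then show ?thesis by (simp only: sum.nat_group[symmetric])
qed

lemma U_star_U_star:
  assumes "m > 0" "l > 0"
  shows "U_star m (U_star l f) z = U_star (l * m) f z"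
proof -
  have "((z + of_nat b) / of_nat m + of_nat \<beta>) / of_nat l = (z + of_nat (\<beta> * m + b)) / of_nat (l * m)" for b \<beta>
    using assms by (simp add: field_simps)
  then have "U_star m (U_star l f) z = (\<Sum>b<m. \<Sum>\<beta><l. f ((z + of_nat (\<beta> * m + b)) / of_nat (l * m)))"
    unfolding U_star_def by simp
  also have "\<dots> = U_star (l * m) f z"
    unfolding U_star_def sum_residues by (rule sum.swap)
  finally show ?thesis .
qed

text \<open>Multiplication by l turns the shift \<beta> m + b into b / m plus the integer \<beta>,
  so by periodicity each value occurs l times.\<close>

lemma U_star_dilate:
  assumes "m > 0" "l > 0" and per: "\<And>w. Im w > 0 \<Longrightarrow> g (w + 1) = g w" and z: "Im z > 0"
  shows "U_star (l * m) (\<lambda>w. g (of_nat l * w)) z = of_nat l * U_star m g z"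
proof -
  have per: "g (w + of_nat \<beta>) = g w" if "Im w > 0" for w \<beta>
  proof (induction \<beta>)
    case (Suc \<beta>)
    then show ?case using per[of "w + of_nat \<beta>"] that by (simp add: add_ac)
  qed simp
  have "of_nat l * ((z + of_nat (\<beta> * m + b)) / of_nat (l * m)) = (z + of_nat b) / of_nat m + of_nat \<beta>" for b \<beta>
    using assms by (simp add: field_simps)
  then have "g (of_nat l * ((z + of_nat (\<beta> * m + b)) / of_nat (l * m))) = g ((z + of_nat b) / of_nat m)" for b \<beta>
    using per[of "(z + of_nat b) / of_nat m" \<beta>] z assms(1) by (simp only:) simp
  then show ?thesis unfolding U_star_def sum_residues by (simp only: sum_constant card_lessThan)
qed

lemma U_star_add: "U_star m (\<lambda>w. f w + g w) z = U_star m f z + U_star m g z"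
  by (simp add: U_star_def sum.distrib)

lemma U_star_cong:
  assumes "\<And>w. Im w > 0 \<Longrightarrow> f w = g w" "Im z > 0" "m > 0"
  shows "U_star m f z = U_star m g z"
  unfolding U_star_def using assms by (intro sum.cong refl assms(1)) simp

lemma hecke_family_1: "hecke_family p 1 F L \<tau> = U_star p (F L) \<tau> + F (plicate_prime p L) (of_nat p * \<tau>)"
  by (simp add: hecke_family_def)

lemma hecke_family_cong:
  assumes "\<And>i w. Im w > 0 \<Longrightarrow> F ((plicate_prime p ^^ i) L) w = G ((plicate_prime p ^^ i) L) w" "Im \<tau> > 0" "p > 0"
  shows "hecke_family p k F L \<tau> = hecke_family p k G L \<tau>"
  unfolding hecke_family_def using assms by (intro sum.cong refl U_star_cong) auto

text \<open>The classical recursion. Averages of averages lengthen to the terms of exponent k + 1.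
  Averages of the dilated functions collapse by \<open>U_star_dilate\<close> to p times a term of
  exponent k - 1 at the plicate, except for the last, which completes the former sum.\<close>

lemma hecke_family_compose:
  assumes p: "prime p" and tau: "Im \<tau> > 0"
    and per: "\<And>i w. Im w > 0 \<Longrightarrow> F ((plicate_prime p ^^ i) L) (w + 1) = F ((plicate_prime p ^^ i) L) w"
  shows "hecke_family p k (hecke_family p 1 F) L \<tau> = hecke_family p (Suc k) F L \<tau> +
    (if k = 0 then 0 else of_nat p * hecke_family p (k - 1) F (plicate_prime p L) \<tau>)"
proof -
  have pp: "p > 0" using p by (simp add: prime_gt_0_nat)
  define Li where "Li i = (plicate_prime p ^^ i) L" for i
  have Suc_Li: "plicate_prime p (Li i) = Li (Suc i)" "(plicate_prime p ^^ i) (plicate_prime p L) = Li (Suc i)" for i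
    by (simp_all add: Li_def funpow_swap1)
  define g where "g i = U_star (p ^ (k - i)) (\<lambda>w. F (Li (Suc i)) (of_nat p * w)) (of_nat (p ^ i) * \<tau>)" for i
  have "hecke_family p k (hecke_family p 1 F) L \<tau> =
      (\<Sum>i\<le>k. U_star (p ^ (k - i)) (U_star p (F (Li i))) (of_nat (p ^ i) * \<tau>) + g i)"
    unfolding hecke_family_def[of p k] Li_def[symmetric] hecke_family_1 Suc_Li U_star_add g_def
    by (simp add: hecke_family_1 U_star_add Suc_Li[unfolded One_nat_def] flip: One_nat_def)
  also have "\<dots> = (\<Sum>i\<le>k. U_star (p ^ (Suc k - i)) (F (Li i)) (of_nat (p ^ i) * \<tau>)) + (\<Sum>i\<le>k. g i)"
    unfolding sum.distrib using pp
    by (intro arg_cong2[of _ _ _ _ "(+)"] sum.cong refl) (simp add: U_star_U_star Suc_diff_le)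
  also have "(\<Sum>i\<le>k. g i) = F (Li (Suc k)) (of_nat (p ^ Suc k) * \<tau>) +
      (if k = 0 then 0 else of_nat p * hecke_family p (k - 1) F (plicate_prime p L) \<tau>)"
  proof -
    have "g k = F (Li (Suc k)) (of_nat (p ^ Suc k) * \<tau>)" by (simp add: g_def mult.assoc)
    moreover have "(\<Sum>i<k. g i) = (if k = 0 then 0 else of_nat p * hecke_family p (k - 1) F (plicate_prime p L) \<tau>)"
    proof (cases k)
      case (Suc m)
      have "g i = of_nat p * U_star (p ^ (m - i)) (F (Li (Suc i))) (of_nat (p ^ i) * \<tau>)" if "i \<le> m" for i
      proof -
        have "p ^ (k - i) = p * p ^ (m - i)" using that Suc by (simp add: Suc_diff_le)
        moreover have "Im (of_nat (p ^ i) * \<tau>) > 0"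
          using tau pp by (simp del: of_nat_power)
        ultimately show ?thesis
          unfolding g_def using U_star_dilate[of "p ^ (m - i)" p "F (Li (Suc i))" "of_nat (p ^ i) * \<tau>"] per[of _ "Suc i"] pp
          by (simp add: Li_def)
      qed
      then have "(\<Sum>i\<le>m. g i) = of_nat p * (\<Sum>i\<le>m. U_star (p ^ (m - i)) (F (Li (Suc i))) (of_nat (p ^ i) * \<tau>))"
        unfolding sum_distrib_left by (intro sum.cong) auto
      then show ?thesis by (simp add: Suc hecke_family_def Suc_Li lessThan_Suc_atMost)
    qed simp
    ultimately show ?thesis by (simp add: lessThan_Suc_atMost[symmetric])
  qed
  also have "(\<Sum>i\<le>k. U_star (p ^ (Suc k - i)) (F (Li i)) (of_nat (p ^ i) * \<tau>)) + (F (Li (Suc k)) (of_nat (p ^ Suc k) * \<tau>) +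
      (if k = 0 then 0 else of_nat p * hecke_family p (k - 1) F (plicate_prime p L) \<tau>)) =
      hecke_family p (Suc k) F L \<tau> + (if k = 0 then 0 else of_nat p * hecke_family p (k - 1) F (plicate_prime p L) \<tau>)"
    by (simp add: hecke_family_def Li_def)
  finally show ?thesis .
qed

lemma hecke_family_linear:
  "hecke_family p k (\<lambda>L \<tau>. \<Sum>j\<in>A. c j * F j L \<tau>) L \<tau> = (\<Sum>j\<in>A. c j * hecke_family p k (F j) L \<tau>)"
proof -
  have U: "U_star m (\<lambda>w. \<Sum>j\<in>A. c j * G j w) z = (\<Sum>j\<in>A. c j * U_star m (G j) z)" for m and G :: "_ \<Rightarrow> complex \<Rightarrow> complex" and z
    unfolding U_star_def sum_distrib_left by (rule sum.swap)
  show ?thesis unfolding hecke_family_def U sum_distrib_left by (rule sum.swap)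
qed

text \<open>Apply exponent m to the relation for p. The terms of index p n with i > 0 cancel against
  the correction of the recursion; what is left is the leading term and the contribution of n / p.
  The recursion reaches back two steps, hence strong induction.\<close>

lemma hecke_family_niebur_j:
  assumes p: "prime p"
  shows "good_level L \<Longrightarrow> n > 0 \<Longrightarrow> Im \<tau> > 0 \<Longrightarrow> hecke_family p k (\<lambda>L. niebur_j L n) L \<tau> =
    (\<Sum>i\<le>k. if p ^ i dvd n then of_nat (p ^ i) * niebur_j ((plicate_prime p ^^ i) L) (p ^ (k - i) * (n div p ^ i)) \<tau> else 0)"
proof (induction k arbitrary: L n \<tau> rule: less_induct)
  case (less k)
  note good = less.prems(1) and n = less.prems(2) and tau = less.prems(3)
  have pp: "p > 0" using p by (simp add: prime_gt_0_nat)
  let ?D = "plicate_prime p"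
  show ?case
  proof (cases k)
    case 0
    then show ?thesis by (simp add: hecke_family_def)
  next
    case (Suc m)
    define T where "T l n' L' = hecke_family p l (\<lambda>L. niebur_j L n') L' \<tau>" for l n' L'
    have goodD: "good_level (?D L)" by (rule good_plicate_prime[OF good p])
    have D_funpow: "(?D ^^ i) (?D L) = (?D ^^ Suc i) L" for i by (simp add: funpow_swap1)
    have ndiv: "n div p > 0" if "p dvd n" using that n pp by (simp add: dvd_imp_le div_greater_zero_iff)
    \<comment> \<open>The two terms of the relation are indexed by a truth value to fit
      \<open>hecke_family_linear\<close>; the coefficient 0 stands for p not dividing n.\<close>
    have "hecke_family p m (hecke_family p 1 (\<lambda>L. niebur_j L n)) L \<tau> =
        hecke_family p m (\<lambda>L \<tau>. \<Sum>b\<in>{False, True}. (if b then (if p dvd n then of_nat p else 0) else 1) *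
          (if b then niebur_j (?D L) (n div p) \<tau> else niebur_j L (p * n) \<tau>)) L \<tau>"
    proof (rule hecke_family_cong[OF _ tau pp])
      fix i w assume w: "Im (w :: complex) > 0"
      show "hecke_family p 1 (\<lambda>L. niebur_j L n) ((?D ^^ i) L) w =
        (\<Sum>b\<in>{False, True}. (if b then (if p dvd n then of_nat p else 0) else 1) *
          (if b then niebur_j (?D ((?D ^^ i) L)) (n div p) w else niebur_j ((?D ^^ i) L) (p * n) w))"
        unfolding hecke_family_1 niebur_j_hecke[OF good_plicate_funpow[OF good p] p n w] by simp
    qed
    also have "\<dots> = T m (p * n) L + (if p dvd n then of_nat p * T m (n div p) (?D L) else 0)"
      unfolding hecke_family_linear by (simp add: T_def hecke_family_def funpow_swap1)
    finally have "T (Suc m) n L + (if m = 0 then 0 else of_nat p * T (m - 1) n (?D L)) =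
        T m (p * n) L + (if p dvd n then of_nat p * T m (n div p) (?D L) else 0)"
      unfolding T_def
      by (subst (asm) hecke_family_compose[OF p tau])
         (auto intro: niebur_j_periodic[OF good_plicate_funpow[OF good p] n])
    moreover have "T m (p * n) L = niebur_j L (p ^ Suc m * n) \<tau> + (if m = 0 then 0 else of_nat p * T (m - 1) n (?D L))"
    proof -
      have "T m (p * n) L = (\<Sum>i\<le>m. if p ^ i dvd p * n then of_nat (p ^ i) * niebur_j ((?D ^^ i) L) (p ^ (m - i) * (p * n div p ^ i)) \<tau> else 0)"
        unfolding T_def using Suc n pp by (intro less.IH good tau) auto
      also have "\<dots> = niebur_j L (p ^ Suc m * n) \<tau> + (if m = 0 then 0 else of_nat p * T (m - 1) n (?D L))"
      proof (cases m)
        case (Suc l)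
        have "T l n (?D L) = (\<Sum>i\<le>l. if p ^ i dvd n then of_nat (p ^ i) * niebur_j ((?D ^^ i) (?D L)) (p ^ (l - i) * (n div p ^ i)) \<tau> else 0)"
          unfolding T_def using \<open>k = Suc m\<close> Suc by (intro less.IH goodD n tau) auto
        then show ?thesis
          unfolding Suc sum.atMost_Suc_shift D_funpow using pp
          by (simp add: sum_distrib_left if_distrib[of "\<lambda>x. of_nat p * x"] mult_ac cong: if_cong)
      qed (simp)
      finally show ?thesis .
    qed
    moreover have "(if p dvd n then of_nat p * T m (n div p) (?D L) else 0) =
        (\<Sum>i\<le>m. if p ^ Suc i dvd n then of_nat (p ^ Suc i) * niebur_j ((?D ^^ Suc i) L) (p ^ (m - i) * (n div p ^ Suc i)) \<tau> else 0)"
    proof (cases "p dvd n")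
      case True
      then obtain n' where n': "n = p * n'" by blast
      have "T m (n div p) (?D L) = (\<Sum>i\<le>m. if p ^ i dvd n div p then of_nat (p ^ i) * niebur_j ((?D ^^ i) (?D L)) (p ^ (m - i) * (n div p div p ^ i)) \<tau> else 0)"
        unfolding T_def using Suc ndiv[OF True] by (intro less.IH goodD tau) auto
      then show ?thesis using True pp
        unfolding D_funpow by (simp add: n' sum_distrib_left if_distrib[of "\<lambda>x. of_nat p * x"] mult_ac cong: if_cong)
    next
      case False
      then have "\<not> p ^ Suc i dvd n" for i by (metis dvd_mult_left power_Suc)
      then show ?thesis using False by simp
    qed
    ultimately have "T (Suc m) n L = niebur_j L (p ^ Suc m * n) \<tau> +
        (\<Sum>i\<le>m. if p ^ Suc i dvd n then of_nat (p ^ Suc i) * niebur_j ((?D ^^ Suc i) L) (p ^ (m - i) * (n div p ^ Suc i)) \<tau> else 0)"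
      by simp
    then show ?thesis unfolding Suc T_def sum.atMost_Suc_shift diff_Suc_Suc by simp
  qed
qed

section \<open>Equality up to constants and chains of operators\<close>

text \<open>\<open>niebur_J\<close> and \<open>niebur_j\<close> differ by a constant whose value is
  never determined, and the relations hold on the upper half-plane only.\<close>

definition eq_const :: "(complex \<Rightarrow> complex) \<Rightarrow> (complex \<Rightarrow> complex) \<Rightarrow> bool" where
  "eq_const f g \<longleftrightarrow> (\<exists>c. \<forall>\<tau>. Im \<tau> > 0 \<longrightarrow> f \<tau> = g \<tau> + c)"

lemma eq_constI: "(\<And>\<tau>. Im \<tau> > 0 \<Longrightarrow> f \<tau> = g \<tau> + c) \<Longrightarrow> eq_const f g"
  unfolding eq_const_def by blast

lemma eq_const_refl: "eq_const f f"
  by (rule eq_constI[of _ _ 0]) simp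

lemma eq_const_sym: "eq_const f g \<Longrightarrow> eq_const g f"
  unfolding eq_const_def by (metis add_diff_cancel_right' diff_add_cancel uminus_add_conv_diff add.commute diff_conv_add_uminus)

lemma eq_const_trans:
  assumes "eq_const f g" "eq_const g h" shows "eq_const f h"
proof -
  obtain c d where "\<And>\<tau>. Im \<tau> > 0 \<Longrightarrow> f \<tau> = g \<tau> + c" "\<And>\<tau>. Im \<tau> > 0 \<Longrightarrow> g \<tau> = h \<tau> + d"
    using assms unfolding eq_const_def by blast
  then show ?thesis by (intro eq_constI[of _ _ "d + c"]) simp
qed

lemma eq_const_sum:
  assumes "\<And>j. j \<in> A \<Longrightarrow> eq_const (f j) (g j)"
  shows "eq_const (\<lambda>\<tau>. \<Sum>j\<in>A. c j * f j \<tau>) (\<lambda>\<tau>. \<Sum>j\<in>A. c j * g j \<tau>)"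
proof -
  obtain d where "\<And>j \<tau>. j \<in> A \<Longrightarrow> Im \<tau> > 0 \<Longrightarrow> f j \<tau> = g j \<tau> + d j"
    using assms unfolding eq_const_def by metis
  then have "(\<Sum>j\<in>A. c j * f j \<tau>) = (\<Sum>j\<in>A. c j * g j \<tau>) + (\<Sum>j\<in>A. c j * d j)" if "Im \<tau> > 0" for \<tau>
    using that by (simp add: distrib_left flip: sum.distrib)
  then show ?thesis by (rule eq_constI)
qed

lemma eq_const_U_star:
  assumes "eq_const f g" "m > 0" "a > 0"
  shows "eq_const (\<lambda>\<tau>. U_star m f (of_nat a * \<tau>)) (\<lambda>\<tau>. U_star m g (of_nat a * \<tau>))"
proof -
  obtain c where c: "\<And>\<tau>. Im \<tau> > 0 \<Longrightarrow> f \<tau> = g \<tau> + c" using assms unfolding eq_const_def by blast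
  show ?thesis
    by (rule eq_constI[of _ _ "of_nat m * c"]) (use assms c in \<open>simp add: U_star_def sum.distrib\<close>)
qed

lemma eq_const_hecke_family:
  assumes "\<And>i. eq_const (F ((plicate_prime p ^^ i) L)) (G ((plicate_prime p ^^ i) L))" "p > 0"
  shows "eq_const (hecke_family p k F L) (hecke_family p k G L)"
  unfolding hecke_family_def[abs_def]
  using eq_const_sum[of "{..k}" "\<lambda>i \<tau>. U_star (p ^ (k - i)) (F ((plicate_prime p ^^ i) L)) (of_nat (p ^ i) * \<tau>)"
    "\<lambda>i \<tau>. U_star (p ^ (k - i)) (G ((plicate_prime p ^^ i) L)) (of_nat (p ^ i) * \<tau>)" "\<lambda>_. 1"]
    eq_const_U_star[OF assms(1)] assms(2) by (simp del: of_nat_power)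

text \<open>The counterpart of \<open>hecke_J_list\<close> without expansion into single functions,
  applicable to a whole linear combination.\<close>

fun hecke_chain :: "(nat \<times> nat) list \<Rightarrow> (level \<Rightarrow> complex \<Rightarrow> complex) \<Rightarrow> level \<Rightarrow> complex \<Rightarrow> complex" where
  "hecke_chain [] F = F"
| "hecke_chain ((p, k) # xs) F = hecke_chain xs (hecke_family p k F)"

lemma hecke_chain_eq_const:
  assumes "\<And>p k. (p, k) \<in> set xs \<Longrightarrow> prime p" "\<And>L. good_level L \<Longrightarrow> eq_const (F L) (G L)" "good_level L"
  shows "eq_const (hecke_chain xs F L) (hecke_chain xs G L)"
  using assms
proof (induction xs arbitrary: F G)
  case (Cons x xs)
  obtain p k where x: "x = (p, k)" by (metis prod.exhaust)
  have p: "prime p" using Cons.prems(1)[of p k] x by simp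
  have "eq_const (hecke_family p k F L') (hecke_family p k G L')" if "good_level L'" for L'
    using Cons.prems(2) good_plicate_funpow[OF that p] prime_gt_0_nat[OF p] by (intro eq_const_hecke_family) auto
  then show ?case unfolding x hecke_chain.simps
    by (intro Cons.IH Cons.prems(3)) (meson Cons.prems(1) list.set_intros(2))
qed simp

lemma hecke_chain_linear:
  "hecke_chain xs (\<lambda>L \<tau>. \<Sum>j\<in>A. c j * F j L \<tau>) = (\<lambda>L \<tau>. \<Sum>j\<in>A. c j * hecke_chain xs (F j) L \<tau>)"
proof (induction xs arbitrary: F)
  case (Cons x xs)
  obtain p k where x: "x = (p, k)" by (metis prod.exhaust)
  have "hecke_family p k (\<lambda>L \<tau>. \<Sum>j\<in>A. c j * F j L \<tau>) = (\<lambda>L \<tau>. \<Sum>j\<in>A. c j * hecke_family p k (F j) L \<tau>)"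
    by (intro ext hecke_family_linear)
  then show ?case by (simp only: x hecke_chain.simps Cons.IH)
qed simp

lemma plicate_funpow_commute:
  assumes "prime p" "prime q"
  shows "(plicate_prime p ^^ i) ((plicate_prime q ^^ j) L) = (plicate_prime q ^^ j) ((plicate_prime p ^^ i) L)"
proof -
  have 1: "plicate_prime p ((plicate_prime q ^^ j) L) = (plicate_prime q ^^ j) (plicate_prime p L)" for L
    by (induction j) (simp_all add: plicate_prime_commute[OF assms])
  show ?thesis by (induction i) (simp_all add: 1)
qed

text \<open>Commuting prime steps let plication pass through every operator. It is used to collect
  terms that live at different plicates under one chain.\<close>

lemma hecke_chain_shift:
  assumes "\<And>p k. (p, k) \<in> set xs \<Longrightarrow> prime p" "prime q"
  shows "hecke_chain xs (\<lambda>L. F ((plicate_prime q ^^ i) L)) L = hecke_chain xs F ((plicate_prime q ^^ i) L)"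
  using assms
proof (induction xs arbitrary: F)
  case (Cons x xs)
  obtain p k where x: "x = (p, k)" by (metis prod.exhaust)
  have p: "prime p" using Cons.prems(1)[of p k] x by simp
  have "hecke_family p k (\<lambda>L. F ((plicate_prime q ^^ i) L)) = (\<lambda>L. hecke_family p k F ((plicate_prime q ^^ i) L))"
    by (intro ext) (simp add: hecke_family_def plicate_funpow_commute[OF p assms(2)])
  moreover have "\<And>p k. (p, k) \<in> set xs \<Longrightarrow> prime p" by (meson Cons.prems(1) list.set_intros(2))
  ultimately show ?case using Cons.IH[of "hecke_family p k F", OF _ assms(2)] by (simp only: x hecke_chain.simps)
qed simp

lemma hecke_chain_const:
  assumes "\<And>p k. (p, k) \<in> set xs \<Longrightarrow> prime p" "\<And>L. good_level L \<Longrightarrow> eq_const (F L) (\<lambda>_. 0)" "good_level L"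
  shows "eq_const (hecke_chain xs F L) (\<lambda>_. 0)"
proof -
  have "hecke_chain xs (\<lambda>L \<tau>. 0) = (\<lambda>L \<tau>. 0)"
    using hecke_chain_linear[where A = "{}"] by simp
  then show ?thesis using hecke_chain_eq_const[where F = F and G = "\<lambda>L \<tau>. 0" and xs = xs and L = L, OF assms(1)] assms(2,3) by simp
qed

lemma eq_const_niebur_J: "n > 0 \<Longrightarrow> eq_const (niebur_J L n) (niebur_j L n)"
  by (rule eq_constI[of _ _ "- niebur_c L n 0"]) (simp add: niebur_J_def)

text \<open>The expansion used in compositions agrees with the averages up to constants: its indices
  j are those with j <= k and p^j | n, and p^k n / p^(2 j) is p^(k - j) (n / p^j), as in
  \<open>hecke_family_niebur_j\<close>.\<close>

lemma hecke_family_niebur_J: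
  assumes p: "prime p" and good: "good_level L" and n: "n > 0"
  shows "eq_const (\<lambda>\<tau>. \<Sum>j | p ^ j dvd gcd n (p ^ k). of_nat (p ^ j) *
      niebur_J ((plicate_prime p ^^ j) L) (p ^ k * n div p ^ (2 * j)) \<tau>) (hecke_family p k (\<lambda>L. niebur_J L n) L)"
    (is "eq_const ?lhs _")
proof -
  have pp: "p > 0" using p by (simp add: prime_gt_0_nat)
  have p1: "p > 1" by (rule prime_gt_1_nat[OF p])
  define A where "A = {j. p ^ j dvd gcd n (p ^ k)}"
  have A: "A = {j. j \<le> k \<and> p ^ j dvd n}"
    using p1 by (auto simp: A_def dvd_power_iff_le)
  have idx: "p ^ k * n div p ^ (2 * j) = p ^ (k - j) * (n div p ^ j)" "p ^ (k - j) * (n div p ^ j) > 0" if j: "j \<in> A" for j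
  proof -
    have "p ^ k = p ^ (k - j) * p ^ j" using j by (simp add: A flip: power_add)
    moreover obtain n' where n': "n = p ^ j * n'" using j by (auto simp: A)
    ultimately have "p ^ k * n = p ^ (2 * j) * (p ^ (k - j) * n')"
      by (metis mult_2 power_add mult.assoc mult.commute)
    moreover have "p ^ j > 0" "p ^ (2 * j) > 0" using pp by simp_all
    ultimately show "p ^ k * n div p ^ (2 * j) = p ^ (k - j) * (n div p ^ j)"
      unfolding n' by (metis nonzero_mult_div_cancel_left less_numeral_extra(3))
    show "p ^ (k - j) * (n div p ^ j) > 0" using n pp n' by simp
  qed
  have "eq_const ?lhs (\<lambda>\<tau>. \<Sum>j\<in>A. of_nat (p ^ j) * niebur_j ((plicate_prime p ^^ j) L) (p ^ (k - j) * (n div p ^ j)) \<tau>)"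
    unfolding A_def[symmetric] using idx by (intro eq_const_sum) (simp add: eq_const_niebur_J)
  moreover have "eq_const (\<lambda>\<tau>. \<Sum>j\<in>A. of_nat (p ^ j) * niebur_j ((plicate_prime p ^^ j) L) (p ^ (k - j) * (n div p ^ j)) \<tau>)
      (hecke_family p k (\<lambda>L. niebur_j L n) L)"
  proof (rule eq_constI[of _ _ 0])
    fix \<tau> :: complex assume tau: "Im \<tau> > 0"
    have "A = {j \<in> {..k}. p ^ j dvd n}" by (auto simp: A)
    then show "(\<Sum>j\<in>A. of_nat (p ^ j) * niebur_j ((plicate_prime p ^^ j) L) (p ^ (k - j) * (n div p ^ j)) \<tau>) =
        hecke_family p k (\<lambda>L. niebur_j L n) L \<tau> + 0"
      unfolding hecke_family_niebur_j[OF p good n tau] by (simp only: sum.inter_filter[OF finite_atMost] add_0_right)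
  qed
  moreover have "eq_const (hecke_family p k (\<lambda>L. niebur_j L n) L) (hecke_family p k (\<lambda>L. niebur_J L n) L)"
    by (intro eq_const_hecke_family eq_const_sym[OF eq_const_niebur_J] n pp)
  ultimately show ?thesis by (blast intro: eq_const_trans)
qed

text \<open>For n > 0 the terms of the first expansion are handled by induction, gathered into one
  chain by linearity and \<open>hecke_chain_shift\<close>, and replaced by the averages under that
  chain. For n = 0 both sides are constant. A single operator is already an average in the
  definition.\<close>

lemma hecke_J_list_chain:
  assumes "\<And>p k. (p, k) \<in> set xs \<Longrightarrow> prime p" "good_level L"
  shows "eq_const (hecke_J_list xs L n) (hecke_chain xs (\<lambda>L. niebur_J L n) L)"
  using assms
proof (induction xs arbitrary: L n)
  case Nil
  have "hecke_J_list [] L n = niebur_J L n" by (intro ext) simp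
  then show ?case by (simp add: eq_const_refl)
next
  case (Cons x xs)
  obtain p k where x: "x = (p, k)" by (metis prod.exhaust)
  have p: "prime p" using Cons.prems(1)[of p k] x by simp
  have primes: "\<And>p k. (p, k) \<in> set xs \<Longrightarrow> prime p" by (meson Cons.prems(1) list.set_intros(2))
  note good = Cons.prems(2)
  have pp: "p > 0" using p by (simp add: prime_gt_0_nat)
  show ?case
  proof (cases xs)
    case Nil
    have "hecke_J_list (x # xs) L n = hecke_family p k (\<lambda>L. niebur_J L n) L"
      by (intro ext) (simp add: Nil x hecke_J_prime_power_def hecke_family_def plicate_level_power[OF p])
    then show ?thesis by (simp add: Nil x eq_const_refl)
  next
    case (Cons y ys)
    show ?thesis
    proof (cases "n = 0")
      case True
      have J0: "eq_const (niebur_J L 0) (\<lambda>_. 0)" for L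
        by (rule eq_constI[of _ _ 1]) (simp add: niebur_J_def)
      have "eq_const (hecke_family p k (\<lambda>L. niebur_J L 0) L') (\<lambda>_. 0)" for L'
      proof -
        have "eq_const (hecke_family p k (\<lambda>L. niebur_J L 0) L') (hecke_family p k (\<lambda>L \<tau>. 0) L')"
          by (intro eq_const_hecke_family J0 pp)
        then show ?thesis by (simp add: hecke_family_def[abs_def] U_star_def)
      qed
      then have 1: "eq_const (hecke_chain (x # xs) (\<lambda>L. niebur_J L n) L) (\<lambda>_. 0)"
        unfolding x hecke_chain.simps True by (intro hecke_chain_const primes good)
      have "eq_const (hecke_J_list xs L 0) (\<lambda>_. 0)"
        by (rule eq_const_trans[OF Cons.IH hecke_chain_const]) (rule J0 good | erule primes)+
      then have "eq_const (\<lambda>\<tau>. \<Sum>j\<in>{()}. of_nat (\<Sum>i\<le>k. p ^ i) * hecke_J_list xs L 0 \<tau>) (\<lambda>\<tau>. \<Sum>j\<in>{()}. of_nat (\<Sum>i\<le>k. p ^ i) * 0)"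
        by (intro eq_const_sum)
      moreover have "hecke_J_list (x # xs) L n = (\<lambda>\<tau>. of_nat (\<Sum>i\<le>k. p ^ i) * hecke_J_list xs L 0 \<tau>)"
        by (intro ext) (simp add: Cons x True)
      ultimately have "eq_const (hecke_J_list (x # xs) L n) (\<lambda>_. 0)" by simp
      then show ?thesis using 1 by (blast intro: eq_const_trans eq_const_sym)
    next
      case False
      then have n: "n > 0" by simp
      define A where "A = {j. p ^ j dvd gcd n (p ^ k)}"
      define nj where "nj j = p ^ k * n div p ^ (2 * j)" for j
      have 1: "hecke_J_list (x # xs) L n = (\<lambda>\<tau>. \<Sum>j\<in>A. of_nat (p ^ j) * hecke_J_list xs ((plicate_prime p ^^ j) L) (nj j) \<tau>)"
        by (intro ext) (simp add: Cons x False A_def nj_def plicate_level_power[OF p])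
      have 2: "eq_const (\<lambda>\<tau>. \<Sum>j\<in>A. of_nat (p ^ j) * hecke_J_list xs ((plicate_prime p ^^ j) L) (nj j) \<tau>)
          (\<lambda>\<tau>. \<Sum>j\<in>A. of_nat (p ^ j) * hecke_chain xs (\<lambda>L. niebur_J L (nj j)) ((plicate_prime p ^^ j) L) \<tau>)"
        by (intro eq_const_sum Cons.IH primes good_plicate_funpow good p)
      have 3: "(\<lambda>\<tau>. \<Sum>j\<in>A. of_nat (p ^ j) * hecke_chain xs (\<lambda>L. niebur_J L (nj j)) ((plicate_prime p ^^ j) L) \<tau>) =
          hecke_chain xs (\<lambda>L \<tau>. \<Sum>j\<in>A. of_nat (p ^ j) * niebur_J ((plicate_prime p ^^ j) L) (nj j) \<tau>) L"
        unfolding hecke_chain_linear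
        by (intro ext sum.cong refl arg_cong2[of _ _ _ _ "(*)"] fun_cong[OF hecke_chain_shift[symmetric]] primes p)
      have 4: "eq_const (hecke_chain xs (\<lambda>L \<tau>. \<Sum>j\<in>A. of_nat (p ^ j) * niebur_J ((plicate_prime p ^^ j) L) (nj j) \<tau>) L)
          (hecke_chain xs (hecke_family p k (\<lambda>L. niebur_J L n)) L)"
        unfolding A_def nj_def by (intro hecke_chain_eq_const primes good hecke_family_niebur_J p n)
      have "eq_const (hecke_J_list (x # xs) L n) (hecke_chain xs (hecke_family p k (\<lambda>L. niebur_J L n)) L)"
        unfolding 1 by (rule eq_const_trans[OF 2], subst 3, rule 4)
      then show ?thesis by (simp only: x hecke_chain.simps)
    qed
  qed
qed

text \<open>A term of exponent i adds the factor p^i to the index of the plicate, so exactly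
  divisors of the product of the prime powers appear.\<close>

lemma hecke_chain_congruence:
  assumes "\<And>p k. (p, k) \<in> set xs \<Longrightarrow> prime p"
    "\<And>d. d dvd (\<Prod>(p, k)\<leftarrow>xs. p ^ k) \<Longrightarrow> congruence_function (F (plicate_level d L))"
  shows "congruence_function (hecke_chain xs F L)"
  using assms
proof (induction xs arbitrary: F)
  case Nil
  then show ?case using Nil(2)[of 1] by simp
next
  case (Cons x xs)
  obtain p k where x: "x = (p, k)" by (metis prod.exhaust)
  have p: "prime p" using Cons.prems(1)[of p k] x by simp
  have pp: "p > 0" using p by (simp add: prime_gt_0_nat)
  have primes: "\<And>p k. (p, k) \<in> set xs \<Longrightarrow> prime p" by (meson Cons.prems(1) list.set_intros(2))
  have pos: "(\<Prod>(p, k)\<leftarrow>xs. p ^ k) > 0"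
    using prime_gt_0_nat[OF primes] by (auto simp: prod_list_zero_iff simp flip: neq0_conv)
  have "congruence_function (hecke_family p k F (plicate_level d L))" if d: "d dvd (\<Prod>(p, k)\<leftarrow>xs. p ^ k)" for d
  proof -
    have "d > 0" using d pos by (auto intro: dvd_pos_nat)
    have "congruence_function (\<lambda>\<tau>. U_star (p ^ (k - i)) (F ((plicate_prime p ^^ i) (plicate_level d L))) (of_nat (p ^ i) * \<tau>))"
      if "i \<le> k" for i
    proof -
      have "d * p ^ i dvd (\<Prod>(p, k)\<leftarrow>x # xs. p ^ k)"
        using mult_dvd_mono[OF d le_imp_power_dvd[OF that, of p]] by (simp add: x mult.commute)
      then have "congruence_function (F ((plicate_prime p ^^ i) (plicate_level d L)))"
        using Cons.prems(2) plicate_level_mult_power[OF p \<open>d > 0\<close>, of i L] by metis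
      then show ?thesis
        unfolding U_star_def using pp congruence_function_affine[of _ "p ^ i" "p ^ (k - i)" "int _"]
        by (intro congruence_function_sum) simp
    qed
    then show ?thesis unfolding hecke_family_def[abs_def] by (intro congruence_function_sum) simp
  qed
  then show ?case unfolding x hecke_chain.simps by (intro Cons.IH primes)
qed

section \<open>From the hypothesis on the plicates to \<open>f | T(n)\<close>\<close>

lemma good_plicate_level:
  assumes "good_level L" shows "good_level (plicate_level d L)"
proof -
  have *: "good_level (fold plicate_prime ps L)" if "\<And>p. p \<in> set ps \<Longrightarrow> prime p" "good_level L" for ps L
    using that
  proof (induction ps arbitrary: L)
    case (Cons a ps)
    have "prime a" by (simp add: Cons.prems(1))
    then show ?case using Cons.IH[of "plicate_prime a L"] Cons.prems good_plicate_prime by simp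
  qed simp
  show ?thesis unfolding plicate_level_def
    by (rule *[OF _ assms]) (simp add: in_prime_factors_iff)
qed

lemma M0_inf_congruence:
  assumes "good_level L" "f \<in> M0_inf (level_group L)"
  shows "congruence_function f"
proof -
  obtain N S where L: "L = (N, S)" by (metis prod.exhaust)
  have "N > 0" using good_levelD(1)[of N S 1] assms(1) by (simp add: L)
  moreover have "principal N \<subseteq> level_group L"
    using principal_subset_Gamma0 by (auto simp: L level_group_generate intro!: generate.incl)
  ultimately show ?thesis
    using assms(2) weakly_holomorphic_on_group_subset unfolding M0_inf_def congruence_function_def by blast
qed

theorem theorem1p8:
  fixes N n :: nat and S :: "nat set" and f :: "complex \<Rightarrow> complex"
  assumes "N > 0"
    and "largest_divisor_set N S"
    and "n > 0"
    and "f \<in> M0_inf (level_group (N, S))"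
    and "\<And>d. d dvd n \<Longrightarrow> plicate d (N, S) f \<in> M0_inf (level_group (plicate_level d (N, S)))"
  shows "weakly_holomorphic (hecke_T n (N, S) f)"
proof -
  define L where "L = (N, S)"
  have good: "good_level L" unfolding L_def by (rule largest_imp_good[OF assms(1,2)])
  define a where "a = niebur_coeffs L f"
  define A where "A = {k. a k \<noteq> 0}"
  \<comment> \<open>The combination with the coefficients of f at the level L, kept fixed while the
    level varies: at \<open>plicate_level d L\<close> it is the d-plicate of f.\<close>
  define F where "F L' \<tau> = (\<Sum>k\<in>A. a k * niebur_J L' k \<tau>)" for L' \<tau>
  define xs where "xs = map (\<lambda>p. (p, multiplicity p n)) (sorted_list_of_set (prime_factors n))"
  have primes: "prime p" if "(p, k) \<in> set xs" for p k using that by (auto simp: xs_def in_prime_factors_iff)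
  have "(\<Prod>(p, k)\<leftarrow>xs. p ^ k) = (\<Prod>p\<leftarrow>sorted_list_of_set (prime_factors n). p ^ multiplicity p n)"
    by (simp add: xs_def o_def)
  also have "\<dots> = (\<Prod>p\<in>prime_factors n. p ^ multiplicity p n)"
    by (simp add: prod.distinct_set_conv_list[symmetric])
  also have "\<dots> = n" using assms(3) by (simp add: prime_factorization_nat[symmetric])
  finally have prod: "(\<Prod>(p, k)\<leftarrow>xs. p ^ k) = n" .
  have cong: "congruence_function (hecke_chain xs F L)"
  proof (rule hecke_chain_congruence[OF primes])
    fix d assume "d dvd (\<Prod>(p, k)\<leftarrow>xs. p ^ k)"
    then have "plicate d L f \<in> M0_inf (level_group (plicate_level d L))" using assms(5) by (simp add: prod L_def)
    moreover have "plicate d L f = F (plicate_level d L)"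
      by (intro ext) (simp add: plicate_def F_def A_def a_def)
    ultimately show "congruence_function (F (plicate_level d L))"
      using M0_inf_congruence[OF good_plicate_level[OF good]] by metis
  qed
  have "hecke_T n L f = (\<lambda>\<tau>. \<Sum>k\<in>A. a k * hecke_J_list xs L k \<tau>)"
    by (intro ext) (simp add: hecke_T_def hecke_J_def xs_def A_def a_def)
  moreover have "eq_const (\<lambda>\<tau>. \<Sum>k\<in>A. a k * hecke_J_list xs L k \<tau>)
      (\<lambda>\<tau>. \<Sum>k\<in>A. a k * hecke_chain xs (\<lambda>L. niebur_J L k) L \<tau>)"
    by (intro eq_const_sum hecke_J_list_chain primes good)
  moreover have "(\<lambda>\<tau>. \<Sum>k\<in>A. a k * hecke_chain xs (\<lambda>L. niebur_J L k) L \<tau>) = hecke_chain xs F L"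
    using fun_cong[OF hecke_chain_linear[where xs = xs and A = A and c = a and F = "\<lambda>k L. niebur_J L k"], of L] by (simp add: F_def[abs_def])
  \<comment> \<open>The combined constant is harmless, since constants are congruence
    functions.\<close>
  ultimately obtain c where "\<And>\<tau>. Im \<tau> > 0 \<Longrightarrow> hecke_T n L f \<tau> = hecke_chain xs F L \<tau> + c"
    unfolding eq_const_def by metis
  then have "congruence_function (hecke_T n L f)"
    by (intro congruence_function_cong[OF congruence_function_add[OF cong congruence_function_const[of c]]])
  then show ?thesis unfolding L_def by (rule congruence_imp_weakly_holomorphic)
qed

end
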